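(* Let $M\ge 1$, masses $m_1,\dots,m_M>0$ and $T_*>0$ be given. Assume that the collision rate has the form $B(t,u;dz)=|u|\,\gamma(t)\,b(u;dz)$, where $b$ does not depend on the kinetic energy (nor on $t$), $b(u;dz)=b(-u;-dz)$ for all $u\in\mathbb{R}^d$, and $0\le\gamma(t)\le\gamma_*$ for $t\in(0,T_* )$, for some constant $\gamma_*$. Let $f^{in}=(f_i^{in})_{i=1}^M$ be nonnegative measurable functions on $\mathbb{R}^d$ with $f^{in}\in L^1_3$, $\int_{\mathbb{R}^d} m_i f_i^{in}\,dv=1$ for every $i$, and $\sum_{i=1}^M\int_{\mathbb{R}^d} m_i f_i^{in}(v)\,v\,dv=0$. Then for all $0<T\le T_*$ there exists a unique solution $f=(f_i)_{i=1}^M\in C([0,T];L^1_2)\cap L^\infty(0,T;L^1_3)$ of the homogeneous multi-species inelastic Boltzmann equation $$\partial_t f_i=\sum_{j=1}^M \mathcal{Q}_{i,j}(f_i,f_j),\qquad f_i(0,\cdot)=f_i^{in},\qquad i=1,\dots,M.$$ Moreover this solution satisfies $$\int_{\mathbb{R}^d} m_i f_i(t,v)\,dv=1\ \ (i=1,\dots,M),\qquad \sum_{i=1}^M\int_{\mathbb{R}^d} m_i f_i(t,v)\,v\,dv=0,\qquad \forall\, t\in[0,T],$$ and its total kinetic energy $\mathcal{E}(f)(t)=\sum_{i=1}^M\int_{\mathbb{R}^d} m_i f_i(t,v)|v|^2\,dv$ is positive and decreasing in time.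
   Context: For $q\in\mathbb{N}$, $L^1_q$ is the space of measurable $f=(f_1,\dots,f_M):\mathbb{R}^d\to\mathbb{R}^M$ with $\|f\|_{L^1_q}=\sum_{i=1}^M\int_{\mathbb{R}^d}|f_i(v)|(1+m_i^{q/2}|v|^q)\,dv<\infty$. Let $\mathcal{D}=\{w\in\mathbb{R}^d:|w|\le 1\}$. For species $i,j$, velocities $v,v_*\in\mathbb{R}^d$ and $z\in\mathcal{D}$, put $u=v-v_*$ and define the post-collisional velocities $$v'=\frac{m_iv+m_jv_*}{m_i+m_j}+\frac{m_j}{m_i+m_j}\,|u|\,z,\qquad v_*'=\frac{m_iv+m_jv_*}{m_i+m_j}-\frac{m_i}{m_i+m_j}\,|u|\,z .$$ For each $u$, $b(u;dz)$ is a probability measure on $\mathcal{D}$ (depending measurably on $u$); the same collision rate $B$ is used for all pairs of species. The collision operators are defined in weak form: for test functions $\psi:\mathbb{R}^d\to\mathbb{R}$, $$\int_{\mathbb{R}^d}\mathcal{Q}_{i,j}(f_i,f_j)\psi\,dv=\int_{\mathbb{R}^d\times\mathbb{R}^d\times\mathcal{D}} f_i(v)f_j(v_* )\big(\psi(v')-\psi(v)\big)\,B(t,u;dz)\,dv\,dv_* .$$ Solutions are understood to be nonnegative and to satisfy the equation in this weak sense. "Decreasing" is meant in the sense of non-increasing. *)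

theory Defs
  imports "HOL-Probability.Probability"
begin

text \<open>
  Velocities live in \<open>real^'d\<close> and the species are the elements of the finite (nonempty) index
  type \<open>'s\<close>, so \<open>M = CARD('s)\<close>; the masses form a vector \<open>m :: real^'s\<close>.  Elements of Lebesgue
  spaces are represented by functions, hence equalities and signs are required almost everywhere.
\<close>

definition L1q_weight :: "real^'s \<Rightarrow> nat \<Rightarrow> 's \<Rightarrow> real^'d \<Rightarrow> real" where
  "L1q_weight m q i v = 1 + (m $ i) powr (real q / 2) * norm v ^ q"

definition L1q :: "real^'s \<Rightarrow> nat \<Rightarrow> (real^'d \<Rightarrow> real^'s) set" where
  "L1q m q = {f. f \<in> borel_measurable lebesgue \<and>
     (\<forall>i. integrable lebesgue (\<lambda>v. \<bar>f v $ i\<bar> * L1q_weight m q i v))}"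

definition L1q_norm :: "real^'s \<Rightarrow> nat \<Rightarrow> (real^'d \<Rightarrow> real^'s) \<Rightarrow> real" where
  "L1q_norm m q f = (\<Sum>i\<in>UNIV. \<integral>v. \<bar>f v $ i\<bar> * L1q_weight m q i v \<partial>lebesgue)"

definition continuous_L1q ::
    "real^'s \<Rightarrow> nat \<Rightarrow> real \<Rightarrow> (real \<Rightarrow> real^'d \<Rightarrow> real^'s) \<Rightarrow> bool" where
  "continuous_L1q m q T f \<longleftrightarrow>
     (\<forall>t\<in>{0..T}. f t \<in> L1q m q \<and>
        ((\<lambda>s. L1q_norm m q (\<lambda>v. f s v - f t v)) \<longlongrightarrow> 0) (at t within {0..T}))"

text \<open>
  Membership in \<open>L\<^sup>\<infinity>(0,T; L\<^sup>1\<^sub>q)\<close> in the sense of Bochner: strong measurability (almost everywhere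
  limit of simple functions with values in \<open>L\<^sup>1\<^sub>q\<close>) and an essential bound on the norm.
\<close>

definition Linf_L1q ::
    "real^'s \<Rightarrow> nat \<Rightarrow> real \<Rightarrow> (real \<Rightarrow> real^'d \<Rightarrow> real^'s) \<Rightarrow> bool" where
  "Linf_L1q m q T f \<longleftrightarrow>
     (AE t in lebesgue_on {0<..<T}. f t \<in> L1q m q) \<and>
     (\<exists>S. (\<forall>n. simple_function (lebesgue_on {0<..<T}) (S n) \<and> (\<forall>t\<in>{0<..<T}. S n t \<in> L1q m q)) \<and>
        (AE t in lebesgue_on {0<..<T}.
           (\<lambda>n::nat. L1q_norm m q (\<lambda>v. S n t v - f t v)) \<longlonglongrightarrow> 0)) \<and>
     (\<exists>C. AE t in lebesgue_on {0<..<T}. L1q_norm m q (f t) \<le> C)"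

definition post_vel :: "real \<Rightarrow> real \<Rightarrow> real^'d \<Rightarrow> real^'d \<Rightarrow> real^'d \<Rightarrow> real^'d" where
  "post_vel m1 m2 v vs z =
     (1 / (m1 + m2)) *\<^sub>R (m1 *\<^sub>R v + m2 *\<^sub>R vs) + (m2 / (m1 + m2) * norm (v - vs)) *\<^sub>R z"

text \<open>
  Weak form of \<open>\<Q>\<^sub>i\<^sub>j(g, h)\<close> at a fixed time, where \<open>\<beta> u\<close> is the measure \<open>B(t, u; dz)\<close> on the unit ball.
  The outer integral is over the completed Lebesgue measure on the product space, because \<open>g\<close> and
  \<open>h\<close> are only Lebesgue measurable.
\<close>

definition collision_weak ::
    "real^'s \<Rightarrow> (real^'d \<Rightarrow> (real^'d) measure) \<Rightarrow> 's \<Rightarrow> 's \<Rightarrow>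
     (real^'d \<Rightarrow> real) \<Rightarrow> (real^'d \<Rightarrow> real) \<Rightarrow> (real^'d \<Rightarrow> real) \<Rightarrow> real" where
  "collision_weak m \<beta> i j g h \<psi> =
     (\<integral>(v, vs). g v * h vs *
        (\<integral>z. \<psi> (post_vel (m $ i) (m $ j) v vs z) - \<psi> v \<partial>\<beta> (v - vs)) \<partial>lebesgue)"

definition test_function :: "(real^'d \<Rightarrow> real) \<Rightarrow> bool" where
  "test_function \<psi> \<longleftrightarrow> continuous_on UNIV \<psi> \<and> compact (closure {v. \<psi> v \<noteq> 0})"

text \<open>
  The equation \<open>\<partial>\<^sub>t f\<^sub>i = \<Sum>\<^sub>j \<Q>\<^sub>i\<^sub>j(f\<^sub>i, f\<^sub>j)\<close> is tested in \<open>v\<close> and integrated in time.  For the collision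
  rates considered here all integrals converge absolutely as soon as \<open>f \<in> C([0,T]; L\<^sup>1\<^sub>2)\<close>, so the
  default value of the Bochner integral plays no role.
\<close>

definition is_solution ::
    "real^'s \<Rightarrow> (real \<Rightarrow> real^'d \<Rightarrow> (real^'d) measure) \<Rightarrow> (real^'d \<Rightarrow> real^'s) \<Rightarrow> real \<Rightarrow>
     (real \<Rightarrow> real^'d \<Rightarrow> real^'s) \<Rightarrow> bool" where
  "is_solution m B fin T f \<longleftrightarrow>
     continuous_L1q m 2 T f \<and> Linf_L1q m 3 T f \<and>
     (\<forall>t\<in>{0..T}. AE v in lebesgue. \<forall>i. 0 \<le> f t v $ i) \<and>
     (AE v in lebesgue. f 0 v = fin v) \<and>
     (\<forall>\<psi> i. test_function \<psi> \<longrightarrow> (\<forall>t\<in>{0..T}.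
        (\<integral>v. f t v $ i * \<psi> v \<partial>lebesgue) =
        (\<integral>v. fin v $ i * \<psi> v \<partial>lebesgue) +
        (\<integral>s. (\<Sum>j\<in>UNIV. collision_weak m (B s) i j (\<lambda>v. f s v $ i) (\<lambda>v. f s v $ j) \<psi>)
           \<partial>lebesgue_on {0<..<t})))"

definition species_mass :: "real^'s \<Rightarrow> (real^'d \<Rightarrow> real^'s) \<Rightarrow> 's \<Rightarrow> real" where
  "species_mass m f i = (\<integral>v. m $ i * f v $ i \<partial>lebesgue)"

definition momentum :: "real^'s \<Rightarrow> (real^'d \<Rightarrow> real^'s) \<Rightarrow> real^'d" where
  "momentum m f = (\<Sum>i\<in>UNIV. \<integral>v. (m $ i * f v $ i) *\<^sub>R v \<partial>lebesgue)"

definition kinetic_energy :: "real^'s \<Rightarrow> (real^'d \<Rightarrow> real^'s) \<Rightarrow> real" where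
  "kinetic_energy m f = (\<Sum>i\<in>UNIV. \<integral>v. m $ i * f v $ i * (norm v)\<^sup>2 \<partial>lebesgue)"

end

theory Submission
  imports Defs
begin

text \<open>
  On the phase space of species and velocities, and after the time change \<open>\<tau>(t) = \<integral>\<^sub>0\<^sup>t \<gamma>\<close>, the equation is
  autonomous with collision frequency \<open>|v - v\<^sub>*| \<le> \<Lambda>(x) W(y)\<close>, where \<open>W = 1 + m |v|\<^sup>2\<close>.  Let \<open>K\<close> be the
  initial value of \<open>\<integral> W F\<close> and let \<open>e\<close> be the energy dissipated so far, so that \<open>K = \<integral> W F + e\<close>.
  Adding \<open>K \<Lambda> F\<close> to both sides and writing \<open>K\<close> on the right as \<open>\<integral> W F + e\<close> turns the loss term into
  \<open>F \<integral> F (\<Lambda> W - |v - v\<^sub>*|) + \<Lambda> F e\<close>, which is monotone in the pair \<open>(F, e)\<close>.  Hence the Picard iterates starting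
  from \<open>(0, 0)\<close> increase, and \<open>\<integral> W F\<^sub>n + e\<^sub>n \<le> K\<close> is preserved.  A Povzner estimate bounds the third
  moment; Gronwall's lemma then shows that the limit does not lose energy, so it solves the equation.

  For uniqueness, every other solution dominates all iterates, hence their limit; as its energy is at
  most \<open>K - e\<close>, which is the energy of the limit, the two agree.
\<close>

text \<open>The collision frequency is unbounded, so the operator loses a power of the velocity
  weight and no contraction argument is at hand. Order takes the place of Lipschitz estimates, and
  this shapes the text: balances are sums in \<open>ennreal\<close>, the loss stands opposite the
  gain, and a term is cancelled only once its integral is known to be finite. Such finiteness is
  what the third moment supplies, since the damping weight \<open>\<Lambda> * W\<close> is of third
  order.

  In an inelastic gas the energy falls, so the integral of \<open>W F\<close> alone is not constant;
  the scalar \<open>e\<close> restores a constant total, and so the damping added on the left is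
  linear in \<open>F\<close> with a known coefficient.

  A competitor is identified through its dissipation: an iterate lying below it dissipates no more
  than it does, because the dissipation is monotone in the density. Since \<open>\<gamma>\<close>
  may vanish, the clock has no inverse, and the change of time is a statement about image
  measures.\<close>

section \<open>Duhamel's formula for a scalar linear equation\<close>

lemma measurable_indicator_Icc [measurable]:
  fixes l f g :: "'a \<Rightarrow> real"
  assumes [measurable]: "l \<in> borel_measurable N" "f \<in> borel_measurable N" "g \<in> borel_measurable N"
  shows "(\<lambda>p. indicator {l p..f p} (g p) :: ennreal) \<in> borel_measurable N"
proof -
  have "(\<lambda>p. indicator {l p..f p} (g p) :: ennreal) = (\<lambda>p. if l p \<le> g p \<and> g p \<le> f p then 1 else 0)"
    by (auto simp: indicator_def fun_eq_iff)
  then show ?thesis by simp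
qed

lemma nn_integral_exp_decay:
  fixes a r t :: real
  assumes "0 \<le> a" "r \<le> t"
  shows "(\<integral>\<^sup>+s. ennreal (a * exp (- (a * (s - r)))) * indicator {r..t} s \<partial>lborel) = ennreal (1 - exp (- (a * (t - r))))"
proof -
  have "(\<integral>\<^sup>+s. ennreal (a * exp (- (a * (s - r)))) * indicator {r..t} s \<partial>lborel)
     = ennreal ((- exp (- (a * (t - r)))) - (- exp (- (a * (r - r)))))"
    by (rule nn_integral_FTC_Icc[where F="\<lambda>s. - exp (- (a * (s - r)))"])
       (use assms in \<open>auto intro!: derivative_eq_intros\<close>)
  then show ?thesis by simp
qed

text \<open>Variation of constants for \<open>u' = h - a u\<close>, with the damping kept on the
  left so that nothing is subtracted and \<open>h\<close>, \<open>u0\<close> may be infinite.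
  Exchanging the two time integrals leaves \<open>a * exp (- (a * (s - r)))\<close> integrated over
  \<open>s\<close> from \<open>r\<close> to \<open>t\<close>, which is
  \<open>1 - exp (- (a * (t - r)))\<close>: the exact complement of the Duhamel kernel.\<close>

lemma duhamel_identity:
  fixes h :: "real \<Rightarrow> ennreal" and a t :: real and u0 :: ennreal
  assumes [measurable]: "h \<in> borel_measurable borel" and a: "0 \<le> a" and t: "0 \<le> t"
  defines "u \<equiv> \<lambda>t. ennreal (exp (- (a * t))) * u0 + (\<integral>\<^sup>+s. ennreal (exp (- (a * (t - s)))) * h s * indicator {0..t} s \<partial>lborel)"
  shows "u t + (\<integral>\<^sup>+s. ennreal a * u s * indicator {0..t} s \<partial>lborel) = u0 + (\<integral>\<^sup>+s. h s * indicator {0..t} s \<partial>lborel)"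
proof -
  have 1: "(\<integral>\<^sup>+s. ennreal (a * exp (- (a * s))) * indicator {0..t} s \<partial>lborel) = ennreal (1 - exp (- (a * t)))"
    using nn_integral_exp_decay[OF a t] by simp
  have "(\<integral>\<^sup>+s. (\<integral>\<^sup>+r. ennreal a * (ennreal (exp (- (a * (s - r)))) * h r * indicator {0..s} r) * indicator {0..t} s \<partial>lborel) \<partial>lborel)
    = (\<integral>\<^sup>+r. (\<integral>\<^sup>+s. ennreal a * (ennreal (exp (- (a * (s - r)))) * h r * indicator {0..s} r) * indicator {0..t} s \<partial>lborel) \<partial>lborel)"
    by (rule lborel_pair.Fubini'[symmetric]) measurable
  also have "\<dots> = (\<integral>\<^sup>+r. (\<integral>\<^sup>+s. (h r * indicator {0..t} r) * (ennreal (a * exp (- (a * (s - r)))) * indicator {r..t} s) \<partial>lborel) \<partial>lborel)"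
    by (intro nn_integral_cong) (auto simp: ennreal_mult a mult_ac split: split_indicator)
  also have "\<dots> = (\<integral>\<^sup>+r. (h r * indicator {0..t} r) * (\<integral>\<^sup>+s. ennreal (a * exp (- (a * (s - r)))) * indicator {r..t} s \<partial>lborel) \<partial>lborel)"
    by (intro nn_integral_cong nn_integral_cmult) measurable
  also have "\<dots> = (\<integral>\<^sup>+r. h r * indicator {0..t} r * ennreal (1 - exp (- (a * (t - r)))) \<partial>lborel)"
    by (intro nn_integral_cong) (simp add: nn_integral_exp_decay a split: split_indicator)
  finally have 2: "(\<integral>\<^sup>+s. ennreal a * (\<integral>\<^sup>+r. ennreal (exp (- (a * (s - r)))) * h r * indicator {0..s} r \<partial>lborel) * indicator {0..t} s \<partial>lborel)
     = (\<integral>\<^sup>+r. h r * indicator {0..t} r * ennreal (1 - exp (- (a * (t - r)))) \<partial>lborel)"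
    by (simp add: nn_integral_cmult nn_integral_multc)
  have "(\<integral>\<^sup>+s. ennreal a * u s * indicator {0..t} s \<partial>lborel) =
     (\<integral>\<^sup>+s. u0 * (ennreal (a * exp (- (a * s))) * indicator {0..t} s) +
        ennreal a * (\<integral>\<^sup>+r. ennreal (exp (- (a * (s - r)))) * h r * indicator {0..s} r \<partial>lborel) * indicator {0..t} s \<partial>lborel)"
    unfolding u_def by (intro nn_integral_cong) (simp add: distrib_left distrib_right ennreal_mult a mult_ac)
  also have "\<dots> = u0 * ennreal (1 - exp (- (a * t))) + (\<integral>\<^sup>+r. h r * indicator {0..t} r * ennreal (1 - exp (- (a * (t - r)))) \<partial>lborel)"
    by (subst nn_integral_add) (simp_all add: nn_integral_cmult 1 2)
  finally have 3: "(\<integral>\<^sup>+s. ennreal a * u s * indicator {0..t} s \<partial>lborel) = \<dots>" .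
  have "u t + (\<integral>\<^sup>+s. ennreal a * u s * indicator {0..t} s \<partial>lborel) =
     u0 * (ennreal (exp (- (a * t))) + ennreal (1 - exp (- (a * t)))) +
     ((\<integral>\<^sup>+s. ennreal (exp (- (a * (t - s)))) * h s * indicator {0..t} s \<partial>lborel) +
      (\<integral>\<^sup>+r. h r * indicator {0..t} r * ennreal (1 - exp (- (a * (t - r)))) \<partial>lborel))"
    unfolding 3 unfolding u_def by (simp only: distrib_left mult.commute[of u0] add.assoc add.left_commute)
  also have "ennreal (exp (- (a * t))) + ennreal (1 - exp (- (a * t))) = 1"
    using a t by (subst ennreal_plus[symmetric]) (auto simp: mult_nonneg_nonneg)
  also have "((\<integral>\<^sup>+s. ennreal (exp (- (a * (t - s)))) * h s * indicator {0..t} s \<partial>lborel) +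
      (\<integral>\<^sup>+r. h r * indicator {0..t} r * ennreal (1 - exp (- (a * (t - r)))) \<partial>lborel)) =
      (\<integral>\<^sup>+s. h s * indicator {0..t} s \<partial>lborel)"
  proof (subst nn_integral_add[symmetric], measurable, intro nn_integral_cong)
    fix s :: real
    have "ennreal (exp (- (a * (t - s)))) + ennreal (1 - exp (- (a * (t - s)))) = 1" if "s \<le> t"
      using a that by (subst ennreal_plus[symmetric]) (auto simp: mult_nonneg_nonneg)
    then show "ennreal (exp (- (a * (t - s)))) * h s * indicator {0..t} s +
         h s * indicator {0..t} s * ennreal (1 - exp (- (a * (t - s)))) = h s * indicator {0..t} s"
      by (auto split: split_indicator simp: mult.commute[of _ "h s"] simp flip: distrib_left)
  qed
  finally show ?thesis by simp
qed

text \<open>Consecutive terms of an exponential series are linked by one time integration; both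
  iterated Gronwall arguments run on this step.\<close>

lemma power_fact_derivative:
  fixes B c x :: real
  shows "((\<lambda>t. B * ((c * t) ^ Suc n / fact (Suc n))) has_real_derivative c * (B * ((c * x) ^ n / fact n))) (at x)"
proof -
  have "((\<lambda>t. B * ((c * t) ^ Suc n / fact (Suc n))) has_real_derivative B * (real (Suc n) * (c * x) ^ n * c / fact (Suc n))) (at x)"
    by (auto intro!: derivative_eq_intros simp del: fact_Suc power_Suc)
  also have "B * (real (Suc n) * (c * x) ^ n * c / fact (Suc n)) = c * (B * ((c * x) ^ n / fact n))"
    by (simp add: mult_ac del: of_nat_Suc)
  finally show ?thesis .
qed

section \<open>Monotone iteration for an abstract collision model\<close>

text \<open>Joint measurability of a curried function is stated once through \<open>fst\<close> and
  \<open>snd\<close>; composed with arbitrary measurable \<open>g\<close> and \<open>h\<close> it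
  takes the form that can be declared for automatic measurability proofs.\<close>

lemma measurable_compose_pair:
  assumes "(\<lambda>p. u (fst p) (snd p)) \<in> measurable (A \<Otimes>\<^sub>M B) L" "g \<in> measurable N A" "h \<in> measurable N B"
  shows "(\<lambda>p. u (g p) (h p)) \<in> measurable N L"
  using measurable_compose[OF measurable_Pair[OF assms(2,3)] assms(1)] by simp

text \<open>Diagonal argument: the product at indices \<open>i\<close> and \<open>j\<close> lies
  below the product at \<open>max i j\<close>.\<close>

lemma SUP_mult_SUP_ennreal:
  fixes a b :: "nat \<Rightarrow> ennreal"
  assumes "incseq a" "incseq b"
  shows "(SUP n. a n) * (SUP n. b n) = (SUP n. a n * b n)"
proof (rule antisym)
  have "a i * b j \<le> (SUP n. a n * b n)" for i j
  proof -
    have "a i * b j \<le> a (max i j) * b (max i j)"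
      using assms by (intro mult_mono) (auto simp: incseq_def)
    also have "\<dots> \<le> (SUP n. a n * b n)" by (rule SUP_upper) simp
    finally show ?thesis .
  qed
  then show "(SUP n. a n) * (SUP n. b n) \<le> (SUP n. a n * b n)"
    unfolding SUP_mult_right_ennreal unfolding SUP_mult_left_ennreal by (intro SUP_least)
  show "(SUP n. a n * b n) \<le> (SUP n. a n) * (SUP n. b n)"
    by (intro SUP_least mult_mono SUP_upper) auto
qed

lemma incseq_add_ennreal:
  fixes a b :: "nat \<Rightarrow> ennreal"
  shows "incseq a \<Longrightarrow> incseq b \<Longrightarrow> incseq (\<lambda>n. a n + b n)"
  by (auto simp: incseq_def intro!: add_mono)

section \<open>The abstract collision model and its monotone source term\<close>

text \<open>Here \<open>k\<close> is the collision frequency, \<open>\<delta>\<close> the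
  dissipation density of an ordered pair, and \<open>W\<close>, \<open>V\<close> are the weights of
  second and third order. The gain \<open>J\<close> enters as an operator: the iteration relies on
  its order properties, its measurability in a time parameter and two moment relations.
  \<open>J_W\<close> is the energy balance with the dissipation on the left; \<open>J_V\<close> is
  the Povzner estimate, in which the growth beyond the loss is only linear in the third
  moment.\<close>

locale collision_model = sigma_finite_measure M for M :: "'x measure" +
  fixes k \<delta> :: "'x \<Rightarrow> 'x \<Rightarrow> ennreal" and W V :: "'x \<Rightarrow> ennreal" and \<Lambda> :: "'x \<Rightarrow> real"
    and J :: "('x \<Rightarrow> ennreal) \<Rightarrow> 'x \<Rightarrow> ennreal" and C :: real
  assumes k_measurable: "case_prod k \<in> borel_measurable (M \<Otimes>\<^sub>M M)"
    and \<delta>_measurable: "case_prod \<delta> \<in> borel_measurable (M \<Otimes>\<^sub>M M)"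
    and W_measurable [measurable]: "W \<in> borel_measurable M"
    and V_measurable [measurable]: "V \<in> borel_measurable M"
    and \<Lambda>_measurable [measurable]: "\<Lambda> \<in> borel_measurable M"
    and C_nonneg: "0 \<le> C"
    and \<Lambda>_nonneg: "0 \<le> \<Lambda> x"
    and W_ge_1: "1 \<le> W x"
    and W_finite: "W x < \<top>"
    and k_le: "k x y \<le> ennreal (\<Lambda> x) * W y"
    and \<Lambda>_W_le: "ennreal (\<Lambda> x) * W x \<le> ennreal C * V x"
    and k_W_le: "k x y * W x \<le> ennreal C * (V x * W y + W x * V y)"
    and J_mono: "(\<And>x. f x \<le> g x) \<Longrightarrow> J f x \<le> J g x"
    and J_SUP: "incseq fs \<Longrightarrow> (\<And>n. fs n \<in> borel_measurable M) \<Longrightarrow> J (\<lambda>x. SUP n. fs n x) x = (SUP n. J (fs n) x)"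
    and J_measurable: "(\<lambda>p. h (fst p) (snd p)) \<in> borel_measurable (borel \<Otimes>\<^sub>M M) \<Longrightarrow>
      (\<lambda>p. J (h (fst p :: real)) (snd p)) \<in> borel_measurable (borel \<Otimes>\<^sub>M M)"
    and J_W: "f \<in> borel_measurable M \<Longrightarrow>
      (\<integral>\<^sup>+x. J f x * W x \<partial>M) + (\<integral>\<^sup>+x. \<integral>\<^sup>+y. f x * f y * \<delta> x y \<partial>M \<partial>M) =
      (\<integral>\<^sup>+x. \<integral>\<^sup>+y. f x * f y * (k x y * W x) \<partial>M \<partial>M)"
    and J_V: "f \<in> borel_measurable M \<Longrightarrow>
      (\<integral>\<^sup>+x. J f x * V x \<partial>M) \<le> (\<integral>\<^sup>+x. \<integral>\<^sup>+y. f x * f y * (k x y * V x) \<partial>M \<partial>M) +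
        ennreal C * ((\<integral>\<^sup>+x. f x * W x \<partial>M) * (\<integral>\<^sup>+x. f x * V x \<partial>M))"
begin

lemmas k_comp [measurable] = measurable_compose_pair[OF k_measurable[unfolded case_prod_beta']]

lemmas \<delta>_comp [measurable] = measurable_compose_pair[OF \<delta>_measurable[unfolded case_prod_beta']]

text \<open>Subtraction in \<open>ennreal\<close> is truncated; \<open>k_le\<close> makes this an
  honest difference, and it is used through \<open>\<kappa>_plus_k\<close>.\<close>

definition \<kappa> :: "'x \<Rightarrow> 'x \<Rightarrow> ennreal" where
  "\<kappa> x y = ennreal (\<Lambda> x) * W y - k x y"

definition loss :: "('x \<Rightarrow> ennreal) \<Rightarrow> 'x \<Rightarrow> ennreal" where
  "loss f x = (\<integral>\<^sup>+y. f y * k x y \<partial>M)"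

definition dissipation :: "('x \<Rightarrow> ennreal) \<Rightarrow> ennreal" where
  "dissipation f = (\<integral>\<^sup>+x. \<integral>\<^sup>+y. f x * f y * \<delta> x y \<partial>M \<partial>M)"

definition source :: "('x \<Rightarrow> ennreal) \<Rightarrow> ennreal \<Rightarrow> 'x \<Rightarrow> ennreal" where
  "source f e x = J f x + f x * (\<integral>\<^sup>+y. f y * \<kappa> x y \<partial>M) + f x * (ennreal (\<Lambda> x) * e)"

lemma \<kappa>_measurable: "(\<lambda>p. \<kappa> (fst p) (snd p)) \<in> borel_measurable (M \<Otimes>\<^sub>M M)"
  unfolding \<kappa>_def by measurable

lemmas \<kappa>_comp [measurable] = measurable_compose_pair[OF \<kappa>_measurable]

lemma \<kappa>_plus_k: "\<kappa> x y + k x y = ennreal (\<Lambda> x) * W y"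
  unfolding \<kappa>_def by (rule diff_add_cancel_ennreal[OF k_le])

lemma \<kappa>_loss:
  assumes [measurable]: "f \<in> borel_measurable M" "x \<in> space M"
  shows "(\<integral>\<^sup>+y. f y * \<kappa> x y \<partial>M) + loss f x = ennreal (\<Lambda> x) * (\<integral>\<^sup>+y. f y * W y \<partial>M)"
proof -
  have "(\<integral>\<^sup>+y. f y * \<kappa> x y \<partial>M) + loss f x = (\<integral>\<^sup>+y. f y * \<kappa> x y + f y * k x y \<partial>M)"
    unfolding loss_def by (rule nn_integral_add[symmetric]) measurable
  also have "\<dots> = (\<integral>\<^sup>+y. ennreal (\<Lambda> x) * (f y * W y) \<partial>M)"
    by (simp add: \<kappa>_plus_k mult_ac flip: distrib_left)
  also have "\<dots> = ennreal (\<Lambda> x) * (\<integral>\<^sup>+y. f y * W y \<partial>M)"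
    by (rule nn_integral_cmult) measurable
  finally show ?thesis .
qed

lemma source_measurable:
  assumes u: "(\<lambda>p. u (fst p :: real) (snd p)) \<in> borel_measurable (borel \<Otimes>\<^sub>M M)"
    and [measurable]: "e \<in> borel_measurable borel"
  shows "(\<lambda>p. source (u (fst p)) (e (fst p)) (snd p)) \<in> borel_measurable (borel \<Otimes>\<^sub>M M)"
proof -
  note [measurable] = measurable_compose_pair[OF u] J_measurable[OF u]
  show ?thesis
    unfolding source_def by measurable
qed

lemma dissipation_measurable:
  assumes u: "(\<lambda>p. u (fst p :: real) (snd p)) \<in> borel_measurable (borel \<Otimes>\<^sub>M M)"
  shows "(\<lambda>t. dissipation (u t)) \<in> borel_measurable borel"
proof -
  note [measurable] = measurable_compose_pair[OF u]
  show ?thesis unfolding dissipation_def by measurable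
qed

lemma double_integral_SUP:
  assumes "incseq f" and [measurable]: "\<And>n. f n \<in> borel_measurable M" "case_prod q \<in> borel_measurable (M \<Otimes>\<^sub>M M)"
  shows "(\<integral>\<^sup>+x. \<integral>\<^sup>+y. (SUP n. f n x) * (SUP n. f n y) * q x y \<partial>M \<partial>M) =
    (SUP n. \<integral>\<^sup>+x. \<integral>\<^sup>+y. f n x * f n y * q x y \<partial>M \<partial>M)"
proof -
  have mono: "incseq (\<lambda>n. f n x)" for x
    using assms(1) by (auto simp: incseq_def le_fun_def)
  have [measurable]: "(\<lambda>y. q x y) \<in> borel_measurable M" if "x \<in> space M" for x
    using that measurable_compose[OF measurable_Pair1' assms(3)] by simp
  have eq: "(SUP n. f n x) * (SUP n. f n y) * q x y = (SUP n. f n x * f n y * q x y)" for x y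
    using mono[of x] mono[of y]
    by (subst SUP_mult_SUP_ennreal) (simp_all add: SUP_mult_right_ennreal)
  have "(\<integral>\<^sup>+y. (SUP n. f n x) * (SUP n. f n y) * q x y \<partial>M) = (SUP n. \<integral>\<^sup>+y. f n x * f n y * q x y \<partial>M)"
    if "x \<in> space M" for x
    unfolding eq using mono that
    by (intro nn_integral_monotone_convergence_SUP) (auto simp: incseq_def le_fun_def intro!: mult_mono)
  then have "(\<integral>\<^sup>+x. \<integral>\<^sup>+y. (SUP n. f n x) * (SUP n. f n y) * q x y \<partial>M \<partial>M) =
     (\<integral>\<^sup>+x. (SUP n. \<integral>\<^sup>+y. f n x * f n y * q x y \<partial>M) \<partial>M)"
    by (intro nn_integral_cong)
  also have "\<dots> = (SUP n. \<integral>\<^sup>+x. \<integral>\<^sup>+y. f n x * f n y * q x y \<partial>M \<partial>M)"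
    using mono
    by (intro nn_integral_monotone_convergence_SUP)
       (auto simp: incseq_def le_fun_def intro!: mult_mono nn_integral_mono)
  finally show ?thesis .
qed


lemma source_mono:
  assumes "\<And>x. f x \<le> g x" "d \<le> e"
  shows "source f d x \<le> source g e x"
  unfolding source_def using assms
  by (intro add_mono mult_mono J_mono nn_integral_mono) auto

lemma dissipation_mono: "(\<And>x. f x \<le> g x) \<Longrightarrow> dissipation f \<le> dissipation g"
  unfolding dissipation_def by (intro mult_mono nn_integral_mono) auto

lemma dissipation_SUP:
  assumes "incseq f" "\<And>n. f n \<in> borel_measurable M"
  shows "dissipation (\<lambda>x. SUP n. f n x) = (SUP n. dissipation (f n))"
  unfolding dissipation_def by (rule double_integral_SUP[OF assms \<delta>_measurable])

lemma source_SUP: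
  assumes f: "incseq f" and [measurable]: "\<And>n. f n \<in> borel_measurable M" and e: "incseq e" and x[measurable]: "x \<in> space M"
  shows "source (\<lambda>x. SUP n. f n x) (SUP n. e n) x = (SUP n. source (f n) (e n) x)"
proof -
  have mono: "incseq (\<lambda>n. f n x)" for x
    using f by (auto simp: incseq_def le_fun_def)
  have "(\<integral>\<^sup>+y. (SUP n. f n y) * \<kappa> x y \<partial>M) = (SUP n. \<integral>\<^sup>+y. f n y * \<kappa> x y \<partial>M)"
    unfolding SUP_mult_right_ennreal using mono
    by (intro nn_integral_monotone_convergence_SUP) (auto simp: incseq_def le_fun_def intro!: mult_mono)
  moreover have "incseq (\<lambda>n. \<integral>\<^sup>+y. f n y * \<kappa> x y \<partial>M)"
    using mono by (auto simp: incseq_def intro!: mult_mono nn_integral_mono)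
  ultimately have 2: "(SUP n. f n x) * (\<integral>\<^sup>+y. (SUP n. f n y) * \<kappa> x y \<partial>M) = (SUP n. f n x * (\<integral>\<^sup>+y. f n y * \<kappa> x y \<partial>M))"
    and i2: "incseq (\<lambda>n. f n x * (\<integral>\<^sup>+y. f n y * \<kappa> x y \<partial>M))"
    using mono[of x] by (auto simp: SUP_mult_SUP_ennreal incseq_def intro!: mult_mono)
  have e': "incseq (\<lambda>n. ennreal (\<Lambda> x) * e n)"
    using e by (auto simp: incseq_def intro!: mult_left_mono)
  have 3: "(SUP n. f n x) * (ennreal (\<Lambda> x) * (SUP n. e n)) = (SUP n. f n x * (ennreal (\<Lambda> x) * e n))"
    using SUP_mult_SUP_ennreal[OF mono[of x] e'] by (simp add: SUP_mult_left_ennreal)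
  have i3: "incseq (\<lambda>n. f n x * (ennreal (\<Lambda> x) * e n))"
    using mono[of x] e by (auto simp: incseq_def intro!: mult_mono)
  have i1: "incseq (\<lambda>n. J (f n) x)"
    using f by (auto simp: incseq_def le_fun_def intro!: J_mono)
  show ?thesis
    unfolding source_def J_SUP[OF assms(1,2)] 2 3
    by (simp only: ennreal_SUP_add[OF incseq_add_ennreal[OF i1 i2] i3] ennreal_SUP_add[OF i1 i2])
qed

lemma double_integral_loss:
  assumes [measurable]: "f \<in> borel_measurable M" "\<psi> \<in> borel_measurable M"
  shows "(\<integral>\<^sup>+x. \<integral>\<^sup>+y. f x * f y * (k x y * \<psi> x) \<partial>M \<partial>M) = (\<integral>\<^sup>+x. f x * loss f x * \<psi> x \<partial>M)"
  unfolding loss_def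
  by (intro nn_integral_cong) (simp add: mult_ac flip: nn_integral_cmult)

text \<open>\<open>R\<close> is the part of the source that is not gain. It is described by its sum
  with the loss, because the loss integral is not known to be finite and cannot be subtracted. In
  that sum \<open>\<kappa>\<close> and \<open>k\<close> merge into the product
  \<open>\<Lambda> x * W y\<close>, so the double integral factorizes.\<close>

lemma source_integral:
  assumes [measurable]: "f \<in> borel_measurable M" "\<psi> \<in> borel_measurable M"
    and [measurable]: "J f \<in> borel_measurable M"
  obtains R where "(\<integral>\<^sup>+x. source f e x * \<psi> x \<partial>M) = (\<integral>\<^sup>+x. J f x * \<psi> x \<partial>M) + R"
    and "R + (\<integral>\<^sup>+x. f x * loss f x * \<psi> x \<partial>M) =
      (\<integral>\<^sup>+x. f x * (ennreal (\<Lambda> x) * \<psi> x) \<partial>M) * ((\<integral>\<^sup>+x. f x * W x \<partial>M) + e)"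
proof
  define r where "r x = f x * (\<integral>\<^sup>+y. f y * \<kappa> x y \<partial>M) + f x * (ennreal (\<Lambda> x) * e)" for x
  have [measurable]: "loss f \<in> borel_measurable M" "r \<in> borel_measurable M"
    unfolding loss_def r_def by measurable
  have "source f e x = J f x + r x" for x
    by (simp add: source_def r_def add_ac)
  then show "(\<integral>\<^sup>+x. source f e x * \<psi> x \<partial>M) = (\<integral>\<^sup>+x. J f x * \<psi> x \<partial>M) + (\<integral>\<^sup>+x. r x * \<psi> x \<partial>M)"
    by (simp add: distrib_right nn_integral_add)
  have "(\<integral>\<^sup>+x. r x * \<psi> x \<partial>M) + (\<integral>\<^sup>+x. f x * loss f x * \<psi> x \<partial>M) =
     (\<integral>\<^sup>+x. r x * \<psi> x + f x * loss f x * \<psi> x \<partial>M)"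
    by (rule nn_integral_add[symmetric]) measurable
  also have "\<dots> = (\<integral>\<^sup>+x. f x * (ennreal (\<Lambda> x) * \<psi> x) * ((\<integral>\<^sup>+x. f x * W x \<partial>M) + e) \<partial>M)"
  proof (rule nn_integral_cong)
    fix x assume x: "x \<in> space M"
    have "r x * \<psi> x + f x * loss f x * \<psi> x =
      (f x * ((\<integral>\<^sup>+y. f y * \<kappa> x y \<partial>M) + loss f x) + f x * (ennreal (\<Lambda> x) * e)) * \<psi> x"
      unfolding r_def by (simp add: distrib_left distrib_right add_ac)
    also have "\<dots> = f x * (ennreal (\<Lambda> x) * \<psi> x) * ((\<integral>\<^sup>+x. f x * W x \<partial>M) + e)"
      unfolding \<kappa>_loss[OF assms(1) x] by (simp only: distrib_left distrib_right mult_ac add_ac)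
    finally show "r x * \<psi> x + f x * loss f x * \<psi> x = \<dots>" .
  qed
  also have "\<dots> = (\<integral>\<^sup>+x. f x * (ennreal (\<Lambda> x) * \<psi> x) \<partial>M) * ((\<integral>\<^sup>+x. f x * W x \<partial>M) + e)"
    by (rule nn_integral_multc) measurable
  finally show "(\<integral>\<^sup>+x. r x * \<psi> x \<partial>M) + (\<integral>\<^sup>+x. f x * loss f x * \<psi> x \<partial>M) = \<dots>" .
qed

text \<open>The balance \<open>J_W\<close> trades gain plus dissipation for loss, and the loss
  completes \<open>R\<close>. What remains is the damping integral times the total energy, so a
  total equal to \<open>K\<close> reproduces exactly the damping that was added.\<close>

lemma source_W_integral:
  assumes [measurable]: "f \<in> borel_measurable M" "J f \<in> borel_measurable M"
  shows "(\<integral>\<^sup>+x. source f e x * W x \<partial>M) + dissipation f =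
    (\<integral>\<^sup>+x. f x * (ennreal (\<Lambda> x) * W x) \<partial>M) * ((\<integral>\<^sup>+x. f x * W x \<partial>M) + e)"
proof -
  obtain R where R: "(\<integral>\<^sup>+x. source f e x * W x \<partial>M) = (\<integral>\<^sup>+x. J f x * W x \<partial>M) + R"
    "R + (\<integral>\<^sup>+x. f x * loss f x * W x \<partial>M) =
      (\<integral>\<^sup>+x. f x * (ennreal (\<Lambda> x) * W x) \<partial>M) * ((\<integral>\<^sup>+x. f x * W x \<partial>M) + e)"
    by (rule source_integral[of f W e]) measurable
  have "(\<integral>\<^sup>+x. J f x * W x \<partial>M) + dissipation f = (\<integral>\<^sup>+x. f x * loss f x * W x \<partial>M)"
    unfolding dissipation_def by (simp add: J_W double_integral_loss)
  with R show ?thesis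
    by (metis add.assoc add.commute)
qed

text \<open>As for \<open>W\<close>, except that the Povzner estimate leaves a term bilinear in the
  second and third moments, which drives the exponential growth in \<open>F_V_bound\<close>.\<close>

lemma source_V_integral:
  assumes [measurable]: "f \<in> borel_measurable M" "J f \<in> borel_measurable M"
  shows "(\<integral>\<^sup>+x. source f e x * V x \<partial>M) \<le>
    (\<integral>\<^sup>+x. f x * (ennreal (\<Lambda> x) * V x) \<partial>M) * ((\<integral>\<^sup>+x. f x * W x \<partial>M) + e) +
    ennreal C * ((\<integral>\<^sup>+x. f x * W x \<partial>M) * (\<integral>\<^sup>+x. f x * V x \<partial>M))"
proof -
  obtain R where R: "(\<integral>\<^sup>+x. source f e x * V x \<partial>M) = (\<integral>\<^sup>+x. J f x * V x \<partial>M) + R"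
    "R + (\<integral>\<^sup>+x. f x * loss f x * V x \<partial>M) =
      (\<integral>\<^sup>+x. f x * (ennreal (\<Lambda> x) * V x) \<partial>M) * ((\<integral>\<^sup>+x. f x * W x \<partial>M) + e)"
    by (rule source_integral[of f V e]) measurable
  have "(\<integral>\<^sup>+x. J f x * V x \<partial>M) \<le> (\<integral>\<^sup>+x. f x * loss f x * V x \<partial>M) +
      ennreal C * ((\<integral>\<^sup>+x. f x * W x \<partial>M) * (\<integral>\<^sup>+x. f x * V x \<partial>M))"
    using J_V[of f] by (simp add: double_integral_loss)
  then have "(\<integral>\<^sup>+x. source f e x * V x \<partial>M) \<le> (\<integral>\<^sup>+x. f x * loss f x * V x \<partial>M) +
      ennreal C * ((\<integral>\<^sup>+x. f x * W x \<partial>M) * (\<integral>\<^sup>+x. f x * V x \<partial>M)) + R"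
    unfolding R(1) by (intro add_right_mono)
  then show ?thesis
    unfolding R(2)[symmetric] by (simp add: add_ac)
qed

end

section \<open>Picard iterates and their uniform moment bounds\<close>

locale collision_iteration = collision_model M k \<delta> W V \<Lambda> J C
  for M :: "'x measure" and k \<delta> W V \<Lambda> J C +
  fixes f0 :: "'x \<Rightarrow> ennreal" and K V0 :: real
  assumes f0_measurable [measurable]: "f0 \<in> borel_measurable M"
    and f0_W: "(\<integral>\<^sup>+x. f0 x * W x \<partial>M) = ennreal K"
    and f0_V: "(\<integral>\<^sup>+x. f0 x * V x \<partial>M) = ennreal V0"
    and K_pos: "0 < K" and V0_nonneg: "0 \<le> V0"
begin

text \<open>One step solves the linear equation with damping rate \<open>K * \<Lambda> x\<close>
  exactly, by Duhamel's formula. Density and dissipated energy are iterated as one pair, because the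
  source of the next density needs both.\<close>

definition step where
  "step p = (\<lambda>t x. ennreal (exp (- (K * \<Lambda> x * t))) * f0 x +
      (\<integral>\<^sup>+s. ennreal (exp (- (K * \<Lambda> x * (t - s)))) * source (fst p s) (snd p s) x * indicator {0..t} s \<partial>lborel),
     \<lambda>t::real. \<integral>\<^sup>+s. dissipation (fst p s) * indicator {0..t} s \<partial>lborel)"

definition F :: "nat \<Rightarrow> real \<Rightarrow> 'x \<Rightarrow> ennreal" where
  "F n = fst ((step ^^ n) (\<lambda>t x. 0, \<lambda>t. 0))"

definition heat :: "nat \<Rightarrow> real \<Rightarrow> ennreal" where
  "heat n = snd ((step ^^ n) (\<lambda>t x. 0, \<lambda>t. 0))"

lemma F_0: "F 0 t x = 0" and heat_0: "heat 0 t = 0"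
  by (simp_all add: F_def heat_def)

lemma F_Suc: "F (Suc n) t x = ennreal (exp (- (K * \<Lambda> x * t))) * f0 x +
      (\<integral>\<^sup>+s. ennreal (exp (- (K * \<Lambda> x * (t - s)))) * source (F n s) (heat n s) x * indicator {0..t} s \<partial>lborel)"
  by (simp add: F_def heat_def step_def)

lemma heat_Suc: "heat (Suc n) t = (\<integral>\<^sup>+s. dissipation (F n s) * indicator {0..t} s \<partial>lborel)"
  by (simp add: F_def heat_def step_def)

lemma F_heat_measurable:
  "(\<lambda>p. F n (fst p) (snd p)) \<in> borel_measurable (borel \<Otimes>\<^sub>M M) \<and> heat n \<in> borel_measurable borel"
proof (induction n)
  case 0
  then show ?case by (simp add: F_0 heat_0 fun_eq_iff cong: measurable_cong)
next
  case (Suc n)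
  note [measurable] = measurable_compose_pair[OF conjunct1[OF Suc]] conjunct2[OF Suc]
     measurable_compose_pair[OF source_measurable[OF conjunct1[OF Suc] conjunct2[OF Suc]]]
     dissipation_measurable[OF conjunct1[OF Suc]]
  show ?case unfolding F_Suc heat_Suc by measurable
qed

lemmas F_measurable = F_heat_measurable[THEN conjunct1]
lemmas F_comp [measurable] = measurable_compose_pair[OF F_measurable]
lemmas heat_measurable [measurable] = F_heat_measurable[THEN conjunct2]
lemmas source_F_comp [measurable] = measurable_compose_pair[OF source_measurable[OF F_measurable heat_measurable]]
lemmas J_F_comp [measurable] = measurable_compose_pair[OF J_measurable[OF F_measurable]]
lemmas dissipation_F_measurable [measurable] = dissipation_measurable[OF F_measurable]

lemma F_heat_mono: "F n t x \<le> F (Suc n) t x \<and> heat n t \<le> heat (Suc n) t"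
proof (induction n arbitrary: t x)
  case 0
  then show ?case by (simp add: F_0 heat_0)
next
  case (Suc n)
  have "F (Suc n) t x \<le> F (Suc (Suc n)) t x"
    using Suc by (subst F_Suc[of n t x], subst F_Suc[of "Suc n" t x], intro add_mono nn_integral_mono mult_mono source_mono) auto
  moreover have "heat (Suc n) t \<le> heat (Suc (Suc n)) t"
    unfolding heat_Suc using Suc by (intro nn_integral_mono mult_mono dissipation_mono) auto
  ultimately show ?case by simp
qed

lemma incseq_F: "incseq (\<lambda>n. F n t x)" and incseq_heat: "incseq (\<lambda>n. heat n t)"
  using F_heat_mono by (auto intro: incseq_SucI)

text \<open>The damping acts on the new iterate and the source on the old one; the moment bounds
  have to absorb this offset.\<close>

lemma F_Suc_identity:
  assumes x[measurable]: "x \<in> space M" and t: "0 \<le> t"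
  shows "F (Suc n) t x + (\<integral>\<^sup>+s. ennreal (K * \<Lambda> x) * F (Suc n) s x * indicator {0..t} s \<partial>lborel) =
    f0 x + (\<integral>\<^sup>+s. source (F n s) (heat n s) x * indicator {0..t} s \<partial>lborel)"
  unfolding F_Suc using K_pos \<Lambda>_nonneg[of x] t
  by (intro duhamel_identity) auto

text \<open>Only Tonelli is involved. The damping term carries the heavier weight
  \<open>\<Lambda> x * \<psi> x\<close>, so its finiteness must be established before it can be
  cancelled.\<close>

lemma F_Suc_integral:
  assumes [measurable]: "\<psi> \<in> borel_measurable M" and t: "0 \<le> t"
  shows "(\<integral>\<^sup>+x. F (Suc n) t x * \<psi> x \<partial>M) +
      ennreal K * (\<integral>\<^sup>+s. (\<integral>\<^sup>+x. F (Suc n) s x * (ennreal (\<Lambda> x) * \<psi> x) \<partial>M) * indicator {0..t} s \<partial>lborel) =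
    (\<integral>\<^sup>+x. f0 x * \<psi> x \<partial>M) + (\<integral>\<^sup>+s. (\<integral>\<^sup>+x. source (F n s) (heat n s) x * \<psi> x \<partial>M) * indicator {0..t} s \<partial>lborel)"
proof -
  interpret P: pair_sigma_finite M lborel ..
  have "(\<integral>\<^sup>+s. (\<integral>\<^sup>+x. F (Suc n) s x * (ennreal (\<Lambda> x) * \<psi> x) \<partial>M) * indicator {0..t} s \<partial>lborel) =
     (\<integral>\<^sup>+s. (\<integral>\<^sup>+x. F (Suc n) s x * (ennreal (\<Lambda> x) * \<psi> x) * indicator {0..t} s \<partial>M) \<partial>lborel)"
    by (simp add: nn_integral_multc)
  also have "\<dots> = (\<integral>\<^sup>+x. (\<integral>\<^sup>+s. F (Suc n) s x * (ennreal (\<Lambda> x) * \<psi> x) * indicator {0..t} s \<partial>lborel) \<partial>M)"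
    by (rule P.Fubini') measurable
  finally have *: "(\<integral>\<^sup>+s. (\<integral>\<^sup>+x. F (Suc n) s x * (ennreal (\<Lambda> x) * \<psi> x) \<partial>M) * indicator {0..t} s \<partial>lborel) = \<dots>" .
  have 1: "ennreal K * (\<integral>\<^sup>+s. (\<integral>\<^sup>+x. F (Suc n) s x * (ennreal (\<Lambda> x) * \<psi> x) \<partial>M) * indicator {0..t} s \<partial>lborel) =
    (\<integral>\<^sup>+x. (\<integral>\<^sup>+s. ennreal (K * \<Lambda> x) * F (Suc n) s x * indicator {0..t} s \<partial>lborel) * \<psi> x \<partial>M)"
  proof -
    have "(\<integral>\<^sup>+s. ennreal (K * \<Lambda> x) * F (Suc n) s x * indicator {0..t} s \<partial>lborel) * \<psi> x =
      ennreal K * (\<integral>\<^sup>+s. F (Suc n) s x * (ennreal (\<Lambda> x) * \<psi> x) * indicator {0..t} s \<partial>lborel)"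
      if [measurable]: "x \<in> space M" for x
    proof -
      have "(\<integral>\<^sup>+s. ennreal (K * \<Lambda> x) * F (Suc n) s x * indicator {0..t} s \<partial>lborel) * \<psi> x =
        (\<integral>\<^sup>+s. ennreal (K * \<Lambda> x) * F (Suc n) s x * indicator {0..t} s * \<psi> x \<partial>lborel)"
        by (rule nn_integral_multc[symmetric]) measurable
      also have "\<dots> = (\<integral>\<^sup>+s. ennreal K * (F (Suc n) s x * (ennreal (\<Lambda> x) * \<psi> x) * indicator {0..t} s) \<partial>lborel)"
        using K_pos \<Lambda>_nonneg[of x] by (intro nn_integral_cong) (simp add: ennreal_mult mult_ac)
      also have "\<dots> = ennreal K * (\<integral>\<^sup>+s. F (Suc n) s x * (ennreal (\<Lambda> x) * \<psi> x) * indicator {0..t} s \<partial>lborel)"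
        by (rule nn_integral_cmult) measurable
      finally show ?thesis .
    qed
    then have "(\<integral>\<^sup>+x. (\<integral>\<^sup>+s. ennreal (K * \<Lambda> x) * F (Suc n) s x * indicator {0..t} s \<partial>lborel) * \<psi> x \<partial>M) =
        (\<integral>\<^sup>+x. ennreal K * (\<integral>\<^sup>+s. F (Suc n) s x * (ennreal (\<Lambda> x) * \<psi> x) * indicator {0..t} s \<partial>lborel) \<partial>M)"
      by (rule nn_integral_cong)
    then show ?thesis
      unfolding * by (subst (asm) nn_integral_cmult) simp_all
  qed
  have "(\<integral>\<^sup>+s. (\<integral>\<^sup>+x. source (F n s) (heat n s) x * \<psi> x \<partial>M) * indicator {0..t} s \<partial>lborel) =
     (\<integral>\<^sup>+s. (\<integral>\<^sup>+x. source (F n s) (heat n s) x * \<psi> x * indicator {0..t} s \<partial>M) \<partial>lborel)"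
    by (simp add: nn_integral_multc)
  also have "\<dots> = (\<integral>\<^sup>+x. (\<integral>\<^sup>+s. source (F n s) (heat n s) x * \<psi> x * indicator {0..t} s \<partial>lborel) \<partial>M)"
    by (rule P.Fubini') measurable
  also have "\<dots> = (\<integral>\<^sup>+x. (\<integral>\<^sup>+s. source (F n s) (heat n s) x * indicator {0..t} s \<partial>lborel) * \<psi> x \<partial>M)"
    by (intro nn_integral_cong) (simp add: mult_ac flip: nn_integral_cmult)
  finally have 2: "(\<integral>\<^sup>+s. (\<integral>\<^sup>+x. source (F n s) (heat n s) x * \<psi> x \<partial>M) * indicator {0..t} s \<partial>lborel) = \<dots>" .
  have "(\<integral>\<^sup>+x. F (Suc n) t x * \<psi> x \<partial>M) +
      (\<integral>\<^sup>+x. (\<integral>\<^sup>+s. ennreal (K * \<Lambda> x) * F (Suc n) s x * indicator {0..t} s \<partial>lborel) * \<psi> x \<partial>M) =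
    (\<integral>\<^sup>+x. F (Suc n) t x * \<psi> x + (\<integral>\<^sup>+s. ennreal (K * \<Lambda> x) * F (Suc n) s x * indicator {0..t} s \<partial>lborel) * \<psi> x \<partial>M)"
    by (rule nn_integral_add[symmetric]) measurable
  also have "\<dots> = (\<integral>\<^sup>+x. f0 x * \<psi> x + (\<integral>\<^sup>+s. source (F n s) (heat n s) x * indicator {0..t} s \<partial>lborel) * \<psi> x \<partial>M)"
    by (intro nn_integral_cong) (simp only: F_Suc_identity t flip: distrib_right)
  also have "\<dots> = (\<integral>\<^sup>+x. f0 x * \<psi> x \<partial>M) +
      (\<integral>\<^sup>+x. (\<integral>\<^sup>+s. source (F n s) (heat n s) x * indicator {0..t} s \<partial>lborel) * \<psi> x \<partial>M)"
    by (rule nn_integral_add) measurable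
  finally show ?thesis
    unfolding 1 2 .
qed

end

lemma ennreal_add_le_add_rightD:
  fixes a b c :: ennreal
  shows "a + c \<le> b + c \<Longrightarrow> c < \<top> \<Longrightarrow> a \<le> b"
  by (auto simp: add.commute[of _ c] ennreal_add_left_cancel_le)

context collision_iteration
begin

text \<open>Both claims are proved in one induction. The energy identity bounds the next iterate up
  to the difference of the damping integrals at \<open>n\<close> and \<open>Suc n\<close>. The
  iterates increase, so this difference has the right sign, and finiteness of the damping integral
  permits the cancellation.\<close>

lemma F_W_bound:
  assumes t: "0 \<le> t"
  shows "(\<integral>\<^sup>+x. F n t x * W x \<partial>M) + heat n t \<le> ennreal K"
    and "(\<integral>\<^sup>+s. (\<integral>\<^sup>+x. F n s x * (ennreal (\<Lambda> x) * W x) \<partial>M) * indicator {0..t} s \<partial>lborel) < \<top>"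
proof -
  have "(\<forall>t\<ge>0. (\<integral>\<^sup>+x. F n t x * W x \<partial>M) + heat n t \<le> ennreal K) \<and>
     (\<integral>\<^sup>+s. (\<integral>\<^sup>+x. F n s x * (ennreal (\<Lambda> x) * W x) \<partial>M) * indicator {0..t} s \<partial>lborel) < \<top>"
    if "0 \<le> t" for t
    using that
  proof (induction n arbitrary: t)
    case 0
    then show ?case by (simp add: F_0 heat_0)
  next
    case (Suc n)
    define a where "a n s = (\<integral>\<^sup>+x. F n s x * (ennreal (\<Lambda> x) * W x) \<partial>M)" for n s
    define A where "A n t = (\<integral>\<^sup>+s. a n s * indicator {0..t} s \<partial>lborel)" for n and t :: real
    have [measurable]: "a n \<in> borel_measurable borel" for n
      unfolding a_def by measurable
    \<comment> \<open>The induction hypothesis at time 0 already contains the bound at every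
      time.\<close>
    note W_bound = Suc.IH[OF order.refl, THEN conjunct1, rule_format]
    \<comment> \<open>The dissipation collected in \<open>heat (Suc n)\<close> completes the source
      to the full balance of \<open>source_W_integral\<close>; the remaining factor, the total
      energy of step \<open>n\<close>, is at most \<open>K\<close>.\<close>
    have key: "(\<integral>\<^sup>+x. F (Suc n) t x * W x \<partial>M) + heat (Suc n) t + ennreal K * A (Suc n) t \<le> ennreal K + ennreal K * A n t"
      if t: "0 \<le> t" for t
    proof -
      have *: "(\<integral>\<^sup>+x. F (Suc n) t x * W x \<partial>M) + ennreal K * A (Suc n) t + heat (Suc n) t =
         ennreal K + ((\<integral>\<^sup>+s. (\<integral>\<^sup>+x. source (F n s) (heat n s) x * W x \<partial>M) * indicator {0..t} s \<partial>lborel) + heat (Suc n) t)"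
        unfolding A_def a_def F_Suc_integral[OF W_measurable t] f0_W by (simp add: add.assoc)
      have "(\<integral>\<^sup>+s. (\<integral>\<^sup>+x. source (F n s) (heat n s) x * W x \<partial>M) * indicator {0..t} s \<partial>lborel) + heat (Suc n) t =
        (\<integral>\<^sup>+s. (\<integral>\<^sup>+x. source (F n s) (heat n s) x * W x \<partial>M) * indicator {0..t} s + dissipation (F n s) * indicator {0..t} s \<partial>lborel)"
        unfolding heat_Suc by (rule nn_integral_add[symmetric]) measurable
      also have "\<dots> = (\<integral>\<^sup>+s. a n s * ((\<integral>\<^sup>+x. F n s x * W x \<partial>M) + heat n s) * indicator {0..t} s \<partial>lborel)"
        unfolding distrib_right[symmetric] a_def
        by (subst source_W_integral) (simp_all)
      also have "\<dots> \<le> (\<integral>\<^sup>+s. ennreal K * (a n s * indicator {0..t} s) \<partial>lborel)"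
        by (intro nn_integral_mono) (auto split: split_indicator simp: mult.commute[of "ennreal K"] intro!: mult_left_mono W_bound)
      also have "\<dots> = ennreal K * A n t"
        unfolding A_def by (rule nn_integral_cmult) measurable
      finally show ?thesis
        unfolding add.assoc[of "\<integral>\<^sup>+x. F (Suc n) t x * W x \<partial>M"] add.commute[of "heat (Suc n) t"]
        unfolding add.assoc[symmetric, of "\<integral>\<^sup>+x. F (Suc n) t x * W x \<partial>M"] * by (rule add_left_mono)
    qed
    have fin_n: "A n t < \<top>" if "0 \<le> t" for t
      using Suc.IH[OF that] unfolding A_def a_def by simp
    have fin: "A (Suc n) t < \<top>" if "0 \<le> t" for t
    proof -
      have "ennreal K * A (Suc n) t \<le> ennreal K + ennreal K * A n t"
        by (rule order_trans[OF _ key[OF that]]) (simp add: add_increasing)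
      also have "\<dots> < \<top>"
        using fin_n[OF that] by (simp add: ennreal_mult_less_top)
      finally show ?thesis
        using K_pos by (auto simp: ennreal_mult_less_top)
    qed
    have "(\<integral>\<^sup>+x. F (Suc n) t x * W x \<partial>M) + heat (Suc n) t \<le> ennreal K" if "0 \<le> t" for t
    proof -
      \<comment> \<open>Monotonicity of the iterates: the damping of the old iterate is absorbed by
        that of the new one.\<close>
      have "A n t \<le> A (Suc n) t"
        unfolding A_def a_def by (intro nn_integral_mono mult_right_mono) (auto simp: F_heat_mono)
      then have "(\<integral>\<^sup>+x. F (Suc n) t x * W x \<partial>M) + heat (Suc n) t + ennreal K * A (Suc n) t
         \<le> ennreal K + ennreal K * A (Suc n) t"
        by (intro order_trans[OF key[OF that]] add_left_mono mult_left_mono) auto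
      then show ?thesis
        by (rule ennreal_add_le_add_rightD) (use fin[OF that] in \<open>simp add: ennreal_mult_less_top\<close>)
    qed
    then show ?case
      using fin[OF Suc.prems] unfolding A_def a_def by simp
  qed
  then show "(\<integral>\<^sup>+x. F n t x * W x \<partial>M) + heat n t \<le> ennreal K"
    "(\<integral>\<^sup>+s. (\<integral>\<^sup>+x. F n s x * (ennreal (\<Lambda> x) * W x) \<partial>M) * indicator {0..t} s \<partial>lborel) < \<top>"
    using t by blast+
qed

text \<open>The bound solves \<open>y' = C K y\<close> with initial value \<open>V0\<close>, and
  therefore reproduces itself under the Povzner term. The damping integral has weight
  \<open>\<Lambda> x * V x\<close>, beyond the moment being estimated; the induction gives its
  finiteness for each single \<open>n\<close>, which suffices for the cancellation.\<close>

lemma F_V_bound: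
  assumes t: "0 \<le> t"
  shows "(\<integral>\<^sup>+x. F n t x * V x \<partial>M) \<le> ennreal (V0 * exp (C * K * t))"
proof -
  have "(\<forall>t\<ge>0. (\<integral>\<^sup>+x. F n t x * V x \<partial>M) \<le> ennreal (V0 * exp (C * K * t))) \<and>
     (\<integral>\<^sup>+s. (\<integral>\<^sup>+x. F n s x * (ennreal (\<Lambda> x) * V x) \<partial>M) * indicator {0..t} s \<partial>lborel) < \<top>"
    if "0 \<le> t" for t
    using that
  proof (induction n arbitrary: t)
    case 0
    then show ?case by (simp add: F_0)
  next
    case (Suc n)
    define a where "a n s = (\<integral>\<^sup>+x. F n s x * (ennreal (\<Lambda> x) * V x) \<partial>M)" for n s
    define A where "A n t = (\<integral>\<^sup>+s. a n s * indicator {0..t} s \<partial>lborel)" for n and t :: real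
    have [measurable]: "a n \<in> borel_measurable borel" for n
      unfolding a_def by measurable
    note V_bound = Suc.IH[OF order.refl, THEN conjunct1, rule_format]
    have key: "(\<integral>\<^sup>+x. F (Suc n) t x * V x \<partial>M) + ennreal K * A (Suc n) t \<le> ennreal (V0 * exp (C * K * t)) + ennreal K * A n t"
      if t: "0 \<le> t" for t
    proof -
      have *: "(\<integral>\<^sup>+x. source (F n s) (heat n s) x * V x \<partial>M) \<le> ennreal K * a n s + ennreal (C * K * (V0 * exp (C * K * s)))"
        if "0 \<le> s" for s
      proof -
        have "(\<integral>\<^sup>+x. F n s x * W x \<partial>M) \<le> ennreal K"
          by (rule order_trans[OF _ F_W_bound(1)[OF that, of n]]) simp
        moreover have "(\<integral>\<^sup>+x. source (F n s) (heat n s) x * V x \<partial>M) \<le>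
           a n s * ((\<integral>\<^sup>+x. F n s x * W x \<partial>M) + heat n s) +
           ennreal C * ((\<integral>\<^sup>+x. F n s x * W x \<partial>M) * (\<integral>\<^sup>+x. F n s x * V x \<partial>M))"
          unfolding a_def by (rule source_V_integral) measurable
        ultimately have "(\<integral>\<^sup>+x. source (F n s) (heat n s) x * V x \<partial>M) \<le>
           a n s * ennreal K + ennreal C * (ennreal K * ennreal (V0 * exp (C * K * s)))"
          using F_W_bound(1)[OF that, of n] V_bound[OF that]
          by (elim order_trans) (rule add_mono[OF mult_left_mono mult_left_mono[OF mult_mono]]; simp)
        also have "\<dots> = ennreal K * a n s + ennreal (C * K * (V0 * exp (C * K * s)))"
          using C_nonneg K_pos V0_nonneg by (simp add: ennreal_mult mult_ac)
        finally show ?thesis .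
      qed
      have **: "(\<integral>\<^sup>+x. F (Suc n) t x * V x \<partial>M) + ennreal K * A (Suc n) t =
         ennreal V0 + (\<integral>\<^sup>+s. (\<integral>\<^sup>+x. source (F n s) (heat n s) x * V x \<partial>M) * indicator {0..t} s \<partial>lborel)"
        unfolding A_def a_def F_Suc_integral[OF V_measurable t] f0_V by simp
      have "(\<integral>\<^sup>+s. (\<integral>\<^sup>+x. source (F n s) (heat n s) x * V x \<partial>M) * indicator {0..t} s \<partial>lborel) \<le>
        (\<integral>\<^sup>+s. ennreal K * (a n s * indicator {0..t} s) + ennreal (C * K * (V0 * exp (C * K * s))) * indicator {0..t} s \<partial>lborel)"
        by (intro nn_integral_mono) (auto split: split_indicator intro!: *)
      also have "\<dots> = ennreal K * A n t + (\<integral>\<^sup>+s. ennreal (C * K * (V0 * exp (C * K * s))) * indicator {0..t} s \<partial>lborel)"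
        unfolding A_def by (subst nn_integral_add) (simp_all add: nn_integral_cmult)
      \<comment> \<open>The Povzner term integrates to exactly the growth of the claimed bound over
        \<open>{0..t}\<close>.\<close>
      also have "(\<integral>\<^sup>+s. ennreal (C * K * (V0 * exp (C * K * s))) * indicator {0..t} s \<partial>lborel) =
        ennreal (V0 * exp (C * K * t) - V0 * exp (C * K * 0))"
        using t C_nonneg K_pos V0_nonneg
        by (intro nn_integral_FTC_Icc) (auto intro!: derivative_eq_intros)
      finally have ***: "ennreal V0 + (\<integral>\<^sup>+s. (\<integral>\<^sup>+x. source (F n s) (heat n s) x * V x \<partial>M) * indicator {0..t} s \<partial>lborel) \<le>
        ennreal V0 + (ennreal K * A n t + ennreal (V0 * exp (C * K * t) - V0 * exp (C * K * 0)))"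
        by (rule add_left_mono)
      have "ennreal V0 + (ennreal K * A n t + ennreal (V0 * exp (C * K * t) - V0 * exp (C * K * 0))) =
        ennreal (V0 * exp (C * K * t)) + ennreal K * A n t"
      proof -
        have "ennreal V0 + ennreal (V0 * exp (C * K * t) - V0 * exp (C * K * 0)) = ennreal (V0 * exp (C * K * t))"
          using t C_nonneg K_pos V0_nonneg
          by (subst ennreal_plus[symmetric]) (auto simp: mult_le_cancel_left1)
        then show ?thesis by (metis add.commute add.left_commute)
      qed
      with *** show ?thesis unfolding ** by (simp only:)
    qed
    have fin_n: "A n t < \<top>" if "0 \<le> t" for t
      using Suc.IH[OF that] unfolding A_def a_def by simp
    have fin: "A (Suc n) t < \<top>" if "0 \<le> t" for t
    proof -
      have "ennreal K * A (Suc n) t \<le> ennreal (V0 * exp (C * K * t)) + ennreal K * A n t"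
        by (rule order_trans[OF _ key[OF that]]) (simp add: add_increasing)
      also have "\<dots> < \<top>"
        using fin_n[OF that] by (simp add: ennreal_mult_less_top)
      finally show ?thesis
        using K_pos by (auto simp: ennreal_mult_less_top)
    qed
    have "(\<integral>\<^sup>+x. F (Suc n) t x * V x \<partial>M) \<le> ennreal (V0 * exp (C * K * t))" if "0 \<le> t" for t
    proof -
      have "A n t \<le> A (Suc n) t"
        unfolding A_def a_def by (intro nn_integral_mono mult_right_mono) (auto simp: F_heat_mono)
      then have "(\<integral>\<^sup>+x. F (Suc n) t x * V x \<partial>M) + ennreal K * A (Suc n) t
         \<le> ennreal (V0 * exp (C * K * t)) + ennreal K * A (Suc n) t"
        by (intro order_trans[OF key[OF that]] add_left_mono mult_left_mono) auto
      then show ?thesis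
        by (rule ennreal_add_le_add_rightD) (use fin[OF that] in \<open>simp add: ennreal_mult_less_top\<close>)
    qed
    then show ?case
      using fin[OF Suc.prems] unfolding A_def a_def by simp
  qed
  then show ?thesis
    using t by blast
qed

end

section \<open>The limit of the iterates: energy balance and equation\<close>

lemma SUP_Suc_shift:
  fixes f :: "nat \<Rightarrow> ennreal"
  assumes "incseq f"
  shows "(SUP n. f (Suc n)) = (SUP n. f n)"
proof (rule antisym)
  show "(SUP n. f (Suc n)) \<le> (SUP n. f n)"
    by (intro SUP_least SUP_upper) auto
  show "(SUP n. f n) \<le> (SUP n. f (Suc n))"
    using assms by (intro SUP_mono) (auto simp: incseq_Suc_iff)
qed

lemma ennreal_cmult_less_top: "b < \<top> \<Longrightarrow> ennreal a * b < \<top>"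
  by (simp add: ennreal_mult_less_top)

text \<open>Feeding the inequality into itself turns the bound \<open>B\<close> into
  \<open>B * (c * t) ^ n / fact n\<close>, which tends to 0.\<close>

lemma gronwall_zero:
  fixes d :: "real \<Rightarrow> ennreal" and B c T :: real
  assumes [measurable]: "d \<in> borel_measurable borel" and "0 \<le> c" "0 \<le> B"
    and bound: "\<And>t. 0 \<le> t \<Longrightarrow> t \<le> T \<Longrightarrow> d t \<le> ennreal B"
    and le: "\<And>t. 0 \<le> t \<Longrightarrow> t \<le> T \<Longrightarrow> d t \<le> ennreal c * (\<integral>\<^sup>+s. d s * indicator {0..t} s \<partial>lborel)"
    and t: "0 \<le> t" "t \<le> T"
  shows "d t = 0"
proof -
  have *: "d t \<le> ennreal (B * ((c * t) ^ n / fact n))" if "0 \<le> t" "t \<le> T" for n t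
    using that
  proof (induction n arbitrary: t)
    case 0
    then show ?case using bound by simp
  next
    case (Suc n)
    have "d t \<le> ennreal c * (\<integral>\<^sup>+s. d s * indicator {0..t} s \<partial>lborel)"
      using Suc.prems le by blast
    also have "\<dots> \<le> ennreal c * (\<integral>\<^sup>+s. ennreal (B * ((c * s) ^ n / fact n)) * indicator {0..t} s \<partial>lborel)"
      using Suc by (intro mult_left_mono nn_integral_mono) (auto split: split_indicator)
    also have "\<dots> = (\<integral>\<^sup>+s. ennreal (c * (B * ((c * s) ^ n / fact n))) * indicator {0..t} s \<partial>lborel)"
      using assms(2) by (subst nn_integral_cmult[symmetric], measurable) (simp only: ennreal_mult' mult.assoc)
    also have "\<dots> = ennreal (B * ((c * t) ^ Suc n / fact (Suc n)) - B * ((c * 0) ^ Suc n / fact (Suc n)))"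
    proof (rule nn_integral_FTC_Icc[where F="\<lambda>t. B * ((c * t) ^ Suc n / fact (Suc n))"])
      show "((\<lambda>t. B * ((c * t) ^ Suc n / fact (Suc n))) has_real_derivative c * (B * ((c * x) ^ n / fact n))) (at x)" for x
        by (rule power_fact_derivative)
    qed (use Suc.prems assms in auto)
    finally show ?case by simp
  qed
  have "(\<lambda>n. ennreal (B * ((c * t) ^ n / fact n))) \<longlonglongrightarrow> ennreal (B * 0)"
    using summable_LIMSEQ_zero[OF summable_exp[of "c * t"]]
    by (intro tendsto_ennrealI tendsto_mult tendsto_const) (simp add: divide_inverse mult.commute)
  then have "d t \<le> ennreal (B * 0)"
    using *[OF t] by (intro LIMSEQ_le_const) auto
  then show ?thesis by simp
qed

context collision_iteration
begin

definition sol :: "real \<Rightarrow> 'x \<Rightarrow> ennreal" where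
  "sol t x = (SUP n. F n t x)"

definition total_heat :: "real \<Rightarrow> ennreal" where
  "total_heat t = (SUP n. heat n t)"

lemma sol_measurable: "(\<lambda>p. sol (fst p) (snd p)) \<in> borel_measurable (borel \<Otimes>\<^sub>M M)"
  unfolding sol_def by measurable

lemma total_heat_measurable [measurable]: "total_heat \<in> borel_measurable borel"
  unfolding total_heat_def by measurable

lemmas sol_comp [measurable] = measurable_compose_pair[OF sol_measurable]
lemmas source_sol_comp [measurable] = measurable_compose_pair[OF source_measurable[OF sol_measurable total_heat_measurable]]
lemmas J_sol_comp [measurable] = measurable_compose_pair[OF J_measurable[OF sol_measurable]]
lemmas dissipation_sol_measurable [measurable] = dissipation_measurable[OF sol_measurable]

lemma loss_sol_measurable: "(\<lambda>p. loss (sol (fst p)) (snd p)) \<in> borel_measurable (borel \<Otimes>\<^sub>M M)"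
  unfolding loss_def by measurable

lemmas loss_sol_comp [measurable] = measurable_compose_pair[OF loss_sol_measurable]

lemma incseq_F_fun: "incseq (\<lambda>n. F n t)"
  using incseq_F by (auto simp: incseq_def le_fun_def)

lemma total_heat_eq: "total_heat t = (\<integral>\<^sup>+s. dissipation (sol s) * indicator {0..t} s \<partial>lborel)"
proof -
  have "total_heat t = (SUP n. \<integral>\<^sup>+s. dissipation (F n s) * indicator {0..t} s \<partial>lborel)"
    unfolding total_heat_def SUP_Suc_shift[OF incseq_heat, symmetric] heat_Suc ..
  also have "\<dots> = (\<integral>\<^sup>+s. (SUP n. dissipation (F n s) * indicator {0..t} s) \<partial>lborel)"
    using incseq_F
    by (intro nn_integral_monotone_convergence_SUP[symmetric])
       (auto simp: incseq_def le_fun_def intro!: mult_right_mono dissipation_mono)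
  also have "(\<lambda>s. SUP n. dissipation (F n s) * indicator {0..t} s) = (\<lambda>s. dissipation (sol s) * indicator {0..t} s)"
    unfolding SUP_mult_right_ennreal[symmetric] sol_def
    by (subst dissipation_SUP[OF incseq_F_fun]) simp_all
  finally show ?thesis .
qed

lemma source_sol: "x \<in> space M \<Longrightarrow> source (sol t) (total_heat t) x = (SUP n. source (F n t) (heat n t) x)"
  unfolding sol_def[abs_def] total_heat_def
  by (rule source_SUP[OF incseq_F_fun _ incseq_heat]) auto

text \<open>Monotone convergence in \<open>F_Suc_identity\<close>. The offset between
  \<open>n\<close> and \<open>Suc n\<close> disappears in the supremum, so the limit solves the
  damped equation with its own source.\<close>

lemma sol_identity:
  assumes x[measurable]: "x \<in> space M" and t: "0 \<le> t"
  shows "sol t x + (\<integral>\<^sup>+s. ennreal (K * \<Lambda> x) * sol s x * indicator {0..t} s \<partial>lborel) =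
    f0 x + (\<integral>\<^sup>+s. source (sol s) (total_heat s) x * indicator {0..t} s \<partial>lborel)"
proof -
  have mF: "m \<le> n \<Longrightarrow> F m s x \<le> F n s x" for m n s x
    using incseq_F by (auto simp: incseq_def)
  have mh: "m \<le> n \<Longrightarrow> heat m s \<le> heat n s" for m n s
    using incseq_heat by (auto simp: incseq_def)
  have i1: "incseq (\<lambda>n. \<integral>\<^sup>+s. ennreal (K * \<Lambda> x) * F n s x * indicator {0..t} s \<partial>lborel)"
    by (auto simp: incseq_def intro!: nn_integral_mono mult_mono mF)
  have i2: "incseq (\<lambda>n. \<integral>\<^sup>+s. source (F n s) (heat n s) x * indicator {0..t} s \<partial>lborel)"
    by (auto simp: incseq_def intro!: nn_integral_mono mult_mono source_mono mF mh)
  have 1: "(\<integral>\<^sup>+s. ennreal (K * \<Lambda> x) * sol s x * indicator {0..t} s \<partial>lborel) =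
     (SUP n. \<integral>\<^sup>+s. ennreal (K * \<Lambda> x) * F n s x * indicator {0..t} s \<partial>lborel)"
    unfolding sol_def SUP_mult_left_ennreal SUP_mult_right_ennreal
    by (intro nn_integral_monotone_convergence_SUP)
       (auto simp: incseq_def le_fun_def intro!: mult_mono mF)
  have 2: "(\<integral>\<^sup>+s. source (sol s) (total_heat s) x * indicator {0..t} s \<partial>lborel) =
     (SUP n. \<integral>\<^sup>+s. source (F n s) (heat n s) x * indicator {0..t} s \<partial>lborel)"
    unfolding source_sol[OF x] SUP_mult_right_ennreal
    by (intro nn_integral_monotone_convergence_SUP)
       (auto simp: incseq_def le_fun_def intro!: mult_mono mF mh source_mono)
  have "sol t x + (\<integral>\<^sup>+s. ennreal (K * \<Lambda> x) * sol s x * indicator {0..t} s \<partial>lborel) =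
    (SUP n. F n t x + (\<integral>\<^sup>+s. ennreal (K * \<Lambda> x) * F n s x * indicator {0..t} s \<partial>lborel))"
    unfolding 1 unfolding sol_def by (rule ennreal_SUP_add[OF incseq_F i1, symmetric])
  also have "\<dots> = (SUP n. F (Suc n) t x + (\<integral>\<^sup>+s. ennreal (K * \<Lambda> x) * F (Suc n) s x * indicator {0..t} s \<partial>lborel))"
    by (rule SUP_Suc_shift[OF incseq_add_ennreal[OF incseq_F i1], symmetric])
  also have "\<dots> = (SUP n. f0 x + (\<integral>\<^sup>+s. source (F n s) (heat n s) x * indicator {0..t} s \<partial>lborel))"
    unfolding F_Suc_identity[OF assms] ..
  also have "\<dots> = f0 x + (SUP n. \<integral>\<^sup>+s. source (F n s) (heat n s) x * indicator {0..t} s \<partial>lborel)"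
    by (rule ennreal_SUP_add_right[symmetric]) simp
  finally show ?thesis unfolding 2 .
qed

lemma sol_integral_SUP:
  assumes [measurable]: "\<psi> \<in> borel_measurable M"
  shows "(\<integral>\<^sup>+x. sol t x * \<psi> x \<partial>M) = (SUP n. \<integral>\<^sup>+x. F n t x * \<psi> x \<partial>M)"
  unfolding sol_def SUP_mult_right_ennreal using incseq_F
  by (intro nn_integral_monotone_convergence_SUP) (auto simp: incseq_def le_fun_def intro!: mult_right_mono)

lemma sol_W_bound:
  assumes "0 \<le> t"
  shows "(\<integral>\<^sup>+x. sol t x * W x \<partial>M) + total_heat t \<le> ennreal K"
proof -
  have "incseq (\<lambda>n. \<integral>\<^sup>+x. F n t x * W x \<partial>M)"
    using incseq_F by (auto simp: incseq_def intro!: nn_integral_mono mult_right_mono)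
  then have "(\<integral>\<^sup>+x. sol t x * W x \<partial>M) + total_heat t = (SUP n. (\<integral>\<^sup>+x. F n t x * W x \<partial>M) + heat n t)"
    unfolding total_heat_def by (simp add: sol_integral_SUP ennreal_SUP_add incseq_heat)
  also have "\<dots> \<le> ennreal K"
    by (intro SUP_least F_W_bound assms)
  finally show ?thesis .
qed

lemma sol_W_le: "0 \<le> t \<Longrightarrow> (\<integral>\<^sup>+x. sol t x * W x \<partial>M) \<le> ennreal K"
  by (rule order_trans[OF _ sol_W_bound[of t]]) simp_all

lemma sol_V_bound: "0 \<le> t \<Longrightarrow> (\<integral>\<^sup>+x. sol t x * V x \<partial>M) \<le> ennreal (V0 * exp (C * K * t))"
  unfolding sol_integral_SUP[OF V_measurable] by (intro SUP_least F_V_bound)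

lemma time_integral_swap:
  assumes u: "(\<lambda>p. u (fst p :: real) (snd p)) \<in> borel_measurable (borel \<Otimes>\<^sub>M M)"
    and [measurable]: "\<psi> \<in> borel_measurable M" "A \<in> sets borel"
  shows "(\<integral>\<^sup>+x. (\<integral>\<^sup>+s. u s x * indicator A s \<partial>lborel) * \<psi> x \<partial>M) =
    (\<integral>\<^sup>+s. (\<integral>\<^sup>+x. u s x * \<psi> x \<partial>M) * indicator A s \<partial>lborel)"
proof -
  note [measurable] = measurable_compose_pair[OF u]
  interpret P: pair_sigma_finite M lborel ..
  have "(\<integral>\<^sup>+x. (\<integral>\<^sup>+s. u s x * indicator A s \<partial>lborel) * \<psi> x \<partial>M) =
     (\<integral>\<^sup>+x. (\<integral>\<^sup>+s. u s x * \<psi> x * indicator A s \<partial>lborel) \<partial>M)"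
    by (intro nn_integral_cong) (simp add: mult_ac flip: nn_integral_cmult)
  also have "\<dots> = (\<integral>\<^sup>+s. (\<integral>\<^sup>+x. u s x * \<psi> x * indicator A s \<partial>M) \<partial>lborel)"
    by (rule P.Fubini'[symmetric]) measurable
  also have "\<dots> = (\<integral>\<^sup>+s. (\<integral>\<^sup>+x. u s x * \<psi> x \<partial>M) * indicator A s \<partial>lborel)"
    by (intro nn_integral_cong nn_integral_multc) measurable
  finally show ?thesis .
qed

text \<open>The third moment controls the damping rate on bounded time intervals; this is the
  Gronwall factor in \<open>energy_balance\<close>.\<close>

lemma sol_\<Lambda>_W_le: "0 \<le> t \<Longrightarrow> (\<integral>\<^sup>+x. sol t x * (ennreal (\<Lambda> x) * W x) \<partial>M) \<le> ennreal (C * (V0 * exp (C * K * t)))"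
proof -
  assume t: "0 \<le> t"
  have "(\<integral>\<^sup>+x. sol t x * (ennreal (\<Lambda> x) * W x) \<partial>M) \<le> (\<integral>\<^sup>+x. ennreal C * (sol t x * V x) \<partial>M)"
  proof (rule nn_integral_mono)
    fix x
    have "sol t x * (ennreal (\<Lambda> x) * W x) \<le> sol t x * (ennreal C * V x)"
      by (intro mult_left_mono \<Lambda>_W_le) simp
    then show "sol t x * (ennreal (\<Lambda> x) * W x) \<le> ennreal C * (sol t x * V x)"
      by (simp add: mult_ac)
  qed
  also have "\<dots> = ennreal C * (\<integral>\<^sup>+x. sol t x * V x \<partial>M)"
    by (rule nn_integral_cmult) measurable
  also have "\<dots> \<le> ennreal C * ennreal (V0 * exp (C * K * t))"
    by (intro mult_left_mono sol_V_bound t) simp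
  finally show ?thesis
    using C_nonneg V0_nonneg by (simp add: ennreal_mult)
qed

lemma sol_damping_finite:
  assumes "0 \<le> t"
  shows "(\<integral>\<^sup>+s. (\<integral>\<^sup>+x. sol s x * (ennreal (\<Lambda> x) * W x) \<partial>M) * indicator {0..t} s \<partial>lborel) < \<top>"
proof -
  have "(\<integral>\<^sup>+s. (\<integral>\<^sup>+x. sol s x * (ennreal (\<Lambda> x) * W x) \<partial>M) * indicator {0..t} s \<partial>lborel) \<le>
     (\<integral>\<^sup>+s. ennreal (C * (V0 * exp (C * K * t))) * indicator {0..t} s \<partial>lborel)"
  proof (rule nn_integral_mono)
    fix s
    have "ennreal (C * (V0 * exp (C * K * s))) \<le> ennreal (C * (V0 * exp (C * K * t)))" if "s \<le> t"
      using that C_nonneg V0_nonneg K_pos by (intro ennreal_leI mult_left_mono) (auto intro!: mult_left_mono)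
    then show "(\<integral>\<^sup>+x. sol s x * (ennreal (\<Lambda> x) * W x) \<partial>M) * indicator {0..t} s \<le>
      ennreal (C * (V0 * exp (C * K * t))) * indicator {0..t} s"
      using sol_\<Lambda>_W_le[of s] by (auto split: split_indicator intro: order_trans)
  qed
  also have "\<dots> < \<top>"
    using assms by (simp add: nn_integral_cmult ennreal_mult_less_top)
  finally show ?thesis .
qed

text \<open>Monotone limits give only the inequality \<open>sol_W_bound\<close>. Testing
  \<open>sol_identity\<close> with \<open>W\<close> leaves the damping \<open>K * a\<close> on the
  left against \<open>a * N\<close> on the right, so the deficit \<open>d = K - N\<close> equals the
  time integral of \<open>a * d\<close>. As \<open>a\<close> is locally bounded, this homogeneous
  relation forces \<open>d = 0\<close>.\<close>

lemma energy_balance: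
  assumes t: "0 \<le> t"
  shows "(\<integral>\<^sup>+x. sol t x * W x \<partial>M) + total_heat t = ennreal K"
proof -
  define a where "a s = (\<integral>\<^sup>+x. sol s x * (ennreal (\<Lambda> x) * W x) \<partial>M)" for s
  define N where "N s = (\<integral>\<^sup>+x. sol s x * W x \<partial>M) + total_heat s" for s
  define d where "d s = ennreal K - N s" for s
  have [measurable]: "a \<in> borel_measurable borel" "N \<in> borel_measurable borel" "d \<in> borel_measurable borel"
    unfolding a_def N_def d_def by measurable
  have N_le: "N s \<le> ennreal K" if "0 \<le> s" for s
    unfolding N_def by (rule sol_W_bound[OF that])
  have Nd: "N s + d s = ennreal K" if "0 \<le> s" for s
    unfolding d_def using N_le[OF that] by (rule add_diff_inverse_ennreal)
  have N_eq: "N t + (\<integral>\<^sup>+s. a s * d s * indicator {0..t} s \<partial>lborel) = ennreal K" if t: "0 \<le> t" for t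
  proof -
    have fin: "(\<integral>\<^sup>+s. a s * N s * indicator {0..t} s \<partial>lborel) < \<top>"
    proof -
      have "(\<integral>\<^sup>+s. a s * N s * indicator {0..t} s \<partial>lborel) \<le> (\<integral>\<^sup>+s. ennreal K * (a s * indicator {0..t} s) \<partial>lborel)"
        by (intro nn_integral_mono) (auto split: split_indicator simp: mult.commute[of "ennreal K"] intro!: mult_left_mono N_le)
      also have "\<dots> = ennreal K * (\<integral>\<^sup>+s. a s * indicator {0..t} s \<partial>lborel)"
        by (rule nn_integral_cmult) measurable
      also have "\<dots> < \<top>"
        using sol_damping_finite[OF t] unfolding a_def by (simp add: ennreal_mult_less_top)
      finally show ?thesis .
    qed
    have "(\<integral>\<^sup>+x. sol t x * W x \<partial>M) + (\<integral>\<^sup>+x. (\<integral>\<^sup>+s. ennreal (K * \<Lambda> x) * sol s x * indicator {0..t} s \<partial>lborel) * W x \<partial>M) =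
      (\<integral>\<^sup>+x. (sol t x + (\<integral>\<^sup>+s. ennreal (K * \<Lambda> x) * sol s x * indicator {0..t} s \<partial>lborel)) * W x \<partial>M)"
      unfolding distrib_right by (rule nn_integral_add[symmetric]) measurable
    also have "\<dots> = (\<integral>\<^sup>+x. (f0 x + (\<integral>\<^sup>+s. source (sol s) (total_heat s) x * indicator {0..t} s \<partial>lborel)) * W x \<partial>M)"
      by (intro nn_integral_cong) (simp only: sol_identity[OF _ t])
    also have "\<dots> = ennreal K + (\<integral>\<^sup>+x. (\<integral>\<^sup>+s. source (sol s) (total_heat s) x * indicator {0..t} s \<partial>lborel) * W x \<partial>M)"
      unfolding distrib_right f0_W[symmetric] by (rule nn_integral_add) measurable
    also have "(\<integral>\<^sup>+x. (\<integral>\<^sup>+s. source (sol s) (total_heat s) x * indicator {0..t} s \<partial>lborel) * W x \<partial>M) =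
      (\<integral>\<^sup>+s. (\<integral>\<^sup>+x. source (sol s) (total_heat s) x * W x \<partial>M) * indicator {0..t} s \<partial>lborel)"
      by (rule time_integral_swap) measurable
    also have "(\<integral>\<^sup>+x. (\<integral>\<^sup>+s. ennreal (K * \<Lambda> x) * sol s x * indicator {0..t} s \<partial>lborel) * W x \<partial>M) =
      (\<integral>\<^sup>+s. (\<integral>\<^sup>+x. ennreal (K * \<Lambda> x) * sol s x * W x \<partial>M) * indicator {0..t} s \<partial>lborel)"
      by (rule time_integral_swap) measurable
    also have "(\<lambda>s. \<integral>\<^sup>+x. ennreal (K * \<Lambda> x) * sol s x * W x \<partial>M) = (\<lambda>s. ennreal K * a s)"
      unfolding a_def using K_pos \<Lambda>_nonneg
      by (simp add: ennreal_mult mult_ac flip: nn_integral_cmult)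
    finally have 1: "(\<integral>\<^sup>+x. sol t x * W x \<partial>M) + (\<integral>\<^sup>+s. ennreal K * a s * indicator {0..t} s \<partial>lborel) =
       ennreal K + (\<integral>\<^sup>+s. (\<integral>\<^sup>+x. source (sol s) (total_heat s) x * W x \<partial>M) * indicator {0..t} s \<partial>lborel)" .
    have 2: "(\<integral>\<^sup>+s. (\<integral>\<^sup>+x. source (sol s) (total_heat s) x * W x \<partial>M) * indicator {0..t} s \<partial>lborel) + total_heat t =
        (\<integral>\<^sup>+s. a s * N s * indicator {0..t} s \<partial>lborel)"
    proof -
      have "(\<integral>\<^sup>+s. (\<integral>\<^sup>+x. source (sol s) (total_heat s) x * W x \<partial>M) * indicator {0..t} s \<partial>lborel) + total_heat t =
        (\<integral>\<^sup>+s. ((\<integral>\<^sup>+x. source (sol s) (total_heat s) x * W x \<partial>M) + dissipation (sol s)) * indicator {0..t} s \<partial>lborel)"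
        unfolding total_heat_eq[of t] distrib_right by (rule nn_integral_add[symmetric]) measurable
      also have "\<dots> = (\<integral>\<^sup>+s. a s * N s * indicator {0..t} s \<partial>lborel)"
        unfolding a_def N_def by (subst source_W_integral) simp_all
      finally show ?thesis .
    qed
    \<comment> \<open>Writing \<open>K\<close> as \<open>N s + d s\<close> inside the damping
      isolates the deficit; the part with \<open>N\<close> cancels against the source.\<close>
    have 3: "(\<integral>\<^sup>+s. ennreal K * a s * indicator {0..t} s \<partial>lborel) =
       (\<integral>\<^sup>+s. a s * N s * indicator {0..t} s \<partial>lborel) + (\<integral>\<^sup>+s. a s * d s * indicator {0..t} s \<partial>lborel)"
    proof -
      have "(\<integral>\<^sup>+s. ennreal K * a s * indicator {0..t} s \<partial>lborel) =
        (\<integral>\<^sup>+s. a s * N s * indicator {0..t} s + a s * d s * indicator {0..t} s \<partial>lborel)"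
        by (intro nn_integral_cong) (auto split: split_indicator simp: Nd mult.commute[of "ennreal K"] simp flip: distrib_left)
      also have "\<dots> = (\<integral>\<^sup>+s. a s * N s * indicator {0..t} s \<partial>lborel) + (\<integral>\<^sup>+s. a s * d s * indicator {0..t} s \<partial>lborel)"
        by (rule nn_integral_add) measurable
      finally show ?thesis .
    qed
    have "(\<integral>\<^sup>+s. a s * N s * indicator {0..t} s \<partial>lborel) + (N t + (\<integral>\<^sup>+s. a s * d s * indicator {0..t} s \<partial>lborel)) =
       ((\<integral>\<^sup>+x. sol t x * W x \<partial>M) + (\<integral>\<^sup>+s. ennreal K * a s * indicator {0..t} s \<partial>lborel)) + total_heat t"
      unfolding 3 N_def by (simp only: add_ac)
    also have "\<dots> = (\<integral>\<^sup>+s. a s * N s * indicator {0..t} s \<partial>lborel) + ennreal K"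
      unfolding 1 2[symmetric] by (simp only: add_ac)
    finally show ?thesis
      using fin by (auto simp: ennreal_add_left_cancel)
  qed
  have "d t = 0"
  proof (rule gronwall_zero[where B=K and T=t])
    show "d s \<le> ennreal K" for s unfolding d_def by (rule diff_le_self_ennreal)
    show "d s \<le> ennreal (C * (V0 * exp (C * K * t))) * (\<integral>\<^sup>+r. d r * indicator {0..s} r \<partial>lborel)" if s: "0 \<le> s" "s \<le> t" for s
    proof -
      have "N s + d s = N s + (\<integral>\<^sup>+r. a r * d r * indicator {0..s} r \<partial>lborel)"
        unfolding N_eq[OF s(1)] Nd[OF s(1)] ..
      then have "d s = (\<integral>\<^sup>+r. a r * d r * indicator {0..s} r \<partial>lborel)"
        using le_less_trans[OF N_le[OF s(1)] ennreal_less_top] by (auto simp: ennreal_add_left_cancel)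
      also have "\<dots> \<le> (\<integral>\<^sup>+r. ennreal (C * (V0 * exp (C * K * t))) * (d r * indicator {0..s} r) \<partial>lborel)"
      proof (rule nn_integral_mono)
        fix r
        have "ennreal (C * (V0 * exp (C * K * r))) \<le> ennreal (C * (V0 * exp (C * K * t)))" if "r \<le> s"
          using that s C_nonneg V0_nonneg K_pos by (intro ennreal_leI mult_left_mono) (auto intro!: mult_left_mono)
        then have "a r \<le> ennreal (C * (V0 * exp (C * K * t)))" if "0 \<le> r" "r \<le> s"
          using sol_\<Lambda>_W_le[of r] that unfolding a_def by (auto intro: order_trans)
        then show "a r * d r * indicator {0..s} r \<le> ennreal (C * (V0 * exp (C * K * t))) * (d r * indicator {0..s} r)"
          by (auto split: split_indicator intro!: mult_right_mono)
      qed
      also have "\<dots> = ennreal (C * (V0 * exp (C * K * t))) * (\<integral>\<^sup>+r. d r * indicator {0..s} r \<partial>lborel)"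
        by (rule nn_integral_cmult) measurable
      finally show ?thesis .
    qed
  qed (use t C_nonneg V0_nonneg K_pos in auto)
  then show ?thesis
    using Nd[OF t] by (simp add: N_def)
qed


lemma sol_W_finite: "0 \<le> t \<Longrightarrow> AE x in M. sol t x < \<top>"
proof -
  assume t: "0 \<le> t"
  have "(\<integral>\<^sup>+x. sol t x * W x \<partial>M) \<noteq> \<top>"
    using sol_W_le[OF t] by (metis ennreal_less_top not_le)
  then have "AE x in M. sol t x * W x \<noteq> \<top>"
    by (intro nn_integral_PInf_AE[unfolded infinity_ennreal_def]) (auto simp: less_top)
  then show ?thesis
  proof (eventually_elim)
    fix x assume *: "sol t x * W x \<noteq> \<top>"
    have "sol t x * 1 \<le> sol t x * W x"
      by (intro mult_left_mono W_ge_1) simp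
    with * show "sol t x < \<top>"
      by (simp add: less_top[symmetric]) (metis top_unique)
  qed
qed

text \<open>With the total energy equal to \<open>K\<close>, source plus loss is gain plus damping,
  and the damping is the one in \<open>sol_identity\<close>. It can be cancelled wherever its time
  integral is finite, that is, almost everywhere.\<close>

lemma sol_equation:
  assumes t: "0 \<le> t"
  shows "AE x in M. sol t x + (\<integral>\<^sup>+s. sol s x * loss (sol s) x * indicator {0..t} s \<partial>lborel) =
    f0 x + (\<integral>\<^sup>+s. J (sol s) x * indicator {0..t} s \<partial>lborel)"
proof -
  \<comment> \<open>Exchanging time and phase space in \<open>sol_damping_finite\<close> gives
    finiteness for almost every \<open>x\<close>; since \<open>1 \<le> W x\<close>, the unweighted
    damping \<open>D\<close> is finite there as well.\<close>
  have "(\<integral>\<^sup>+x. (\<integral>\<^sup>+s. sol s x * indicator {0..t} s \<partial>lborel) * (ennreal (\<Lambda> x) * W x) \<partial>M) < \<top>"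
    by (subst time_integral_swap) (use sol_damping_finite[OF t] in \<open>simp_all\<close>)
  then have "AE x in M. (\<integral>\<^sup>+s. sol s x * indicator {0..t} s \<partial>lborel) * (ennreal (\<Lambda> x) * W x) \<noteq> \<top>"
    by (intro nn_integral_PInf_AE[unfolded infinity_ennreal_def]) (auto simp: less_top)
  then show ?thesis
  proof (rule AE_mp, intro AE_I2 impI)
    fix x assume [measurable]: "x \<in> space M"
      and *: "(\<integral>\<^sup>+s. sol s x * indicator {0..t} s \<partial>lborel) * (ennreal (\<Lambda> x) * W x) \<noteq> \<top>"
    define D where "D = (\<integral>\<^sup>+s. ennreal (K * \<Lambda> x) * sol s x * indicator {0..t} s \<partial>lborel)"
    have "D = ennreal (K * \<Lambda> x) * (\<integral>\<^sup>+s. sol s x * indicator {0..t} s \<partial>lborel)"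
      unfolding D_def by (simp add: mult.assoc nn_integral_cmult)
    also have "\<dots> = ennreal K * ((\<integral>\<^sup>+s. sol s x * indicator {0..t} s \<partial>lborel) * (ennreal (\<Lambda> x) * 1))"
      using K_pos \<Lambda>_nonneg[of x] by (simp add: ennreal_mult mult_ac)
    also have "\<dots> \<le> ennreal K * ((\<integral>\<^sup>+s. sol s x * indicator {0..t} s \<partial>lborel) * (ennreal (\<Lambda> x) * W x))"
      by (intro mult_left_mono W_ge_1) auto
    also have "\<dots> < \<top>"
      by (rule ennreal_cmult_less_top) (unfold less_top[symmetric], rule *)
    finally have fin: "D < \<top>" .
    have key: "source (sol s) (total_heat s) x + sol s x * loss (sol s) x = J (sol s) x + ennreal (K * \<Lambda> x) * sol s x"
      if "0 \<le> s" for s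
    proof -
      have "source (sol s) (total_heat s) x + sol s x * loss (sol s) x =
        J (sol s) x + sol s x * ((\<integral>\<^sup>+y. sol s y * \<kappa> x y \<partial>M) + loss (sol s) x) + sol s x * (ennreal (\<Lambda> x) * total_heat s)"
        unfolding source_def by (simp add: distrib_left add_ac)
      also have "\<dots> = J (sol s) x + sol s x * (ennreal (\<Lambda> x) * ((\<integral>\<^sup>+x. sol s x * W x \<partial>M) + total_heat s))"
        by (subst \<kappa>_loss[OF _ \<open>x \<in> space M\<close>]) (simp_all add: distrib_left add_ac)
      also have "\<dots> = J (sol s) x + ennreal (K * \<Lambda> x) * sol s x"
        unfolding energy_balance[OF that] using K_pos \<Lambda>_nonneg[of x] by (simp add: ennreal_mult mult_ac)
      finally show ?thesis .
    qed
    have "sol t x + D + (\<integral>\<^sup>+s. sol s x * loss (sol s) x * indicator {0..t} s \<partial>lborel) =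
      f0 x + ((\<integral>\<^sup>+s. source (sol s) (total_heat s) x * indicator {0..t} s \<partial>lborel) +
        (\<integral>\<^sup>+s. sol s x * loss (sol s) x * indicator {0..t} s \<partial>lborel))"
      unfolding D_def sol_identity[OF \<open>x \<in> space M\<close> t] by (simp only: add.assoc)
    also have "(\<integral>\<^sup>+s. source (sol s) (total_heat s) x * indicator {0..t} s \<partial>lborel) +
        (\<integral>\<^sup>+s. sol s x * loss (sol s) x * indicator {0..t} s \<partial>lborel) =
      (\<integral>\<^sup>+s. (source (sol s) (total_heat s) x + sol s x * loss (sol s) x) * indicator {0..t} s \<partial>lborel)"
      unfolding distrib_right by (rule nn_integral_add[symmetric]) measurable
    also have "\<dots> = (\<integral>\<^sup>+s. J (sol s) x * indicator {0..t} s + ennreal (K * \<Lambda> x) * sol s x * indicator {0..t} s \<partial>lborel)"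
      by (intro nn_integral_cong) (auto split: split_indicator simp: key)
    also have "\<dots> = (\<integral>\<^sup>+s. J (sol s) x * indicator {0..t} s \<partial>lborel) + D"
      unfolding D_def by (rule nn_integral_add) measurable
    finally have "sol t x + (\<integral>\<^sup>+s. sol s x * loss (sol s) x * indicator {0..t} s \<partial>lborel) + D =
      f0 x + (\<integral>\<^sup>+s. J (sol s) x * indicator {0..t} s \<partial>lborel) + D"
      by (simp only: add_ac)
    then show "sol t x + (\<integral>\<^sup>+s. sol s x * loss (sol s) x * indicator {0..t} s \<partial>lborel) =
      f0 x + (\<integral>\<^sup>+s. J (sol s) x * indicator {0..t} s \<partial>lborel)"
      using fin by (auto simp: add.commute[of _ D] ennreal_add_left_cancel)
  qed
qed

text \<open>The pointwise equation integrated by Tonelli against any nonnegative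
  \<open>\<psi>\<close>. All four terms may be infinite; each application supplies the finiteness it
  needs.\<close>

lemma sol_weak_equation:
  assumes t: "0 \<le> t" and [measurable]: "\<psi> \<in> borel_measurable M"
  shows "(\<integral>\<^sup>+x. sol t x * \<psi> x \<partial>M) + (\<integral>\<^sup>+s. (\<integral>\<^sup>+x. sol s x * loss (sol s) x * \<psi> x \<partial>M) * indicator {0..t} s \<partial>lborel) =
    (\<integral>\<^sup>+x. f0 x * \<psi> x \<partial>M) + (\<integral>\<^sup>+s. (\<integral>\<^sup>+x. J (sol s) x * \<psi> x \<partial>M) * indicator {0..t} s \<partial>lborel)"
proof -
  have 1: "(\<integral>\<^sup>+s. (\<integral>\<^sup>+x. sol s x * loss (sol s) x * \<psi> x \<partial>M) * indicator {0..t} s \<partial>lborel) =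
    (\<integral>\<^sup>+x. (\<integral>\<^sup>+s. sol s x * loss (sol s) x * indicator {0..t} s \<partial>lborel) * \<psi> x \<partial>M)"
    by (rule time_integral_swap[symmetric]) measurable
  have 2: "(\<integral>\<^sup>+s. (\<integral>\<^sup>+x. J (sol s) x * \<psi> x \<partial>M) * indicator {0..t} s \<partial>lborel) =
    (\<integral>\<^sup>+x. (\<integral>\<^sup>+s. J (sol s) x * indicator {0..t} s \<partial>lborel) * \<psi> x \<partial>M)"
    by (rule time_integral_swap[symmetric]) measurable
  have "(\<integral>\<^sup>+x. sol t x * \<psi> x \<partial>M) + (\<integral>\<^sup>+x. (\<integral>\<^sup>+s. sol s x * loss (sol s) x * indicator {0..t} s \<partial>lborel) * \<psi> x \<partial>M) =
    (\<integral>\<^sup>+x. (sol t x + (\<integral>\<^sup>+s. sol s x * loss (sol s) x * indicator {0..t} s \<partial>lborel)) * \<psi> x \<partial>M)"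
    unfolding distrib_right by (rule nn_integral_add[symmetric]) measurable
  also have "\<dots> = (\<integral>\<^sup>+x. (f0 x + (\<integral>\<^sup>+s. J (sol s) x * indicator {0..t} s \<partial>lborel)) * \<psi> x \<partial>M)"
    by (rule nn_integral_cong_AE) (use sol_equation[OF t] in \<open>eventually_elim, simp\<close>)
  also have "\<dots> = (\<integral>\<^sup>+x. f0 x * \<psi> x \<partial>M) + (\<integral>\<^sup>+x. (\<integral>\<^sup>+s. J (sol s) x * indicator {0..t} s \<partial>lborel) * \<psi> x \<partial>M)"
    unfolding distrib_right by (rule nn_integral_add) measurable
  finally show ?thesis
    unfolding 1 2 .
qed

section \<open>Lipschitz continuity in time\<close>

lemma loss_W_le:
  assumes [measurable]: "f \<in> borel_measurable M"
  shows "(\<integral>\<^sup>+x. f x * loss f x * W x \<partial>M) \<le> ennreal (2 * C) * ((\<integral>\<^sup>+x. f x * W x \<partial>M) * (\<integral>\<^sup>+x. f x * V x \<partial>M))"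
proof -
  define v where "v = (\<integral>\<^sup>+x. f x * V x \<partial>M)"
  define w where "w = (\<integral>\<^sup>+x. f x * W x \<partial>M)"
  have "(\<integral>\<^sup>+x. f x * loss f x * W x \<partial>M) = (\<integral>\<^sup>+x. \<integral>\<^sup>+y. f x * f y * (k x y * W x) \<partial>M \<partial>M)"
    by (rule double_integral_loss[symmetric]) measurable
  also have "\<dots> \<le> (\<integral>\<^sup>+x. \<integral>\<^sup>+y. f x * f y * (ennreal C * (V x * W y + W x * V y)) \<partial>M \<partial>M)"
    by (intro nn_integral_mono mult_left_mono k_W_le) simp
  also have "\<dots> = (\<integral>\<^sup>+x. \<integral>\<^sup>+y. ennreal C * (f x * V x) * (f y * W y) + ennreal C * (f x * W x) * (f y * V y) \<partial>M \<partial>M)"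
    by (simp add: distrib_left mult_ac)
  also have "\<dots> = (\<integral>\<^sup>+x. ennreal C * w * (f x * V x) + ennreal C * v * (f x * W x) \<partial>M)"
    unfolding v_def w_def
    by (intro nn_integral_cong, subst nn_integral_add, measurable, subst (1 2) nn_integral_cmult, measurable)
       (simp_all add: mult_ac)
  also have "\<dots> = ennreal C * w * v + ennreal C * v * w"
    by (simp add: nn_integral_add nn_integral_cmult v_def[symmetric] w_def[symmetric])
  also have "\<dots> = ennreal (2 * C) * (w * v)"
    using C_nonneg by (simp add: ennreal_mult mult_ac flip: mult_2)
  finally show ?thesis unfolding v_def w_def .
qed

lemma sol_loss_W_le:
  assumes "0 \<le> s"
  shows "(\<integral>\<^sup>+x. sol s x * loss (sol s) x * W x \<partial>M) \<le> ennreal (2 * C * K * (V0 * exp (C * K * s)))"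
proof -
  have [measurable]: "sol s \<in> borel_measurable M" by measurable
  have "(\<integral>\<^sup>+x. sol s x * loss (sol s) x * W x \<partial>M) \<le> ennreal (2 * C) * ((\<integral>\<^sup>+x. sol s x * W x \<partial>M) * (\<integral>\<^sup>+x. sol s x * V x \<partial>M))"
    by (rule loss_W_le) measurable
  also have "\<dots> \<le> ennreal (2 * C) * (ennreal K * ennreal (V0 * exp (C * K * s)))"
    by (intro mult_left_mono mult_mono sol_W_le sol_V_bound assms) auto
  also have "\<dots> = ennreal (2 * C * K * (V0 * exp (C * K * s)))"
    using C_nonneg K_pos V0_nonneg by (simp add: ennreal_mult mult_ac)
  finally show ?thesis .
qed

text \<open>Over \<open>{s<..t}\<close> the solution changes by gain minus loss. Each has a
  second-order moment of at most \<open>c * (t - s)\<close>, the gain because by \<open>J_W\<close>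
  its moment does not exceed that of the loss. The factor 2 in \<open>c\<close> comes from
  \<open>loss_W_le\<close>, and the two contributions make it 4.\<close>

lemma sol_lipschitz:
  assumes s: "0 \<le> s" "s \<le> t"
  shows "(\<integral>\<^sup>+x. ennreal \<bar>enn2real (sol t x) - enn2real (sol s x)\<bar> * W x \<partial>M) \<le>
    ennreal (4 * C * K * (V0 * exp (C * K * t)) * (t - s))"
proof -
  define P where "P A x = (\<integral>\<^sup>+r. J (sol r) x * indicator A r \<partial>lborel)" for A x
  define Q where "Q A x = (\<integral>\<^sup>+r. sol r x * loss (sol r) x * indicator A r \<partial>lborel)" for A x
  have split: "indicator {0..t} r = indicator {0..s} r + (indicator {s<..t} r :: ennreal)" for r :: real
    using s by (auto split: split_indicator)
  have [measurable]: "P {s<..t} \<in> borel_measurable M" "Q {s<..t} \<in> borel_measurable M"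
    "P {0..s} \<in> borel_measurable M" "Q {0..s} \<in> borel_measurable M"
    unfolding P_def Q_def by measurable
  have P: "P {0..t} x = P {0..s} x + P {s<..t} x" and Q: "Q {0..t} x = Q {0..s} x + Q {s<..t} x"
    if [measurable]: "x \<in> space M" for x
    unfolding P_def Q_def split distrib_left by (rule nn_integral_add; measurable)+
  have J_W_le: "(\<integral>\<^sup>+x. J (sol r) x * W x \<partial>M) \<le> (\<integral>\<^sup>+x. sol r x * loss (sol r) x * W x \<partial>M)" for r
  proof -
    have *: "(\<integral>\<^sup>+x. J (sol r) x * W x \<partial>M) + (\<integral>\<^sup>+x. \<integral>\<^sup>+y. sol r x * sol r y * \<delta> x y \<partial>M \<partial>M) =
      (\<integral>\<^sup>+x. sol r x * loss (sol r) x * W x \<partial>M)"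
      by (subst J_W, measurable, rule double_integral_loss) measurable
    show ?thesis unfolding *[symmetric] by simp
  qed
  define c where "c = 2 * C * K * (V0 * exp (C * K * t))"
  have loss_le: "(\<integral>\<^sup>+x. sol r x * loss (sol r) x * W x \<partial>M) \<le> ennreal c" if "0 \<le> r" "r \<le> t" for r
  proof -
    have "2 * C * K * (V0 * exp (C * K * r)) \<le> c"
      unfolding c_def using that C_nonneg K_pos V0_nonneg by (intro mult_left_mono) (auto intro!: mult_left_mono)
    then show ?thesis
      using sol_loss_W_le[OF that(1)] by (meson ennreal_leI order_trans)
  qed
  have PQ_le: "(\<integral>\<^sup>+x. P A x * W x \<partial>M) \<le> ennreal c * emeasure lborel A" "(\<integral>\<^sup>+x. Q A x * W x \<partial>M) \<le> ennreal c * emeasure lborel A"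
    if A[measurable]: "A \<in> sets borel" and "A \<subseteq> {0..t}" for A
  proof -
    have "(\<integral>\<^sup>+x. Q A x * W x \<partial>M) = (\<integral>\<^sup>+r. (\<integral>\<^sup>+x. sol r x * loss (sol r) x * W x \<partial>M) * indicator A r \<partial>lborel)"
      unfolding Q_def by (rule time_integral_swap) measurable
    also have "\<dots> \<le> (\<integral>\<^sup>+r. ennreal c * indicator A r \<partial>lborel)"
      using that(2) by (intro nn_integral_mono) (auto split: split_indicator intro!: loss_le)
    finally show "(\<integral>\<^sup>+x. Q A x * W x \<partial>M) \<le> ennreal c * emeasure lborel A"
      by (simp add: nn_integral_cmult)
    have "(\<integral>\<^sup>+x. P A x * W x \<partial>M) = (\<integral>\<^sup>+r. (\<integral>\<^sup>+x. J (sol r) x * W x \<partial>M) * indicator A r \<partial>lborel)"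
      unfolding P_def by (rule time_integral_swap) measurable
    also have "\<dots> \<le> (\<integral>\<^sup>+r. ennreal c * indicator A r \<partial>lborel)"
      using that(2) by (intro nn_integral_mono) (auto split: split_indicator intro!: loss_le order_trans[OF J_W_le])
    finally show "(\<integral>\<^sup>+x. P A x * W x \<partial>M) \<le> ennreal c * emeasure lborel A"
      by (simp add: nn_integral_cmult)
  qed
  \<comment> \<open>The loss accumulated up to \<open>s\<close> is finite almost everywhere and can
    be removed from the equations at \<open>s\<close> and \<open>t\<close>, which leaves a relation
    over \<open>{s<..t}\<close> alone.\<close>
  have "(\<integral>\<^sup>+x. Q {0..s} x * W x \<partial>M) \<noteq> \<top>"
    using PQ_le(2)[of "{0..s}"] s by (auto simp: ennreal_mult_eq_top_iff top_unique)
  then have "AE x in M. Q {0..s} x * W x \<noteq> \<top>"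
    by (intro nn_integral_PInf_AE[unfolded infinity_ennreal_def]) auto
  then have "AE x in M. ennreal \<bar>enn2real (sol t x) - enn2real (sol s x)\<bar> * W x \<le> P {s<..t} x * W x + Q {s<..t} x * W x"
    using sol_equation[OF s(1)] sol_equation[OF order_trans[OF s]] sol_W_finite[OF s(1)] sol_W_finite[OF order_trans[OF s]] AE_space
  proof eventually_elim
    case (elim x)
    note [simp] = elim(6)
    have "Q {0..s} x * 1 \<le> Q {0..s} x * W x"
      by (intro mult_left_mono W_ge_1) simp
    then have q: "Q {0..s} x < \<top>"
      using elim(1) by (auto simp: less_top top_unique)
    have e1: "sol s x + Q {0..s} x = f0 x + P {0..s} x" and e2: "sol t x + Q {0..t} x = f0 x + P {0..t} x"
      using elim unfolding P_def Q_def by auto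
    have "Q {0..s} x + (sol t x + Q {s<..t} x) = sol t x + Q {0..t} x"
      using Q by (simp add: add_ac)
    also have "\<dots> = (f0 x + P {0..s} x) + P {s<..t} x"
      unfolding e2 using P by (simp add: add_ac)
    also have "\<dots> = Q {0..s} x + (sol s x + P {s<..t} x)"
      unfolding e1[symmetric] by (simp add: add_ac)
    finally have e: "sol t x + Q {s<..t} x = sol s x + P {s<..t} x"
      using q by (auto simp: ennreal_add_left_cancel)
    have "ennreal \<bar>enn2real (sol t x) - enn2real (sol s x)\<bar> \<le> P {s<..t} x + Q {s<..t} x"
    proof (cases "P {s<..t} x + Q {s<..t} x")
      case (real r)
      then obtain p q where pq: "P {s<..t} x = ennreal p" "Q {s<..t} x = ennreal q" "0 \<le> p" "0 \<le> q"
        by (cases "P {s<..t} x"; cases "Q {s<..t} x") auto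
      obtain a a' where a: "sol t x = ennreal a" "sol s x = ennreal a'" "0 \<le> a" "0 \<le> a'"
        using elim by (cases "sol t x"; cases "sol s x") auto
      have "a + q = a' + p"
        using e unfolding pq a by (simp add: pq a flip: ennreal_plus)
      then show ?thesis
        unfolding pq a using pq(3,4) a(3,4) by (simp flip: ennreal_plus add: ennreal_leI)
    qed auto
    then show ?case
      by (simp add: mult_right_mono flip: distrib_right)
  qed
  then have "(\<integral>\<^sup>+x. ennreal \<bar>enn2real (sol t x) - enn2real (sol s x)\<bar> * W x \<partial>M) \<le>
     (\<integral>\<^sup>+x. P {s<..t} x * W x + Q {s<..t} x * W x \<partial>M)"
    by (rule nn_integral_mono_AE)
  also have "\<dots> = (\<integral>\<^sup>+x. P {s<..t} x * W x \<partial>M) + (\<integral>\<^sup>+x. Q {s<..t} x * W x \<partial>M)"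
    by (rule nn_integral_add) measurable
  also have "\<dots> \<le> ennreal c * emeasure lborel {s<..t} + ennreal c * emeasure lborel {s<..t}"
    using s by (intro add_mono PQ_le) auto
  also have "\<dots> = ennreal (4 * C * K * (V0 * exp (C * K * t)) * (t - s))"
  proof -
    have "0 \<le> c" unfolding c_def using C_nonneg K_pos V0_nonneg by simp
    then have "ennreal c * emeasure lborel {s<..t} + ennreal c * emeasure lborel {s<..t} = ennreal (c * (t - s) + c * (t - s))"
      using s by (subst ennreal_plus) (auto simp: ennreal_mult)
    also have "c * (t - s) + c * (t - s) = 4 * C * K * (V0 * exp (C * K * t)) * (t - s)"
      unfolding c_def by simp
    finally show ?thesis .
  qed
  finally show ?thesis .
qed

end

section \<open>The inelastic collision kernel\<close>

lemma nn_integral_lborel_translate: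
  fixes h :: "'a::euclidean_space \<Rightarrow> ennreal"
  assumes [measurable]: "h \<in> borel_measurable borel"
  shows "(\<integral>\<^sup>+w. h (w + a) \<partial>lborel) = (\<integral>\<^sup>+w. h w \<partial>lborel)"
proof -
  have "(\<integral>\<^sup>+w. h w \<partial>lborel) = (\<integral>\<^sup>+w. h w \<partial>distr lborel borel ((+) a))"
    by (simp add: lborel_distr_plus)
  also have "\<dots> = (\<integral>\<^sup>+w. h (a + w) \<partial>lborel)"
    by (rule nn_integral_distr) measurable
  finally show ?thesis by (simp add: add.commute)
qed

lemma nn_integral_lborel_reflect:
  fixes h :: "'a::euclidean_space \<Rightarrow> ennreal"
  assumes [measurable]: "h \<in> borel_measurable borel"
  shows "(\<integral>\<^sup>+w. h (a - w) \<partial>lborel) = (\<integral>\<^sup>+w. h w \<partial>lborel)"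
proof -
  have "lborel = distr lborel borel (\<lambda>w::'a. a - w)"
    using lborel_affine[of "-1" a] by (simp add: density_1 one_ennreal_def[symmetric])
  then have "(\<integral>\<^sup>+w. h w \<partial>lborel) = (\<integral>\<^sup>+w. h w \<partial>distr lborel borel (\<lambda>w. a - w))"
    by metis
  also have "\<dots> = (\<integral>\<^sup>+w. h (a - w) \<partial>lborel)"
    by (rule nn_integral_distr) measurable
  finally show ?thesis ..
qed

text \<open>With counting measure on the species, the coupled system becomes a single equation, and
  the sum over partner species becomes part of the integral over the partner.\<close>

abbreviation phase_measure :: "('s::finite \<times> (real^'d)) measure" where
  "phase_measure \<equiv> count_space UNIV \<Otimes>\<^sub>M lborel"

lemma sigma_finite_phase_measure: "sigma_finite_measure (phase_measure :: ('s::finite \<times> (real^'d)) measure)"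
proof -
  interpret A: sigma_finite_measure "count_space UNIV :: 's measure"
    by (rule sigma_finite_measure_count_space_finite) simp
  interpret pair_sigma_finite "count_space UNIV :: 's measure" "lborel :: (real^'d) measure" ..
  show ?thesis by unfold_locales
qed

lemma nn_integral_phase_measure:
  assumes [measurable]: "h \<in> borel_measurable (phase_measure :: ('s::finite \<times> (real^'d)) measure)"
  shows "(\<integral>\<^sup>+x. h x \<partial>phase_measure) = (\<Sum>i\<in>UNIV. \<integral>\<^sup>+v. h (i, v) \<partial>lborel)"
proof -
  have "(\<integral>\<^sup>+x. h x \<partial>phase_measure) = (\<integral>\<^sup>+i. \<integral>\<^sup>+v. h (i, v) \<partial>lborel \<partial>count_space UNIV)"
    by (rule lborel.nn_integral_fst[symmetric]) measurable
  then show ?thesis by (simp add: nn_integral_count_space_finite)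
qed

text \<open>The shift may depend on the species, as the displacement in a collision depends on the
  masses.\<close>

lemma nn_integral_phase_translate:
  assumes [measurable]: "h \<in> borel_measurable (phase_measure :: ('s::finite \<times> (real^'d)) measure)"
  shows "(\<integral>\<^sup>+x. h (fst x, snd x + a (fst x)) \<partial>phase_measure) = (\<integral>\<^sup>+x. h x \<partial>phase_measure)"
  by (subst (1 2) nn_integral_phase_measure, measurable)
     (auto intro!: sum.cong nn_integral_lborel_translate[of "\<lambda>v. h (_, v)"])

lemma nn_integral_phase_reflect:
  assumes [measurable]: "h \<in> borel_measurable (phase_measure :: ('s::finite \<times> (real^'d)) measure)"
  shows "(\<integral>\<^sup>+x. h (fst x, a - snd x) \<partial>phase_measure) = (\<integral>\<^sup>+x. h x \<partial>phase_measure)"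
  by (subst (1 2) nn_integral_phase_measure, measurable)
     (auto intro!: sum.cong nn_integral_lborel_reflect[of "\<lambda>v. h (_, v)"])

lemma phase_components [measurable (raw)]:
  assumes "g \<in> N \<rightarrow>\<^sub>M (phase_measure :: ('s::finite \<times> (real^'d)) measure)"
  shows "(\<lambda>p. fst (g p)) \<in> N \<rightarrow>\<^sub>M count_space UNIV" "(\<lambda>p. snd (g p)) \<in> borel_measurable N"
  using measurable_compose[OF assms measurable_fst] measurable_compose[OF assms measurable_snd] by simp_all

lemma phase_Pair [measurable (raw)]:
  "f \<in> N \<rightarrow>\<^sub>M count_space UNIV \<Longrightarrow> g \<in> borel_measurable N \<Longrightarrow>
    (\<lambda>p. (f p, g p)) \<in> N \<rightarrow>\<^sub>M (phase_measure :: ('s::finite \<times> (real^'d)) measure)"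
  by (rule measurable_Pair) simp_all

definition speed :: "'s \<times> (real^'d) \<Rightarrow> 's \<times> (real^'d) \<Rightarrow> real" where
  "speed x y = norm (snd x - snd y)"

text \<open>The kernel lives on the whole velocity space and is concentrated on the ball, so that
  measurability and integrals refer to \<open>borel\<close>. It is the probability part of the rate:
  the factor \<open>|u|\<close> is kept in \<open>speed\<close>, and \<open>\<gamma>\<close> is
  removed later by the change of time. \<open>\<beta>_sym\<close> says that exchanging the partners
  describes the same collision.\<close>

locale inelastic_kernel =
  fixes m :: "real^'s" and \<beta> :: "real^'d \<Rightarrow> (real^'d) measure"
  assumes mass_pos: "0 < m $ i"
    and \<beta>_measurable: "\<beta> \<in> borel \<rightarrow>\<^sub>M prob_algebra borel"
    and \<beta>_ball: "AE z in \<beta> u. norm z \<le> 1"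
    and \<beta>_sym: "\<beta> u = distr (\<beta> (- u)) borel uminus"
begin

abbreviation M :: "('s \<times> (real^'d)) measure" where "M \<equiv> phase_measure"

lemma mass_nonzero: "m $ i \<noteq> 0" "m $ i + m $ j \<noteq> 0" "0 < m $ i + m $ j"
  using mass_pos[of i] mass_pos[of j] by auto

lemma prob_\<beta>: "prob_space (\<beta> u)" and sets_\<beta>[measurable_cong, simp]: "sets (\<beta> u) = sets borel"
  using measurable_space[OF \<beta>_measurable, of u] by (auto simp: space_prob_algebra)

lemma \<beta>_subprob[measurable]: "\<beta> \<in> borel \<rightarrow>\<^sub>M subprob_algebra borel"
  using \<beta>_measurable by (rule measurable_prob_algebraD)

section \<open>Weights, the collision map and the gain operator\<close>

text \<open>Mass-weighted speed: its square is twice the kinetic energy, and the weight in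
  \<open>L1q\<close> is \<open>1 + rt x ^ q\<close>. In this variable the energy bound of a
  collision contains no masses.\<close>

definition rt :: "'s \<times> (real^'d) \<Rightarrow> real" where
  "rt x = sqrt (m $ fst x) * norm (snd x)"

definition frac :: "'s \<Rightarrow> 's \<Rightarrow> real" where
  "frac i j = m $ j / (m $ i + m $ j)"

text \<open>Each \<open>1 / sqrt (m $ i)\<close> is at most the sum, so \<open>c0 * rt x\<close>
  bounds the velocity for all species at once.\<close>

definition c0 :: real where "c0 = (\<Sum>i\<in>UNIV. 1 / sqrt (m $ i))"

definition Wr :: "'s \<times> (real^'d) \<Rightarrow> real" where "Wr x = 1 + (rt x)\<^sup>2"
definition Vr :: "'s \<times> (real^'d) \<Rightarrow> real" where "Vr x = 1 + (rt x) ^ 3"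
definition rate :: "'s \<times> (real^'d) \<Rightarrow> real" where "rate x = c0 * (1 + rt x)"

definition post :: "'s \<times> (real^'d) \<Rightarrow> 's \<times> (real^'d) \<Rightarrow> real^'d \<Rightarrow> 's \<times> (real^'d)" where
  "post x y z = (fst x, post_vel (m $ fst x) (m $ fst y) (snd x) (snd y) z)"

text \<open>The factor \<open>m $ fst x * frac (fst x) (fst y)\<close> is the reduced mass of the
  pair; the value is the loss of \<open>m |v|\<close> squared, summed over both partners, in one
  collision.\<close>

definition energy_loss :: "'s \<times> (real^'d) \<Rightarrow> 's \<times> (real^'d) \<Rightarrow> real^'d \<Rightarrow> real" where
  "energy_loss x y z = m $ fst x * frac (fst x) (fst y) * (speed x y)\<^sup>2 * (1 - (norm z)\<^sup>2)"

text \<open>Double integrals run over ordered pairs and so meet every collision twice; the division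
  by 2 corrects this.\<close>

definition diss :: "'s \<times> (real^'d) \<Rightarrow> 's \<times> (real^'d) \<Rightarrow> ennreal" where
  "diss x y = ennreal (speed x y) * (\<integral>\<^sup>+z. ennreal (energy_loss x y z / 2) \<partial>\<beta> (snd x - snd y))"

text \<open>Adjoint of the gain: by \<open>gain_weak\<close>, testing \<open>gain f\<close> with
  \<open>\<psi>\<close> amounts to integrating \<open>f x * f y\<close> against this
  function.\<close>

definition gain_adj :: "('s \<times> (real^'d) \<Rightarrow> ennreal) \<Rightarrow> 's \<times> (real^'d) \<Rightarrow> 's \<times> (real^'d) \<Rightarrow> ennreal" where
  "gain_adj \<psi> x y = ennreal (speed x y) * (\<integral>\<^sup>+z. \<psi> (post x y z) \<partial>\<beta> (snd x - snd y))"

text \<open>In the gain term the integration variables are the species of the partner, the relative velocity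
  \<open>u\<close> and \<open>z\<close>; for fixed \<open>(u, z)\<close> the collision is a translation in the velocity, which gives the
  gain a density whatever the kernel \<open>\<beta>\<close> is.\<close>

definition gain :: "('s \<times> (real^'d) \<Rightarrow> ennreal) \<Rightarrow> 's \<times> (real^'d) \<Rightarrow> ennreal" where
  "gain f x = (\<integral>\<^sup>+y. \<integral>\<^sup>+z. f (fst x, snd x + frac (fst x) (fst y) *\<^sub>R (snd y - norm (snd y) *\<^sub>R z)) *
      f (fst y, snd x + frac (fst x) (fst y) *\<^sub>R (snd y - norm (snd y) *\<^sub>R z) - snd y) * ennreal (norm (snd y)) \<partial>\<beta> (snd y) \<partial>M)"

lemma mass_comp [measurable (raw)]:
  assumes "g \<in> N \<rightarrow>\<^sub>M count_space UNIV"
  shows "(\<lambda>p. m $ g p) \<in> borel_measurable N"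
  by (rule measurable_compose[OF assms]) simp

lemma speed_measurable [measurable (raw)]:
  assumes [measurable]: "g \<in> N \<rightarrow>\<^sub>M M" "h \<in> N \<rightarrow>\<^sub>M M"
  shows "(\<lambda>p. speed (g p) (h p)) \<in> borel_measurable N"
  unfolding speed_def by measurable

lemma rt_measurable [measurable]: "rt \<in> borel_measurable M"
  unfolding rt_def by measurable

lemma Wr_measurable [measurable]: "Wr \<in> borel_measurable M"
  and Vr_measurable [measurable]: "Vr \<in> borel_measurable M"
  and rate_measurable [measurable]: "rate \<in> borel_measurable M"
  unfolding Wr_def Vr_def rate_def by measurable

lemma frac_measurable [measurable (raw)]:
  assumes [measurable]: "g \<in> N \<rightarrow>\<^sub>M count_space UNIV" "h \<in> N \<rightarrow>\<^sub>M count_space UNIV"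
  shows "(\<lambda>p. frac (g p) (h p)) \<in> borel_measurable N"
  unfolding frac_def by (intro borel_measurable_divide borel_measurable_add mass_comp assms)

lemma post_vel_frac:
  "post_vel (m $ i) (m $ j) v w z = frac j i *\<^sub>R v + frac i j *\<^sub>R w + (frac i j * norm (v - w)) *\<^sub>R z"
  unfolding post_vel_def frac_def by (simp add: scaleR_add_right add.commute)

lemma post_measurable [measurable (raw)]:
  assumes [measurable]: "g \<in> N \<rightarrow>\<^sub>M M" "h \<in> N \<rightarrow>\<^sub>M M" "q \<in> borel_measurable N"
  shows "(\<lambda>p. post (g p) (h p) (q p)) \<in> N \<rightarrow>\<^sub>M M"
  unfolding post_def post_vel_frac by measurable

lemma energy_loss_measurable [measurable (raw)]:
  assumes [measurable]: "g \<in> N \<rightarrow>\<^sub>M M" "h \<in> N \<rightarrow>\<^sub>M M" "q \<in> borel_measurable N"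
  shows "(\<lambda>p. energy_loss (g p) (h p) (q p)) \<in> borel_measurable N"
  unfolding energy_loss_def by measurable

lemma nn_integral_\<beta>_measurable:
  assumes h: "(\<lambda>p. h (fst p) (snd p)) \<in> borel_measurable (N \<Otimes>\<^sub>M borel)" and [measurable]: "g \<in> borel_measurable N"
  shows "(\<lambda>p. \<integral>\<^sup>+z. h p z \<partial>\<beta> (g p)) \<in> borel_measurable N"
  by (rule nn_integral_measurable_subprob_algebra2[where N=borel]) (use h in \<open>simp_all add: case_prod_beta'\<close>)

lemma gain_adj_measurable [measurable (raw)]:
  assumes [measurable]: "\<psi> \<in> borel_measurable M" "g \<in> N \<rightarrow>\<^sub>M M" "h \<in> N \<rightarrow>\<^sub>M M"
  shows "(\<lambda>p. gain_adj \<psi> (g p) (h p)) \<in> borel_measurable N"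
proof -
  have [measurable]: "(\<lambda>p. \<integral>\<^sup>+z. \<psi> (post (g p) (h p) z) \<partial>\<beta> (snd (g p) - snd (h p))) \<in> borel_measurable N"
    by (rule nn_integral_\<beta>_measurable) measurable
  show ?thesis unfolding gain_adj_def by measurable
qed

lemma diss_measurable [measurable (raw)]:
  assumes [measurable]: "g \<in> N \<rightarrow>\<^sub>M M" "h \<in> N \<rightarrow>\<^sub>M M"
  shows "(\<lambda>p. diss (g p) (h p)) \<in> borel_measurable N"
proof -
  have [measurable]: "(\<lambda>p. \<integral>\<^sup>+z. ennreal (energy_loss (g p) (h p) z / 2) \<partial>\<beta> (snd (g p) - snd (h p))) \<in> borel_measurable N"
    by (rule nn_integral_\<beta>_measurable) measurable
  show ?thesis unfolding diss_def by measurable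
qed

lemma gain_measurable:
  assumes u: "(\<lambda>p. u (fst p) (snd p)) \<in> borel_measurable (N \<Otimes>\<^sub>M M)"
  shows "(\<lambda>p. gain (u (fst p)) (snd p)) \<in> borel_measurable (N \<Otimes>\<^sub>M M)"
proof -
  note [measurable] = measurable_compose_pair[OF u]
  interpret sigma_finite_measure M by (rule sigma_finite_phase_measure)
  have [measurable]: "(\<lambda>q. \<integral>\<^sup>+z. u (fst (fst q)) (fst (snd (fst q)), snd (snd (fst q)) + frac (fst (snd (fst q))) (fst (snd q)) *\<^sub>R (snd (snd q) - norm (snd (snd q)) *\<^sub>R z)) *
      u (fst (fst q)) (fst (snd q), snd (snd (fst q)) + frac (fst (snd (fst q))) (fst (snd q)) *\<^sub>R (snd (snd q) - norm (snd (snd q)) *\<^sub>R z) - snd (snd q)) *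
      ennreal (norm (snd (snd q))) \<partial>\<beta> (snd (snd q))) \<in> borel_measurable ((N \<Otimes>\<^sub>M M) \<Otimes>\<^sub>M M)"
    by (rule nn_integral_\<beta>_measurable) measurable
  show ?thesis
    unfolding gain_def by measurable
qed

lemma space_phase [simp]: "space M = UNIV"
  by (simp add: space_pair_measure)

lemma frac_add [simp]: "frac i j + frac j i = 1"
  using mass_nonzero(2)[of i j] mass_nonzero(2)[of j i]
  unfolding frac_def by (simp add: add.commute flip: add_divide_distrib)

lemma frac_nonneg: "0 \<le> frac i j"
  unfolding frac_def using mass_pos by (simp add: less_imp_le)

lemma mass_frac: "m $ i * frac i j = m $ j * frac j i"
  unfolding frac_def by (simp add: add.commute)

text \<open>For a fixed relative velocity \<open>u\<close> and fixed \<open>z\<close>, a collision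
  translates \<open>snd x\<close> by a vector that depends on the species but not on
  \<open>snd x\<close>. The shift inside \<open>gain\<close> undoes this translation.\<close>

lemma post_shift:
  "post x (j, snd x - u) z = (fst x, snd x - frac (fst x) j *\<^sub>R (u - norm u *\<^sub>R z))"
proof -
  have "frac j (fst x) *\<^sub>R snd x + frac (fst x) j *\<^sub>R snd x = snd x"
    by (simp flip: scaleR_add_left)
  then show ?thesis
    unfolding post_def post_vel_frac by (simp add: algebra_simps)
qed

lemma pair_sigma_finite_phase: "pair_sigma_finite M M"
  using sigma_finite_phase_measure sigma_finite_phase_measure by (rule pair_sigma_finite.intro)

lemma pair_sigma_finite_\<beta>: "pair_sigma_finite M (\<beta> u)"
proof -
  interpret prob_space "\<beta> u" by (rule prob_\<beta>)
  show ?thesis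
    using sigma_finite_phase_measure sigma_finite_measure_axioms by (rule pair_sigma_finite.intro)
qed

text \<open>With the partner species, the relative velocity and \<open>z\<close> held fixed outside,
  the velocity integral is invariant under translation, which moves the shift from the densities to
  \<open>\<psi>\<close>. A reflection then turns the relative velocity back into the velocity of the
  partner.\<close>

lemma gain_weak:
  assumes [measurable]: "f \<in> borel_measurable M" "\<psi> \<in> borel_measurable M"
  shows "(\<integral>\<^sup>+x. gain f x * \<psi> x \<partial>M) = (\<integral>\<^sup>+x. \<integral>\<^sup>+y. f x * f y * gain_adj \<psi> x y \<partial>M \<partial>M)"
proof -
  interpret P: pair_sigma_finite M M by (rule pair_sigma_finite_phase)
  interpret B: pair_sigma_finite M "\<beta> u" for u by (rule pair_sigma_finite_\<beta>)
  define sh where "sh i y z = frac i (fst y) *\<^sub>R (snd y - norm (snd y) *\<^sub>R z)" for i :: 's and y :: "'s \<times> (real^'d)" and z :: "real^'d"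
  define H where "H x y z = f (fst x, snd x + sh (fst x) y z) * f (fst y, snd x + sh (fst x) y z - snd y) * ennreal (norm (snd y)) * \<psi> x" for x y z
  \<comment> \<open>\<open>H'\<close> is \<open>H\<close> with \<open>x\<close> translated: the
    shift has left the two densities and appears in \<open>\<psi>\<close>.\<close>
  define H' where "H' x y z = f x * f (fst y, snd x - snd y) * ennreal (norm (snd y)) * \<psi> (fst x, snd x - sh (fst x) y z)" for x y z
  have sh_m [measurable (raw)]: "(\<lambda>p. sh (a p) (b p) (c p)) \<in> borel_measurable N"
    if [measurable]: "a \<in> N \<rightarrow>\<^sub>M count_space UNIV" "b \<in> N \<rightarrow>\<^sub>M M" "c \<in> borel_measurable N" for a b c and N :: "'n measure"
    unfolding sh_def by measurable
  have H_m: "(\<lambda>p. H (a p) (b p) (c p)) \<in> borel_measurable N" "(\<lambda>p. H' (a p) (b p) (c p)) \<in> borel_measurable N"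
    if [measurable]: "a \<in> N \<rightarrow>\<^sub>M M" "b \<in> N \<rightarrow>\<^sub>M M" "c \<in> borel_measurable N" for a b c and N :: "'n measure"
    unfolding H_def H'_def sh_def by measurable
  have iH: "(\<lambda>p. \<integral>\<^sup>+z. H (fst p) (snd p) z \<partial>\<beta> (snd (snd p))) \<in> borel_measurable (M \<Otimes>\<^sub>M M)"
    unfolding H_def sh_def by (rule nn_integral_\<beta>_measurable) measurable
  have iH': "(\<lambda>p. \<integral>\<^sup>+z. H' (fst p) (snd p) z \<partial>\<beta> (snd (snd p))) \<in> borel_measurable (M \<Otimes>\<^sub>M M)"
    unfolding H'_def sh_def by (rule nn_integral_\<beta>_measurable) measurable
  have gain_m: "gain f \<in> borel_measurable M" 
    using measurable_compose[OF measurable_Pair1' gain_measurable[of "\<lambda>_. f" "borel :: real measure"], of 0] by simp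
  have meas_z: "(\<lambda>z. f (fst x, snd x + sh (fst x) y z) * f (fst y, snd x + sh (fst x) y z - snd y) * ennreal (norm (snd y))) \<in> borel_measurable (\<beta> (snd y))" for x y
    unfolding sh_def measurable_cong_sets[OF sets_\<beta> refl] by measurable
  have meas_y: "(\<lambda>y. \<integral>\<^sup>+z. f (fst x, snd x + sh (fst x) y z) * f (fst y, snd x + sh (fst x) y z - snd y) * ennreal (norm (snd y)) \<partial>\<beta> (snd y)) \<in> borel_measurable M" for x
    unfolding sh_def by (rule nn_integral_\<beta>_measurable) measurable
  have "(\<integral>\<^sup>+x. gain f x * \<psi> x \<partial>M) = (\<integral>\<^sup>+x. \<integral>\<^sup>+y. \<integral>\<^sup>+z. H x y z \<partial>\<beta> (snd y) \<partial>M \<partial>M)"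
    unfolding gain_def H_def sh_def[symmetric]
    by (intro nn_integral_cong) (simp add: nn_integral_multc[OF meas_z] nn_integral_multc[OF meas_y])
  also have "\<dots> = (\<integral>\<^sup>+y. \<integral>\<^sup>+x. \<integral>\<^sup>+z. H x y z \<partial>\<beta> (snd y) \<partial>M \<partial>M)"
    by (rule P.Fubini'[symmetric]) (use iH in \<open>simp add: case_prod_beta'\<close>)
  also have "\<dots> = (\<integral>\<^sup>+y. \<integral>\<^sup>+x. \<integral>\<^sup>+z. H' x y z \<partial>\<beta> (snd y) \<partial>M \<partial>M)"
  proof (rule nn_integral_cong)
    fix y :: "'s \<times> (real^'d)" assume "y \<in> space M"
    have "(\<integral>\<^sup>+x. \<integral>\<^sup>+z. H x y z \<partial>\<beta> (snd y) \<partial>M) = (\<integral>\<^sup>+z. \<integral>\<^sup>+x. H x y z \<partial>M \<partial>\<beta> (snd y))"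
      by (rule B.Fubini'[symmetric]) (simp add: case_prod_beta', intro H_m, simp_all)
    also have "\<dots> = (\<integral>\<^sup>+z. \<integral>\<^sup>+x. H' x y z \<partial>M \<partial>\<beta> (snd y))"
    proof (rule nn_integral_cong)
      fix z
      have "(\<integral>\<^sup>+x. H' x y z \<partial>M) = (\<integral>\<^sup>+x. H' (fst x, snd x + sh (fst x) y z) y z \<partial>M)"
        by (rule nn_integral_phase_translate[symmetric, where h="\<lambda>x. H' x y z" and a="\<lambda>i. sh i y z"]) (intro H_m, simp_all)
      also have "\<dots> = (\<integral>\<^sup>+x. H x y z \<partial>M)"
        unfolding H_def H'_def by (simp add: algebra_simps)
      finally show "(\<integral>\<^sup>+x. H x y z \<partial>M) = (\<integral>\<^sup>+x. H' x y z \<partial>M)" ..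
    qed
    also have "\<dots> = (\<integral>\<^sup>+x. \<integral>\<^sup>+z. H' x y z \<partial>\<beta> (snd y) \<partial>M)"
      by (rule B.Fubini') (simp add: case_prod_beta', intro H_m, simp_all)
    finally show "(\<integral>\<^sup>+x. \<integral>\<^sup>+z. H x y z \<partial>\<beta> (snd y) \<partial>M) = (\<integral>\<^sup>+x. \<integral>\<^sup>+z. H' x y z \<partial>\<beta> (snd y) \<partial>M)" .
  qed
  also have "\<dots> = (\<integral>\<^sup>+x. \<integral>\<^sup>+y. \<integral>\<^sup>+z. H' x y z \<partial>\<beta> (snd y) \<partial>M \<partial>M)"
    by (rule P.Fubini') (use iH' in \<open>simp add: case_prod_beta'\<close>)
  also have "\<dots> = (\<integral>\<^sup>+x. \<integral>\<^sup>+y. f x * f y * gain_adj \<psi> x y \<partial>M \<partial>M)"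
  proof (rule nn_integral_cong)
    fix x :: "'s \<times> (real^'d)" assume x[measurable]: "x \<in> space M"
    have "(\<integral>\<^sup>+y. f x * f y * gain_adj \<psi> x y \<partial>M) =
      (\<integral>\<^sup>+y. f x * f (fst y, snd x - snd y) * gain_adj \<psi> x (fst y, snd x - snd y) \<partial>M)"
      by (rule nn_integral_phase_reflect[symmetric, where h="\<lambda>y. f x * f y * gain_adj \<psi> x y" and a="snd x"]) measurable
    also have "\<dots> = (\<integral>\<^sup>+y. \<integral>\<^sup>+z. H' x y z \<partial>\<beta> (snd y) \<partial>M)"
    proof (rule nn_integral_cong)
      fix y :: "'s \<times> (real^'d)"
      have [measurable]: "(\<lambda>z. \<psi> (fst x, snd x - sh (fst x) y z)) \<in> borel_measurable (\<beta> (snd y))"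
        unfolding sh_def measurable_cong_sets[OF sets_\<beta> refl] by measurable
      show "f x * f (fst y, snd x - snd y) * gain_adj \<psi> x (fst y, snd x - snd y) = (\<integral>\<^sup>+z. H' x y z \<partial>\<beta> (snd y))"
        unfolding gain_adj_def H'_def post_shift speed_def
        by (simp add: nn_integral_cmult mult.assoc flip: sh_def)
    qed
    finally show "(\<integral>\<^sup>+y. \<integral>\<^sup>+z. H' x y z \<partial>\<beta> (snd y) \<partial>M) = (\<integral>\<^sup>+y. f x * f y * gain_adj \<psi> x y \<partial>M)" ..
  qed
  finally show ?thesis .
qed

section \<open>Conservation laws and energy loss in a collision\<close>

text \<open>Seen from the partner, a collision with parameter \<open>z\<close> has parameter
  \<open>- z\<close>, so this is the outgoing velocity of the partner.\<close>

lemma post_sym: "post y x (- z) = (fst y, frac (fst y) (fst x) *\<^sub>R snd x + frac (fst x) (fst y) *\<^sub>R snd y - (frac (fst y) (fst x) * speed x y) *\<^sub>R z)"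
  unfolding post_def post_vel_frac speed_def by (simp add: norm_minus_commute add.commute)

text \<open>Exchanging the partners reverses the relative velocity, and \<open>\<beta>_sym\<close>
  converts the kernel back at the price of \<open>- z\<close>. Both outgoing velocities are then
  averaged by the same measure, so that conservation laws can be applied pointwise in
  \<open>z\<close>.\<close>

lemma gain_adj_sym:
  assumes [measurable]: "\<psi> \<in> borel_measurable M"
  shows "gain_adj \<psi> y x = ennreal (speed x y) * (\<integral>\<^sup>+z. \<psi> (post y x (- z)) \<partial>\<beta> (snd x - snd y))"
proof -
  have "(\<integral>\<^sup>+z. \<psi> (post y x z) \<partial>\<beta> (snd y - snd x)) = (\<integral>\<^sup>+z. \<psi> (post y x z) \<partial>distr (\<beta> (snd x - snd y)) borel uminus)"
    by (subst \<beta>_sym) simp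
  also have "\<dots> = (\<integral>\<^sup>+z. \<psi> (post y x (- z)) \<partial>\<beta> (snd x - snd y))"
    by (rule nn_integral_distr) measurable
  finally show ?thesis
    unfolding gain_adj_def speed_def by (simp add: norm_minus_commute)
qed

lemma momentum_collision:
  "m $ fst x *\<^sub>R snd (post x y z) + m $ fst y *\<^sub>R snd (post y x (- z)) = m $ fst x *\<^sub>R snd x + m $ fst y *\<^sub>R snd y"
proof -
  define i j where "i = fst x" and "j = fst y"
  have e: "m $ i * frac i j = m $ j * frac j i" by (rule mass_frac)
  have "m $ i *\<^sub>R snd (post x y z) + m $ j *\<^sub>R snd (post y x (- z)) =
    (m $ i * frac j i + m $ j * frac j i) *\<^sub>R snd x + (m $ i * frac i j + m $ j * frac i j) *\<^sub>R snd y +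
    (m $ i * frac i j * speed x y - m $ j * frac j i * speed x y) *\<^sub>R z"
    unfolding post_sym unfolding post_def post_vel_frac speed_def i_def[symmetric] j_def[symmetric]
    by (simp add: algebra_simps)
  also have "m $ i * frac j i + m $ j * frac j i = m $ i"
    by (simp add: mass_frac[of j i, simplified] e[symmetric] flip: distrib_left)
  also have "m $ i * frac i j + m $ j * frac i j = m $ j"
    by (simp add: e flip: distrib_left)
  finally show ?thesis using e by (simp add: i_def j_def)
qed

text \<open>In terms of the centre-of-mass velocity \<open>A\<close> and the relative velocity
  \<open>u\<close>, the pair passes from \<open>A + p u\<close>, \<open>A - q u\<close> to
  \<open>A + p |u| z\<close>, \<open>A - q |u| z\<close>. Mixed terms vanish since
  \<open>m $ i * p = m $ j * q\<close>; only the internal part, reduced mass times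
  \<open>|u|\<close> squared, is multiplied by \<open>|z|\<close> squared.\<close>

lemma energy_collision:
  "(rt (post x y z))\<^sup>2 + (rt (post y x (- z)))\<^sup>2 + energy_loss x y z = (rt x)\<^sup>2 + (rt y)\<^sup>2"
proof -
  define i j v w where "i = fst x" and "j = fst y" and "v = snd x" and "w = snd y"
  define p q where "p = frac i j" and "q = frac j i"
  have pq: "q = 1 - p" using frac_add[of i j] unfolding p_def q_def by linarith
  have e: "m $ i * p = m $ j * q" unfolding p_def q_def by (rule mass_frac)
  define A where "A = q *\<^sub>R v + p *\<^sub>R w"
  define u where "u = v - w"
  have v: "v = A + p *\<^sub>R u" and w: "w = A - q *\<^sub>R u"
    unfolding A_def u_def pq by (simp_all add: algebra_simps)
  have sq: "(rt x)\<^sup>2 = m $ fst x * (snd x \<bullet> snd x)" for x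
    unfolding rt_def using mass_pos[of "fst x"] by (simp add: power_mult_distrib power2_norm_eq_inner)
  have "(rt (post x y z))\<^sup>2 + (rt (post y x (- z)))\<^sup>2 = m $ i * ((A + (p * norm u) *\<^sub>R z) \<bullet> (A + (p * norm u) *\<^sub>R z)) +
     m $ j * ((A - (q * norm u) *\<^sub>R z) \<bullet> (A - (q * norm u) *\<^sub>R z))"
    unfolding sq post_sym unfolding post_def post_vel_frac speed_def A_def u_def p_def q_def i_def j_def v_def w_def
    by (simp add: add.commute)
  also have "\<dots> = (m $ i + m $ j) * (A \<bullet> A) + 2 * norm u * (m $ i * p - m $ j * q) * (A \<bullet> z) +
     (m $ i * p * p + m $ j * q * q) * (norm u)\<^sup>2 * (z \<bullet> z)"
    by (simp add: inner_simps inner_commute power2_eq_square algebra_simps)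
  also have "\<dots> = (m $ i + m $ j) * (A \<bullet> A) + (m $ i * p) * (norm u)\<^sup>2 * (z \<bullet> z)"
  proof -
    have "m $ i * p * p + m $ j * q * q = m $ i * p * (p + q)"
      unfolding distrib_left e ..
    then show ?thesis using pq e by simp
  qed
  finally have 1: "(rt (post x y z))\<^sup>2 + (rt (post y x (- z)))\<^sup>2 = \<dots>" .
  have "(rt x)\<^sup>2 + (rt y)\<^sup>2 = m $ i * ((A + p *\<^sub>R u) \<bullet> (A + p *\<^sub>R u)) + m $ j * ((A - q *\<^sub>R u) \<bullet> (A - q *\<^sub>R u))"
    unfolding sq i_def[symmetric] j_def[symmetric] v_def[symmetric] w_def[symmetric] using v w by metis
  also have "\<dots> = (m $ i + m $ j) * (A \<bullet> A) + 2 * (m $ i * p - m $ j * q) * (A \<bullet> u) +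
     (m $ i * p * p + m $ j * q * q) * (u \<bullet> u)"
    by (simp add: inner_simps inner_commute power2_eq_square algebra_simps)
  also have "\<dots> = (m $ i + m $ j) * (A \<bullet> A) + (m $ i * p) * (u \<bullet> u)"
  proof -
    have "m $ i * p * p + m $ j * q * q = m $ i * p * (p + q)"
      unfolding distrib_left e ..
    then show ?thesis using pq e by simp
  qed
  finally have 2: "(rt x)\<^sup>2 + (rt y)\<^sup>2 = \<dots>" .
  have 3: "energy_loss x y z = m $ i * p * (norm u)\<^sup>2 * (1 - z \<bullet> z)"
    unfolding energy_loss_def speed_def i_def j_def p_def u_def v_def w_def by (simp add: power2_norm_eq_inner)
  show ?thesis
    unfolding 1 2 3 by (simp add: algebra_simps power2_norm_eq_inner)
qed


lemma double_integral_swap: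
  assumes [measurable]: "f \<in> borel_measurable M" "(\<lambda>p. h (fst p) (snd p)) \<in> borel_measurable (M \<Otimes>\<^sub>M M)"
  shows "(\<integral>\<^sup>+x. \<integral>\<^sup>+y. f x * f y * h y x \<partial>M \<partial>M) = (\<integral>\<^sup>+x. \<integral>\<^sup>+y. f x * f y * h x y \<partial>M \<partial>M)"
proof -
  interpret P: pair_sigma_finite M M by (rule pair_sigma_finite_phase)
  have "(\<integral>\<^sup>+x. \<integral>\<^sup>+y. f x * f y * h x y \<partial>M \<partial>M) = (\<integral>\<^sup>+y. \<integral>\<^sup>+x. f x * f y * h x y \<partial>M \<partial>M)"
    by (rule P.Fubini'[symmetric]) (simp add: case_prod_beta')
  then show ?thesis by (simp add: mult.commute)
qed

lemma double_integral_add: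
  assumes [measurable]: "f \<in> borel_measurable M" "(\<lambda>p. h (fst p) (snd p)) \<in> borel_measurable (M \<Otimes>\<^sub>M M)"
    "(\<lambda>p. g (fst p) (snd p)) \<in> borel_measurable (M \<Otimes>\<^sub>M M)"
  shows "(\<integral>\<^sup>+x. \<integral>\<^sup>+y. f x * f y * (h x y + g x y) \<partial>M \<partial>M) =
    (\<integral>\<^sup>+x. \<integral>\<^sup>+y. f x * f y * h x y \<partial>M \<partial>M) + (\<integral>\<^sup>+x. \<integral>\<^sup>+y. f x * f y * g x y \<partial>M \<partial>M)"
proof -
  interpret sigma_finite_measure M by (rule sigma_finite_phase_measure)
  note [measurable (raw)] = measurable_compose_pair[OF assms(2)] measurable_compose_pair[OF assms(3)]
  show ?thesis
    by (simp add: distrib_left nn_integral_add)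
qed

lemma ennreal_double_cancel: "a + a = b + b \<Longrightarrow> a = b" for a b :: ennreal
  by (cases a; cases b) (auto simp flip: ennreal_plus)

lemma ennreal_double_cancel_le: "a + a \<le> b + b \<Longrightarrow> a \<le> b" for a b :: ennreal
  by (cases a; cases b) (auto simp: ennreal_le_iff top_unique simp flip: ennreal_plus)

lemma gain_adj_add_sym:
  assumes [measurable]: "\<psi> \<in> borel_measurable M"
  shows "gain_adj \<psi> x y + gain_adj \<psi> y x =
    ennreal (speed x y) * (\<integral>\<^sup>+z. \<psi> (post x y z) + \<psi> (post y x (- z)) \<partial>\<beta> (snd x - snd y))"
proof -
  have [measurable]: "(\<lambda>z. \<psi> (post x y z)) \<in> borel_measurable (\<beta> (snd x - snd y))"
    "(\<lambda>z. \<psi> (post y x (- z))) \<in> borel_measurable (\<beta> (snd x - snd y))"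
    unfolding measurable_cong_sets[OF sets_\<beta> refl] by measurable
  show ?thesis
    unfolding gain_adj_sym[OF assms, where x=x and y=y] unfolding gain_adj_def
    by (simp add: distrib_left nn_integral_add)
qed

text \<open>One statement serves all invariants: species indicators with \<open>c = 0\<close>, the
  energy with \<open>c = 1\<close>, and a combination of momentum and energy. The pointwise law
  concerns a pair, so the double integrals are symmetrized and the doubled identity is halved. The
  dissipation stays on the left because no integral is assumed finite.\<close>

lemma gain_invariant:
  fixes \<psi> :: "'s \<times> (real^'d) \<Rightarrow> real" and c :: real
  assumes [measurable]: "f \<in> borel_measurable M" "\<psi> \<in> borel_measurable M" and \<psi>: "\<And>x. 0 \<le> \<psi> x" and c: "0 \<le> c"
    and inv: "\<And>x y z. norm z \<le> 1 \<Longrightarrow> \<psi> (post x y z) + \<psi> (post y x (- z)) + c * energy_loss x y z = \<psi> x + \<psi> y"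
  shows "(\<integral>\<^sup>+x. gain f x * ennreal (\<psi> x) \<partial>M) + ennreal c * (\<integral>\<^sup>+x. \<integral>\<^sup>+y. f x * f y * diss x y \<partial>M \<partial>M) =
    (\<integral>\<^sup>+x. \<integral>\<^sup>+y. f x * f y * (ennreal (speed x y) * ennreal (\<psi> x)) \<partial>M \<partial>M)"
proof -
  interpret sigma_finite_measure M by (rule sigma_finite_phase_measure)
  define S where "S = (\<integral>\<^sup>+x. \<integral>\<^sup>+y. f x * f y * gain_adj (\<lambda>x. ennreal (\<psi> x)) x y \<partial>M \<partial>M)"
  define D where "D = (\<integral>\<^sup>+x. \<integral>\<^sup>+y. f x * f y * (ennreal c * diss x y) \<partial>M \<partial>M)"
  define T where "T = (\<integral>\<^sup>+x. \<integral>\<^sup>+y. f x * f y * (ennreal (speed x y) * ennreal (\<psi> x)) \<partial>M \<partial>M)"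
  have pointwise: "gain_adj (\<lambda>x. ennreal (\<psi> x)) x y + gain_adj (\<lambda>x. ennreal (\<psi> x)) y x + (ennreal c * diss x y + ennreal c * diss x y) =
    ennreal (speed x y) * ennreal (\<psi> x) + ennreal (speed x y) * ennreal (\<psi> y)" for x y
  proof -
    let ?u = "snd x - snd y"
    interpret prob_space "\<beta> ?u" by (rule prob_\<beta>)
    \<comment> \<open>On the ball the energy loss is nonnegative, so \<open>ennreal\<close> does not
      truncate it; \<open>\<beta>_ball\<close> restricts the average to this case.\<close>
    have el: "0 \<le> energy_loss x y z" if "norm z \<le> 1" for z
    proof -
      have "(norm z)\<^sup>2 \<le> 1" using that by (simp add: power_le_one)
      then show ?thesis
        unfolding energy_loss_def using mass_pos by (auto intro!: mult_nonneg_nonneg frac_nonneg simp: less_imp_le)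
    qed
    have m: "(\<lambda>z. ennreal (energy_loss x y z / 2)) \<in> borel_measurable (\<beta> ?u)"
      "(\<lambda>z. ennreal (\<psi> (post x y z)) + ennreal (\<psi> (post y x (- z)))) \<in> borel_measurable (\<beta> ?u)"
      unfolding measurable_cong_sets[OF sets_\<beta> refl] by measurable
    have "(\<integral>\<^sup>+z. ennreal (\<psi> (post x y z)) + ennreal (\<psi> (post y x (- z))) \<partial>\<beta> ?u) +
        ennreal (2 * c) * (\<integral>\<^sup>+z. ennreal (energy_loss x y z / 2) \<partial>\<beta> ?u) =
      (\<integral>\<^sup>+z. ennreal (\<psi> (post x y z)) + ennreal (\<psi> (post y x (- z))) + ennreal (2 * c) * ennreal (energy_loss x y z / 2) \<partial>\<beta> ?u)"
      using m by (simp add: nn_integral_add nn_integral_cmult)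
    also have "\<dots> = (\<integral>\<^sup>+z. ennreal (\<psi> x + \<psi> y) \<partial>\<beta> ?u)"
    proof (rule nn_integral_cong_AE, use \<beta>_ball[of ?u] in eventually_elim)
      case (elim z)
      have "ennreal (2 * c) * ennreal (energy_loss x y z / 2) = ennreal (c * energy_loss x y z)"
        using c el[OF elim] by (simp flip: ennreal_mult)
      then show ?case
        using inv[OF elim, of x y] c el[OF elim] \<psi> by (simp flip: ennreal_plus)
    qed
    also have "\<dots> = ennreal (\<psi> x) + ennreal (\<psi> y)"
      using \<psi> by (simp add: emeasure_space_1[simplified])
    finally have *: "(\<integral>\<^sup>+z. ennreal (\<psi> (post x y z)) + ennreal (\<psi> (post y x (- z))) \<partial>\<beta> ?u) +
        ennreal (2 * c) * (\<integral>\<^sup>+z. ennreal (energy_loss x y z / 2) \<partial>\<beta> ?u) = \<dots>" .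
    have "ennreal c * diss x y + ennreal c * diss x y =
      ennreal (speed x y) * (ennreal (2 * c) * (\<integral>\<^sup>+z. ennreal (energy_loss x y z / 2) \<partial>\<beta> ?u))"
      unfolding diss_def using c by (simp add: ennreal_mult mult_ac flip: mult_2)
    then show ?thesis
      by (simp add: gain_adj_add_sym * flip: distrib_left)
  qed
  have 1: "S = (\<integral>\<^sup>+x. \<integral>\<^sup>+y. f x * f y * gain_adj (\<lambda>x. ennreal (\<psi> x)) y x \<partial>M \<partial>M)"
    unfolding S_def by (rule double_integral_swap[symmetric]) measurable
  have 2: "T = (\<integral>\<^sup>+x. \<integral>\<^sup>+y. f x * f y * (ennreal (speed x y) * ennreal (\<psi> y)) \<partial>M \<partial>M)"
    unfolding T_def by (subst double_integral_swap[symmetric]) (simp_all add: speed_def norm_minus_commute)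
  have "(S + D) + (S + D) = S + S + (D + D)" by (simp add: add_ac)
  also have "\<dots> = (\<integral>\<^sup>+x. \<integral>\<^sup>+y. f x * f y * (gain_adj (\<lambda>x. ennreal (\<psi> x)) x y + gain_adj (\<lambda>x. ennreal (\<psi> x)) y x + (ennreal c * diss x y + ennreal c * diss x y)) \<partial>M \<partial>M)"
    by (subst (2) 1) (simp add: double_integral_add S_def D_def)
  also have "\<dots> = T + T"
    unfolding pointwise by (subst (2) 2) (simp add: double_integral_add T_def)
  finally have "S + D = T" by (rule ennreal_double_cancel)
  moreover have "D = ennreal c * (\<integral>\<^sup>+x. \<integral>\<^sup>+y. f x * f y * diss x y \<partial>M \<partial>M)"
  proof -
    have "D = (\<integral>\<^sup>+x. \<integral>\<^sup>+y. ennreal c * (f x * f y * diss x y) \<partial>M \<partial>M)"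
      unfolding D_def by (simp add: mult_ac)
    then show ?thesis by (simp add: nn_integral_cmult)
  qed
  ultimately show ?thesis
    unfolding S_def T_def by (subst gain_weak) simp_all
qed

section \<open>Moment weights and the Povzner estimate\<close>

lemma rt_nonneg: "0 \<le> rt x"
  unfolding rt_def using mass_pos[of "fst x"] by simp

lemma c0_nonneg: "0 \<le> c0"
  unfolding c0_def using mass_pos by (intro sum_nonneg) (simp add: less_imp_le)

lemma Wr_ge_1: "1 \<le> Wr x" and Vr_ge_1: "1 \<le> Vr x" and rate_nonneg: "0 \<le> rate x"
  unfolding Wr_def Vr_def rate_def using rt_nonneg[of x] c0_nonneg by auto

lemma speed_nonneg: "0 \<le> speed x y"
  by (simp add: speed_def)

lemma speed_le: "speed x y \<le> c0 * (rt x + rt y)"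
proof -
  have *: "norm (snd x) \<le> c0 * rt x" for x :: "'s \<times> (real^'d)"
  proof -
    have "1 / sqrt (m $ fst x) \<le> c0"
      unfolding c0_def using mass_pos by (intro member_le_sum) (auto simp: less_imp_le)
    then have "1 / sqrt (m $ fst x) * rt x \<le> c0 * rt x"
      using rt_nonneg by (rule mult_right_mono)
    then show ?thesis
      unfolding rt_def using mass_pos[of "fst x"] by simp
  qed
  have "speed x y \<le> norm (snd x) + norm (snd y)"
    unfolding speed_def by (rule norm_triangle_ineq4)
  also have "\<dots> \<le> c0 * (rt x + rt y)"
    using *[of x] *[of y] by (simp add: distrib_left)
  finally show ?thesis .
qed

lemma le_one_plus_square: "a \<le> 1 + a\<^sup>2" for a :: real
  using zero_le_power2[of "a - 1 / 2"] by (simp add: power2_diff field_simps)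

lemma cubic_bounds:
  fixes a b :: real
  assumes "0 \<le> a" "0 \<le> b"
  shows "a \<le> 1 + a ^ 3" "a\<^sup>2 \<le> 1 + a ^ 3"
    "a ^ 3 * b \<le> (1 + a ^ 3) * (1 + b\<^sup>2)" "a\<^sup>2 * b\<^sup>2 \<le> (1 + a ^ 3) * (1 + b\<^sup>2)"
proof -
  have "a \<le> 1 + a ^ 3 \<and> a\<^sup>2 \<le> 1 + a ^ 3"
  proof (cases "a \<le> 1")
    case True
    then show ?thesis
      using power_le_one[of a 2] assms(1) zero_le_power[OF assms(1), of 3] by (intro conjI) linarith+
  next
    case False
    then show ?thesis
    proof -
      have "a ^ 1 \<le> a ^ 3" "a ^ 2 \<le> a ^ 3"
        using False by (intro power_increasing; simp)+
      then show ?thesis by simp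
    qed
  qed
  then show 2: "a \<le> 1 + a ^ 3" "a\<^sup>2 \<le> 1 + a ^ 3" by auto
  show "a ^ 3 * b \<le> (1 + a ^ 3) * (1 + b\<^sup>2)" "a\<^sup>2 * b\<^sup>2 \<le> (1 + a ^ 3) * (1 + b\<^sup>2)"
    using assms le_one_plus_square[of b] 2 by (auto intro!: mult_mono)
qed

text \<open>The product form, first order in \<open>x\<close> and second order in \<open>y\<close>,
  is what allows a damping that depends on \<open>x\<close> alone while the energy integrates out
  \<open>y\<close>.\<close>

lemma speed_le_rate_W: "speed x y \<le> rate x * Wr y"
proof -
  have "rt x * 1 + 1 * rt y \<le> rt x * (1 + (rt y)\<^sup>2) + 1 * (1 + (rt y)\<^sup>2)"
    using le_one_plus_square[of "rt y"] rt_nonneg[of x] rt_nonneg[of y] by (intro add_mono mult_mono) auto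
  then have "rt x + rt y \<le> (1 + rt x) * (1 + (rt y)\<^sup>2)"
    by (simp add: distrib_right)
  then have "c0 * (rt x + rt y) \<le> c0 * ((1 + rt x) * (1 + (rt y)\<^sup>2))"
    using c0_nonneg by (rule mult_left_mono)
  then show ?thesis
    using speed_le[of x y] unfolding rate_def Wr_def by (simp add: mult.assoc)
qed

lemma quadruple_bound: "a \<le> 1 + c \<Longrightarrow> b \<le> 1 + c \<Longrightarrow> 0 \<le> c \<Longrightarrow> 1 + a + b + c \<le> 4 * (1 + c)" for a b c :: real
  by simp

lemma four_bound: "0 \<le> a \<Longrightarrow> 0 \<le> b \<Longrightarrow> p \<le> 2 * q \<Longrightarrow> q \<le> a \<Longrightarrow> r \<le> b \<Longrightarrow> p + r \<le> 4 * (a + b)" for a b p q r :: real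
  by simp

lemma rate_W_le: "rate x * Wr x \<le> 4 * c0 * Vr x"
proof -
  have "(1 + rt x) * (1 + (rt x)\<^sup>2) = 1 + rt x + (rt x)\<^sup>2 + rt x ^ 3"
    by (simp add: algebra_simps power2_eq_square power3_eq_cube)
  also have "\<dots> \<le> 4 * (1 + rt x ^ 3)"
    by (intro quadruple_bound cubic_bounds(1,2)[OF rt_nonneg rt_nonneg] zero_le_power rt_nonneg)
  finally have "c0 * ((1 + rt x) * (1 + (rt x)\<^sup>2)) \<le> c0 * (4 * (1 + rt x ^ 3))"
    using c0_nonneg by (rule mult_left_mono)
  then show ?thesis unfolding rate_def Wr_def Vr_def by (simp add: mult_ac)
qed

text \<open>The part \<open>rt x * Wr x\<close> has order three and goes into \<open>Vr x\<close>,
  while \<open>rt y\<close> goes into \<open>Vr y\<close>; no moment above the third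
  appears.\<close>

lemma speed_W_le: "speed x y * Wr x \<le> 4 * c0 * (Vr x * Wr y + Wr x * Vr y)"
proof -
  have 1: "rt x * Wr x \<le> 2 * Vr x"
    using cubic_bounds(1)[OF rt_nonneg[of x] rt_nonneg[of x]] zero_le_power[OF rt_nonneg[of x], of 3]
    unfolding Wr_def Vr_def by (simp add: algebra_simps power2_eq_square power3_eq_cube)
  have 2: "Vr x \<le> Vr x * Wr y"
    using mult_left_mono[OF Wr_ge_1[of y], of "Vr x"] Vr_ge_1[of x] by simp
  have 3: "rt y * Wr x \<le> Wr x * Vr y"
    using cubic_bounds(1)[OF rt_nonneg[of y] rt_nonneg[of y]] Wr_ge_1[of x] unfolding Vr_def
    by (subst mult.commute) (rule mult_left_mono, auto)
  have "0 \<le> Vr x * Wr y" "0 \<le> Wr x * Vr y"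
    using Wr_ge_1[of x] Vr_ge_1[of x] Wr_ge_1[of y] Vr_ge_1[of y] by auto
  then have "(rt x + rt y) * Wr x \<le> 4 * (Vr x * Wr y + Wr x * Vr y)"
    unfolding distrib_right using 1 2 3 by (intro four_bound)
  then have "c0 * ((rt x + rt y) * Wr x) \<le> c0 * (4 * (Vr x * Wr y + Wr x * Vr y))"
    using c0_nonneg by (rule mult_left_mono)
  moreover have "speed x y * Wr x \<le> c0 * (rt x + rt y) * Wr x"
    using speed_le Wr_ge_1[of x] by (intro mult_right_mono) auto
  ultimately show ?thesis by (simp add: mult_ac)
qed

text \<open>Energy does not increase, so both outgoing values of \<open>rt\<close> are at most
  \<open>a + b\<close>, and the sum of their cubes is at most
  \<open>(a + b) * (a\<^sup>2 + b\<^sup>2)\<close>. The pure cubes in this product are those before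
  the collision; only \<open>a * b * (a + b)\<close> is new. Multiplied by the speed it stays at
  most cubic in one variable and quadratic in the other, hence the products of \<open>Vr\<close> and
  \<open>Wr\<close>.\<close>

lemma povzner_pointwise:
  assumes "norm z \<le> 1"
  shows "speed x y * (Vr (post x y z) + Vr (post y x (- z))) \<le>
    speed x y * (Vr x + Vr y) + 4 * c0 * (Vr x * Wr y + Wr x * Vr y)"
proof -
  define a b a' b' where "a = rt x" and "b = rt y" and "a' = rt (post x y z)" and "b' = rt (post y x (- z))"
  have nn: "0 \<le> a" "0 \<le> b" "0 \<le> a'" "0 \<le> b'"
    unfolding a_def b_def a'_def b'_def by (rule rt_nonneg)+
  have "0 \<le> energy_loss x y z"
  proof -
    have "(norm z)\<^sup>2 \<le> 1" using assms by (simp add: power_le_one)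
    then show ?thesis
      unfolding energy_loss_def using mass_pos by (auto intro!: mult_nonneg_nonneg frac_nonneg simp: less_imp_le)
  qed
  then have e: "a'\<^sup>2 + b'\<^sup>2 \<le> a\<^sup>2 + b\<^sup>2"
    using energy_collision[of x y z] unfolding a_def b_def a'_def b'_def by linarith
  have s: "a\<^sup>2 + b\<^sup>2 \<le> (a + b)\<^sup>2" using nn by (simp add: power2_sum)
  have "a' \<le> a + b" "b' \<le> a + b"
  proof -
    have "a'\<^sup>2 \<le> (a + b)\<^sup>2" "b'\<^sup>2 \<le> (a + b)\<^sup>2"
      using e s zero_le_power2[of a'] zero_le_power2[of b'] by linarith+
    then show "a' \<le> a + b" "b' \<le> a + b"
      by - (rule power2_le_imp_le[OF _ add_nonneg_nonneg[OF nn(1,2)]], assumption)+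
  qed
  then have "a' * a'\<^sup>2 + b' * b'\<^sup>2 \<le> (a + b) * a'\<^sup>2 + (a + b) * b'\<^sup>2"
    by (intro add_mono mult_right_mono) auto
  also have "\<dots> \<le> (a + b) * (a\<^sup>2 + b\<^sup>2)"
    unfolding distrib_left[symmetric] using e nn by (intro mult_left_mono) auto
  finally have V: "Vr (post x y z) + Vr (post y x (- z)) \<le> Vr x + Vr y + a * b * (a + b)"
    unfolding Vr_def a_def[symmetric] b_def[symmetric] a'_def[symmetric] b'_def[symmetric]
    by (simp add: algebra_simps power2_eq_square power3_eq_cube)
  have "speed x y * (a * b * (a + b)) \<le> c0 * (a + b) * (a * b * (a + b))"
    using speed_le[of x y] nn unfolding a_def b_def by (intro mult_right_mono) auto
  also have "\<dots> = c0 * (a ^ 3 * b + a\<^sup>2 * b\<^sup>2 + (b\<^sup>2 * a\<^sup>2 + b ^ 3 * a))"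
    by (simp add: algebra_simps power2_eq_square power3_eq_cube)
  also have "\<dots> \<le> c0 * ((1 + a ^ 3) * (1 + b\<^sup>2) + (1 + a ^ 3) * (1 + b\<^sup>2) + ((1 + b ^ 3) * (1 + a\<^sup>2) + (1 + b ^ 3) * (1 + a\<^sup>2)))"
    using cubic_bounds(3,4)[OF nn(1,2)] cubic_bounds(3,4)[OF nn(2,1)]
    by (intro mult_left_mono add_mono c0_nonneg) auto
  also have "\<dots> \<le> 4 * c0 * (Vr x * Wr y + Wr x * Vr y)"
    using c0_nonneg nn unfolding Vr_def Wr_def a_def[symmetric] b_def[symmetric] by (simp add: algebra_simps)
  finally have "speed x y * (a * b * (a + b)) \<le> \<dots>" .
  moreover have "speed x y * (Vr (post x y z) + Vr (post y x (- z))) \<le> speed x y * (Vr x + Vr y + a * b * (a + b))"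
    by (rule mult_left_mono[OF V speed_nonneg])
  ultimately show ?thesis by (simp add: distrib_left)
qed

lemma gain_mono: "(\<And>x. f x \<le> g x) \<Longrightarrow> gain f x \<le> gain g x"
  unfolding gain_def by (intro nn_integral_mono mult_mono) auto

lemma gain_SUP:
  assumes inc: "incseq f" and [measurable]: "\<And>n. f n \<in> borel_measurable M"
  shows "gain (\<lambda>x. SUP n. f n x) x = (SUP n. gain (f n) x)"
proof -
  have mono: "incseq (\<lambda>n. f n x)" for x
    using inc by (simp add: incseq_def le_funD)
  have mono': "m \<le> n \<Longrightarrow> f m x \<le> f n x" for m n x
    using inc by (simp add: incseq_def le_funD)
  define a where "a y z = (fst x, snd x + frac (fst x) (fst y) *\<^sub>R (snd y - norm (snd y) *\<^sub>R z))" for y :: "'s \<times> (real^'d)" and z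
  define b where "b y z = (fst y, snd x + frac (fst x) (fst y) *\<^sub>R (snd y - norm (snd y) *\<^sub>R z) - snd y)" for y :: "'s \<times> (real^'d)" and z
  define T where "T n y z = f n (a y z) * f n (b y z) * ennreal (norm (snd y))" for n y z
  have T_m: "T n y \<in> borel_measurable (\<beta> (snd y))" for n y
    unfolding T_def a_def b_def measurable_cong_sets[OF sets_\<beta> refl] by measurable
  have T_int: "(\<lambda>y. \<integral>\<^sup>+z. T n y z \<partial>\<beta> (snd y)) \<in> borel_measurable M" for n
    unfolding T_def a_def b_def by (rule nn_integral_\<beta>_measurable) measurable
  have T_mono: "m \<le> n \<Longrightarrow> T m y z \<le> T n y z" for m n y z
    unfolding T_def by (intro mult_mono mono') auto
  have "gain (\<lambda>x. SUP n. f n x) x = (\<integral>\<^sup>+y. \<integral>\<^sup>+z. (SUP n. T n y z) \<partial>\<beta> (snd y) \<partial>M)"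
    unfolding gain_def T_def a_def b_def
    by (simp add: SUP_mult_SUP_ennreal[OF mono mono] flip: SUP_mult_right_ennreal)
  also have "\<dots> = (\<integral>\<^sup>+y. (SUP n. \<integral>\<^sup>+z. T n y z \<partial>\<beta> (snd y)) \<partial>M)"
    by (intro nn_integral_cong nn_integral_monotone_convergence_SUP T_m) (auto simp: incseq_def le_fun_def intro: T_mono)
  also have "\<dots> = (SUP n. \<integral>\<^sup>+y. \<integral>\<^sup>+z. T n y z \<partial>\<beta> (snd y) \<partial>M)"
    by (intro nn_integral_monotone_convergence_SUP T_int) (auto simp: incseq_def le_fun_def intro!: nn_integral_mono T_mono)
  finally show ?thesis
    unfolding T_def a_def b_def gain_def .
qed

text \<open>Symmetrization as in \<open>gain_invariant\<close>, with the Povzner inequality in place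
  of an identity; the mixed terms factorize into a product of the two moments.\<close>

lemma gain_V:
  assumes [measurable]: "f \<in> borel_measurable M"
  shows "(\<integral>\<^sup>+x. gain f x * ennreal (Vr x) \<partial>M) \<le>
    (\<integral>\<^sup>+x. \<integral>\<^sup>+y. f x * f y * (ennreal (speed x y) * ennreal (Vr x)) \<partial>M \<partial>M) +
    ennreal (4 * c0) * ((\<integral>\<^sup>+x. f x * ennreal (Wr x) \<partial>M) * (\<integral>\<^sup>+x. f x * ennreal (Vr x) \<partial>M))"
proof -
  interpret sigma_finite_measure M by (rule sigma_finite_phase_measure)
  define V W where "V x = ennreal (Vr x)" and "W x = ennreal (Wr x)" for x
  have [measurable]: "V \<in> borel_measurable M" "W \<in> borel_measurable M" unfolding V_def W_def by measurable
  define S where "S = (\<integral>\<^sup>+x. \<integral>\<^sup>+y. f x * f y * gain_adj V x y \<partial>M \<partial>M)"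
  define T where "T = (\<integral>\<^sup>+x. \<integral>\<^sup>+y. f x * f y * (ennreal (speed x y) * V x) \<partial>M \<partial>M)"
  define D where "D = (\<integral>\<^sup>+x. \<integral>\<^sup>+y. f x * f y * (ennreal (4 * c0) * (V x * W y)) \<partial>M \<partial>M)"
  have pointwise: "gain_adj V x y + gain_adj V y x \<le> ennreal (speed x y) * V x + ennreal (speed x y) * V y +
     (ennreal (4 * c0) * (V x * W y) + ennreal (4 * c0) * (V y * W x))" for x y
  proof -
    let ?u = "snd x - snd y"
    interpret prob_space "\<beta> ?u" by (rule prob_\<beta>)
    have m: "(\<lambda>z. V (post x y z) + V (post y x (- z))) \<in> borel_measurable (\<beta> ?u)"
      unfolding measurable_cong_sets[OF sets_\<beta> refl] by measurable
    have V0: "0 \<le> Vr x" "0 \<le> Wr x" for x using Vr_ge_1[of x] Wr_ge_1[of x] by auto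
    have "gain_adj V x y + gain_adj V y x = (\<integral>\<^sup>+z. ennreal (speed x y) * (V (post x y z) + V (post y x (- z))) \<partial>\<beta> ?u)"
      using m by (simp add: gain_adj_add_sym nn_integral_cmult)
    also have "\<dots> \<le> (\<integral>\<^sup>+z. ennreal (speed x y * (Vr x + Vr y) + 4 * c0 * (Vr x * Wr y + Wr x * Vr y)) \<partial>\<beta> ?u)"
    proof (rule nn_integral_mono_AE, use \<beta>_ball[of ?u] in eventually_elim)
      case (elim z)
      have "ennreal (speed x y) * (V (post x y z) + V (post y x (- z))) = ennreal (speed x y * (Vr (post x y z) + Vr (post y x (- z))))"
        unfolding V_def by (simp add: speed_nonneg V0 ennreal_mult)
      then show ?case using povzner_pointwise[OF elim, of x y] by (simp add: ennreal_leI)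
    qed
    also have "\<dots> = ennreal (speed x y * (Vr x + Vr y) + 4 * c0 * (Vr x * Wr y + Wr x * Vr y))"
      by (simp add: emeasure_space_1[simplified])
    also have "\<dots> = ennreal (speed x y) * V x + ennreal (speed x y) * V y +
     (ennreal (4 * c0) * (V x * W y) + ennreal (4 * c0) * (V y * W x))"
      unfolding V_def W_def
      by (simp add: distrib_left speed_nonneg c0_nonneg V0 ennreal_mult mult_ac)
    finally show ?thesis .
  qed
  have 1: "S = (\<integral>\<^sup>+x. \<integral>\<^sup>+y. f x * f y * gain_adj V y x \<partial>M \<partial>M)"
    unfolding S_def by (rule double_integral_swap[symmetric]) measurable
  have 2: "T = (\<integral>\<^sup>+x. \<integral>\<^sup>+y. f x * f y * (ennreal (speed x y) * V y) \<partial>M \<partial>M)"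
    unfolding T_def by (subst double_integral_swap[symmetric]) (simp_all add: speed_def norm_minus_commute)
  have 3: "D = (\<integral>\<^sup>+x. \<integral>\<^sup>+y. f x * f y * (ennreal (4 * c0) * (V y * W x)) \<partial>M \<partial>M)"
    unfolding D_def by (rule double_integral_swap[symmetric]) measurable
  have "S + S = (\<integral>\<^sup>+x. \<integral>\<^sup>+y. f x * f y * (gain_adj V x y + gain_adj V y x) \<partial>M \<partial>M)"
    by (subst (2) 1) (simp add: double_integral_add S_def)
  also have "\<dots> \<le> (\<integral>\<^sup>+x. \<integral>\<^sup>+y. f x * f y * (ennreal (speed x y) * V x + ennreal (speed x y) * V y +
     (ennreal (4 * c0) * (V x * W y) + ennreal (4 * c0) * (V y * W x))) \<partial>M \<partial>M)"
    by (intro nn_integral_mono mult_left_mono pointwise) simp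
  also have "\<dots> = T + T + (D + D)"
    by (subst (2) 2, subst (2) 3) (simp add: double_integral_add T_def D_def)
  also have "\<dots> = (T + D) + (T + D)" by (simp add: add_ac)
  finally have "S \<le> T + D" by (rule ennreal_double_cancel_le)
  moreover have "D = ennreal (4 * c0) * ((\<integral>\<^sup>+x. f x * W x \<partial>M) * (\<integral>\<^sup>+x. f x * V x \<partial>M))"
  proof -
    have "D = (\<integral>\<^sup>+x. \<integral>\<^sup>+y. ennreal (4 * c0) * (f x * V x) * (f y * W y) \<partial>M \<partial>M)"
      unfolding D_def by (simp add: mult_ac)
    also have "\<dots> = (\<integral>\<^sup>+x. ennreal (4 * c0) * (f x * V x) * (\<integral>\<^sup>+y. f y * W y \<partial>M) \<partial>M)"
      by (intro nn_integral_cong nn_integral_cmult) measurable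
    also have "\<dots> = (\<integral>\<^sup>+x. ennreal (4 * c0) * (f x * V x) \<partial>M) * (\<integral>\<^sup>+y. f y * W y \<partial>M)"
      by (rule nn_integral_multc) measurable
    also have "(\<integral>\<^sup>+x. ennreal (4 * c0) * (f x * V x) \<partial>M) = ennreal (4 * c0) * (\<integral>\<^sup>+x. f x * V x \<partial>M)"
      by (rule nn_integral_cmult) measurable
    finally show ?thesis by (simp add: mult_ac)
  qed
  ultimately show ?thesis
    unfolding S_def T_def V_def W_def by (subst gain_weak) simp_all
qed

text \<open>The relation \<open>J_W\<close> is \<open>gain_invariant\<close> for \<open>Wr\<close>
  with \<open>c = 1\<close>: the constant in \<open>Wr\<close> is the same on both sides, and
  \<open>energy_collision\<close> supplies the rest. \<open>J_V\<close> is
  \<open>gain_V\<close>.\<close>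

sublocale collision_model M "\<lambda>x y. ennreal (speed x y)" diss "\<lambda>x. ennreal (Wr x)" "\<lambda>x. ennreal (Vr x)" rate gain "4 * c0"
proof (intro collision_model.intro sigma_finite_phase_measure collision_model_axioms.intro)
  fix x y :: "'s \<times> (real^'d)" and f g :: "'s \<times> (real^'d) \<Rightarrow> ennreal" and fs :: "nat \<Rightarrow> 's \<times> (real^'d) \<Rightarrow> ennreal"
    and h :: "real \<Rightarrow> 's \<times> (real^'d) \<Rightarrow> ennreal"
  have nn: "0 \<le> Vr x" "0 \<le> Wr x" "0 \<le> rate x" for x using Vr_ge_1[of x] Wr_ge_1[of x] rate_nonneg[of x] by auto
  show "(\<lambda>(x, y). ennreal (speed x y)) \<in> borel_measurable (M \<Otimes>\<^sub>M M)"
    unfolding case_prod_beta' by measurable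
  show "(\<lambda>(x, y). diss x y) \<in> borel_measurable (M \<Otimes>\<^sub>M M)"
    unfolding case_prod_beta' by measurable
  show "ennreal (speed x y) \<le> ennreal (rate x) * ennreal (Wr y)"
    using speed_le_rate_W[of x y] nn by (simp add: ennreal_leI flip: ennreal_mult)
  show "ennreal (rate x) * ennreal (Wr x) \<le> ennreal (4 * c0) * ennreal (Vr x)"
    using rate_W_le[of x] nn c0_nonneg by (simp add: ennreal_leI flip: ennreal_mult)
  show "ennreal (speed x y) * ennreal (Wr x) \<le> ennreal (4 * c0) * (ennreal (Vr x) * ennreal (Wr y) + ennreal (Wr x) * ennreal (Vr y))"
    using speed_W_le[of x y] nn c0_nonneg speed_nonneg[of x y] by (simp add: ennreal_leI flip: ennreal_mult ennreal_plus)
  show "gain f x \<le> gain g x" if "\<And>x. f x \<le> g x"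
    using that by (rule gain_mono)
  show "gain (\<lambda>x. SUP n. fs n x) x = (SUP n. gain (fs n) x)" if "incseq fs" "\<And>n. fs n \<in> borel_measurable M"
    using that by (rule gain_SUP)
  show "(\<lambda>p. gain (h (fst p)) (snd p)) \<in> borel_measurable (borel \<Otimes>\<^sub>M M)"
    if "(\<lambda>p. h (fst p) (snd p)) \<in> borel_measurable (borel \<Otimes>\<^sub>M M)"
    using that by (rule gain_measurable)
  show "(\<integral>\<^sup>+x. gain f x * ennreal (Wr x) \<partial>M) + (\<integral>\<^sup>+x. \<integral>\<^sup>+y. f x * f y * diss x y \<partial>M \<partial>M) =
    (\<integral>\<^sup>+x. \<integral>\<^sup>+y. f x * f y * (ennreal (speed x y) * ennreal (Wr x)) \<partial>M \<partial>M)" if "f \<in> borel_measurable M"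
  proof -
    have "Wr (post x y z) + Wr (post y x (- z)) + 1 * energy_loss x y z = Wr x + Wr y" for x y z
      using energy_collision[of x y z] by (simp add: Wr_def)
    from gain_invariant[OF that Wr_measurable nn(2) _ this] show ?thesis by simp
  qed
  show "(\<integral>\<^sup>+x. gain f x * ennreal (Vr x) \<partial>M) \<le>
    (\<integral>\<^sup>+x. \<integral>\<^sup>+y. f x * f y * (ennreal (speed x y) * ennreal (Vr x)) \<partial>M \<partial>M) +
    ennreal (4 * c0) * ((\<integral>\<^sup>+x. f x * ennreal (Wr x) \<partial>M) * (\<integral>\<^sup>+x. f x * ennreal (Vr x) \<partial>M))" if "f \<in> borel_measurable M"
    using that by (rule gain_V)
qed (use c0_nonneg rate_nonneg Wr_ge_1 in auto)

lemma rate_le_Wr: "rate x \<le> 2 * c0 * Wr x"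
  using mult_left_mono[OF le_one_plus_square[of "rt x"] c0_nonneg] mult_left_mono[OF Wr_ge_1[of x] c0_nonneg]
  unfolding rate_def Wr_def by (simp add: algebra_simps)

lemma speed_le_Wr: "ennreal (speed x y) \<le> ennreal (2 * c0) * (ennreal (Wr x) * ennreal (Wr y))"
proof -
  have "speed x y \<le> rate x * Wr y" by (rule speed_le_rate_W)
  also have "\<dots> \<le> 2 * c0 * Wr x * Wr y"
    using Wr_ge_1[of y] by (intro mult_right_mono rate_le_Wr) auto
  finally show ?thesis
    using c0_nonneg Wr_ge_1[of x] Wr_ge_1[of y] by (simp add: ennreal_leI mult.assoc flip: ennreal_mult)
qed

lemma quadratic_form_le:
  assumes [measurable]: "f \<in> borel_measurable M" "g \<in> borel_measurable M"
    and q_le: "\<And>x y. q x y \<le> ennreal c * (ennreal (Wr x) * ennreal (Wr y))"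
  shows "(\<integral>\<^sup>+x. \<integral>\<^sup>+y. f x * g y * q x y \<partial>M \<partial>M) \<le>
    ennreal c * ((\<integral>\<^sup>+x. f x * ennreal (Wr x) \<partial>M) * (\<integral>\<^sup>+x. g x * ennreal (Wr x) \<partial>M))"
proof -
  have "(\<integral>\<^sup>+x. \<integral>\<^sup>+y. f x * g y * q x y \<partial>M \<partial>M) \<le> (\<integral>\<^sup>+x. \<integral>\<^sup>+y. f x * g y * (ennreal c * (ennreal (Wr x) * ennreal (Wr y))) \<partial>M \<partial>M)"
    by (intro nn_integral_mono mult_left_mono q_le) simp
  also have "\<dots> = (\<integral>\<^sup>+x. \<integral>\<^sup>+y. ennreal c * (f x * ennreal (Wr x)) * (g y * ennreal (Wr y)) \<partial>M \<partial>M)"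
    by (simp add: mult_ac)
  also have "\<dots> = (\<integral>\<^sup>+x. ennreal c * (f x * ennreal (Wr x)) * (\<integral>\<^sup>+y. g y * ennreal (Wr y) \<partial>M) \<partial>M)"
    by (intro nn_integral_cong nn_integral_cmult) measurable
  also have "\<dots> = (\<integral>\<^sup>+x. ennreal c * (f x * ennreal (Wr x)) \<partial>M) * (\<integral>\<^sup>+y. g y * ennreal (Wr y) \<partial>M)"
    by (rule nn_integral_multc) measurable
  also have "(\<integral>\<^sup>+x. ennreal c * (f x * ennreal (Wr x)) \<partial>M) = ennreal c * (\<integral>\<^sup>+x. f x * ennreal (Wr x) \<partial>M)"
    by (rule nn_integral_cmult) measurable
  finally show ?thesis by (simp add: mult.assoc)
qed

end

section \<open>Time change and comparison principles\<close>

text \<open>For an infinite integral \<open>enn2real\<close> would return 0; an upper bound on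
  \<open>\<gamma>\<close> excludes this case, see \<open>clock_eq\<close>.\<close>

definition clock :: "(real \<Rightarrow> real) \<Rightarrow> real \<Rightarrow> real" where
  "clock \<gamma> t = enn2real (\<integral>\<^sup>+s. ennreal (\<gamma> s) * indicator {0..t} s \<partial>lborel)"

lemma clock_finite:
  assumes "\<And>s. \<gamma> s \<le> G" "A \<in> sets borel" "emeasure lborel A < \<top>"
  shows "(\<integral>\<^sup>+s. ennreal (\<gamma> s) * indicator A s \<partial>lborel) \<le> ennreal G * emeasure lborel A"
proof -
  have "(\<integral>\<^sup>+s. ennreal (\<gamma> s) * indicator A s \<partial>lborel) \<le> (\<integral>\<^sup>+s. ennreal G * indicator A s \<partial>lborel)"
    using assms by (intro nn_integral_mono mult_right_mono ennreal_leI) auto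
  then show ?thesis using assms by (simp add: nn_integral_cmult)
qed

lemma clock_eq:
  assumes "\<And>s. \<gamma> s \<le> G"
  shows "ennreal (clock \<gamma> t) = (\<integral>\<^sup>+s. ennreal (\<gamma> s) * indicator {0..t} s \<partial>lborel)"
proof -
  have "(\<integral>\<^sup>+s. ennreal (\<gamma> s) * indicator {0..t} s \<partial>lborel) \<le> ennreal G * emeasure lborel {0..t}"
    by (rule clock_finite) (use assms in \<open>auto simp: emeasure_lborel_Icc_eq\<close>)
  also have "\<dots> < \<top>" by (cases "0 \<le> t") (auto simp: ennreal_mult_less_top)
  finally show ?thesis unfolding clock_def by simp
qed

lemma clock_increment:
  assumes [measurable]: "\<gamma> \<in> borel_measurable borel" and "\<And>s. \<gamma> s \<le> G" "0 \<le> s" "s \<le> t"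
  shows "ennreal (clock \<gamma> t) = ennreal (clock \<gamma> s) + (\<integral>\<^sup>+r. ennreal (\<gamma> r) * indicator {s<..t} r \<partial>lborel)"
proof -
  have "indicator {0..t} r = indicator {0..s} r + (indicator {s<..t} r :: ennreal)" for r
    using assms(3,4) by (auto split: split_indicator)
  then show ?thesis
    unfolding clock_eq[OF assms(2)] by (simp add: distrib_left nn_integral_add)
qed

lemma clock_nonneg: "0 \<le> clock \<gamma> t"
  by (simp add: clock_def)

lemma clock_0 [simp]: "clock \<gamma> 0 = 0"
proof -
  have "(\<integral>\<^sup>+s. ennreal (\<gamma> s) * indicator {0..0} s \<partial>lborel) = (\<integral>\<^sup>+s. 0 \<partial>(lborel :: real measure))"
    by (rule nn_integral_cong_AE) (use AE_lborel_singleton[of 0] in \<open>eventually_elim, auto\<close>)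
  then show ?thesis by (simp add: clock_def)
qed

lemma clock_lipschitz:
  assumes [measurable]: "\<gamma> \<in> borel_measurable borel" and G: "\<And>s. \<gamma> s \<le> G" "0 \<le> G" and st: "0 \<le> s" "s \<le> t"
  shows "clock \<gamma> s \<le> clock \<gamma> t" "clock \<gamma> t \<le> clock \<gamma> s + G * (t - s)"
proof -
  note inc = clock_increment[OF assms(1,2) st]
  have "ennreal (clock \<gamma> s) \<le> ennreal (clock \<gamma> t)"
    unfolding inc by simp
  then show "clock \<gamma> s \<le> clock \<gamma> t"
    using clock_nonneg by (simp add: ennreal_le_iff)
  have "ennreal (clock \<gamma> t) \<le> ennreal (clock \<gamma> s) + ennreal G * emeasure lborel {s<..t}"
    unfolding inc by (intro add_left_mono clock_finite G) (auto simp: emeasure_lborel_Ioc st)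
  also have "\<dots> = ennreal (clock \<gamma> s + G * (t - s))"
    using G st clock_nonneg[of \<gamma> s] by (simp add: ennreal_mult)
  finally show "clock \<gamma> t \<le> clock \<gamma> s + G * (t - s)"
    using G st clock_nonneg[of \<gamma> s] by (subst (asm) ennreal_le_iff) auto
qed

lemma clock_measurable [measurable]:
  assumes [measurable]: "\<gamma> \<in> borel_measurable borel"
  shows "clock \<gamma> \<in> borel_measurable borel"
  unfolding clock_def by measurable

text \<open>The clock may be constant on intervals, so there is no inverse to substitute. Instead,
  the image under the clock of the measure with density \<open>\<gamma>\<close> on
  \<open>{0..t}\<close> is identified with Lebesgue measure on \<open>{0..clock \<gamma> t}\<close>,
  by comparing both on half-lines.\<close>

lemma time_change:
  fixes \<gamma> :: "real \<Rightarrow> real" and H :: "real \<Rightarrow> ennreal"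
  assumes \<gamma>[measurable]: "\<gamma> \<in> borel_measurable borel" and G: "\<And>s. \<gamma> s \<le> G" "0 \<le> G"
    and H[measurable]: "H \<in> borel_measurable borel" and t: "0 \<le> t"
  shows "(\<integral>\<^sup>+s. ennreal (\<gamma> s) * H (clock \<gamma> s) * indicator {0..t} s \<partial>lborel) =
    (\<integral>\<^sup>+\<sigma>. H \<sigma> * indicator {0..clock \<gamma> t} \<sigma> \<partial>lborel)"
proof -
  define A where "A = distr (density lborel (\<lambda>s. ennreal (\<gamma> s) * indicator {0..t} s)) borel (clock \<gamma>)"
  define D where "D = density lborel (indicator {0..clock \<gamma> t} :: real \<Rightarrow> ennreal)"
  have A_em: "emeasure A {x<..} = (\<integral>\<^sup>+s. ennreal (\<gamma> s) * indicator {s\<in>{0..t}. x < clock \<gamma> s} s \<partial>lborel)" for x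
  proof -
    have "emeasure A {x<..} = (\<integral>\<^sup>+\<sigma>. indicator {x<..} \<sigma> \<partial>A)"
      by (rule nn_integral_indicator[symmetric]) (simp add: A_def)
    also have "\<dots> = (\<integral>\<^sup>+s. ennreal (\<gamma> s) * indicator {0..t} s * indicator {x<..} (clock \<gamma> s) \<partial>lborel)"
      unfolding A_def by (subst nn_integral_distr) (simp_all add: nn_integral_density)
    also have "\<dots> = (\<integral>\<^sup>+s. ennreal (\<gamma> s) * indicator {s\<in>{0..t}. x < clock \<gamma> s} s \<partial>lborel)"
      by (intro nn_integral_cong) (auto split: split_indicator)
    finally show ?thesis .
  qed
  have D_em: "emeasure D {x<..} = emeasure lborel ({0..clock \<gamma> t} \<inter> {x<..})" for x
    unfolding D_def by (subst emeasure_density) (auto simp: indicator_inter_arith[symmetric])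
  have mono: "0 \<le> r \<Longrightarrow> r \<le> s \<Longrightarrow> clock \<gamma> r \<le> clock \<gamma> s" for r s
    by (rule clock_lipschitz[OF \<gamma> G])
  have cont: "continuous_on {0..t} (clock \<gamma>)"
  proof (rule continuous_onI)
    fix x e :: real assume x: "x \<in> {0..t}" and e: "0 < e"
    have "dist (clock \<gamma> y) (clock \<gamma> x) \<le> e" if "y \<in> {0..t}" "dist y x < e / (G + 1)" for y
    proof -
      have "\<bar>clock \<gamma> y - clock \<gamma> x\<bar> \<le> G * \<bar>y - x\<bar>"
        using clock_lipschitz[OF \<gamma> G, of x y] clock_lipschitz[OF \<gamma> G, of y x] x that(1) by (cases "x \<le> y") auto
      also have "\<dots> \<le> (G + 1) * \<bar>y - x\<bar>" using G by (intro mult_right_mono) auto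
      also have "\<dots> \<le> e" using that(2) G by (simp add: dist_real_def field_simps)
      finally show ?thesis by (simp add: dist_real_def)
    qed
    then show "\<exists>d>0. \<forall>y\<in>{0..t}. dist y x < d \<longrightarrow> dist (clock \<gamma> y) (clock \<gamma> x) \<le> e"
      using e G by (intro exI[of _ "e / (G + 1)"]) auto
  qed
  have em: "emeasure A {x<..} = emeasure D {x<..}" for x
  proof (cases "x < clock \<gamma> t")
    case False
    then have "{s\<in>{0..t}. x < clock \<gamma> s} = {}"
      using mono[of _ t] by fastforce
    moreover have "{0..clock \<gamma> t} \<inter> {x<..} = {}" using False by auto
    ultimately show ?thesis unfolding A_em D_em by simp
  next
    case True
    show ?thesis
    proof (cases "x < 0")
      case True
      then have "{s\<in>{0..t}. x < clock \<gamma> s} = {0..t}" "{0..clock \<gamma> t} \<inter> {x<..} = {0..clock \<gamma> t}"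
        using clock_nonneg[of \<gamma>] by (auto intro: less_le_trans)
      then show ?thesis
        unfolding A_em D_em using clock_eq[of \<gamma> G t, OF G(1)] clock_nonneg[of \<gamma> t] by simp
    next
      case False
      \<comment> \<open>The largest element of \<open>Z\<close> is the last time at which the clock
        is at most \<open>x\<close>. Beyond it lies exactly the set where the clock exceeds
        \<open>x\<close>, and at it the clock equals \<open>x\<close> by the intermediate value
        theorem.\<close>
      define Z where "Z = {s\<in>{0..t}. clock \<gamma> s \<in> {..x}}"
      have "closed Z"
      proof -
        have "Z = {0..t} \<inter> clock \<gamma> -` {..x}" by (auto simp: Z_def)
        then show ?thesis using continuous_closed_preimage[OF cont, of "{..x}"] by simp
      qed
      moreover have "Z \<subseteq> {0..t}" by (auto simp: Z_def)
      ultimately have "compact Z"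
        by (metis compact_Icc compact_Int_closed inf.absorb_iff2)
      have "0 \<in> Z" using t False by (auto simp: Z_def)
      then obtain s0 where s0: "s0 \<in> Z" "\<And>s. s \<in> Z \<Longrightarrow> s \<le> s0"
        using \<open>compact Z\<close> compact_attains_sup[of Z] by auto
      have eq: "{s\<in>{0..t}. x < clock \<gamma> s} = {s0<..t}"
      proof (rule set_eqI, rule iffI)
        fix s assume "s \<in> {s\<in>{0..t}. x < clock \<gamma> s}"
        then show "s \<in> {s0<..t}"
          using s0(1) mono[of s s0] unfolding Z_def by (cases "s \<le> s0") auto
      next
        fix s assume s: "s \<in> {s0<..t}"
        then have "s \<notin> Z" using s0(2)[of s] by auto
        then show "s \<in> {s\<in>{0..t}. x < clock \<gamma> s}"
          using s s0(1) unfolding Z_def by auto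
      qed
      have "clock \<gamma> s0 = x"
      proof (rule ccontr)
        assume "clock \<gamma> s0 \<noteq> x"
        then have lt: "clock \<gamma> s0 < x" using s0(1) by (auto simp: Z_def)
        have "\<exists>r\<ge>s0. r \<le> t \<and> clock \<gamma> r = x"
          using lt True s0(1) by (intro IVT') (auto simp: Z_def intro!: continuous_on_subset[OF cont])
        then obtain r where r: "s0 \<le> r" "r \<le> t" "clock \<gamma> r = x" by blast
        then have "r \<in> Z" using s0(1) by (auto simp: Z_def)
        then show False using s0(2)[of r] r lt by auto
      qed
      moreover have "{0..clock \<gamma> t} \<inter> {x<..} = {x<..clock \<gamma> t}" using False by auto
      moreover have "ennreal (clock \<gamma> t) = ennreal (clock \<gamma> s0) + (\<integral>\<^sup>+r. ennreal (\<gamma> r) * indicator {s0<..t} r \<partial>lborel)"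
        using s0(1) by (intro clock_increment[OF \<gamma> G(1)]) (auto simp: Z_def)
      ultimately have I: "ennreal (clock \<gamma> t) = ennreal x + emeasure A {x<..}"
        and D: "emeasure D {x<..} = ennreal (clock \<gamma> t - x)"
        unfolding A_em D_em eq using True by simp_all
      show ?thesis
      proof (cases "emeasure A {x<..}")
        case (real r)
        then have "clock \<gamma> t = x + r"
          using I False clock_nonneg[of \<gamma> t] by (simp flip: ennreal_plus)
        then show ?thesis unfolding D real by simp
      next
        case top
        then show ?thesis using I by simp
      qed
    qed
  qed
  have "A = D"
  proof (rule measure_eqI_lessThan)
    show "emeasure A {x<..} < \<infinity>" for x
    proof -
      have "emeasure D {x<..} \<le> emeasure lborel {0..clock \<gamma> t}"
        unfolding D_em by (intro emeasure_mono) auto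
      also have "\<dots> < \<infinity>" by (simp add: emeasure_lborel_Icc_eq)
      finally show ?thesis unfolding em .
    qed
  qed (auto simp: A_def D_def intro: em[unfolded A_def D_def])
  have "(\<integral>\<^sup>+\<sigma>. H \<sigma> \<partial>A) = (\<integral>\<^sup>+s. ennreal (\<gamma> s) * indicator {0..t} s * H (clock \<gamma> s) \<partial>lborel)"
    unfolding A_def by (subst nn_integral_distr) (simp_all add: nn_integral_density)
  moreover have "(\<integral>\<^sup>+\<sigma>. H \<sigma> \<partial>D) = (\<integral>\<^sup>+\<sigma>. indicator {0..clock \<gamma> t} \<sigma> * H \<sigma> \<partial>lborel)"
    unfolding D_def by (rule nn_integral_density) auto
  ultimately show ?thesis
    unfolding \<open>A = D\<close> by (simp add: mult_ac)
qed

section \<open>Comparison principles\<close>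

text \<open>The lower bound on the rate \<open>q\<close> is available only where \<open>y\<close> is
  negative. If \<open>y t < 0\<close>, integration starts at the last time with
  \<open>y \<ge> 0\<close>; from there on the bound applies throughout.\<close>

lemma scalar_comparison:
  fixes q h y :: "real \<Rightarrow> real"
  assumes q: "set_integrable lborel {0..T} q" and h: "set_integrable lborel {0..T} h"
    and y: "\<And>t. 0 \<le> t \<Longrightarrow> t \<le> T \<Longrightarrow> y t = (LINT s:{0..t}|lborel. q s)"
    and h_nonneg: "\<And>s. s \<in> {0..T} \<Longrightarrow> 0 \<le> h s"
    and le: "\<And>s. s \<in> {0..T} \<Longrightarrow> y s < 0 \<Longrightarrow> - h s \<le> q s"
    and t: "0 \<le> t" "t \<le> T"
  shows "- (LINT s:{0..t}|lborel. h s) \<le> y t"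
proof (cases "0 \<le> y t")
  case True
  have "0 \<le> (LINT s:{0..t}|lborel. h s)"
    using h_nonneg t unfolding set_lebesgue_integral_def by (intro Bochner_Integration.integral_nonneg) (auto split: split_indicator)
  then show ?thesis using True by simp
next
  case False
  have y_eq: "y s = integral {0..s} q" if "0 \<le> s" "s \<le> T" for s
    using set_borel_integral_eq_integral(2)[OF set_integrable_subset[OF q, of "{0..s}"]] y[OF that] that by auto
  have "continuous_on {0..T} (\<lambda>s. integral {0..s} q)"
    by (rule indefinite_integral_continuous_1[OF set_borel_integral_eq_integral(1)[OF q]])
  then have cont: "continuous_on {0..t} y"
    using y_eq t by (subst continuous_on_cong[OF refl, of _ _ "\<lambda>s. integral {0..s} q"])
       (auto intro: continuous_on_subset)
  define Z where "Z = {s\<in>{0..t}. y s \<in> {0..}}"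
  have "closed Z"
  proof -
    have "Z = {0..t} \<inter> y -` {0..}" by (auto simp: Z_def)
    then show ?thesis using continuous_closed_preimage[OF cont, of "{0..}"] by simp
  qed
  moreover have "Z \<subseteq> {0..t}" by (auto simp: Z_def)
  ultimately have "compact Z"
    by (metis compact_Icc compact_Int_closed inf.absorb_iff2)
  have "y 0 = 0" using y_eq[of 0] t by simp
  then have "0 \<in> Z" using t by (auto simp: Z_def)
  then obtain s0 where s0: "s0 \<in> Z" "\<And>s. s \<in> Z \<Longrightarrow> s \<le> s0"
    using \<open>compact Z\<close> compact_attains_sup[of Z] by auto
  have s0': "0 \<le> s0" "s0 \<le> t" "0 \<le> y s0" using s0(1) by (auto simp: Z_def)
  have neg: "y s < 0" if "s \<in> {s0<..t}" for s
  proof (rule ccontr)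
    assume "\<not> y s < 0"
    then have "s \<in> Z" using that s0' by (auto simp: Z_def)
    then show False using s0(2)[of s] that by auto
  qed
  have int: "set_integrable lborel A q" "set_integrable lborel A h" if "A \<in> sets borel" "A \<subseteq> {0..T}" for A
    using that by (auto intro: set_integrable_subset[OF q] set_integrable_subset[OF h])
  have split: "(LINT s:{0..t}|lborel. p s) = (LINT s:{0..s0}|lborel. p s) + (LINT s:{s0<..t}|lborel. p s)"
    if "\<And>A. A \<in> sets borel \<Longrightarrow> A \<subseteq> {0..T} \<Longrightarrow> set_integrable lborel A p" for p :: "real \<Rightarrow> real"
  proof -
    have "{0..t} = {0..s0} \<union> {s0<..t}" using s0' by auto
    then show ?thesis
      using s0' t by (simp only:) (intro set_integral_Un that, auto)
  qed
  have "- (LINT s:{0..t}|lborel. h s) \<le> - (LINT s:{s0<..t}|lborel. h s)"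
  proof -
    have "0 \<le> (LINT s:{0..s0}|lborel. h s)"
      using h_nonneg t s0' unfolding set_lebesgue_integral_def by (intro Bochner_Integration.integral_nonneg) (auto split: split_indicator)
    then show ?thesis using split[OF int(2)] by simp
  qed
  also have "\<dots> = (LINT s:{s0<..t}|lborel. - h s)"
    by (simp add: set_lebesgue_integral_def)
  also have "\<dots> \<le> (LINT s:{s0<..t}|lborel. q s)"
  proof (rule set_integral_mono)
    show "set_integrable lborel {s0<..t} q"
      using s0' t by (intro int) auto
    have "set_integrable lborel {s0<..t} h"
      using s0' t by (intro int) auto
    then show "set_integrable lborel {s0<..t} (\<lambda>s. - h s)"
      by (simp add: set_integrable_def)
    show "- h s \<le> q s" if "s \<in> {s0<..t}" for s
      using that neg[OF that] s0' t by (intro le) auto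
  qed
  also have "\<dots> \<le> (LINT s:{0..t}|lborel. q s)"
    using split[OF int(1)] s0' y[of s0] t by simp
  also have "\<dots> = y t" using y[OF t] by simp
  finally show ?thesis .
qed

text \<open>Test functions approximate indicators of compact sets, and inner regularity passes from
  compact sets to the set \<open>A\<close> where the inequality fails. The integral of
  \<open>a - b\<close> over \<open>A\<close> must then vanish.\<close>

lemma AE_le_of_tests:
  fixes a b :: "'a::euclidean_space \<Rightarrow> ennreal"
  assumes [measurable]: "a \<in> borel_measurable borel" "b \<in> borel_measurable borel"
    and a: "(\<integral>\<^sup>+x. a x \<partial>lborel) < \<top>" and b: "(\<integral>\<^sup>+x. b x \<partial>lborel) < \<top>"
    and tests: "\<And>\<psi> :: 'a \<Rightarrow> real. continuous_on UNIV \<psi> \<Longrightarrow> compact (closure {x. \<psi> x \<noteq> 0}) \<Longrightarrow> (\<And>x. 0 \<le> \<psi> x \<and> \<psi> x \<le> 1) \<Longrightarrow>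
      (\<integral>\<^sup>+x. a x * ennreal (\<psi> x) \<partial>lborel) \<le> (\<integral>\<^sup>+x. b x * ennreal (\<psi> x) \<partial>lborel)"
  shows "AE x in lborel. a x \<le> b x"
proof -
  have compact_le: "(\<integral>\<^sup>+x. a x * indicator K x \<partial>lborel) \<le> (\<integral>\<^sup>+x. b x * indicator K x \<partial>lborel)" if K: "compact K" for K
  proof (cases "K = {}")
    case False
    have [measurable]: "K \<in> sets borel" using K by (simp add: borel_compact)
    define \<psi> where "\<psi> n x = max 0 (1 - real (Suc n) * infdist x K)" for n x
    have cont: "continuous_on UNIV (\<psi> n)" for n
      unfolding \<psi>_def by (intro continuous_intros)
    have [measurable]: "\<psi> n \<in> borel_measurable borel" for n
      using cont by (rule borel_measurable_continuous_onI)
    have bounds: "0 \<le> \<psi> n x \<and> \<psi> n x \<le> 1" for n x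
      unfolding \<psi>_def using infdist_nonneg[of x K] by auto
    have supp: "compact (closure {x. \<psi> n x \<noteq> 0})" for n
    proof -
      have "{x. \<psi> n x \<noteq> 0} \<subseteq> {x. infdist x K \<le> 1}"
      proof safe
        fix x assume "\<psi> n x \<noteq> 0"
        then have "real (Suc n) * infdist x K < 1" unfolding \<psi>_def by (auto simp: max_def split: if_splits)
        moreover have "1 * infdist x K \<le> real (Suc n) * infdist x K"
          by (intro mult_right_mono infdist_nonneg) auto
        ultimately show "infdist x K \<le> 1" by linarith
      qed
      moreover have "compact {x. infdist x K \<le> 1}"
        using False K by (intro compact_infdist_le) simp_all
      ultimately show ?thesis
        by (metis bounded_subset compact_closure compact_imp_bounded)
    qed
    have lim: "(\<lambda>n. \<psi> n x) \<longlonglongrightarrow> indicator K x" for x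
    proof (cases "x \<in> K")
      case True
      then show ?thesis unfolding \<psi>_def by simp
    next
      case False
      then have pos: "0 < infdist x K"
        using K \<open>K \<noteq> {}\<close> compact_imp_closed[OF K] by (metis in_closed_iff_infdist_zero infdist_nonneg order_less_le)
      obtain N where N: "1 / infdist x K < real N" using reals_Archimedean2 by blast
      have "\<psi> n x = 0" if "N \<le> n" for n
      proof -
        have "1 / infdist x K < real (Suc n)" using N that by simp
        then have "1 < real (Suc n) * infdist x K" using pos by (simp add: field_simps)
        then show ?thesis unfolding \<psi>_def by simp
      qed
      then have "eventually (\<lambda>n. \<psi> n x = 0) sequentially" by (auto simp: eventually_sequentially)
      then have "(\<lambda>n. \<psi> n x) \<longlonglongrightarrow> 0" by (rule tendsto_eventually)
      then show ?thesis using False by simp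
    qed
    have conv: "(\<lambda>n. \<integral>\<^sup>+x. c x * ennreal (\<psi> n x) \<partial>lborel) \<longlonglongrightarrow> (\<integral>\<^sup>+x. c x * indicator K x \<partial>lborel)"
      if [measurable]: "c \<in> borel_measurable borel" and c: "(\<integral>\<^sup>+x. c x \<partial>lborel) < \<top>" for c :: "'a \<Rightarrow> ennreal"
    proof (rule nn_integral_dominated_convergence[where w=c])
      have "AE x in lborel. c x \<noteq> \<infinity>"
        using c by (intro nn_integral_PInf_AE) auto
      then show "AE x in lborel. (\<lambda>n. c x * ennreal (\<psi> n x)) \<longlonglongrightarrow> c x * indicator K x"
      proof eventually_elim
        case (elim x)
        have "(\<lambda>n. ennreal (\<psi> n x)) \<longlonglongrightarrow> ennreal (indicator K x)"
          using lim[of x] by (rule tendsto_ennrealI)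
        then have "(\<lambda>n. c x * ennreal (\<psi> n x)) \<longlonglongrightarrow> c x * ennreal (indicator K x)"
          using elim by (intro ennreal_tendsto_cmult) (auto simp: less_top)
        then show ?case by (simp add: ennreal_indicator)
      qed
      show "AE x in lborel. c x * ennreal (\<psi> n x) \<le> c x" for n
      proof (rule AE_I2)
        fix x
        have "c x * ennreal (\<psi> n x) \<le> c x * 1"
          using bounds[of n x] by (intro mult_left_mono) (auto simp: ennreal_le_1)
        then show "c x * ennreal (\<psi> n x) \<le> c x" by simp
      qed
    qed (use c in auto)
    show ?thesis
      by (rule LIMSEQ_le[OF conv[OF assms(1) a] conv[OF assms(2) b]])
         (use tests[OF cont supp bounds] in auto)
  qed simp
  define \<mu> where "\<mu> = density lborel a"
  define \<nu> where "\<nu> = density lborel b"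
  have \<mu>\<nu>: "sets \<mu> = sets borel" "sets \<nu> = sets borel" by (simp_all add: \<mu>_def \<nu>_def)
  have em: "emeasure \<mu> A = (\<integral>\<^sup>+x. a x * indicator A x \<partial>lborel)" "emeasure \<nu> A = (\<integral>\<^sup>+x. b x * indicator A x \<partial>lborel)"
    if "A \<in> sets borel" for A
    using that by (auto simp: \<mu>_def \<nu>_def emeasure_density)
  define A where "A = {x. b x < a x}"
  have [measurable]: "A \<in> sets borel" unfolding A_def by measurable
  have "emeasure \<mu> A = (SUP K\<in>{K. K \<subseteq> A \<and> compact K}. emeasure \<mu> K)"
  proof (rule inner_regular)
    show "emeasure \<mu> (space \<mu>) \<noteq> \<infinity>"
      using a unfolding \<mu>_def by (subst emeasure_density) auto
  qed (simp_all add: \<mu>\<nu>)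
  also have "\<dots> \<le> emeasure \<nu> A"
  proof (rule SUP_least)
    fix K assume "K \<in> {K. K \<subseteq> A \<and> compact K}"
    then have K: "K \<subseteq> A" "compact K" by auto
    then have "emeasure \<mu> K \<le> emeasure \<nu> K"
      using compact_le[OF K(2)] em[OF borel_compact[OF K(2)]] by simp
    also have "\<dots> \<le> emeasure \<nu> A" using K by (intro emeasure_mono) (auto simp: \<mu>\<nu>)
    finally show "emeasure \<mu> K \<le> emeasure \<nu> A" .
  qed
  finally have le: "(\<integral>\<^sup>+x. a x * indicator A x \<partial>lborel) \<le> (\<integral>\<^sup>+x. b x * indicator A x \<partial>lborel)"
    using em[of A] by simp
  have fin: "(\<integral>\<^sup>+x. b x * indicator A x \<partial>lborel) \<noteq> \<top>"
  proof -
    have "(\<integral>\<^sup>+x. b x * indicator A x \<partial>lborel) \<le> (\<integral>\<^sup>+x. b x \<partial>lborel)"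
      by (intro nn_integral_mono) (auto split: split_indicator)
    then show ?thesis using b by (metis less_top top_unique)
  qed
  have "(\<integral>\<^sup>+x. (a x - b x) * indicator A x \<partial>lborel) = (\<integral>\<^sup>+x. a x * indicator A x - b x * indicator A x \<partial>lborel)"
    by (intro nn_integral_cong) (auto split: split_indicator)
  also have "\<dots> = (\<integral>\<^sup>+x. a x * indicator A x \<partial>lborel) - (\<integral>\<^sup>+x. b x * indicator A x \<partial>lborel)"
    using fin by (intro nn_integral_diff) (auto split: split_indicator simp: A_def less_imp_le)
  also have "\<dots> = 0" using le fin by (simp add: diff_eq_0_iff_ennreal less_top)
  finally have "AE x in lborel. (a x - b x) * indicator A x = 0"
    by (subst (asm) nn_integral_0_iff_AE) auto
  then show ?thesis
  proof eventually_elim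
    case (elim x)
    then show ?case
      by (cases "x \<in> A") (auto simp: A_def not_less diff_eq_0_iff_ennreal)
  qed
qed

section \<open>The weak collision operator on Lebesgue classes\<close>

text \<open>Lebesgue measure is complete, so altering a Borel function on a null set preserves
  measurability. Together with the next lemma this links the Lebesgue classes of the theorem with
  the Borel representatives of the proof.\<close>

lemma lebesgue_measurable_AE:
  fixes f g :: "'a::euclidean_space \<Rightarrow> 'b::topological_space"
  assumes [measurable]: "g \<in> borel_measurable borel" and eq: "AE x in lborel. f x = g x"
  shows "f \<in> borel_measurable lebesgue"
proof (rule measurableI)
  fix A :: "'b set" assume [measurable]: "A \<in> sets borel"
  have "g -` A \<in> sets lebesgue"
    by (rule sets_completionI_sets) (simp add: measurable_sets_borel[OF assms(1)])
  moreover have "AE x in lebesgue. x \<in> g -` A \<longleftrightarrow> x \<in> f -` A"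
    using eq by (intro AE_completion) auto
  ultimately show "f -` A \<inter> space lebesgue \<in> sets lebesgue"
    by - (rule completion.in_sets_AE[where A="g -` A"], simp_all)
qed simp

lemma lebesgue_integral_AE:
  fixes f g :: "'a::euclidean_space \<Rightarrow> 'b::{banach, second_countable_topology}"
  assumes [measurable]: "g \<in> borel_measurable borel" and eq: "AE x in lborel. f x = g x"
  shows "(LINT x|lebesgue. f x) = (LINT x|lborel. g x)"
    and "integrable lebesgue f \<longleftrightarrow> integrable lborel g"
proof -
  have m: "f \<in> borel_measurable lebesgue" "g \<in> borel_measurable lebesgue"
    using lebesgue_measurable_AE[OF assms] by (auto intro: measurable_completion)
  have eq': "AE x in lebesgue. f x = g x" using eq by (rule AE_completion)
  show "(LINT x|lebesgue. f x) = (LINT x|lborel. g x)"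
    using integral_cong_AE[OF m eq'] by (simp add: integral_completion)
  show "integrable lebesgue f \<longleftrightarrow> integrable lborel g"
    using integrable_cong_AE[OF m eq'] by (simp add: integrable_completion)
qed

text \<open>\<open>collision_weak\<close> integrates over a product of velocity spaces; an
  exceptional set of one velocity must be null in the product as well.\<close>

lemma AE_lborel_fst:
  assumes "AE x in (lborel :: 'a::euclidean_space measure). P x"
  shows "AE p in (lborel :: ('a \<times> 'b::euclidean_space) measure). P (fst p)"
proof -
  obtain N where N: "{x. \<not> P x} \<subseteq> N" "N \<in> null_sets (lborel :: 'a measure)"
    using assms unfolding eventually_ae_filter by auto
  have "N \<times> (UNIV :: 'b set) \<in> null_sets (lborel :: ('a \<times> 'b) measure)"
    using lborel.times_in_null_sets1[OF N(2), of UNIV] by (simp add: lborel_prod)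
  then show ?thesis
    by (rule AE_I') (use N in auto)
qed

lemma AE_lborel_snd:
  assumes "AE x in (lborel :: 'b::euclidean_space measure). P x"
  shows "AE p in (lborel :: ('a::euclidean_space \<times> 'b) measure). P (snd p)"
proof -
  obtain N where N: "{x. \<not> P x} \<subseteq> N" "N \<in> null_sets (lborel :: 'b measure)"
    using assms unfolding eventually_ae_filter by auto
  have "(UNIV :: 'a set) \<times> N \<in> null_sets (lborel :: ('a \<times> 'b) measure)"
    using lborel.times_in_null_sets2[OF _ N(2), of UNIV lborel] by (simp add: lborel_prod)
  then show ?thesis
    by (rule AE_I') (use N in auto)
qed

lemma nn_integral_lborel_prod:
  fixes h :: "'a::euclidean_space \<Rightarrow> 'b::euclidean_space \<Rightarrow> ennreal"
  assumes [measurable]: "(\<lambda>p. h (fst p) (snd p)) \<in> borel_measurable borel"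
  shows "(\<integral>\<^sup>+p. h (fst p) (snd p) \<partial>lborel) = (\<integral>\<^sup>+x. \<integral>\<^sup>+y. h x y \<partial>lborel \<partial>lborel)"
proof -
  have "(\<lambda>p. h (fst p) (snd p)) \<in> borel_measurable (lborel \<Otimes>\<^sub>M lborel)"
    using assms by (simp add: lborel_prod)
  from lborel.nn_integral_fst[OF this] show ?thesis by (simp add: lborel_prod)
qed

lemma AE_phase_iff:
  fixes P :: "'s::finite \<times> (real^'d) \<Rightarrow> bool"
  assumes [measurable]: "Measurable.pred (phase_measure :: ('s \<times> (real^'d)) measure) P"
  shows "(AE x in (phase_measure :: ('s \<times> (real^'d)) measure). P x) \<longleftrightarrow> (\<forall>i. AE v in lborel. P (i, v))"
proof -
  interpret A: sigma_finite_measure "count_space UNIV :: 's measure"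
    by (rule sigma_finite_measure_count_space_finite) simp
  interpret pair_sigma_finite "count_space UNIV :: 's measure" "lborel :: (real^'d) measure" ..
  have "(AE x in (phase_measure :: ('s \<times> (real^'d)) measure). P x) \<longleftrightarrow>
     (AE i in (count_space UNIV :: 's measure). AE v in (lborel :: (real^'d) measure). P (i, v))"
    by (subst AE_pair_iff[where P="\<lambda>i v. P (i, v)"]) simp_all
  then show ?thesis by (simp add: AE_count_space)
qed

section \<open>Gain and loss form of the weak operator\<close>

context inelastic_kernel
begin

text \<open>Testing the phase-space equation with this function singles out the equation of species
  \<open>i\<close>.\<close>

definition species_test :: "'s \<Rightarrow> (real^'d \<Rightarrow> real) \<Rightarrow> 's \<times> (real^'d) \<Rightarrow> ennreal" where
  "species_test i \<psi> x = (if fst x = i then ennreal (\<psi> (snd x)) else 0)"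

text \<open>\<open>ennreal\<close> sends negative values to 0, so this represents \<open>f\<close>
  faithfully where its components are nonnegative.\<close>

definition phase :: "(real^'d \<Rightarrow> real^'s) \<Rightarrow> 's \<times> (real^'d) \<Rightarrow> ennreal" where
  "phase f x = ennreal (f (snd x) $ fst x)"

lemma borel_phase_measurable:
  assumes [measurable]: "\<And>i. (\<lambda>v. h (i, v)) \<in> borel_measurable borel"
  shows "h \<in> borel_measurable (M :: ('s \<times> (real^'d)) measure)"
proof -
  have "h = (\<lambda>x. (\<lambda>v. h (fst x, v)) (snd x))" by simp
  moreover have "(\<lambda>x. (\<lambda>v. h (fst x, v)) (snd x)) \<in> borel_measurable (M :: ('s \<times> (real^'d)) measure)"
    by (rule measurable_compose_countable'[where I=UNIV and g=fst]) (auto intro: countable_finite)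
  ultimately show ?thesis by simp
qed

lemma species_test_measurable [measurable (raw)]:
  assumes [measurable]: "\<psi> \<in> borel_measurable borel"
  shows "species_test i \<psi> \<in> borel_measurable M"
  unfolding species_test_def by (rule borel_phase_measurable) simp

lemma phase_measurable:
  assumes [measurable]: "\<And>i. (\<lambda>v. f v $ i) \<in> borel_measurable borel"
  shows "phase f \<in> borel_measurable M"
  unfolding phase_def by (rule borel_phase_measurable) simp

lemma nn_integral_species_test:
  assumes [measurable]: "h \<in> borel_measurable M" "\<psi> \<in> borel_measurable borel"
  shows "(\<integral>\<^sup>+x. h x * species_test i \<psi> x \<partial>M) = (\<integral>\<^sup>+v. h (i, v) * ennreal (\<psi> v) \<partial>lborel)"
proof -
  have "(\<integral>\<^sup>+x. h x * species_test i \<psi> x \<partial>M) = (\<Sum>j\<in>UNIV. \<integral>\<^sup>+v. h (j, v) * species_test i \<psi> (j, v) \<partial>lborel)"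
    by (rule nn_integral_phase_measure) measurable
  also have "\<dots> = (\<Sum>j\<in>UNIV. if j = i then (\<integral>\<^sup>+v. h (i, v) * ennreal (\<psi> v) \<partial>lborel) else 0)"
    by (intro sum.cong refl) (simp add: species_test_def)
  finally show ?thesis by simp
qed

lemma double_integral_cong_AE:
  assumes "AE x in M. f x = g x"
  shows "(\<integral>\<^sup>+x. \<integral>\<^sup>+y. f x * f y * h x y \<partial>M \<partial>M) = (\<integral>\<^sup>+x. \<integral>\<^sup>+y. g x * g y * h x y \<partial>M \<partial>M)"
proof -
  have "(\<integral>\<^sup>+y. f x * f y * h x y \<partial>M) = (\<integral>\<^sup>+y. f x * g y * h x y \<partial>M)" for x
    by (rule nn_integral_cong_AE) (use assms in eventually_elim, simp)
  then show ?thesis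
    by (simp only:) (rule nn_integral_cong_AE, use assms in eventually_elim, simp)
qed

text \<open>The rate is a multiple of a measure on the ball, but the notion of solution sees it only
  through integrals. This formula expresses them by \<open>\<beta>\<close>, a kernel on the whole
  space.\<close>

lemma integral_scaled_kernel:
  fixes h :: "real^'d \<Rightarrow> real"
  assumes bk: "b \<in> borel \<rightarrow>\<^sub>M prob_algebra (restrict_space borel (cball 0 1))"
    and \<beta>: "\<beta> u = distr (b u) borel (\<lambda>z. z)"
    and Bu: "Bu = scale_measure (ennreal r) (b u)" and r: "0 \<le> r"
    and h[measurable]: "h \<in> borel_measurable borel"
  shows "(LINT z|Bu. h z) = r * (LINT z|\<beta> u. h z)"
proof -
  have sets: "sets (b u) = sets (restrict_space borel (cball 0 1))"
    using measurable_space[OF bk, of u] by (simp add: space_prob_algebra)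
  have [measurable]: "h \<in> borel_measurable (b u)" "(\<lambda>z. z) \<in> b u \<rightarrow>\<^sub>M borel"
    unfolding measurable_cong_sets[OF sets refl] by (auto intro: measurable_restrict_space1)
  have "Bu = density (b u) (\<lambda>_. ennreal r)"
    unfolding Bu by (rule measure_eqI) (auto simp: emeasure_density nn_integral_cmult)
  then have "(LINT z|Bu. h z) = (LINT z|b u. r *\<^sub>R h z)"
    using r by (simp only:) (rule integral_density, auto)
  also have "\<dots> = r * (LINT z|\<beta> u. h z)"
    unfolding \<beta> by (subst integral_distr) simp_all
  finally show ?thesis .
qed

text \<open>The weak operator is a Bochner integral of a difference, whereas the model works with
  two nonnegative integrals. Boundedness of \<open>\<psi>\<close> and the finite speed moment
  \<open>fin\<close> make both parts integrable, so the difference may be split. The function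
  \<open>a\<close> is a nonnegative Borel representative of \<open>a'\<close>.\<close>

lemma collision_weak_eq:
  fixes i :: 's and \<psi> :: "real^'d \<Rightarrow> real" and a a' :: "real^'d \<Rightarrow> real^'s"
  assumes Bs: "\<And>u h. h \<in> borel_measurable borel \<Longrightarrow> (LINT z|Bs u. h z) = norm u * g * (LINT z|\<beta> u. (h z :: real))"
    and g: "0 \<le> g"
    and \<psi>[measurable]: "\<psi> \<in> borel_measurable borel" and \<psi>_bound: "\<And>v. 0 \<le> \<psi> v" "\<And>v. \<psi> v \<le> c"
    and [measurable]: "\<And>i. (\<lambda>v. a v $ i) \<in> borel_measurable borel" and a: "\<And>v i. 0 \<le> a v $ i"
    and aa': "\<And>i. AE v in lborel. a' v $ i = a v $ i"
    and fin: "(\<integral>\<^sup>+x. \<integral>\<^sup>+y. phase a x * phase a y * ennreal (speed x y) \<partial>M \<partial>M) < \<top>"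
  defines "P \<equiv> (\<integral>\<^sup>+x. \<integral>\<^sup>+y. phase a x * phase a y * gain_adj (species_test i \<psi>) x y \<partial>M \<partial>M)"
    and "N \<equiv> (\<integral>\<^sup>+x. \<integral>\<^sup>+y. phase a x * phase a y * (ennreal (speed x y) * species_test i \<psi> x) \<partial>M \<partial>M)"
  shows "(\<Sum>j\<in>UNIV. collision_weak m Bs i j (\<lambda>v. a' v $ i) (\<lambda>v. a' v $ j) \<psi>) = g * (enn2real P - enn2real N)"
    and "P \<le> ennreal c * (\<integral>\<^sup>+x. \<integral>\<^sup>+y. phase a x * phase a y * ennreal (speed x y) \<partial>M \<partial>M)"
    and "N \<le> ennreal c * (\<integral>\<^sup>+x. \<integral>\<^sup>+y. phase a x * phase a y * ennreal (speed x y) \<partial>M \<partial>M)"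
proof -
  interpret sigma_finite_measure M by (rule sigma_finite_phase_measure)
  note [measurable] = phase_measurable[of a]
  define S where "S = (\<integral>\<^sup>+x. \<integral>\<^sup>+y. phase a x * phase a y * ennreal (speed x y) \<partial>M \<partial>M)"
  have c: "0 \<le> c" using \<psi>_bound[of 0] by linarith
  have st_le: "species_test i \<psi> x \<le> ennreal c" for x
    unfolding species_test_def using \<psi>_bound by (auto intro: ennreal_leI)
  have ga_le: "gain_adj (species_test i \<psi>) x y \<le> ennreal c * ennreal (speed x y)" for x y
  proof -
    interpret p: prob_space "\<beta> (snd x - snd y)" by (rule prob_\<beta>)
    have "(\<integral>\<^sup>+z. species_test i \<psi> (post x y z) \<partial>\<beta> (snd x - snd y)) \<le> (\<integral>\<^sup>+z. ennreal c \<partial>\<beta> (snd x - snd y))"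
      by (intro nn_integral_mono st_le)
    also have "\<dots> = ennreal c" by (simp add: p.emeasure_space_1[simplified])
    finally show ?thesis unfolding gain_adj_def by (subst mult.commute) (rule mult_right_mono, auto)
  qed
  have cS: "(\<integral>\<^sup>+x. \<integral>\<^sup>+y. phase a x * phase a y * (ennreal c * ennreal (speed x y)) \<partial>M \<partial>M) = ennreal c * S"
  proof -
    have "(\<integral>\<^sup>+x. \<integral>\<^sup>+y. phase a x * phase a y * (ennreal c * ennreal (speed x y)) \<partial>M \<partial>M) =
      (\<integral>\<^sup>+x. \<integral>\<^sup>+y. ennreal c * (phase a x * phase a y * ennreal (speed x y)) \<partial>M \<partial>M)"
      by (simp add: mult_ac)
    then show ?thesis unfolding S_def by (simp add: nn_integral_cmult)
  qed
  show P_le: "P \<le> ennreal c * (\<integral>\<^sup>+x. \<integral>\<^sup>+y. phase a x * phase a y * ennreal (speed x y) \<partial>M \<partial>M)"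
    unfolding P_def S_def[symmetric] cS[symmetric] by (intro nn_integral_mono mult_left_mono ga_le) simp
  show N_le: "N \<le> ennreal c * (\<integral>\<^sup>+x. \<integral>\<^sup>+y. phase a x * phase a y * ennreal (speed x y) \<partial>M \<partial>M)"
  proof -
    have "N \<le> (\<integral>\<^sup>+x. \<integral>\<^sup>+y. phase a x * phase a y * (ennreal (speed x y) * ennreal c) \<partial>M \<partial>M)"
      unfolding N_def by (intro nn_integral_mono mult_left_mono st_le) simp_all
    also have "\<dots> = ennreal c * S"
      unfolding cS[symmetric] by (intro nn_integral_cong) (simp add: mult_ac)
    finally show ?thesis unfolding S_def .
  qed
  define Pj where "Pj j = (\<integral>\<^sup>+v. \<integral>\<^sup>+w. phase a (i, v) * phase a (j, w) * gain_adj (species_test i \<psi>) (i, v) (j, w) \<partial>lborel \<partial>lborel)" for j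
  define Nj where "Nj j = (\<integral>\<^sup>+v. \<integral>\<^sup>+w. phase a (i, v) * phase a (j, w) * (ennreal (speed (i, v) (j, w)) * ennreal (\<psi> v)) \<partial>lborel \<partial>lborel)" for j
  have pm [measurable]: "(\<lambda>v. (l, v)) \<in> borel \<rightarrow>\<^sub>M M" for l by (rule phase_Pair) simp_all
  have pm' [measurable]: "(\<lambda>v. (l, f v)) \<in> N \<rightarrow>\<^sub>M M" if [measurable]: "f \<in> borel_measurable N" for l f and N :: "'n measure"
    by (rule phase_Pair) simp_all
  \<comment> \<open>The test function selects species \<open>i\<close> in the first variable; the
    sum over the second variable remains and becomes the sum over collision partners.\<close>
  have dbl: "(\<integral>\<^sup>+x. \<integral>\<^sup>+y. phase a x * phase a y * H x y \<partial>M \<partial>M) =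
    (\<Sum>j\<in>UNIV. \<integral>\<^sup>+v. \<integral>\<^sup>+w. phase a (i, v) * phase a (j, w) * H (i, v) (j, w) \<partial>lborel \<partial>lborel)"
    if H[measurable]: "(\<lambda>p. H (fst p) (snd p)) \<in> borel_measurable (M \<Otimes>\<^sub>M M)" and zero: "\<And>x y. fst x \<noteq> i \<Longrightarrow> H x y = 0" for H
  proof -
    note [measurable (raw)] = measurable_compose_pair[OF H]
    have "(\<integral>\<^sup>+x. \<integral>\<^sup>+y. phase a x * phase a y * H x y \<partial>M \<partial>M) =
       (\<Sum>l\<in>UNIV. \<integral>\<^sup>+v. \<integral>\<^sup>+y. phase a (l, v) * phase a y * H (l, v) y \<partial>M \<partial>lborel)"
      by (rule nn_integral_phase_measure) measurable
    also have "\<dots> = (\<Sum>l\<in>UNIV. if l = i then (\<integral>\<^sup>+v. \<integral>\<^sup>+y. phase a (i, v) * phase a y * H (i, v) y \<partial>M \<partial>lborel) else 0)"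
      by (intro sum.cong refl) (simp add: zero)
    also have "\<dots> = (\<integral>\<^sup>+v. (\<Sum>j\<in>UNIV. \<integral>\<^sup>+w. phase a (i, v) * phase a (j, w) * H (i, v) (j, w) \<partial>lborel) \<partial>lborel)"
      by (simp, intro nn_integral_cong nn_integral_phase_measure) measurable
    also have "\<dots> = (\<Sum>j\<in>UNIV. \<integral>\<^sup>+v. \<integral>\<^sup>+w. phase a (i, v) * phase a (j, w) * H (i, v) (j, w) \<partial>lborel \<partial>lborel)"
      by (rule nn_integral_sum) measurable
    finally show ?thesis .
  qed
  have P_sum: "P = (\<Sum>j\<in>UNIV. Pj j)"
  proof -
    have gm: "(\<lambda>p. gain_adj (species_test i \<psi>) (fst p) (snd p)) \<in> borel_measurable (M \<Otimes>\<^sub>M M)" by measurable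
    have "gain_adj (species_test i \<psi>) x y = 0" if "fst x \<noteq> i" for x y
      using that by (simp add: gain_adj_def species_test_def post_def)
    then show ?thesis unfolding P_def Pj_def by (rule dbl[OF gm])
  qed
  have N_sum: "N = (\<Sum>j\<in>UNIV. Nj j)"
    unfolding N_def Nj_def
    by (subst dbl) (simp_all add: species_test_def)
  have cS_fin: "ennreal c * S < \<top>" using fin unfolding S_def by (simp add: ennreal_mult_less_top)
  have Pj_fin: "Pj j < \<top>" and Nj_fin: "Nj j < \<top>" for j
  proof -
    have "Pj j \<le> P" unfolding P_sum by (rule member_le_sum) auto
    then show "Pj j < \<top>" using P_le cS_fin unfolding S_def by (meson le_less_trans order_trans)
    have "Nj j \<le> N" unfolding N_sum by (rule member_le_sum) auto
    then show "Nj j < \<top>" using N_le cS_fin unfolding S_def by (meson le_less_trans order_trans)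
  qed
  have cw: "collision_weak m Bs i j (\<lambda>v. a' v $ i) (\<lambda>v. a' v $ j) \<psi> = g * (enn2real (Pj j) - enn2real (Nj j))" for j
  proof -
    let ?pv = "\<lambda>v w z. post_vel (m $ i) (m $ j) v w z"
    define E where "E v w = (LINT z|\<beta> (v - w). \<psi> (?pv v w z))" for v w
    define p where "p v w = a v $ i * a w $ j * (norm (v - w) * E v w)" for v w
    define n where "n v w = a v $ i * a w $ j * (norm (v - w) * \<psi> v)" for v w
    have pv_m [measurable]: "(\<lambda>z. ?pv v w z) \<in> borel_measurable borel" for v w
      unfolding post_vel_frac by measurable
    have E_bound: "integrable (\<beta> (v - w)) (\<lambda>z. \<psi> (?pv v w z))" for v w
    proof -
      interpret q: prob_space "\<beta> (v - w)" by (rule prob_\<beta>)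
      show ?thesis
        using \<psi>_bound by (intro q.integrable_const_bound[where B=c])
          (auto simp: measurable_cong_sets[OF sets_\<beta> refl])
    qed
    have E_nn: "0 \<le> E v w" for v w unfolding E_def using \<psi>_bound by simp
    have E_ennreal: "ennreal (E v w) = (\<integral>\<^sup>+z. ennreal (\<psi> (?pv v w z)) \<partial>\<beta> (v - w))" for v w
      unfolding E_def using \<psi>_bound by (intro nn_integral_eq_integral[symmetric] E_bound) auto
    \<comment> \<open>Measurability of the average in both velocities is obtained from its
      nonnegative version, where measurability of the kernel applies.\<close>
    have E_m: "(\<lambda>q. E (fst q) (snd q)) \<in> borel_measurable (borel \<Otimes>\<^sub>M borel)"
    proof -
      have "(\<lambda>q. \<integral>\<^sup>+z. ennreal (\<psi> (?pv (fst q) (snd q) z)) \<partial>\<beta> (fst q - snd q)) \<in> borel_measurable (borel \<Otimes>\<^sub>M borel)"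
        unfolding post_vel_frac by (rule nn_integral_\<beta>_measurable) measurable
      then have "(\<lambda>q. enn2real (ennreal (E (fst q) (snd q)))) \<in> borel_measurable (borel \<Otimes>\<^sub>M borel)"
        unfolding E_ennreal by (rule borel_measurable_enn2real)
      then show ?thesis using E_nn by simp
    qed
    have inner: "(LINT z|Bs (v - w). \<psi> (?pv v w z) - \<psi> v) = norm (v - w) * g * (E v w - \<psi> v)" for v w
    proof -
      interpret q: prob_space "\<beta> (v - w)" by (rule prob_\<beta>)
      have "(LINT z|Bs (v - w). \<psi> (?pv v w z) - \<psi> v) = norm (v - w) * g * (LINT z|\<beta> (v - w). \<psi> (?pv v w z) - \<psi> v)"
        by (rule Bs) measurable
      also have "(LINT z|\<beta> (v - w). \<psi> (?pv v w z) - \<psi> v) = E v w - \<psi> v"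
        unfolding E_def using E_bound by (simp add: q.prob_space[simplified])
      finally show ?thesis .
    qed
    have "(\<lambda>q. p (fst q) (snd q)) \<in> borel_measurable (borel \<Otimes>\<^sub>M borel)"
      "(\<lambda>q. n (fst q) (snd q)) \<in> borel_measurable (borel \<Otimes>\<^sub>M borel)"
      unfolding p_def n_def using E_m by measurable
    then have m_pn: "(\<lambda>q. p (fst q) (snd q)) \<in> borel_measurable borel" "(\<lambda>q. n (fst q) (snd q)) \<in> borel_measurable borel"
      by (simp_all only: borel_prod)
    have nn: "0 \<le> p v w" "0 \<le> n v w" for v w
      unfolding p_def n_def using a E_nn \<psi>_bound by (auto intro!: mult_nonneg_nonneg)
    have Pj_eq: "(\<integral>\<^sup>+q. ennreal (p (fst q) (snd q)) \<partial>lborel) = Pj j"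
    proof -
      have "(\<integral>\<^sup>+q. ennreal (p (fst q) (snd q)) \<partial>lborel) = (\<integral>\<^sup>+v. \<integral>\<^sup>+w. ennreal (p v w) \<partial>lborel \<partial>lborel)"
        by (rule nn_integral_lborel_prod) (use m_pn in simp)
      also have "\<dots> = Pj j"
        unfolding Pj_def p_def phase_def gain_adj_def speed_def species_test_def post_def using a E_nn
        by (simp add: ennreal_mult E_ennreal mult.assoc)
      finally show ?thesis .
    qed
    have Nj_eq: "(\<integral>\<^sup>+q. ennreal (n (fst q) (snd q)) \<partial>lborel) = Nj j"
    proof -
      have "(\<integral>\<^sup>+q. ennreal (n (fst q) (snd q)) \<partial>lborel) = (\<integral>\<^sup>+v. \<integral>\<^sup>+w. ennreal (n v w) \<partial>lborel \<partial>lborel)"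
        by (rule nn_integral_lborel_prod) (use m_pn in simp)
      also have "\<dots> = Nj j"
        unfolding Nj_def n_def phase_def speed_def using a \<psi>_bound
        by (simp add: ennreal_mult mult.assoc)
      finally show ?thesis .
    qed
    have int: "integrable lborel (\<lambda>q. p (fst q) (snd q))" "integrable lborel (\<lambda>q. n (fst q) (snd q))"
      using m_pn nn Pj_fin[of j] Nj_fin[of j] by (auto intro!: integrableI_nonneg simp: Pj_eq Nj_eq)
    have "collision_weak m Bs i j (\<lambda>v. a' v $ i) (\<lambda>v. a' v $ j) \<psi> =
      (LINT q|lborel. g * (p (fst q) (snd q) - n (fst q) (snd q)))"
      unfolding collision_weak_def
    proof (rule lebesgue_integral_AE(1))
      show "(\<lambda>q. g * (p (fst q) (snd q) - n (fst q) (snd q))) \<in> borel_measurable borel"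
        using m_pn by measurable
      show "AE q in lborel. (case q of (v, vs) \<Rightarrow> a' v $ i * a' vs $ j * (LINT z|Bs (v - vs). \<psi> (?pv v vs z) - \<psi> v)) =
         g * (p (fst q) (snd q) - n (fst q) (snd q))"
        using AE_lborel_fst[OF aa'[of i]] AE_lborel_snd[OF aa'[of j]]
        by eventually_elim (simp add: case_prod_beta' inner p_def n_def algebra_simps)
    qed
    also have "\<dots> = g * ((LINT q|lborel. p (fst q) (snd q)) - (LINT q|lborel. n (fst q) (snd q)))"
      using int by simp
    also have "(LINT q|lborel. p (fst q) (snd q)) = enn2real (Pj j)"
      unfolding Pj_eq[symmetric] using m_pn nn by (intro integral_eq_nn_integral) auto
    also have "(LINT q|lborel. n (fst q) (snd q)) = enn2real (Nj j)"
      unfolding Nj_eq[symmetric] using m_pn nn by (intro integral_eq_nn_integral) auto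
    finally show ?thesis .
  qed
  have "enn2real P = (\<Sum>j\<in>UNIV. enn2real (Pj j))"
    unfolding P_sum using Pj_fin by (subst enn2real_sum) auto
  moreover have "enn2real N = (\<Sum>j\<in>UNIV. enn2real (Nj j))"
    unfolding N_sum using Nj_fin by (subst enn2real_sum) auto
  ultimately show "(\<Sum>j\<in>UNIV. collision_weak m Bs i j (\<lambda>v. a' v $ i) (\<lambda>v. a' v $ j) \<psi>) = g * (enn2real P - enn2real N)"
    unfolding cw by (simp add: sum_distrib_left sum_subtractf flip: sum_distrib_left)
qed

end

section \<open>Existence\<close>

lemma borel_measurable_vec_components:
  fixes f :: "'a \<Rightarrow> real^'n"
  assumes "\<And>i. (\<lambda>x. f x $ i) \<in> borel_measurable N"
  shows "f \<in> borel_measurable N"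
  using assms by (subst borel_measurable_euclidean_space) (auto simp: Basis_vec_def inner_axis)

context inelastic_kernel
begin

lemma L1q_weight_2: "L1q_weight m 2 i v = Wr (i, v)"
  using mass_pos[of i] unfolding L1q_weight_def Wr_def rt_def by (simp add: power_mult_distrib)

lemma L1q_weight_3: "L1q_weight m 3 i v = Vr (i, v)"
proof -
  have "(m $ i) powr (3 / 2) = sqrt (m $ i) ^ 3"
    using mass_pos[of i] by (simp add: powr_half_sqrt[symmetric] powr_powr flip: powr_numeral)
  then show ?thesis unfolding L1q_weight_def Vr_def rt_def by (simp add: power_mult_distrib)
qed

lemma pair_measurable [measurable]: "(\<lambda>v. (i, v)) \<in> borel \<rightarrow>\<^sub>M M"
  by (rule phase_Pair) simp_all

text \<open>Translates membership and norm in \<open>L1q\<close> into one integral over phase space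
  of a Borel representative; it is applied with the weights \<open>Wr\<close> and
  \<open>Vr\<close>.\<close>

lemma L1q_phase:
  assumes w[measurable]: "w \<in> borel_measurable M" and w_nn: "\<And>x. 0 \<le> w x"
    and weight: "\<And>i v. L1q_weight m q i v = w (i, v)"
    and h[measurable]: "\<And>i. (\<lambda>v. h v $ i) \<in> borel_measurable borel" and eq: "AE v in lborel. f v = h v"
    and fin: "(\<integral>\<^sup>+x. ennreal \<bar>h (snd x) $ fst x\<bar> * ennreal (w x) \<partial>M) < \<top>"
  shows "f \<in> L1q m q" and "L1q_norm m q f = enn2real (\<integral>\<^sup>+x. ennreal \<bar>h (snd x) $ fst x\<bar> * ennreal (w x) \<partial>M)"
proof -
  have [measurable]: "(\<lambda>v. w (i, v)) \<in> borel_measurable borel" for i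
    by (rule measurable_compose[OF pair_measurable w])
  define N where "N i = (\<integral>\<^sup>+v. ennreal (\<bar>h v $ i\<bar> * w (i, v)) \<partial>lborel)" for i
  have hm: "(\<lambda>x. ennreal \<bar>h (snd x) $ fst x\<bar> * ennreal (w x)) \<in> borel_measurable M"
    by (rule borel_phase_measurable) simp
  have sum: "(\<integral>\<^sup>+x. ennreal \<bar>h (snd x) $ fst x\<bar> * ennreal (w x) \<partial>M) = (\<Sum>i\<in>UNIV. N i)"
    unfolding N_def nn_integral_phase_measure[OF hm] using w_nn by (simp add: ennreal_mult)
  have N_fin: "N i < \<top>" for i
  proof -
    have "N i \<le> (\<Sum>i\<in>UNIV. N i)" by (rule member_le_sum) auto
    then show ?thesis using fin unfolding sum by (rule le_less_trans)
  qed
  have eqi: "AE v in lborel. \<bar>f v $ i\<bar> * L1q_weight m q i v = \<bar>h v $ i\<bar> * w (i, v)" for i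
    using eq by eventually_elim (simp add: weight)
  have mi: "(\<lambda>v. \<bar>h v $ i\<bar> * w (i, v)) \<in> borel_measurable borel" for i by measurable
  have int: "integrable lborel (\<lambda>v. \<bar>h v $ i\<bar> * w (i, v))" for i
    using N_fin[of i] w_nn by (intro integrableI_nonneg) (auto simp: N_def)
  have "f \<in> borel_measurable lebesgue"
    by (rule lebesgue_measurable_AE[OF _ eq]) (rule borel_measurable_vec_components, simp)
  then show "f \<in> L1q m q"
    unfolding L1q_def using int lebesgue_integral_AE(2)[OF mi eqi] by auto
  have "(LINT v|lebesgue. \<bar>f v $ i\<bar> * L1q_weight m q i v) = enn2real (N i)" for i
    unfolding lebesgue_integral_AE(1)[OF mi eqi] N_def using w_nn by (intro integral_eq_nn_integral) auto
  then show "L1q_norm m q f = enn2real (\<integral>\<^sup>+x. ennreal \<bar>h (snd x) $ fst x\<bar> * ennreal (w x) \<partial>M)"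
    unfolding L1q_norm_def sum using N_fin by (subst enn2real_sum) auto
qed

lemma species_integral:
  fixes h :: "'s \<times> (real^'d) \<Rightarrow> ennreal" and \<theta> :: "real^'d \<Rightarrow> real"
  assumes h[measurable]: "h \<in> borel_measurable M" and h_fin: "AE x in M. h x < \<top>"
    and \<theta>[measurable]: "\<theta> \<in> borel_measurable borel" and \<theta>_nn: "\<And>v. 0 \<le> \<theta> v"
    and fin: "(\<integral>\<^sup>+v. h (i, v) * ennreal (\<theta> v) \<partial>lborel) < \<top>"
  shows "integrable lebesgue (\<lambda>v. enn2real (h (i, v)) * \<theta> v)"
    and "(LINT v|lebesgue. enn2real (h (i, v)) * \<theta> v) = enn2real (\<integral>\<^sup>+v. h (i, v) * ennreal (\<theta> v) \<partial>lborel)"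
proof -
  have [measurable]: "(\<lambda>v. h (i, v)) \<in> borel_measurable borel"
    by (rule measurable_compose[OF pair_measurable h])
  have m: "(\<lambda>v. enn2real (h (i, v)) * \<theta> v) \<in> borel_measurable borel" by measurable
  have "\<forall>i. AE v in lborel. h (i, v) < \<top>"
    using h_fin by (subst (asm) AE_phase_iff) simp_all
  then have "AE v in lborel. h (i, v) < \<top>" ..
  then have eq: "(\<integral>\<^sup>+v. ennreal (enn2real (h (i, v)) * \<theta> v) \<partial>lborel) = (\<integral>\<^sup>+v. h (i, v) * ennreal (\<theta> v) \<partial>lborel)"
    by (intro nn_integral_cong_AE, eventually_elim) (simp add: ennreal_mult \<theta>_nn)
  show "integrable lebesgue (\<lambda>v. enn2real (h (i, v)) * \<theta> v)"
    using m \<theta>_nn fin eq by (subst integrable_completion) (auto intro!: integrableI_nonneg)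
  show "(LINT v|lebesgue. enn2real (h (i, v)) * \<theta> v) = enn2real (\<integral>\<^sup>+v. h (i, v) * ennreal (\<theta> v) \<partial>lborel)"
    using m \<theta>_nn by (subst integral_completion) (auto simp: integral_eq_nn_integral eq)
qed

end

section \<open>The solution in the original time and its regularity\<close>

text \<open>The initial datum and \<open>\<gamma>\<close> are Borel and \<open>\<gamma>\<close> is
  bounded on the whole line, so the change of time applies globally. The rate \<open>B\<close> is
  visible only through the integrals it defines, at almost every time. \<open>K\<close> and
  \<open>V0\<close> are the initial moments as finite reals.\<close>

locale boltzmann_problem = inelastic_kernel m \<beta> for m :: "real^'s" and \<beta> :: "real^'d \<Rightarrow> (real^'d) measure" +
  fixes f0 :: "real^'d \<Rightarrow> real^'s" and \<gamma> :: "real \<Rightarrow> real" and B :: "real \<Rightarrow> real^'d \<Rightarrow> (real^'d) measure"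
    and G T K V0 :: real
  assumes f0_borel [measurable]: "\<And>i. (\<lambda>v. f0 v $ i) \<in> borel_measurable borel"
    and f0_nonneg: "0 \<le> f0 v $ i"
    and phase_f0_W: "(\<integral>\<^sup>+x. phase f0 x * ennreal (Wr x) \<partial>M) = ennreal K"
    and phase_f0_V: "(\<integral>\<^sup>+x. phase f0 x * ennreal (Vr x) \<partial>M) = ennreal V0"
    and K_positive: "0 < K" and V0_nonnegative: "0 \<le> V0"
    and \<gamma>_borel [measurable]: "\<gamma> \<in> borel_measurable borel"
    and \<gamma>_nonneg: "0 \<le> \<gamma> s" and \<gamma>_le: "\<gamma> s \<le> G"
    and T_pos: "0 < T"
    and B_integral: "AE s in lborel. 0 < s \<longrightarrow> s < T \<longrightarrow> (\<forall>u h. h \<in> borel_measurable borel \<longrightarrow>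
      (LINT z|B s u. h z) = norm u * \<gamma> s * (LINT z|\<beta> u. (h z :: real)))"
begin

lemma G_nonneg: "0 \<le> G"
  using \<gamma>_nonneg[of 0] \<gamma>_le[of 0] by linarith

sublocale collision_iteration M "\<lambda>x y. ennreal (speed x y)" diss "\<lambda>x. ennreal (Wr x)" "\<lambda>x. ennreal (Vr x)" rate gain "4 * c0" "phase f0" K V0
  using phase_measurable[of f0] phase_f0_W phase_f0_V K_positive V0_nonnegative
  by unfold_locales auto

abbreviation \<tau> :: "real \<Rightarrow> real" where "\<tau> \<equiv> clock \<gamma>"

text \<open>\<open>enn2real\<close> sends infinity to 0; \<open>sol\<close> is finite almost
  everywhere, so this affects a null set only.\<close>

definition u :: "real \<Rightarrow> real^'d \<Rightarrow> real^'s" where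
  "u t v = (\<chi> i. enn2real (sol (\<tau> t) (i, v)))"

lemma u_component [simp]: "u t v $ i = enn2real (sol (\<tau> t) (i, v))"
  by (simp add: u_def)

lemma sol_section_measurable [measurable]: "sol t \<in> borel_measurable M"
  by measurable

lemma sol_species_measurable [measurable]: "(\<lambda>v. sol t (i, v)) \<in> borel_measurable borel"
  by (rule measurable_compose[OF pair_measurable]) simp

lemma u_borel [measurable]: "(\<lambda>v. u t v $ i) \<in> borel_measurable borel"
  by simp

lemma phase_u: "AE x in M. phase (u t) x = sol (\<tau> t) x"
  using sol_W_finite[OF clock_nonneg[of \<gamma> t]] by eventually_elim (simp add: phase_def)

lemma abs_u_nn: "(\<integral>\<^sup>+x. ennreal \<bar>u t (snd x) $ fst x\<bar> * w x \<partial>M) = (\<integral>\<^sup>+x. sol (\<tau> t) x * w x \<partial>M)"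
  by (rule nn_integral_cong_AE, use phase_u[of t] in eventually_elim) (simp add: phase_def)

lemma u_L1q_2: "u t \<in> L1q m 2" and u_L1q_3: "u t \<in> L1q m 3"
  and u_norm_3: "L1q_norm m 3 (u t) \<le> V0 * exp (4 * c0 * K * \<tau> t)"
proof -
  have nn: "0 \<le> Wr x" "0 \<le> Vr x" for x using Wr_ge_1[of x] Vr_ge_1[of x] by linarith+
  have "(\<integral>\<^sup>+x. ennreal \<bar>u t (snd x) $ fst x\<bar> * ennreal (Wr x) \<partial>M) < \<top>"
    unfolding abs_u_nn using sol_W_le[OF clock_nonneg] by (rule le_less_trans) simp
  then show "u t \<in> L1q m 2"
    by (intro L1q_phase(1)[where w=Wr and h="u t"]) (auto simp: nn L1q_weight_2)
  have V: "(\<integral>\<^sup>+x. ennreal \<bar>u t (snd x) $ fst x\<bar> * ennreal (Vr x) \<partial>M) \<le> ennreal (V0 * exp (4 * c0 * K * \<tau> t))"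
    unfolding abs_u_nn by (rule sol_V_bound[OF clock_nonneg])
  have "(\<integral>\<^sup>+x. ennreal \<bar>u t (snd x) $ fst x\<bar> * ennreal (Vr x) \<partial>M) < \<top>"
    using V by (rule le_less_trans) simp
  note * = L1q_phase[OF Vr_measurable nn(2) L1q_weight_3 u_borel AE_I2[OF refl] this]
  show "u t \<in> L1q m 3" by (rule *(1))
  show "L1q_norm m 3 (u t) \<le> V0 * exp (4 * c0 * K * \<tau> t)"
    unfolding *(2) using V V0_nonnegative by (intro enn2real_leI) auto
qed

text \<open>The constant of \<open>sol_lipschitz\<close> with \<open>C = 4 * c0\<close> at the final
  clock value, times the bound \<open>G\<close> on the speed of the clock.\<close>

definition lip :: real where
  "lip = 4 * (4 * c0) * K * (V0 * exp (4 * c0 * K * \<tau> T)) * G"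

lemma lip_nonneg: "0 \<le> lip"
  unfolding lip_def using c0_nonneg K_positive V0_nonnegative G_nonneg by (auto intro!: mult_nonneg_nonneg)

lemma clock_mono: "0 \<le> s \<Longrightarrow> s \<le> t \<Longrightarrow> \<tau> s \<le> \<tau> t"
  by (rule clock_lipschitz(1)[OF \<gamma>_borel \<gamma>_le G_nonneg])

lemma u_lipschitz_nn:
  assumes "0 \<le> s" "s \<le> t" "t \<le> T"
  shows "(\<integral>\<^sup>+x. ennreal \<bar>(u t (snd x) - u s (snd x)) $ fst x\<bar> * ennreal (Wr x) \<partial>M) \<le> ennreal (lip * (t - s))"
proof -
  have "(\<integral>\<^sup>+x. ennreal \<bar>(u t (snd x) - u s (snd x)) $ fst x\<bar> * ennreal (Wr x) \<partial>M) \<le>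
     ennreal (4 * (4 * c0) * K * (V0 * exp (4 * c0 * K * \<tau> t)) * (\<tau> t - \<tau> s))"
    using sol_lipschitz[OF clock_nonneg clock_mono[OF assms(1,2)]] by simp
  also have "\<dots> \<le> ennreal (4 * (4 * c0) * K * (V0 * exp (4 * c0 * K * \<tau> T)) * (G * (t - s)))"
  proof (intro ennreal_leI mult_mono)
    show "\<tau> t - \<tau> s \<le> G * (t - s)"
      using clock_lipschitz(2)[OF \<gamma>_borel \<gamma>_le G_nonneg assms(1,2)] by simp
    show "0 \<le> \<tau> t - \<tau> s" using clock_mono[OF assms(1,2)] by simp
    show "exp (4 * c0 * K * \<tau> t) \<le> exp (4 * c0 * K * \<tau> T)"
      using clock_mono[of t T] assms c0_nonneg K_positive by (simp add: mult_left_mono)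
  qed (use c0_nonneg K_positive V0_nonnegative in auto)
  finally show ?thesis unfolding lip_def by (simp add: mult.assoc)
qed

lemma u_lipschitz:
  assumes "0 \<le> s" "s \<le> T" "0 \<le> t" "t \<le> T"
  shows "L1q_norm m 2 (\<lambda>v. u s v - u t v) \<le> lip * \<bar>s - t\<bar>"
proof -
  have nn: "0 \<le> Wr x" for x using Wr_ge_1[of x] by linarith
  have le: "(\<integral>\<^sup>+x. ennreal \<bar>(u s (snd x) - u t (snd x)) $ fst x\<bar> * ennreal (Wr x) \<partial>M) \<le> ennreal (lip * \<bar>s - t\<bar>)"
    using u_lipschitz_nn[of s t] u_lipschitz_nn[of t s] assms
    by (cases "s \<le> t") (auto simp: abs_minus_commute)
  then have fin: "(\<integral>\<^sup>+x. ennreal \<bar>(u s (snd x) - u t (snd x)) $ fst x\<bar> * ennreal (Wr x) \<partial>M) < \<top>"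
    by (rule le_less_trans) simp
  have "L1q_norm m 2 (\<lambda>v. u s v - u t v) = enn2real (\<integral>\<^sup>+x. ennreal \<bar>(u s (snd x) - u t (snd x)) $ fst x\<bar> * ennreal (Wr x) \<partial>M)"
    by (rule L1q_phase(2)[where w=Wr and h="\<lambda>v. u s v - u t v"]) (use fin in \<open>auto simp: nn L1q_weight_2\<close>)
  also have "\<dots> \<le> lip * \<bar>s - t\<bar>"
    using le lip_nonneg by (intro enn2real_leI) auto
  finally show ?thesis .
qed

lemma u_continuous: "continuous_L1q m 2 T u"
  unfolding continuous_L1q_def
proof (intro ballI conjI u_L1q_2)
  fix t assume t: "t \<in> {0..T}"
  have "0 \<le> L1q_weight m 2 i v" for i and v :: "real^'d"
    unfolding L1q_weight_2 using Wr_ge_1[of "(i, v)"] by linarith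
  then have nn: "0 \<le> L1q_norm m 2 f" for f :: "real^'d \<Rightarrow> real^'s"
    unfolding L1q_norm_def by (intro sum_nonneg Bochner_Integration.integral_nonneg mult_nonneg_nonneg) auto
  show "((\<lambda>s. L1q_norm m 2 (\<lambda>v. u s v - u t v)) \<longlongrightarrow> 0) (at t within {0..T})"
  proof (rule real_tendsto_sandwich[OF always_eventually[OF allI[OF nn]]])
    show "\<forall>\<^sub>F s in at t within {0..T}. L1q_norm m 2 (\<lambda>v. u s v - u t v) \<le> lip * \<bar>s - t\<bar>"
      using t by (auto simp: eventually_at_filter intro!: u_lipschitz always_eventually)
    have "((\<lambda>s. lip * \<bar>s - t\<bar>) \<longlongrightarrow> lip * \<bar>t - t\<bar>) (at t within {0..T})"
      by (intro tendsto_intros)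
    then show "((\<lambda>s. lip * \<bar>s - t\<bar>) \<longlongrightarrow> 0) (at t within {0..T})" by simp
  qed (rule tendsto_const)
qed


definition cut :: "nat \<Rightarrow> (real^'d \<Rightarrow> real^'s) \<Rightarrow> real^'d \<Rightarrow> real^'s" where
  "cut n f v = (if norm v \<le> real n then f v else 0)"

lemma cut_component: "cut n f v $ i = (if norm v \<le> real n then f v $ i else 0)"
  by (simp add: cut_def)

text \<open>On a ball the third-order weight is controlled by the second-order one. After large
  velocities are cut off, continuity in the weaker norm therefore gives continuity in the stronger
  one.\<close>

lemma Vr_le_Wr_ball:
  assumes "norm (snd x) \<le> R"
  shows "Vr x \<le> (1 + (\<Sum>i\<in>UNIV. sqrt (m $ i)) * R) * Wr x"
proof -
  have R: "0 \<le> R" using assms norm_ge_zero order_trans by blast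
  have "sqrt (m $ fst x) \<le> (\<Sum>i\<in>UNIV. sqrt (m $ i))"
    using mass_pos by (intro member_le_sum) (auto simp: less_imp_le)
  then have "rt x \<le> (\<Sum>i\<in>UNIV. sqrt (m $ i)) * R"
    unfolding rt_def using assms mass_pos[of "fst x"] R by (intro mult_mono) (auto intro!: sum_nonneg simp: less_imp_le mass_pos)
  moreover have "Vr x \<le> (1 + rt x) * Wr x"
    unfolding Vr_def Wr_def using rt_nonneg[of x] by (simp add: algebra_simps power2_eq_square power3_eq_cube)
  moreover have "0 \<le> Wr x" using Wr_ge_1[of x] by linarith
  ultimately show ?thesis
    by (meson add_left_mono mult_right_mono order_trans)
qed

text \<open>Strong measurability in \<open>L1q m 3\<close> is not immediate from continuity, which
  is available in \<open>L1q m 2\<close>. The approximants freeze time on a grid and cut off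
  velocities above \<open>n\<close>. The mesh shrinks fast enough to beat the constant of
  \<open>Vr_le_Wr_ball\<close>, and the third moment makes the tail vanish.\<close>

lemma u_Linf: "Linf_L1q m 3 T u"
proof -
  define c1 where "c1 = (\<Sum>i\<in>UNIV. sqrt (m $ i))"
  \<comment> \<open>The mesh \<open>1 / k n\<close> makes
    \<open>(1 + c1 * real n) * lip / k n\<close> at most \<open>1 / real (Suc n)\<close>; the added
    1 keeps \<open>k n\<close> positive.\<close>
  define k where "k n = (1 + c1 * real n) * lip * real (Suc n) + 1" for n
  define h where "h n t = nat \<lfloor>t * k n\<rfloor>" for n and t :: real
  define S where "S n t = cut n (u (real (h n t) / k n))" for n t
  have nn: "0 \<le> Wr x" "0 \<le> Vr x" for x using Wr_ge_1[of x] Vr_ge_1[of x] by linarith+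
  have c1: "0 \<le> c1" unfolding c1_def by (intro sum_nonneg) (simp add: less_imp_le mass_pos)
  have k_pos: "0 < k n" for n
    unfolding k_def using c1 lip_nonneg by (intro add_nonneg_pos mult_nonneg_nonneg) auto
  have grid: "0 \<le> real (h n t) / k n" "real (h n t) / k n \<le> t" "t - real (h n t) / k n \<le> 1 / k n" if "0 \<le> t" for n t
  proof -
    have "real (h n t) = of_int \<lfloor>t * k n\<rfloor>" unfolding h_def using that k_pos[of n] by simp
    then have "real (h n t) \<le> t * k n" "t * k n \<le> real (h n t) + 1" by linarith+
    then have "t \<le> (real (h n t) + 1) / k n" "real (h n t) / k n \<le> t"
      using k_pos[of n] by (simp_all add: pos_le_divide_eq pos_divide_le_eq)
    then show "0 \<le> real (h n t) / k n" "real (h n t) / k n \<le> t" "t - real (h n t) / k n \<le> 1 / k n"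
      using k_pos[of n] by (auto simp: add_divide_distrib)
  qed
  have cut_borel: "(\<lambda>v. cut n f v $ i) \<in> borel_measurable borel" if [measurable]: "\<And>i. (\<lambda>v. f v $ i) \<in> borel_measurable borel" for n f i
    unfolding cut_component by measurable
  have S_borel: "(\<lambda>v. S n t v $ i) \<in> borel_measurable borel" for n t i
    unfolding S_def by (rule cut_borel) simp
  have S_L1q: "S n t \<in> L1q m 3" for n t
  proof (rule L1q_phase(1)[OF Vr_measurable nn(2) L1q_weight_3 S_borel AE_I2[OF refl]])
    have "(\<integral>\<^sup>+x. ennreal \<bar>S n t (snd x) $ fst x\<bar> * ennreal (Vr x) \<partial>M) \<le>
      (\<integral>\<^sup>+x. ennreal \<bar>u (real (h n t) / k n) (snd x) $ fst x\<bar> * ennreal (Vr x) \<partial>M)"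
      unfolding S_def cut_component by (intro nn_integral_mono mult_right_mono) auto
    also have "\<dots> < \<top>"
      unfolding abs_u_nn using sol_V_bound[OF clock_nonneg] by (rule le_less_trans) simp
    finally show "(\<integral>\<^sup>+x. ennreal \<bar>S n t (snd x) $ fst x\<bar> * ennreal (Vr x) \<partial>M) < \<top>" .
  qed
  have S_simple: "simple_function (lebesgue_on {0<..<T}) (S n)" for n
  proof -
    have h_m: "h n \<in> lebesgue_on {0<..<T} \<rightarrow>\<^sub>M count_space UNIV"
      unfolding h_def by (rule measurable_restrict_space1, rule measurable_completion) measurable
    have "h n ` {0<..<T} \<subseteq> {0..nat \<lfloor>T * k n\<rfloor>}"
      unfolding h_def using k_pos[of n] by (auto intro!: nat_mono floor_mono mult_right_mono)
    then have "simple_function (lebesgue_on {0<..<T}) (h n)"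
      unfolding simple_function_def using measurable_sets[OF h_m]
      by (auto intro: finite_subset simp: space_restrict_space)
    then have "simple_function (lebesgue_on {0<..<T}) ((\<lambda>j. cut n (u (real j / k n))) \<circ> h n)"
      by (rule simple_function_compose)
    then show ?thesis by (simp add: S_def[abs_def] comp_def)
  qed
  have conv: "(\<lambda>n. L1q_norm m 3 (\<lambda>v. S n t v - u t v)) \<longlonglongrightarrow> 0" if t: "0 < t" "t < T" for t
  proof -
    define tail where "tail n = (\<integral>\<^sup>+x. sol (\<tau> t) x * ennreal (Vr x) * indicator {x. real n < norm (snd x)} x \<partial>M)" for n
    have set_m[measurable]: "{x :: 's \<times> (real^'d). real n < norm (snd x)} \<in> sets M" for n
    proof -
      have "{x \<in> space M. real n < norm (snd x)} \<in> sets M" by measurable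
      then show ?thesis by simp
    qed
    have "tail \<longlonglongrightarrow> (\<integral>\<^sup>+x. 0 \<partial>M)"
      unfolding tail_def
    proof (rule nn_integral_dominated_convergence[where w="\<lambda>x. sol (\<tau> t) x * ennreal (Vr x)"])
      show "AE x in M. (\<lambda>n. sol (\<tau> t) x * ennreal (Vr x) * indicator {x. real n < norm (snd x)} x) \<longlonglongrightarrow> 0"
      proof (rule AE_I2)
        fix x :: "'s \<times> (real^'d)"
        obtain N where N: "norm (snd x) < real N" using reals_Archimedean2 by blast
        have "eventually (\<lambda>n. sol (\<tau> t) x * ennreal (Vr x) * indicator {x. real n < norm (snd x)} x = 0) sequentially"
          using N by (auto simp: eventually_sequentially intro!: exI[of _ N] split: split_indicator)
        then show "(\<lambda>n. sol (\<tau> t) x * ennreal (Vr x) * indicator {x. real n < norm (snd x)} x) \<longlonglongrightarrow> 0"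
          by (rule tendsto_eventually)
      qed
      show "(\<integral>\<^sup>+x. sol (\<tau> t) x * ennreal (Vr x) \<partial>M) < \<infinity>"
        using sol_V_bound[OF clock_nonneg] by (rule le_less_trans) simp
    qed (auto split: split_indicator)
    then have tail: "tail \<longlonglongrightarrow> 0" by simp
    define N where "N n = (\<integral>\<^sup>+x. ennreal \<bar>(S n t (snd x) - u t (snd x)) $ fst x\<bar> * ennreal (Vr x) \<partial>M)" for n
    have N_le: "N n \<le> ennreal (1 / real (Suc n)) + tail n" for n
    proof -
      define s where "s = real (h n t) / k n"
      have s: "0 \<le> s" "s \<le> t" "t - s \<le> 1 / k n" unfolding s_def using grid[of t n] t by auto
      define D where "D x = ennreal \<bar>(u t (snd x) - u s (snd x)) $ fst x\<bar>" for x :: "'s \<times> (real^'d)"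
      have [measurable]: "D \<in> borel_measurable M" unfolding D_def by (rule borel_phase_measurable) simp
      \<comment> \<open>Inside the ball two time values of \<open>u\<close> are compared in the
        weight \<open>Wr\<close>; outside it the approximant is 0 and the tail of \<open>u\<close>
        remains.\<close>
      have "N n \<le> (\<integral>\<^sup>+x. ennreal (1 + c1 * real n) * (D x * ennreal (Wr x)) + ennreal \<bar>u t (snd x) $ fst x\<bar> * (ennreal (Vr x) * indicator {x. real n < norm (snd x)} x) \<partial>M)"
        unfolding N_def
      proof (rule nn_integral_mono)
        fix x :: "'s \<times> (real^'d)"
        show "ennreal \<bar>(S n t (snd x) - u t (snd x)) $ fst x\<bar> * ennreal (Vr x) \<le>
          ennreal (1 + c1 * real n) * (D x * ennreal (Wr x)) + ennreal \<bar>u t (snd x) $ fst x\<bar> * (ennreal (Vr x) * indicator {x. real n < norm (snd x)} x)"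
        proof (cases "norm (snd x) \<le> real n")
          case True
          have "ennreal \<bar>(S n t (snd x) - u t (snd x)) $ fst x\<bar> * ennreal (Vr x) = D x * ennreal (Vr x)"
            unfolding S_def s_def[symmetric] D_def cut_def using True by (simp add: abs_minus_commute)
          also have "\<dots> \<le> D x * ennreal ((1 + c1 * real n) * Wr x)"
            unfolding c1_def by (intro mult_left_mono ennreal_leI Vr_le_Wr_ball True) simp
          also have "\<dots> = ennreal (1 + c1 * real n) * (D x * ennreal (Wr x))"
            using nn c1 by (simp add: ennreal_mult mult_ac)
          finally show ?thesis by (simp add: add_increasing2)
        next
          case False
          then have "ennreal \<bar>(S n t (snd x) - u t (snd x)) $ fst x\<bar> = ennreal \<bar>u t (snd x) $ fst x\<bar>"
            unfolding S_def cut_def by simp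
          then show ?thesis using False by (simp add: add_increasing del: u_component)
        qed
      qed
      also have "\<dots> = ennreal (1 + c1 * real n) * (\<integral>\<^sup>+x. D x * ennreal (Wr x) \<partial>M) +
        (\<integral>\<^sup>+x. ennreal \<bar>u t (snd x) $ fst x\<bar> * (ennreal (Vr x) * indicator {x. real n < norm (snd x)} x) \<partial>M)"
        by (subst nn_integral_add) (auto simp: nn_integral_cmult intro!: borel_phase_measurable)
      also have "(\<integral>\<^sup>+x. ennreal \<bar>u t (snd x) $ fst x\<bar> * (ennreal (Vr x) * indicator {x. real n < norm (snd x)} x) \<partial>M) = tail n"
        unfolding abs_u_nn tail_def by (simp add: mult.assoc)
      also have "ennreal (1 + c1 * real n) * (\<integral>\<^sup>+x. D x * ennreal (Wr x) \<partial>M) \<le> ennreal (1 + c1 * real n) * ennreal (lip * (t - s))"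
        unfolding D_def using s t by (intro mult_left_mono u_lipschitz_nn) auto
      also have "\<dots> \<le> ennreal (1 / real (Suc n))"
      proof -
        have "(1 + c1 * real n) * (lip * (t - s)) \<le> (1 + c1 * real n) * (lip * (1 / k n))"
          using s c1 lip_nonneg by (intro mult_left_mono) auto
        also have "\<dots> \<le> 1 / real (Suc n)"
        proof -
          have "(1 + c1 * real n) * lip * real (Suc n) \<le> k n" unfolding k_def by simp
          then show ?thesis using k_pos[of n] by (simp add: field_simps)
        qed
        finally show ?thesis
          using c1 lip_nonneg s by (subst ennreal_mult[symmetric]) (auto intro!: ennreal_leI)
      qed
      finally show ?thesis by (simp add: add_right_mono)
    qed
    have "(\<lambda>n. ennreal (1 / real (Suc n)) + tail n) \<longlonglongrightarrow> ennreal 0 + 0"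
      by (intro tendsto_add tail tendsto_ennrealI) (use LIMSEQ_inverse_real_of_nat in \<open>simp add: inverse_eq_divide\<close>)
    then have lim: "(\<lambda>n. ennreal (1 / real (Suc n)) + tail n) \<longlonglongrightarrow> 0" by simp
    have "N \<longlonglongrightarrow> 0"
      by (rule tendsto_sandwich[OF _ always_eventually[OF allI[OF N_le]] tendsto_const lim]) simp
    then have "(\<lambda>n. enn2real (N n)) \<longlonglongrightarrow> 0"
      by (intro tendsto_enn2real) auto
    moreover have "L1q_norm m 3 (\<lambda>v. S n t v - u t v) = enn2real (N n)" for n
      unfolding N_def
    proof (rule L1q_phase(2)[OF Vr_measurable nn(2) L1q_weight_3 _ AE_I2[OF refl]])
      show "(\<lambda>v. (S n t v - u t v) $ i) \<in> borel_measurable borel" for i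
        using S_borel[of n t i] by simp
      have "tail n \<le> (\<integral>\<^sup>+x. sol (\<tau> t) x * ennreal (Vr x) \<partial>M)"
        unfolding tail_def by (intro nn_integral_mono) (auto split: split_indicator)
      also have "\<dots> < \<top>"
        using sol_V_bound[OF clock_nonneg] by (rule le_less_trans) simp
      finally have "ennreal (1 / real (Suc n)) + tail n < \<top>" by simp
      then show "(\<integral>\<^sup>+x. ennreal \<bar>(S n t (snd x) - u t (snd x)) $ fst x\<bar> * ennreal (Vr x) \<partial>M) < \<top>"
        using N_le[of n] unfolding N_def by (rule le_less_trans[rotated])
    qed
    ultimately show ?thesis by simp
  qed
  show ?thesis
    unfolding Linf_L1q_def
  proof (intro conjI exI[of _ S] exI[of _ "V0 * exp (4 * c0 * K * \<tau> T)"] allI ballI)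
    show "AE t in lebesgue_on {0<..<T}. (\<lambda>n. L1q_norm m 3 (\<lambda>v. S n t v - u t v)) \<longlonglongrightarrow> 0"
      by (rule AE_I2) (auto simp: space_restrict_space intro: conv)
    show "AE t in lebesgue_on {0<..<T}. L1q_norm m 3 (u t) \<le> V0 * exp (4 * c0 * K * \<tau> T)"
    proof (rule AE_I2)
      fix t assume "t \<in> space (lebesgue_on {0<..<T})"
      then have "\<tau> t \<le> \<tau> T" by (intro clock_mono) (auto simp: space_restrict_space)
      then have "V0 * exp (4 * c0 * K * \<tau> t) \<le> V0 * exp (4 * c0 * K * \<tau> T)"
        using V0_nonnegative c0_nonneg K_positive by (intro mult_left_mono) (auto intro!: mult_left_mono)
      then show "L1q_norm m 3 (u t) \<le> V0 * exp (4 * c0 * K * \<tau> T)"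
        using u_norm_3[of t] by linarith
    qed
  qed (auto intro: u_L1q_3 S_L1q S_simple)
qed

section \<open>Invariants of the limit, and tools for its time integrals\<close>

text \<open>At each time gain plus dissipation equals loss by \<open>gain_invariant\<close>. As
  \<open>\<psi>\<close> is dominated by \<open>Wr\<close>, the time-integrated loss \<open>L\<close>
  is finite and cancels from the weak equation.\<close>

lemma sol_invariant:
  fixes \<psi> :: "'s \<times> (real^'d) \<Rightarrow> real" and c c' :: real
  assumes \<psi>_m[measurable]: "\<psi> \<in> borel_measurable M" and \<psi>: "\<And>x. 0 \<le> \<psi> x" "\<And>x. \<psi> x \<le> c' * Wr x" and c: "0 \<le> c"
    and inv: "\<And>x y z. norm z \<le> 1 \<Longrightarrow> \<psi> (post x y z) + \<psi> (post y x (- z)) + c * energy_loss x y z = \<psi> x + \<psi> y"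
    and t: "0 \<le> t"
  shows "(\<integral>\<^sup>+x. sol t x * ennreal (\<psi> x) \<partial>M) + ennreal c * total_heat t = (\<integral>\<^sup>+x. phase f0 x * ennreal (\<psi> x) \<partial>M)"
proof -
  define L where "L = (\<integral>\<^sup>+s. (\<integral>\<^sup>+x. sol s x * loss (sol s) x * ennreal (\<psi> x) \<partial>M) * indicator {0..t} s \<partial>lborel)"
  have "0 \<le> c' * Wr undefined" using \<psi>[of undefined] by linarith
  then have c': "0 \<le> c'" using Wr_ge_1[of undefined] by (simp add: zero_le_mult_iff)
  have "L < \<top>"
  proof -
    define b where "b = 2 * (4 * c0) * K * (V0 * exp (4 * c0 * K * t))"
    have "L \<le> (\<integral>\<^sup>+s. ennreal c' * ennreal b * indicator {0..t} s \<partial>lborel)"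
      unfolding L_def
    proof (rule nn_integral_mono)
      fix s :: real
      show "(\<integral>\<^sup>+x. sol s x * loss (sol s) x * ennreal (\<psi> x) \<partial>M) * indicator {0..t} s \<le> ennreal c' * ennreal b * indicator {0..t} s"
      proof (cases "s \<in> {0..t}")
        case True
        have "(\<integral>\<^sup>+x. sol s x * loss (sol s) x * ennreal (\<psi> x) \<partial>M) \<le> (\<integral>\<^sup>+x. sol s x * loss (sol s) x * ennreal (c' * Wr x) \<partial>M)"
          by (intro nn_integral_mono mult_left_mono ennreal_leI \<psi>) simp
        also have "\<dots> = (\<integral>\<^sup>+x. ennreal c' * (sol s x * loss (sol s) x * ennreal (Wr x)) \<partial>M)"
          using c' by (simp add: ennreal_mult' mult_ac)
        also have "\<dots> = ennreal c' * (\<integral>\<^sup>+x. sol s x * loss (sol s) x * ennreal (Wr x) \<partial>M)"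
          by (rule nn_integral_cmult) measurable
        also have "\<dots> \<le> ennreal c' * ennreal (2 * (4 * c0) * K * (V0 * exp (4 * c0 * K * s)))"
          using True by (intro mult_left_mono sol_loss_W_le) auto
        also have "\<dots> \<le> ennreal c' * ennreal b"
          unfolding b_def using True c0_nonneg K_positive V0_nonnegative
          by (intro mult_left_mono ennreal_leI) (auto intro!: mult_left_mono)
        finally show ?thesis using True by simp
      qed simp
    qed
    also have "\<dots> < \<top>"
      using t by (simp add: nn_integral_cmult ennreal_mult_less_top)
    finally show ?thesis .
  qed
  have key: "(\<integral>\<^sup>+x. gain (sol s) x * ennreal (\<psi> x) \<partial>M) + ennreal c * dissipation (sol s) =
    (\<integral>\<^sup>+x. sol s x * loss (sol s) x * ennreal (\<psi> x) \<partial>M)" for s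
    unfolding dissipation_def
    by (subst double_integral_loss[symmetric], measurable, rule gain_invariant) (use \<psi> c inv in simp_all)
  have "(\<integral>\<^sup>+s. (\<integral>\<^sup>+x. gain (sol s) x * ennreal (\<psi> x) \<partial>M) * indicator {0..t} s \<partial>lborel) + ennreal c * total_heat t =
     (\<integral>\<^sup>+s. (\<integral>\<^sup>+x. gain (sol s) x * ennreal (\<psi> x) \<partial>M) * indicator {0..t} s + ennreal c * dissipation (sol s) * indicator {0..t} s \<partial>lborel)"
    unfolding total_heat_eq by (simp add: nn_integral_add nn_integral_cmult mult.assoc)
  also have "\<dots> = L"
    unfolding L_def by (intro nn_integral_cong) (simp only: key flip: distrib_right)
  finally have "L + ((\<integral>\<^sup>+x. sol t x * ennreal (\<psi> x) \<partial>M) + ennreal c * total_heat t) = L + (\<integral>\<^sup>+x. phase f0 x * ennreal (\<psi> x) \<partial>M)"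
    using sol_weak_equation[OF t, of "\<lambda>x. ennreal (\<psi> x)"] unfolding L_def by (simp add: add_ac)
  then show ?thesis
    using \<open>L < \<top>\<close> by (auto simp: ennreal_add_left_cancel)
qed

end

text \<open>Links the time integral in the notion of solution with Borel integrals over closed
  intervals. The endpoints form a null set, and the integrands need to agree only almost
  everywhere.\<close>

lemma integral_lebesgue_on_Ioo:
  fixes q q' :: "real \<Rightarrow> real"
  assumes [measurable]: "q' \<in> borel_measurable borel" and eq: "AE s in lborel. 0 < s \<longrightarrow> s < t \<longrightarrow> q s = q' s"
  shows "(LINT s|lebesgue_on {0<..<t}. q s) = (LINT s:{0..t}|lborel. q' s)"
proof -
  have "(LINT s|lebesgue_on {0<..<t}. q s) = (LINT s|lebesgue. indicator {0<..<t} s *\<^sub>R q s)"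
    by (rule integral_restrict_space) simp
  also have "\<dots> = (LINT s|lborel. indicator {0..t} s *\<^sub>R q' s)"
  proof (rule lebesgue_integral_AE(1))
    show "AE s in lborel. indicator {0<..<t} s *\<^sub>R q s = indicator {0..t} s *\<^sub>R q' s"
      using eq AE_lborel_singleton[of 0] AE_lborel_singleton[of t]
      by eventually_elim (auto split: split_indicator)
  qed measurable
  finally show ?thesis by (simp add: set_lebesgue_integral_def)
qed

text \<open>Gain and loss rates are bounded on \<open>{0..t}\<close>, so the real integral of their
  difference is the difference of two finite nonnegative integrals.\<close>

lemma set_integral_enn2real_diff:
  fixes p n :: "real \<Rightarrow> ennreal" and \<gamma> :: "real \<Rightarrow> real"
  assumes [measurable]: "p \<in> borel_measurable borel" "n \<in> borel_measurable borel" "\<gamma> \<in> borel_measurable borel"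
    and \<gamma>: "\<And>s. 0 \<le> \<gamma> s" "\<And>s. \<gamma> s \<le> G"
    and p: "\<And>s. s \<in> {0..t} \<Longrightarrow> p s \<le> ennreal b" and n: "\<And>s. s \<in> {0..t} \<Longrightarrow> n s \<le> ennreal b" and b: "0 \<le> b"
  shows "set_integrable lborel {0..t} (\<lambda>s. \<gamma> s * (enn2real (p s) - enn2real (n s)))"
    and "(LINT s:{0..t}|lborel. \<gamma> s * (enn2real (p s) - enn2real (n s))) =
      enn2real (\<integral>\<^sup>+s. ennreal (\<gamma> s) * p s * indicator {0..t} s \<partial>lborel) - enn2real (\<integral>\<^sup>+s. ennreal (\<gamma> s) * n s * indicator {0..t} s \<partial>lborel)"
    and "(\<integral>\<^sup>+s. ennreal (\<gamma> s) * p s * indicator {0..t} s \<partial>lborel) < \<top>"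
proof -
  have *: "integrable lborel (\<lambda>s. indicator {0..t} s * (\<gamma> s * enn2real (r s)))"
    "(LINT s|lborel. indicator {0..t} s * (\<gamma> s * enn2real (r s))) = enn2real (\<integral>\<^sup>+s. ennreal (\<gamma> s) * r s * indicator {0..t} s \<partial>lborel)"
    "(\<integral>\<^sup>+s. ennreal (\<gamma> s) * r s * indicator {0..t} s \<partial>lborel) < \<top>"
    if [measurable]: "r \<in> borel_measurable borel" and r: "\<And>s. s \<in> {0..t} \<Longrightarrow> r s \<le> ennreal b" for r :: "real \<Rightarrow> ennreal"
  proof -
    have eq: "(\<integral>\<^sup>+s. ennreal (indicator {0..t} s * (\<gamma> s * enn2real (r s))) \<partial>lborel) = (\<integral>\<^sup>+s. ennreal (\<gamma> s) * r s * indicator {0..t} s \<partial>lborel)"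
    proof (rule nn_integral_cong)
      fix s :: real
      show "ennreal (indicator {0..t} s * (\<gamma> s * enn2real (r s))) = ennreal (\<gamma> s) * r s * indicator {0..t} s"
      proof (cases "s \<in> {0..t}")
        case True
        then have "r s < \<top>" using r[OF True] by (rule_tac le_less_trans) auto
        then show ?thesis using True \<gamma>[of s] by (simp add: ennreal_mult)
      qed simp
    qed
    have "(\<integral>\<^sup>+s. ennreal (\<gamma> s) * r s * indicator {0..t} s \<partial>lborel) \<le> (\<integral>\<^sup>+s. ennreal G * ennreal b * indicator {0..t} s \<partial>lborel)"
      using r \<gamma> by (intro nn_integral_mono) (auto split: split_indicator intro!: mult_mono ennreal_leI)
    also have "\<dots> < \<top>"
      by (simp add: nn_integral_cmult ennreal_mult_less_top emeasure_lborel_Icc_eq)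
    finally show fin: "(\<integral>\<^sup>+s. ennreal (\<gamma> s) * r s * indicator {0..t} s \<partial>lborel) < \<top>" .
    then show "integrable lborel (\<lambda>s. indicator {0..t} s * (\<gamma> s * enn2real (r s)))"
      using \<gamma> by (intro integrableI_nonneg) (auto simp: eq)
    show "(LINT s|lborel. indicator {0..t} s * (\<gamma> s * enn2real (r s))) = enn2real (\<integral>\<^sup>+s. ennreal (\<gamma> s) * r s * indicator {0..t} s \<partial>lborel)"
      unfolding eq[symmetric] using \<gamma> by (intro integral_eq_nn_integral) auto
  qed
  have split: "indicator {0..t} s *\<^sub>R (\<gamma> s * (enn2real (p s) - enn2real (n s))) =
     indicator {0..t} s * (\<gamma> s * enn2real (p s)) - indicator {0..t} s * (\<gamma> s * enn2real (n s))" for s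
    by (simp add: algebra_simps)
  show "set_integrable lborel {0..t} (\<lambda>s. \<gamma> s * (enn2real (p s) - enn2real (n s)))"
    unfolding set_integrable_def split using *[OF _ p] *[OF _ n] by (intro Bochner_Integration.integrable_diff) auto
  show "(LINT s:{0..t}|lborel. \<gamma> s * (enn2real (p s) - enn2real (n s))) =
      enn2real (\<integral>\<^sup>+s. ennreal (\<gamma> s) * p s * indicator {0..t} s \<partial>lborel) - enn2real (\<integral>\<^sup>+s. ennreal (\<gamma> s) * n s * indicator {0..t} s \<partial>lborel)"
    unfolding set_lebesgue_integral_def split using *[OF _ p] *[OF _ n] by (subst Bochner_Integration.integral_diff) auto
  show "(\<integral>\<^sup>+s. ennreal (\<gamma> s) * p s * indicator {0..t} s \<partial>lborel) < \<top>"
    using *[OF _ p] by simp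
qed

section \<open>The weak equation for bounded nonnegative test functions\<close>

context boltzmann_problem
begin

lemma phase_f0_measurable [measurable]: "phase f0 \<in> borel_measurable M"
  by (rule phase_measurable) simp

lemma bounded_weak:
  assumes h[measurable]: "h \<in> borel_measurable M" and hW: "(\<integral>\<^sup>+x. h x * ennreal (Wr x) \<partial>M) < \<top>"
    and \<psi>[measurable]: "\<psi> \<in> borel_measurable borel" and \<psi>_le: "\<And>v. \<psi> v \<le> c * Wr (i, v)"
  shows "(\<integral>\<^sup>+v. h (i, v) * ennreal (\<psi> v) \<partial>lborel) < \<top>"
proof -
  have "(\<integral>\<^sup>+v. h (i, v) * ennreal (\<psi> v) \<partial>lborel) = (\<integral>\<^sup>+x. h x * species_test i \<psi> x \<partial>M)"
    by (rule nn_integral_species_test[symmetric]) simp_all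
  also have "\<dots> \<le> (\<integral>\<^sup>+x. h x * (ennreal c * ennreal (Wr x)) \<partial>M)"
  proof (intro nn_integral_mono mult_left_mono)
    fix x :: "'s \<times> (real^'d)"
    have "species_test i \<psi> x \<le> ennreal (c * Wr x)"
      unfolding species_test_def using \<psi>_le[of "snd x"] by (cases x) (auto intro: ennreal_leI)
    also have "\<dots> = ennreal c * ennreal (Wr x)"
      using Wr_ge_1[of x] by (intro ennreal_mult'') simp
    finally show "species_test i \<psi> x \<le> ennreal c * ennreal (Wr x)" .
  qed simp
  also have "\<dots> = (\<integral>\<^sup>+x. ennreal c * (h x * ennreal (Wr x)) \<partial>M)"
    by (simp add: mult_ac)
  also have "\<dots> < \<top>"
    using hW by (simp add: nn_integral_cmult ennreal_mult_less_top)
  finally show ?thesis .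
qed

lemma f0_integral:
  assumes [measurable]: "\<psi> \<in> borel_measurable borel" and "\<And>v. 0 \<le> \<psi> v" "\<And>v. \<psi> v \<le> c * Wr (i, v)"
  shows "integrable lebesgue (\<lambda>v. f0 v $ i * \<psi> v)"
    and "(LINT v|lebesgue. f0 v $ i * \<psi> v) = enn2real (\<integral>\<^sup>+x. phase f0 x * species_test i \<psi> x \<partial>M)"
proof -
  have fin: "(\<integral>\<^sup>+v. phase f0 (i, v) * ennreal (\<psi> v) \<partial>lborel) < \<top>"
    by (rule bounded_weak[where c=c]) (use assms phase_f0_W in auto)
  have "AE x in M. phase f0 x < \<top>" by (simp add: phase_def)
  note * = species_integral[OF phase_f0_measurable this assms(1,2) fin]
  have e: "enn2real (phase f0 (i, v)) = f0 v $ i" for v by (simp add: phase_def f0_nonneg)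
  show "integrable lebesgue (\<lambda>v. f0 v $ i * \<psi> v)" using *(1) unfolding e .
  show "(LINT v|lebesgue. f0 v $ i * \<psi> v) = enn2real (\<integral>\<^sup>+x. phase f0 x * species_test i \<psi> x \<partial>M)"
    using *(2) unfolding e by (subst nn_integral_species_test) simp_all
qed

lemma sol_W_fin: "0 \<le> t \<Longrightarrow> (\<integral>\<^sup>+x. sol t x * ennreal (Wr x) \<partial>M) < \<top>"
  using sol_W_le[of t] by (rule_tac le_less_trans) auto

lemma u_integral:
  assumes [measurable]: "\<psi> \<in> borel_measurable borel" and "\<And>v. 0 \<le> \<psi> v" "\<And>v. \<psi> v \<le> c * Wr (i, v)"
  shows "integrable lebesgue (\<lambda>v. u t v $ i * \<psi> v)"
    and "(LINT v|lebesgue. u t v $ i * \<psi> v) = enn2real (\<integral>\<^sup>+x. sol (\<tau> t) x * species_test i \<psi> x \<partial>M)"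
proof -
  have fin: "(\<integral>\<^sup>+v. sol (\<tau> t) (i, v) * ennreal (\<psi> v) \<partial>lborel) < \<top>"
    by (rule bounded_weak[where c=c]) (use assms sol_W_fin[OF clock_nonneg] in auto)
  note * = species_integral[OF sol_section_measurable sol_W_finite[OF clock_nonneg] assms(1,2) fin]
  show "integrable lebesgue (\<lambda>v. u t v $ i * \<psi> v)" using *(1) by simp
  show "(LINT v|lebesgue. u t v $ i * \<psi> v) = enn2real (\<integral>\<^sup>+x. sol (\<tau> t) x * species_test i \<psi> x \<partial>M)"
    using *(2) by (subst nn_integral_species_test) simp_all
qed

definition rate_bound :: real where
  "rate_bound = 2 * c0 * (K * K)"

lemma rate_bound_nonneg: "0 \<le> rate_bound"
  unfolding rate_bound_def using c0_nonneg K_positive by auto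

lemma sol_speed_le:
  "(\<integral>\<^sup>+x. \<integral>\<^sup>+y. sol (\<tau> s) x * sol (\<tau> s) y * ennreal (speed x y) \<partial>M \<partial>M) \<le> ennreal rate_bound"
proof -
  have "(\<integral>\<^sup>+x. \<integral>\<^sup>+y. sol (\<tau> s) x * sol (\<tau> s) y * ennreal (speed x y) \<partial>M \<partial>M) \<le>
      ennreal (2 * c0) * ((\<integral>\<^sup>+x. sol (\<tau> s) x * ennreal (Wr x) \<partial>M) * (\<integral>\<^sup>+x. sol (\<tau> s) x * ennreal (Wr x) \<partial>M))"
    by (intro quadratic_form_le speed_le_Wr sol_section_measurable)
  also have "\<dots> \<le> ennreal (2 * c0) * (ennreal K * ennreal K)"
    by (intro mult_left_mono mult_mono sol_W_le clock_nonneg) auto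
  also have "\<dots> = ennreal rate_bound"
    unfolding rate_bound_def using c0_nonneg K_positive by (simp add: ennreal_mult)
  finally show ?thesis .
qed

text \<open>This is \<open>sol_weak_equation\<close> at the clock value, with its time integrals
  pulled back by \<open>time_change\<close>. Boundedness of \<open>\<psi>\<close> makes all four
  terms finite, so the identity of sums in \<open>ennreal\<close> becomes an equation between
  reals.\<close>

lemma u_weak_bounded:
  assumes \<psi>[measurable]: "\<psi> \<in> borel_measurable borel" and \<psi>_bound: "\<And>v. 0 \<le> \<psi> v" "\<And>v. \<psi> v \<le> c"
    and t: "0 \<le> t" "t \<le> T"
  shows "(LINT v|lebesgue. u t v $ i * \<psi> v) = (LINT v|lebesgue. f0 v $ i * \<psi> v) +
    (LINT s|lebesgue_on {0<..<t}. (\<Sum>j\<in>UNIV. collision_weak m (B s) i j (\<lambda>v. u s v $ i) (\<lambda>v. u s v $ j) \<psi>))"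
proof -
  define st where "st = species_test i \<psi>"
  have st_m[measurable]: "st \<in> borel_measurable M" unfolding st_def by measurable
  define P where "P \<sigma> = (\<integral>\<^sup>+x. gain (sol \<sigma>) x * st x \<partial>M)" for \<sigma>
  define N where "N \<sigma> = (\<integral>\<^sup>+x. sol \<sigma> x * loss (sol \<sigma>) x * st x \<partial>M)" for \<sigma>
  have [measurable]: "P \<in> borel_measurable borel" "N \<in> borel_measurable borel"
    unfolding P_def N_def by measurable
  have c: "0 \<le> c" using \<psi>_bound[of 0] by linarith
  have \<psi>_W: "\<psi> v \<le> c * Wr (i, v)" for v
    using \<psi>_bound(2)[of v] mult_left_mono[OF Wr_ge_1[of "(i, v)"] c] by simp
  have P: "(\<integral>\<^sup>+x. \<integral>\<^sup>+y. phase (u s) x * phase (u s) y * gain_adj st x y \<partial>M \<partial>M) = P (\<tau> s)" for s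
    unfolding P_def by (subst gain_weak, measurable, rule double_integral_cong_AE[OF phase_u])
  have N: "(\<integral>\<^sup>+x. \<integral>\<^sup>+y. phase (u s) x * phase (u s) y * (ennreal (speed x y) * st x) \<partial>M \<partial>M) = N (\<tau> s)" for s
    unfolding N_def by (subst double_integral_loss[symmetric], measurable, rule double_integral_cong_AE[OF phase_u])
  have sp: "(\<integral>\<^sup>+x. \<integral>\<^sup>+y. phase (u s) x * phase (u s) y * ennreal (speed x y) \<partial>M \<partial>M) \<le> ennreal rate_bound"
    if "s \<in> {0..T}" for s
    using double_integral_cong_AE[OF phase_u[of s], of "\<lambda>x y. ennreal (speed x y)"] sol_speed_le[of s] by simp
  have fin: "(\<integral>\<^sup>+x. \<integral>\<^sup>+y. phase (u s) x * phase (u s) y * ennreal (speed x y) \<partial>M \<partial>M) < \<top>"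
    if "s \<in> {0..T}" for s
    using sp[OF that] by (rule le_less_trans) simp
  have coll: "(\<Sum>j\<in>UNIV. collision_weak m (B s) i j (\<lambda>v. u s v $ i) (\<lambda>v. u s v $ j) \<psi>) = \<gamma> s * (enn2real (P (\<tau> s)) - enn2real (N (\<tau> s)))"
    if Bs: "\<forall>u h. h \<in> borel_measurable borel \<longrightarrow> (LINT z|B s u. h z) = norm u * \<gamma> s * (LINT z|\<beta> u. (h z :: real))"
      and s: "0 < s" "s < t" for s
    unfolding P[symmetric] N[symmetric] st_def
    by (rule collision_weak_eq(1)[OF Bs[rule_format] \<gamma>_nonneg \<psi> \<psi>_bound u_borel]) (use s t in \<open>auto intro!: fin\<close>)
  have bnd: "P (\<tau> s) \<le> ennreal (c * rate_bound)" "N (\<tau> s) \<le> ennreal (c * rate_bound)" if s: "s \<in> {0..t}" for s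
  proof -
    have sT: "s \<in> {0..T}" using s t by auto
    \<comment> \<open>The bounds on \<open>P\<close> and \<open>N\<close> do not involve the rate;
      the null measure with \<open>g = 0\<close> meets the hypothesis on \<open>Bs\<close> at every
      time, also where \<open>B\<close> is not controlled.\<close>
    note cw = collision_weak_eq(2,3)[where Bs="\<lambda>_. null_measure borel" and g=0 and \<psi>=\<psi> and c=c and a="u s" and a'="u s" and i=i]
    have "P (\<tau> s) \<le> ennreal c * (\<integral>\<^sup>+x. \<integral>\<^sup>+y. phase (u s) x * phase (u s) y * ennreal (speed x y) \<partial>M \<partial>M)"
      unfolding P[symmetric] st_def by (rule cw(1)) (use \<psi>_bound fin[OF sT] in auto)
    also have "\<dots> \<le> ennreal c * ennreal rate_bound" by (intro mult_left_mono sp sT) simp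
    finally show "P (\<tau> s) \<le> ennreal (c * rate_bound)" using c rate_bound_nonneg by (simp add: ennreal_mult)
    have "N (\<tau> s) \<le> ennreal c * (\<integral>\<^sup>+x. \<integral>\<^sup>+y. phase (u s) x * phase (u s) y * ennreal (speed x y) \<partial>M \<partial>M)"
      unfolding N[symmetric] st_def by (rule cw(2)) (use \<psi>_bound fin[OF sT] in auto)
    also have "\<dots> \<le> ennreal c * ennreal rate_bound" by (intro mult_left_mono sp sT) simp
    finally show "N (\<tau> s) \<le> ennreal (c * rate_bound)" using c rate_bound_nonneg by (simp add: ennreal_mult)
  qed
  define p where "p = (\<integral>\<^sup>+s. ennreal (\<gamma> s) * P (\<tau> s) * indicator {0..t} s \<partial>lborel)"
  define n where "n = (\<integral>\<^sup>+s. ennreal (\<gamma> s) * N (\<tau> s) * indicator {0..t} s \<partial>lborel)"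
  have cb: "0 \<le> c * rate_bound" using c rate_bound_nonneg by simp
  have m: "(\<lambda>s. P (\<tau> s)) \<in> borel_measurable borel" "(\<lambda>s. N (\<tau> s)) \<in> borel_measurable borel" by measurable
  note pn = set_integral_enn2real_diff[OF m \<gamma>_borel \<gamma>_nonneg \<gamma>_le bnd cb] and np = set_integral_enn2real_diff(3)[OF m(2,1) \<gamma>_borel \<gamma>_nonneg \<gamma>_le bnd(2,1) cb]
  have pf: "p < \<top>" "n < \<top>" unfolding p_def n_def using pn(3) np by simp_all
  have "(LINT s|lebesgue_on {0<..<t}. (\<Sum>j\<in>UNIV. collision_weak m (B s) i j (\<lambda>v. u s v $ i) (\<lambda>v. u s v $ j) \<psi>)) =
    (LINT s:{0..t}|lborel. \<gamma> s * (enn2real (P (\<tau> s)) - enn2real (N (\<tau> s))))"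
  proof (rule integral_lebesgue_on_Ioo, measurable, use B_integral in eventually_elim, intro impI)
    fix s :: real
    assume "0 < s \<longrightarrow> s < T \<longrightarrow> (\<forall>u h. h \<in> borel_measurable borel \<longrightarrow> (LINT z|B s u. h z) = norm u * \<gamma> s * (LINT z|\<beta> u. (h z :: real)))"
      "0 < s" "s < t"
    then show "(\<Sum>j\<in>UNIV. collision_weak m (B s) i j (\<lambda>v. u s v $ i) (\<lambda>v. u s v $ j) \<psi>) = \<gamma> s * (enn2real (P (\<tau> s)) - enn2real (N (\<tau> s)))"
      using t by (intro coll) auto
  qed
  also have "\<dots> = enn2real p - enn2real n"
    unfolding p_def n_def by (rule pn(2))
  finally have I: "(LINT s|lebesgue_on {0<..<t}. (\<Sum>j\<in>UNIV. collision_weak m (B s) i j (\<lambda>v. u s v $ i) (\<lambda>v. u s v $ j) \<psi>)) = enn2real p - enn2real n" .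
  have eq: "(\<integral>\<^sup>+x. sol (\<tau> t) x * st x \<partial>M) + n = (\<integral>\<^sup>+x. phase f0 x * st x \<partial>M) + p"
    using sol_weak_equation[OF clock_nonneg st_m, of \<gamma> t]
    unfolding p_def n_def time_change[OF \<gamma>_borel \<gamma>_le G_nonneg \<open>P \<in> borel_measurable borel\<close> t(1)]
      time_change[OF \<gamma>_borel \<gamma>_le G_nonneg \<open>N \<in> borel_measurable borel\<close> t(1)]
    unfolding P_def N_def .
  have f1: "(\<integral>\<^sup>+x. sol (\<tau> t) x * st x \<partial>M) < \<top>"
    unfolding st_def by (subst nn_integral_species_test) (auto intro!: bounded_weak[where c=c] sol_W_fin clock_nonneg \<psi>_W)
  have f2: "(\<integral>\<^sup>+x. phase f0 x * st x \<partial>M) < \<top>"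
    unfolding st_def by (subst nn_integral_species_test) (use phase_f0_W \<psi>_W in \<open>auto intro!: bounded_weak[where c=c]\<close>)
  have "enn2real (\<integral>\<^sup>+x. sol (\<tau> t) x * st x \<partial>M) + enn2real n = enn2real (\<integral>\<^sup>+x. phase f0 x * st x \<partial>M) + enn2real p"
    using arg_cong[OF eq, of enn2real] unfolding enn2real_plus[OF f1 pf(2)] enn2real_plus[OF f2 pf(1)] .
  then show ?thesis
    unfolding I u_integral(2)[OF \<psi> \<psi>_bound(1) \<psi>_W] f0_integral(2)[OF \<psi> \<psi>_bound(1) \<psi>_W] st_def by simp
qed


lemma nn_integral_Icc_zero: "(\<integral>\<^sup>+s. h s * indicator {0..0::real} s \<partial>lborel) = 0" for h :: "real \<Rightarrow> ennreal"
proof -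
  have "(\<integral>\<^sup>+s. h s * indicator {0..0} s \<partial>lborel) = (\<integral>\<^sup>+s. 0 \<partial>(lborel :: real measure))"
    by (rule nn_integral_cong_AE) (use AE_lborel_singleton[of 0] in \<open>eventually_elim, auto\<close>)
  then show ?thesis by simp
qed

lemma u_initial: "AE v in lborel. u 0 v = f0 v"
proof -
  have "AE x in M. sol 0 x = phase f0 x"
    using sol_equation[of 0] by (simp add: nn_integral_Icc_zero)
  then have "\<forall>i. AE v in lborel. sol 0 (i, v) = phase f0 (i, v)"
    by (subst (asm) AE_phase_iff) simp_all
  then have "AE v in lborel. \<forall>i. sol 0 (i, v) = phase f0 (i, v)"
    by (intro eventually_all_finite) auto
  then show ?thesis
    by eventually_elim (simp add: vec_eq_iff phase_def f0_nonneg)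
qed

section \<open>Mass, momentum and energy of the solution\<close>

lemma u_sum:
  fixes \<theta> :: "'s \<times> (real^'d) \<Rightarrow> real"
  assumes \<theta>[measurable]: "\<theta> \<in> borel_measurable M" and \<theta>_bound: "\<And>x. 0 \<le> \<theta> x" "\<And>x. \<theta> x \<le> c * Wr x"
  shows "integrable lebesgue (\<lambda>v. u t v $ i * \<theta> (i, v))"
    and "(\<Sum>i\<in>UNIV. LINT v|lebesgue. u t v $ i * \<theta> (i, v)) = enn2real (\<integral>\<^sup>+x. sol (\<tau> t) x * ennreal (\<theta> x) \<partial>M)"
    and "(\<integral>\<^sup>+x. sol (\<tau> t) x * ennreal (\<theta> x) \<partial>M) < \<top>"
proof -
  have m[measurable]: "(\<lambda>v. \<theta> (i, v)) \<in> borel_measurable borel" for i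
    by (rule measurable_compose[OF pair_measurable \<theta>])
  note int = u_integral[OF m \<theta>_bound]
  show "integrable lebesgue (\<lambda>v. u t v $ i * \<theta> (i, v))" by (rule int(1))
  have fin: "(\<integral>\<^sup>+v. sol (\<tau> t) (i, v) * ennreal (\<theta> (i, v)) \<partial>lborel) < \<top>" for i
    by (rule bounded_weak[where c=c]) (use \<theta>_bound sol_W_fin[OF clock_nonneg] in auto)
  have eq: "(\<integral>\<^sup>+x. sol (\<tau> t) x * ennreal (\<theta> x) \<partial>M) = (\<Sum>i\<in>UNIV. \<integral>\<^sup>+v. sol (\<tau> t) (i, v) * ennreal (\<theta> (i, v)) \<partial>lborel)"
    by (rule nn_integral_phase_measure) measurable
  show "(\<integral>\<^sup>+x. sol (\<tau> t) x * ennreal (\<theta> x) \<partial>M) < \<top>"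
    unfolding eq using fin by simp
  show "(\<Sum>i\<in>UNIV. LINT v|lebesgue. u t v $ i * \<theta> (i, v)) = enn2real (\<integral>\<^sup>+x. sol (\<tau> t) x * ennreal (\<theta> x) \<partial>M)"
    unfolding eq int(2) using fin by (subst enn2real_sum) (auto simp: nn_integral_species_test)
qed

lemma u_invariant:
  fixes \<psi> :: "'s \<times> (real^'d) \<Rightarrow> real" and c c' :: real
  assumes \<psi>_m[measurable]: "\<psi> \<in> borel_measurable M" and \<psi>: "\<And>x. 0 \<le> \<psi> x" "\<And>x. \<psi> x \<le> c' * Wr x" and c: "0 \<le> c"
    and inv: "\<And>x y z. norm z \<le> 1 \<Longrightarrow> \<psi> (post x y z) + \<psi> (post y x (- z)) + c * energy_loss x y z = \<psi> x + \<psi> y"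
    and t: "0 \<le> t"
  shows "(\<Sum>i\<in>UNIV. LINT v|lebesgue. u t v $ i * \<psi> (i, v)) + c * enn2real (total_heat (\<tau> t)) =
    (\<Sum>i\<in>UNIV. LINT v|lebesgue. u 0 v $ i * \<psi> (i, v))"
proof -
  have heat0: "total_heat 0 = 0" unfolding total_heat_eq by (rule nn_integral_Icc_zero)
  have "total_heat (\<tau> t) < \<top>"
    using sol_W_bound[OF clock_nonneg[of \<gamma> t]] by (rule_tac le_less_trans[where y="ennreal K"]) (auto intro: order_trans[rotated])
  moreover have "(\<integral>\<^sup>+x. sol (\<tau> t) x * ennreal (\<psi> x) \<partial>M) + ennreal c * total_heat (\<tau> t) = (\<integral>\<^sup>+x. sol 0 x * ennreal (\<psi> x) \<partial>M)"
    using sol_invariant[OF \<psi>_m \<psi> c inv clock_nonneg[of \<gamma> t]] sol_invariant[OF \<psi>_m \<psi> c inv order_refl] by (simp add: heat0)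
  ultimately have "enn2real (\<integral>\<^sup>+x. sol (\<tau> t) x * ennreal (\<psi> x) \<partial>M) + c * enn2real (total_heat (\<tau> t)) = enn2real (\<integral>\<^sup>+x. sol 0 x * ennreal (\<psi> x) \<partial>M)"
    using u_sum(3)[OF \<psi>_m \<psi>, of t] c
    by (subst enn2real_plus[symmetric, of _ "ennreal c * total_heat (\<tau> t)", unfolded enn2real_mult enn2real_ennreal[OF c]]) (auto simp: ennreal_mult_less_top)
  then show ?thesis
    unfolding u_sum(2)[OF \<psi>_m \<psi>] by simp
qed

text \<open>The invariant is the indicator of species \<open>i\<close>; collisions do not change the
  species, hence \<open>c = 0\<close>.\<close>

lemma u_mass:
  assumes "0 \<le> t"
  shows "(LINT v|lebesgue. u t v $ i) = (LINT v|lebesgue. u 0 v $ i)"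
proof -
  define \<psi> where "\<psi> x = (if fst x = i then 1 else 0 :: real)" for x :: "'s \<times> (real^'d)"
  have m: "\<psi> \<in> borel_measurable M" unfolding \<psi>_def by (rule borel_phase_measurable) simp
  have b: "0 \<le> \<psi> x" "\<psi> x \<le> 1 * Wr x" for x using Wr_ge_1[of x] by (auto simp: \<psi>_def)
  have sum: "(\<Sum>j\<in>UNIV. LINT v|lebesgue. u t v $ j * \<psi> (j, v)) = (LINT v|lebesgue. u t v $ i)" for t
  proof -
    have "(\<Sum>j\<in>UNIV. LINT v|lebesgue. u t v $ j * \<psi> (j, v)) = (\<Sum>j\<in>UNIV. if j = i then (LINT v|lebesgue. u t v $ i) else 0)"
      by (intro sum.cong refl) (simp add: \<psi>_def)
    then show ?thesis by simp
  qed
  show ?thesis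
    using u_invariant[OF m b order_refl _ assms] unfolding sum by (simp add: \<psi>_def post_def)
qed

lemma u_integrable: "integrable lebesgue (\<lambda>v. u t v $ i)"
  using u_integral(1)[of "\<lambda>_. 1" 1] Wr_ge_1 by simp

lemma mass_velocity_le: "\<bar>m $ fst x * snd x $ l\<bar> \<le> (\<Sum>i\<in>UNIV. sqrt (m $ i)) * Wr x"
proof -
  have "\<bar>m $ fst x * snd x $ l\<bar> \<le> m $ fst x * norm (snd x)"
    using component_le_norm_cart[of "snd x" l] mass_pos[of "fst x"] by (simp add: abs_mult)
  also have "\<dots> = sqrt (m $ fst x) * rt x"
    unfolding rt_def using mass_pos[of "fst x"] by (simp flip: mult.assoc)
  also have "\<dots> \<le> (\<Sum>i\<in>UNIV. sqrt (m $ i)) * Wr x"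
  proof (intro mult_mono)
    show "sqrt (m $ fst x) \<le> (\<Sum>i\<in>UNIV. sqrt (m $ i))"
      using mass_pos by (intro member_le_sum) (auto simp: less_imp_le)
    show "rt x \<le> Wr x" unfolding Wr_def by (rule le_one_plus_square)
  qed (auto simp: rt_nonneg less_imp_le mass_pos intro!: sum_nonneg)
  finally show ?thesis .
qed

text \<open>A component \<open>q\<close> of the momentum has no sign, while invariants are tested
  with nonnegative functions. Adding \<open>c * Wr\<close>, which dominates \<open>|q|\<close>,
  makes it admissible; the energy identity, weighted by \<open>c\<close>, is subtracted at the
  end.\<close>

lemma u_momentum:
  assumes t: "0 \<le> t"
  shows "momentum m (u t) = momentum m (u 0)"
proof (rule vec_eq_iff[THEN iffD2], rule allI)
  fix l :: 'd
  define c where "c = (\<Sum>i\<in>UNIV. sqrt (m $ i))"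
  have c: "0 \<le> c" unfolding c_def by (intro sum_nonneg) (simp add: less_imp_le mass_pos)
  define q where "q x = m $ fst x * snd x $ l" for x :: "'s \<times> (real^'d)"
  define \<psi> where "\<psi> x = c * Wr x + q x" for x :: "'s \<times> (real^'d)"
  have q_le: "\<bar>q x\<bar> \<le> c * Wr x" for x unfolding q_def c_def by (rule mass_velocity_le)
  have q_m[measurable]: "q \<in> borel_measurable M" unfolding q_def by (rule borel_phase_measurable) simp
  have m: "\<psi> \<in> borel_measurable M" unfolding \<psi>_def by measurable
  have b: "0 \<le> \<psi> x" "\<psi> x \<le> (2 * c) * Wr x" for x using q_le[of x] unfolding \<psi>_def by auto
  have W: "0 \<le> Wr x" "Wr x \<le> 1 * Wr x" for x using Wr_ge_1[of x] by auto
  have "Wr (post x y z) + Wr (post y x (- z)) + 1 * energy_loss x y z = Wr x + Wr y" for x y z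
    using energy_collision[of x y z] by (simp add: Wr_def)
  note inv_W = this
  have "q (post x y z) + q (post y x (- z)) = q x + q y" for x y z
    using arg_cong[OF momentum_collision[of x y z], of "\<lambda>v. v $ l"] unfolding q_def by (simp add: post_def)
  note inv_q = this
  have inv: "\<psi> (post x y z) + \<psi> (post y x (- z)) + c * energy_loss x y z = \<psi> x + \<psi> y" for x y z
  proof -
    have "c * Wr (post x y z) + c * Wr (post y x (- z)) + c * energy_loss x y z = c * Wr x + c * Wr y"
      using arg_cong[OF inv_W[of x y z], of "\<lambda>r. c * r"] by (simp only: distrib_left mult_1)
    then show ?thesis unfolding \<psi>_def using inv_q[of x y z] by linarith
  qed
  have q_int: "integrable lebesgue (\<lambda>v. u t v $ i * q (i, v))" for t i
  proof -
    have "integrable lebesgue (\<lambda>v. u t v $ i * \<psi> (i, v) - c * (u t v $ i * Wr (i, v)))"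
      using u_sum(1)[OF m b, of t i] u_sum(1)[OF Wr_measurable W, of t i] by (intro Bochner_Integration.integrable_diff integrable_mult_right) auto
    then show ?thesis unfolding \<psi>_def by (simp add: algebra_simps)
  qed
  have mom: "momentum m (u t) $ l = (\<Sum>i\<in>UNIV. LINT v|lebesgue. u t v $ i * q (i, v))" for t
  proof -
    have "(LINT v|lebesgue. (m $ i * u t v $ i) *\<^sub>R v) $ l = (LINT v|lebesgue. u t v $ i * q (i, v))" for i
    proof -
      have vm: "(\<lambda>v. (m $ i * u t v $ i) *\<^sub>R v) \<in> borel_measurable lebesgue"
        by (rule measurable_completion) simp
      have W_int: "integrable lebesgue (\<lambda>v. c * (u t v $ i * Wr (i, v)))"
        using u_sum(1)[OF Wr_measurable W, of t i] by simp
      have "integrable lebesgue (\<lambda>v. (m $ i * u t v $ i) *\<^sub>R v)"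
      proof (rule Bochner_Integration.integrable_bound[OF W_int vm], rule AE_I2)
        fix v :: "real^'d"
        have "m $ i * norm v \<le> c * Wr (i, v)"
        proof -
          have "m $ i * norm v = sqrt (m $ i) * rt (i, v)"
            unfolding rt_def using mass_pos[of i] by (simp flip: mult.assoc)
          also have "\<dots> \<le> c * Wr (i, v)"
          proof (intro mult_mono)
            show "sqrt (m $ i) \<le> c"
              unfolding c_def using mass_pos by (intro member_le_sum) (auto simp: less_imp_le)
            show "rt (i, v) \<le> Wr (i, v)" unfolding Wr_def by (rule le_one_plus_square)
          qed (auto simp: rt_nonneg c)
          finally show ?thesis .
        qed
        then have "u t v $ i * (m $ i * norm v) \<le> u t v $ i * (c * Wr (i, v))"
          by (intro mult_left_mono) simp_all
        then show "norm ((m $ i * u t v $ i) *\<^sub>R v) \<le> norm (c * (u t v $ i * Wr (i, v)))"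
          using mass_pos[of i] c W(1)[of "(i, v)"] by (simp add: abs_mult mult_ac)
      qed
      then have "(LINT v|lebesgue. ((m $ i * u t v $ i) *\<^sub>R v) \<bullet> axis l 1) = (LINT v|lebesgue. (m $ i * u t v $ i) *\<^sub>R v) \<bullet> axis l 1"
        by (intro integral_inner_left)
      then show ?thesis
        unfolding q_def by (simp add: inner_axis mult_ac)
    qed
    then show ?thesis unfolding momentum_def by simp
  qed
  have split: "(\<Sum>i\<in>UNIV. LINT v|lebesgue. u t v $ i * \<psi> (i, v)) =
    c * (\<Sum>i\<in>UNIV. LINT v|lebesgue. u t v $ i * Wr (i, v)) + (\<Sum>i\<in>UNIV. LINT v|lebesgue. u t v $ i * q (i, v))" for t
  proof -
    have "(LINT v|lebesgue. u t v $ i * \<psi> (i, v)) = c * (LINT v|lebesgue. u t v $ i * Wr (i, v)) + (LINT v|lebesgue. u t v $ i * q (i, v))" for i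
    proof -
      have "(LINT v|lebesgue. u t v $ i * \<psi> (i, v)) = (LINT v|lebesgue. c * (u t v $ i * Wr (i, v)) + u t v $ i * q (i, v))"
        unfolding \<psi>_def by (simp add: algebra_simps)
      also have "\<dots> = (LINT v|lebesgue. c * (u t v $ i * Wr (i, v))) + (LINT v|lebesgue. u t v $ i * q (i, v))"
        using u_sum(1)[OF Wr_measurable W, of t i] q_int[of t i] by (intro Bochner_Integration.integral_add integrable_mult_right) auto
      finally show ?thesis by simp
    qed
    then show ?thesis by (simp add: sum.distrib sum_distrib_left)
  qed
  show "momentum m (u t) $ l = momentum m (u 0) $ l"
    using u_invariant[OF m b c inv t]
    unfolding mom split u_invariant[OF Wr_measurable W zero_le_one inv_W t, symmetric] by (simp add: distrib_left del: u_component)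
qed

lemma u_kinetic_energy:
  "kinetic_energy m (u t) = (\<Sum>i\<in>UNIV. LINT v|lebesgue. u t v $ i * (rt (i, v))\<^sup>2)"
proof -
  have "(\<lambda>v. m $ i * u t v $ i * (norm v)\<^sup>2) = (\<lambda>v. u t v $ i * (rt (i, v))\<^sup>2)" for i
    unfolding rt_def using mass_pos[of i] by (auto simp: power_mult_distrib)
  then show ?thesis unfolding kinetic_energy_def by (simp only:)
qed

lemma rt2_bounds: "0 \<le> (rt x)\<^sup>2" "(rt x)\<^sup>2 \<le> 1 * Wr x" and rt2_measurable: "(\<lambda>x. (rt x)\<^sup>2) \<in> borel_measurable M"
  by (auto simp: Wr_def)

text \<open>Kinetic energy plus \<open>total_heat\<close> is constant, and the heat is the integral
  of a nonnegative rate up to a nondecreasing clock value.\<close>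

lemma u_energy_antimono: "antimono_on {0..T} (\<lambda>t. kinetic_energy m (u t))"
proof (rule monotone_onI)
  fix s t assume st: "s \<in> {0..T}" "t \<in> {0..T}" "s \<le> t"
  have bal: "kinetic_energy m (u r) + enn2real (total_heat (\<tau> r)) = kinetic_energy m (u 0)" if "0 \<le> r" for r
    using u_invariant[OF rt2_measurable rt2_bounds zero_le_one _ that] energy_collision unfolding u_kinetic_energy by simp
  have "total_heat (\<tau> s) \<le> total_heat (\<tau> t)"
    unfolding total_heat_eq using clock_mono[of s t] st
    by (intro nn_integral_mono) (auto split: split_indicator)
  moreover have "total_heat (\<tau> t) < \<top>"
    using sol_W_bound[OF clock_nonneg[of \<gamma> t]] by (rule_tac le_less_trans[where y="ennreal K"]) (auto intro: order_trans[rotated])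
  ultimately have "enn2real (total_heat (\<tau> s)) \<le> enn2real (total_heat (\<tau> t))"
    by (rule enn2real_mono)
  then show "kinetic_energy m (u s) \<ge> kinetic_energy m (u t)"
    using bal[of s] bal[of t] st by simp
qed

text \<open>Zero energy would confine the density to \<open>v = 0\<close>, a null set, against the
  positive mass of species \<open>i\<close>.\<close>

lemma u_energy_pos:
  assumes mass: "0 < (LINT v|lebesgue. u t v $ i)"
  shows "0 < kinetic_energy m (u t)"
proof (rule ccontr)
  assume "\<not> 0 < kinetic_energy m (u t)"
  then have "enn2real (\<integral>\<^sup>+x. sol (\<tau> t) x * ennreal ((rt x)\<^sup>2) \<partial>M) = 0"
    unfolding u_kinetic_energy u_sum(2)[OF rt2_measurable rt2_bounds] by (simp add: not_less antisym)
  then have "(\<integral>\<^sup>+x. sol (\<tau> t) x * ennreal ((rt x)\<^sup>2) \<partial>M) = 0"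
    using u_sum(3)[OF rt2_measurable rt2_bounds, of t] by (auto simp: enn2real_eq_0_iff)
  then have "AE x in M. sol (\<tau> t) x * ennreal ((rt x)\<^sup>2) = 0"
    by (subst (asm) nn_integral_0_iff_AE) auto
  then have "\<forall>i. AE v in lborel. sol (\<tau> t) (i, v) * ennreal ((rt (i, v))\<^sup>2) = 0"
    by (subst (asm) AE_phase_iff) simp_all
  then have "AE v in lborel. sol (\<tau> t) (i, v) * ennreal ((rt (i, v))\<^sup>2) = 0" ..
  then have "AE v in lborel. u t v $ i = 0"
    using AE_lborel_singleton[of 0]
    by eventually_elim (use mass_pos[of i] in \<open>auto simp: rt_def\<close>)
  then have "(LINT v|lebesgue. u t v $ i) = (LINT v|(lborel :: (real^'d) measure). 0)"
    by (intro lebesgue_integral_AE(1)) auto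
  then show False using mass by simp
qed

lemma test_function_bounded:
  assumes "test_function \<psi>"
  obtains c where "0 \<le> c" "\<And>v. \<bar>\<psi> v\<bar> \<le> c" "\<psi> \<in> borel_measurable borel"
proof -
  define S where "S = closure {v. \<psi> v \<noteq> 0}"
  have "compact (\<psi> ` S)"
    using assms unfolding test_function_def S_def by (intro compact_continuous_image) (auto intro: continuous_on_subset)
  then have "bounded (\<psi> ` S)" by (rule compact_imp_bounded)
  then obtain c where "\<forall>x\<in>\<psi> ` S. norm x \<le> c"
    unfolding bounded_iff by blast
  then have c: "\<bar>\<psi> v\<bar> \<le> c" if "v \<in> S" for v using that by auto
  have "\<bar>\<psi> v\<bar> \<le> max c 0" for v
  proof (cases "\<psi> v = 0")
    case False
    then have "v \<in> S" unfolding S_def using closure_subset[of "{v. \<psi> v \<noteq> 0}"] by auto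
    then have "\<bar>\<psi> v\<bar> \<le> c" by (rule c)
    then show ?thesis by simp
  qed simp
  moreover have "\<psi> \<in> borel_measurable borel"
    using assms unfolding test_function_def by (intro borel_measurable_continuous_onI) auto
  ultimately show ?thesis by (intro that[of "max c 0"]) auto
qed

text \<open>A signed test function becomes nonnegative after adding a constant. The weak operator
  does not see constants, and the extra term is a multiple of the mass, which is conserved.\<close>

lemma u_weak:
  assumes \<psi>: "test_function \<psi>" and t: "0 \<le> t" "t \<le> T"
  shows "(LINT v|lebesgue. u t v $ i * \<psi> v) = (LINT v|lebesgue. f0 v $ i * \<psi> v) +
    (LINT s|lebesgue_on {0<..<t}. (\<Sum>j\<in>UNIV. collision_weak m (B s) i j (\<lambda>v. u s v $ i) (\<lambda>v. u s v $ j) \<psi>))"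
proof -
  obtain c where c: "0 \<le> c" "\<And>v. \<bar>\<psi> v\<bar> \<le> c" and [measurable]: "\<psi> \<in> borel_measurable borel"
    using test_function_bounded[OF \<psi>] by blast
  define \<phi> where "\<phi> v = \<psi> v + c" for v
  have \<phi>m[measurable]: "\<phi> \<in> borel_measurable borel" unfolding \<phi>_def by measurable
  have \<phi>: "0 \<le> \<phi> v" "\<phi> v \<le> 2 * c" for v using c(2)[of v] unfolding \<phi>_def by auto
  have \<phi>W: "\<phi> v \<le> 2 * c * Wr (i, v)" for v
    using \<phi>(2)[of v] mult_left_mono[OF Wr_ge_1[of "(i, v)"], of "2 * c"] c(1) by simp
  have cw: "collision_weak m (B s) i j a b \<phi> = collision_weak m (B s) i j a b \<psi>" for s j a b
    unfolding collision_weak_def \<phi>_def by simp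
  have u_split: "(LINT v|lebesgue. u t v $ i * \<phi> v) = (LINT v|lebesgue. u t v $ i * \<psi> v) + c * (LINT v|lebesgue. u t v $ i)" for t
  proof -
    have "integrable lebesgue (\<lambda>v. u t v $ i * \<phi> v - c * u t v $ i)"
      using u_integral(1)[OF \<phi>m \<phi>(1) \<phi>W, of t] u_integrable[of t i] by (intro Bochner_Integration.integrable_diff integrable_mult_right) auto
    then have "integrable lebesgue (\<lambda>v. u t v $ i * \<psi> v)" unfolding \<phi>_def by (simp add: algebra_simps)
    then have "(LINT v|lebesgue. u t v $ i * \<psi> v + c * u t v $ i) = (LINT v|lebesgue. u t v $ i * \<psi> v) + (LINT v|lebesgue. c * u t v $ i)"
      using u_integrable[of t i] by (intro Bochner_Integration.integral_add integrable_mult_right) auto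
    then show ?thesis unfolding \<phi>_def by (simp add: algebra_simps)
  qed
  have f0_eq: "(LINT v|lebesgue. f0 v $ i * h v) = (LINT v|lebesgue. u 0 v $ i * h v)" if [measurable]: "h \<in> borel_measurable borel" for h
  proof -
    have "(LINT v|lebesgue. u 0 v $ i * h v) = (LINT v|lborel. f0 v $ i * h v)"
      by (rule lebesgue_integral_AE(1), measurable, use u_initial in eventually_elim, simp)
    also have "\<dots> = (LINT v|lebesgue. f0 v $ i * h v)"
      by (rule integral_completion[symmetric]) measurable
    finally show ?thesis ..
  qed
  show ?thesis
    using u_weak_bounded[OF \<phi>m \<phi> t, of i] u_mass[OF t(1), of i] unfolding cw f0_eq[OF \<phi>m] u_split f0_eq[OF \<open>\<psi> \<in> borel_measurable borel\<close>] by simp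
qed

end

section \<open>Uniqueness\<close>

lemma enn2real_inject: "x < \<top> \<Longrightarrow> y < \<top> \<Longrightarrow> enn2real x = enn2real y \<Longrightarrow> x = y"
  by (cases x; cases y) auto

section \<open>A competing solution and the regularity of its collision rates\<close>

text \<open>\<open>h\<close> is a Borel representative, at each time separately, of another
  solution, set to 0 outside \<open>{0..T}\<close>. Joint measurability in time and velocity is not
  assumed, so measurability in time has to come from \<open>h_cont\<close>. The second moment is
  bounded at every time and the third at almost every time, as continuity and the essential bound
  provide.\<close>

locale comparison = boltzmann_problem m \<beta> f0 \<gamma> B G T K V0
  for m :: "real^'s" and \<beta> :: "real^'d \<Rightarrow> (real^'d) measure" and f0 \<gamma> B G T K V0 +
  fixes h :: "real \<Rightarrow> real^'d \<Rightarrow> real^'s" and Kh Vh :: real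
  assumes h_borel [measurable]: "\<And>t i. (\<lambda>v. h t v $ i) \<in> borel_measurable borel"
    and h_nonneg: "0 \<le> h t v $ i"
    and h_outside: "t \<notin> {0..T} \<Longrightarrow> h t v = 0"
    and h_cont: "t \<in> {0..T} \<Longrightarrow>
      ((\<lambda>s. \<integral>\<^sup>+x. ennreal \<bar>h s (snd x) $ fst x - h t (snd x) $ fst x\<bar> * ennreal (Wr x) \<partial>M) \<longlongrightarrow> 0) (at t within {0..T})"
    and h_W: "(\<integral>\<^sup>+x. phase (h t) x * ennreal (Wr x) \<partial>M) \<le> ennreal Kh" and Kh_nonneg: "0 \<le> Kh"
    and h_V: "AE t in lborel. (\<integral>\<^sup>+x. phase (h t) x * ennreal (Vr x) \<partial>M) \<le> ennreal Vh" and Vh_nonneg: "0 \<le> Vh"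
    and h_weak: "test_function \<psi> \<Longrightarrow> (\<And>v. 0 \<le> \<psi> v) \<Longrightarrow> t \<in> {0..T} \<Longrightarrow>
      enn2real (\<integral>\<^sup>+x. phase (h t) x * species_test i \<psi> x \<partial>M) =
      enn2real (\<integral>\<^sup>+x. phase f0 x * species_test i \<psi> x \<partial>M) +
      (LINT s|lebesgue_on {0<..<t}. \<gamma> s *
        (enn2real (\<integral>\<^sup>+x. gain (phase (h s)) x * species_test i \<psi> x \<partial>M) -
         enn2real (\<integral>\<^sup>+x. phase (h s) x * loss (phase (h s)) x * species_test i \<psi> x \<partial>M)))"
begin

abbreviation H :: "real \<Rightarrow> 's \<times> (real^'d) \<Rightarrow> ennreal" where "H t \<equiv> phase (h t)"

lemma H_measurable [measurable]: "H t \<in> borel_measurable M"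
  by (rule phase_measurable) simp

lemma gain_H_measurable [measurable]: "gain (H t) \<in> borel_measurable M"
  using measurable_compose[OF measurable_Pair1' gain_measurable[of "\<lambda>_. H t" "borel :: real measure"], of 0] by simp

lemma loss_H_measurable [measurable]: "loss (H t) \<in> borel_measurable M"
  unfolding loss_def by measurable

definition dist_W :: "real \<Rightarrow> real \<Rightarrow> ennreal" where
  "dist_W s t = (\<integral>\<^sup>+x. ennreal \<bar>h s (snd x) $ fst x - h t (snd x) $ fst x\<bar> * ennreal (Wr x) \<partial>M)"

lemma dist_W_sym: "dist_W s t = dist_W t s"
  unfolding dist_W_def by (simp add: abs_minus_commute)

text \<open>The product \<open>H s x * H s y\<close> is compared with \<open>H t x * H t y\<close>
  through \<open>H t x * H s y\<close>; the bound on \<open>q\<close> turns each difference into a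
  second moment times \<open>dist_W\<close>.\<close>

lemma quadratic_le:
  assumes q: "(\<lambda>p. q (fst p) (snd p)) \<in> borel_measurable (M \<Otimes>\<^sub>M M)"
    and q_le: "\<And>x y. q x y \<le> ennreal c * (ennreal (Wr x) * ennreal (Wr y))"
  shows "(\<integral>\<^sup>+x. \<integral>\<^sup>+y. H s x * H s y * q x y \<partial>M \<partial>M) \<le>
    (\<integral>\<^sup>+x. \<integral>\<^sup>+y. H t x * H t y * q x y \<partial>M \<partial>M) + ennreal c * (2 * ennreal Kh) * dist_W s t"
proof -
  note [measurable (raw)] = measurable_compose_pair[OF q]
  define d where "d x = ennreal \<bar>h s (snd x) $ fst x - h t (snd x) $ fst x\<bar>" for x
  have [measurable]: "d \<in> borel_measurable M" unfolding d_def by (rule borel_phase_measurable) simp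
  have Hd: "H s x \<le> H t x + d x" for x
  proof -
    have "ennreal (h s (snd x) $ fst x) \<le> ennreal (h t (snd x) $ fst x + \<bar>h s (snd x) $ fst x - h t (snd x) $ fst x\<bar>)"
      by (intro ennreal_leI) linarith
    also have "\<dots> = ennreal (h t (snd x) $ fst x) + ennreal \<bar>h s (snd x) $ fst x - h t (snd x) $ fst x\<bar>"
      by (rule ennreal_plus) (auto simp: h_nonneg)
    finally show ?thesis unfolding phase_def d_def .
  qed
  have "(\<integral>\<^sup>+x. \<integral>\<^sup>+y. H s x * H s y * q x y \<partial>M \<partial>M) \<le>
    (\<integral>\<^sup>+x. \<integral>\<^sup>+y. H t x * H t y * q x y + (H t x * d y * q x y + d x * H s y * q x y) \<partial>M \<partial>M)"
  proof (intro nn_integral_mono)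
    fix x y
    have "H s x * H s y \<le> (H t x + d x) * H s y" by (intro mult_right_mono Hd) simp
    also have "\<dots> = H t x * H s y + d x * H s y" by (rule distrib_right)
    also have "\<dots> \<le> H t x * (H t y + d y) + d x * H s y" by (intro add_mono mult_left_mono Hd) auto
    finally have "H s x * H s y * q x y \<le> (H t x * (H t y + d y) + d x * H s y) * q x y"
      by (rule mult_right_mono) simp
    then show "H s x * H s y * q x y \<le> H t x * H t y * q x y + (H t x * d y * q x y + d x * H s y * q x y)"
      by (simp add: distrib_left distrib_right add_ac)
  qed
  also have "\<dots> = (\<integral>\<^sup>+x. \<integral>\<^sup>+y. H t x * H t y * q x y \<partial>M \<partial>M) + ((\<integral>\<^sup>+x. \<integral>\<^sup>+y. H t x * d y * q x y \<partial>M \<partial>M) + (\<integral>\<^sup>+x. \<integral>\<^sup>+y. d x * H s y * q x y \<partial>M \<partial>M))"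
    by (simp add: nn_integral_add)
  also have "\<dots> \<le> (\<integral>\<^sup>+x. \<integral>\<^sup>+y. H t x * H t y * q x y \<partial>M \<partial>M) + (ennreal c * (ennreal Kh * dist_W s t) + ennreal c * (dist_W s t * ennreal Kh))"
  proof (intro add_left_mono add_mono)
    have e: "(\<integral>\<^sup>+x. d x * ennreal (Wr x) \<partial>M) = dist_W s t" unfolding d_def dist_W_def ..
    show "(\<integral>\<^sup>+x. \<integral>\<^sup>+y. H t x * d y * q x y \<partial>M \<partial>M) \<le> ennreal c * (ennreal Kh * dist_W s t)"
      by (rule order_trans[OF quadratic_form_le[OF _ _ q_le]], measurable) (auto simp: e intro!: mult_left_mono mult_right_mono h_W)
    show "(\<integral>\<^sup>+x. \<integral>\<^sup>+y. d x * H s y * q x y \<partial>M \<partial>M) \<le> ennreal c * (dist_W s t * ennreal Kh)"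
      by (rule order_trans[OF quadratic_form_le[OF _ _ q_le]], measurable) (auto simp: e intro!: mult_left_mono h_W)
  qed
  also have "ennreal c * (ennreal Kh * dist_W s t) + ennreal c * (dist_W s t * ennreal Kh) = ennreal c * (2 * ennreal Kh) * dist_W s t"
    by (simp add: mult_ac flip: mult_2)
  finally show ?thesis .
qed

text \<open>Used in both directions, \<open>quadratic_le\<close> makes the form continuous in time
  on \<open>{0..T}\<close>, hence Borel there, and outside it vanishes. This stands in for joint
  measurability of \<open>h\<close>.\<close>

lemma quadratic_measurable:
  assumes q: "(\<lambda>p. q (fst p) (snd p)) \<in> borel_measurable (M \<Otimes>\<^sub>M M)"
    and q_le: "\<And>x y. q x y \<le> ennreal c * (ennreal (Wr x) * ennreal (Wr y))" and c: "0 \<le> c"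
  shows "(\<lambda>s. \<integral>\<^sup>+x. \<integral>\<^sup>+y. H s x * H s y * q x y \<partial>M \<partial>M) \<in> borel_measurable borel"
    and "(\<integral>\<^sup>+x. \<integral>\<^sup>+y. H s x * H s y * q x y \<partial>M \<partial>M) \<le> ennreal (c * Kh * Kh)"
proof -
  define X where "X s = (\<integral>\<^sup>+x. \<integral>\<^sup>+y. H s x * H s y * q x y \<partial>M \<partial>M)" for s
  note [measurable (raw)] = measurable_compose_pair[OF q]
  have X_le: "X s \<le> ennreal (c * Kh * Kh)" for s
  proof -
    have "X s \<le> ennreal c * ((\<integral>\<^sup>+x. H s x * ennreal (Wr x) \<partial>M) * (\<integral>\<^sup>+x. H s x * ennreal (Wr x) \<partial>M))"
      unfolding X_def by (intro quadratic_form_le H_measurable q_le)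
    also have "\<dots> \<le> ennreal c * (ennreal Kh * ennreal Kh)"
      by (intro mult_mono h_W) auto
    finally show ?thesis using c Kh_nonneg by (simp add: ennreal_mult mult.assoc)
  qed
  then show "(\<integral>\<^sup>+x. \<integral>\<^sup>+y. H s x * H s y * q x y \<partial>M \<partial>M) \<le> ennreal (c * Kh * Kh)" unfolding X_def .
  have X_fin: "X s < \<top>" for s using X_le[of s] by (rule le_less_trans) simp
  have "continuous_on {0..T} X"
    unfolding continuous_on_def
  proof
    fix t assume t: "t \<in> {0..T}"
    define b where "b = ennreal c * (2 * ennreal Kh)"
    have b: "b < \<top>" unfolding b_def by (simp add: ennreal_mult_less_top)
    have le1: "X s \<le> X t + b * dist_W s t" and le2: "X t \<le> X s + b * dist_W s t" for s
      using quadratic_le[OF q q_le, of s t] quadratic_le[OF q q_le, of t s] unfolding X_def b_def dist_W_sym[of t s] by auto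
    have d0: "((\<lambda>s. dist_W s t) \<longlongrightarrow> 0) (at t within {0..T})"
      using h_cont[OF t] unfolding dist_W_def .
    have "((\<lambda>s. b * dist_W s t) \<longlongrightarrow> b * 0) (at t within {0..T})"
      by (rule ennreal_tendsto_cmult[OF b d0])
    then have bd: "((\<lambda>s. b * dist_W s t) \<longlongrightarrow> 0) (at t within {0..T})" by simp
    have "((\<lambda>s. X t + b * dist_W s t) \<longlongrightarrow> X t + 0) (at t within {0..T})"
      by (intro tendsto_add tendsto_const bd)
    then have up: "((\<lambda>s. X t + b * dist_W s t) \<longlongrightarrow> X t) (at t within {0..T})" by simp
    have "((\<lambda>s. X t - b * dist_W s t) \<longlongrightarrow> X t - 0) (at t within {0..T})"
      using X_fin[of t] by (intro tendsto_diff_ennreal tendsto_const bd) auto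
    then have low: "((\<lambda>s. X t - b * dist_W s t) \<longlongrightarrow> X t) (at t within {0..T})" by simp
    show "(X \<longlongrightarrow> X t) (at t within {0..T})"
    proof (rule tendsto_sandwich[OF _ _ low up])
      show "\<forall>\<^sub>F s in at t within {0..T}. X t - b * dist_W s t \<le> X s"
        using le2 X_fin[of t] by (intro always_eventually allI) (auto simp: ennreal_minus_le_iff add.commute)
      show "\<forall>\<^sub>F s in at t within {0..T}. X s \<le> X t + b * dist_W s t"
        using le1 by (intro always_eventually allI)
    qed
  qed
  then have "X \<in> borel_measurable (restrict_space borel {0..T})"
    by (rule borel_measurable_continuous_on_restrict)
  then have "(\<lambda>s. X s * indicator {0..T} s) \<in> borel_measurable borel"
    by (subst (asm) borel_measurable_restrict_space_iff_ennreal) auto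
  moreover have "X s * indicator {0..T} s = X s" for s
    using h_outside[of s] by (cases "s \<in> {0..T}") (auto simp: X_def phase_def)
  ultimately show "(\<lambda>s. \<integral>\<^sup>+x. \<integral>\<^sup>+y. H s x * H s y * q x y \<partial>M \<partial>M) \<in> borel_measurable borel"
    unfolding X_def by simp
qed

lemma bounded_test_rates:
  assumes [measurable]: "\<psi> \<in> borel_measurable M" and \<psi>: "\<And>x. \<psi> x \<le> ennreal c" and c: "0 \<le> c"
  shows "(\<lambda>s. \<integral>\<^sup>+x. gain (H s) x * \<psi> x \<partial>M) \<in> borel_measurable borel"
    and "(\<lambda>s. \<integral>\<^sup>+x. H s x * loss (H s) x * \<psi> x \<partial>M) \<in> borel_measurable borel"
    and "(\<integral>\<^sup>+x. gain (H s) x * \<psi> x \<partial>M) \<le> ennreal (2 * c0 * c * Kh * Kh)"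
    and "(\<integral>\<^sup>+x. H s x * loss (H s) x * \<psi> x \<partial>M) \<le> ennreal (2 * c0 * c * Kh * Kh)"
proof -
  have P: "(\<integral>\<^sup>+x. gain (H s) x * \<psi> x \<partial>M) = (\<integral>\<^sup>+x. \<integral>\<^sup>+y. H s x * H s y * gain_adj \<psi> x y \<partial>M \<partial>M)" for s
    by (rule gain_weak) measurable
  have N: "(\<integral>\<^sup>+x. H s x * loss (H s) x * \<psi> x \<partial>M) = (\<integral>\<^sup>+x. \<integral>\<^sup>+y. H s x * H s y * (ennreal (speed x y) * \<psi> x) \<partial>M \<partial>M)" for s
    by (rule double_integral_loss[symmetric]) measurable
  have sc: "ennreal (speed x y) * ennreal c \<le> ennreal (2 * c0 * c) * (ennreal (Wr x) * ennreal (Wr y))" for x y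
  proof -
    have "ennreal (speed x y) * ennreal c \<le> ennreal (2 * c0) * (ennreal (Wr x) * ennreal (Wr y)) * ennreal c"
      by (intro mult_right_mono speed_le_Wr) simp
    then show ?thesis using c c0_nonneg by (simp add: ennreal_mult mult_ac)
  qed
  have q1: "gain_adj \<psi> x y \<le> ennreal (2 * c0 * c) * (ennreal (Wr x) * ennreal (Wr y))" for x y
  proof -
    interpret p: prob_space "\<beta> (snd x - snd y)" by (rule prob_\<beta>)
    have "(\<integral>\<^sup>+z. \<psi> (post x y z) \<partial>\<beta> (snd x - snd y)) \<le> (\<integral>\<^sup>+z. ennreal c \<partial>\<beta> (snd x - snd y))"
      by (intro nn_integral_mono \<psi>)
    also have "\<dots> = ennreal c" by (simp add: p.emeasure_space_1[simplified])
    finally have "gain_adj \<psi> x y \<le> ennreal (speed x y) * ennreal c"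
      unfolding gain_adj_def by (intro mult_left_mono) auto
    then show ?thesis using sc order_trans by blast
  qed
  have q2: "ennreal (speed x y) * \<psi> x \<le> ennreal (2 * c0 * c) * (ennreal (Wr x) * ennreal (Wr y))" for x y
    by (rule order_trans[OF mult_left_mono[OF \<psi>] sc]) simp
  have m1: "(\<lambda>p. gain_adj \<psi> (fst p) (snd p)) \<in> borel_measurable (M \<Otimes>\<^sub>M M)"
    and m2: "(\<lambda>p. ennreal (speed (fst p) (snd p)) * \<psi> (fst p)) \<in> borel_measurable (M \<Otimes>\<^sub>M M)"
    by measurable
  have cc: "0 \<le> 2 * c0 * c" using c c0_nonneg by simp
  show "(\<lambda>s. \<integral>\<^sup>+x. gain (H s) x * \<psi> x \<partial>M) \<in> borel_measurable borel"
    "(\<integral>\<^sup>+x. gain (H s) x * \<psi> x \<partial>M) \<le> ennreal (2 * c0 * c * Kh * Kh)"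
    unfolding P by (rule quadratic_measurable[OF m1 q1 cc])+
  show "(\<lambda>s. \<integral>\<^sup>+x. H s x * loss (H s) x * \<psi> x \<partial>M) \<in> borel_measurable borel"
    "(\<integral>\<^sup>+x. H s x * loss (H s) x * \<psi> x \<partial>M) \<le> ennreal (2 * c0 * c * Kh * Kh)"
    unfolding N by (rule quadratic_measurable[OF m2 q2 cc])+
qed

lemma species_test_le: "(\<And>v. \<psi> v \<le> c) \<Longrightarrow> species_test i \<psi> x \<le> ennreal c"
  unfolding species_test_def by (auto intro: ennreal_leI)

text \<open>The real form restates the hypothesis on \<open>h\<close> with Borel integrals. The
  second form has the loss on the left and lives in \<open>ennreal\<close>, where it survives the
  passage to the unbounded weight in \<open>H_energy_equation\<close>.\<close>

lemma H_weak:
  assumes \<psi>: "test_function \<psi>" "\<And>v. 0 \<le> \<psi> v" and t: "t \<in> {0..T}"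
  shows "enn2real (\<integral>\<^sup>+x. H t x * species_test i \<psi> x \<partial>M) = enn2real (\<integral>\<^sup>+x. phase f0 x * species_test i \<psi> x \<partial>M) +
      (LINT s:{0..t}|lborel. \<gamma> s *
        (enn2real (\<integral>\<^sup>+x. gain (H s) x * species_test i \<psi> x \<partial>M) -
         enn2real (\<integral>\<^sup>+x. H s x * loss (H s) x * species_test i \<psi> x \<partial>M)))" (is ?real)
    and "(\<integral>\<^sup>+x. H t x * species_test i \<psi> x \<partial>M) +
      (\<integral>\<^sup>+s. ennreal (\<gamma> s) * (\<integral>\<^sup>+x. H s x * loss (H s) x * species_test i \<psi> x \<partial>M) * indicator {0..t} s \<partial>lborel) =
      (\<integral>\<^sup>+x. phase f0 x * species_test i \<psi> x \<partial>M) +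
      (\<integral>\<^sup>+s. ennreal (\<gamma> s) * (\<integral>\<^sup>+x. gain (H s) x * species_test i \<psi> x \<partial>M) * indicator {0..t} s \<partial>lborel)"
proof -
  obtain c where c: "0 \<le> c" "\<And>v. \<bar>\<psi> v\<bar> \<le> c" and [measurable]: "\<psi> \<in> borel_measurable borel"
    using test_function_bounded[OF \<psi>(1)] by blast
  have c': "\<psi> v \<le> c" for v using c(2)[of v] by simp
  define st where "st = species_test i \<psi>"
  have st[measurable]: "st \<in> borel_measurable M" unfolding st_def by measurable
  have st_le: "st x \<le> ennreal c" for x unfolding st_def by (rule species_test_le) (rule c')
  note r = bounded_test_rates[OF st st_le c(1)]
  define P where "P s = (\<integral>\<^sup>+x. gain (H s) x * st x \<partial>M)" for s
  define N where "N s = (\<integral>\<^sup>+x. H s x * loss (H s) x * st x \<partial>M)" for s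
  have [measurable]: "P \<in> borel_measurable borel" "N \<in> borel_measurable borel"
    unfolding P_def N_def by (rule r)+
  have "(LINT s|lebesgue_on {0<..<t}. \<gamma> s * (enn2real (P s) - enn2real (N s))) = (LINT s:{0..t}|lborel. \<gamma> s * (enn2real (P s) - enn2real (N s)))"
    by (rule integral_lebesgue_on_Ioo) auto
  then show R: ?real
    using h_weak[OF \<psi> t, of i] unfolding P_def N_def st_def by simp
  have bb: "0 \<le> 2 * c0 * c * Kh * Kh" using c c0_nonneg Kh_nonneg by simp
  have P_le: "P s \<le> ennreal (2 * c0 * c * Kh * Kh)" and N_le: "N s \<le> ennreal (2 * c0 * c * Kh * Kh)" for s
    unfolding P_def N_def by (rule r)+
  note D = set_integral_enn2real_diff[OF \<open>P \<in> _\<close> \<open>N \<in> _\<close> \<gamma>_borel \<gamma>_nonneg \<gamma>_le P_le N_le bb, of t]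
  define p where "p = (\<integral>\<^sup>+s. ennreal (\<gamma> s) * P s * indicator {0..t} s \<partial>lborel)"
  define n where "n = (\<integral>\<^sup>+s. ennreal (\<gamma> s) * N s * indicator {0..t} s \<partial>lborel)"
  have pf: "p < \<top>" unfolding p_def by (rule D(3))
  have nf: "n < \<top>" unfolding n_def
    by (rule set_integral_enn2real_diff(3)[OF \<open>N \<in> _\<close> \<open>P \<in> _\<close> \<gamma>_borel \<gamma>_nonneg \<gamma>_le N_le P_le bb])
  have \<psi>W: "\<psi> v \<le> c * Wr (i, v)" for v
    using c'[of v] mult_left_mono[OF Wr_ge_1[of "(i, v)"] c(1)] by simp
  have a: "(\<integral>\<^sup>+x. H t x * st x \<partial>M) < \<top>" "(\<integral>\<^sup>+x. phase f0 x * st x \<partial>M) < \<top>"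
    unfolding st_def using \<psi>W phase_f0_W le_less_trans[OF h_W ennreal_less_top]
    by (subst nn_integral_species_test; auto intro!: bounded_weak[where c=c])+
  have "enn2real (\<integral>\<^sup>+x. H t x * st x \<partial>M) + enn2real n = enn2real (\<integral>\<^sup>+x. phase f0 x * st x \<partial>M) + enn2real p"
    using R D(2) unfolding p_def n_def P_def N_def st_def by simp
  then have "enn2real ((\<integral>\<^sup>+x. H t x * st x \<partial>M) + n) = enn2real ((\<integral>\<^sup>+x. phase f0 x * st x \<partial>M) + p)"
    unfolding enn2real_plus[OF a(1) nf] enn2real_plus[OF a(2) pf] .
  then have "(\<integral>\<^sup>+x. H t x * st x \<partial>M) + n = (\<integral>\<^sup>+x. phase f0 x * st x \<partial>M) + p"
    using a pf nf by (intro enn2real_inject) simp_all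
  then show "(\<integral>\<^sup>+x. H t x * species_test i \<psi> x \<partial>M) +
      (\<integral>\<^sup>+s. ennreal (\<gamma> s) * (\<integral>\<^sup>+x. H s x * loss (H s) x * species_test i \<psi> x \<partial>M) * indicator {0..t} s \<partial>lborel) =
      (\<integral>\<^sup>+x. phase f0 x * species_test i \<psi> x \<partial>M) +
      (\<integral>\<^sup>+s. ennreal (\<gamma> s) * (\<integral>\<^sup>+x. gain (H s) x * species_test i \<psi> x \<partial>M) * indicator {0..t} s \<partial>lborel)"
    unfolding p_def n_def P_def N_def st_def .
qed

lemma double_integral_mono_AE:
  assumes "AE x in M. f x \<le> g x"
  shows "(\<integral>\<^sup>+x. \<integral>\<^sup>+y. f x * f y * q x y \<partial>M \<partial>M) \<le> (\<integral>\<^sup>+x. \<integral>\<^sup>+y. g x * g y * q x y \<partial>M \<partial>M)"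
proof (rule nn_integral_mono_AE, use assms in eventually_elim)
  case (elim x)
  show ?case
    by (rule nn_integral_mono_AE, use assms in eventually_elim) (intro mult_mono elim, auto)
qed

section \<open>The energy of the competitor\<close>

text \<open>The weight \<open>Wr\<close> is not compactly supported; its products with these cutoffs
  are test functions, and they increase to it.\<close>

definition cutoff :: "nat \<Rightarrow> real^'d \<Rightarrow> real" where
  "cutoff R v = max 0 (min 1 (real R + 1 - norm v))"

lemma cutoff_bounds: "0 \<le> cutoff R v" "cutoff R v \<le> 1"
  by (auto simp: cutoff_def)

lemma test_functionI:
  assumes "continuous_on UNIV \<psi>" and "\<And>v. \<psi> v \<noteq> 0 \<Longrightarrow> norm v \<le> R"
  shows "test_function \<psi>"
proof -
  have "{v. \<psi> v \<noteq> 0} \<subseteq> cball 0 R" using assms(2) by auto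
  then have "bounded {v. \<psi> v \<noteq> 0}" by (rule bounded_subset[OF bounded_cball])
  then show ?thesis using assms(1) unfolding test_function_def by (simp add: compact_closure)
qed

lemma cutoff_test: "test_function (\<lambda>v. cutoff R v * Wr (i, v))"
proof (rule test_functionI)
  show "continuous_on UNIV (\<lambda>v. cutoff R v * Wr (i, v))"
    unfolding cutoff_def Wr_def rt_def fst_conv snd_conv by (intro continuous_intros)
  show "norm v \<le> real R + 1" if "cutoff R v * Wr (i, v) \<noteq> 0" for v
    using that by (auto simp: cutoff_def max_def min_def split: if_splits)
qed

lemma cutoff_W_nonneg: "0 \<le> cutoff R v * Wr (i, v)"
  using cutoff_bounds(1)[of R v] Wr_ge_1[of "(i, v)"] by simp

definition cutoff_W :: "nat \<Rightarrow> 's \<times> (real^'d) \<Rightarrow> ennreal" where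
  "cutoff_W R x = ennreal (cutoff R (snd x) * Wr x)"

lemma cutoff_borel [measurable]: "cutoff R \<in> borel_measurable borel"
  unfolding cutoff_def by measurable

lemma cutoff_W_borel [measurable]: "(\<lambda>v. cutoff R v * Wr (i, v)) \<in> borel_measurable borel"
  using measurable_compose[OF pair_measurable Wr_measurable, of i] by measurable

lemma cutoff_W_measurable [measurable]: "cutoff_W R \<in> borel_measurable M"
  unfolding cutoff_W_def by measurable

lemma cutoff_W_sum: "cutoff_W R x = (\<Sum>i\<in>UNIV. species_test i (\<lambda>v. cutoff R v * Wr (i, v)) x)"
  unfolding cutoff_W_def species_test_def by simp

lemma cutoff_W_mono: "R \<le> R' \<Longrightarrow> cutoff_W R x \<le> cutoff_W R' x"
  unfolding cutoff_W_def using Wr_ge_1[of x]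
  by (intro ennreal_leI mult_right_mono) (auto simp: cutoff_def intro!: max.mono min.mono)

lemma cutoff_W_SUP: "(SUP R. cutoff_W R x) = ennreal (Wr x)"
proof (rule antisym)
  have W: "0 \<le> Wr x" using Wr_ge_1[of x] by simp
  show "(SUP R. cutoff_W R x) \<le> ennreal (Wr x)"
    unfolding cutoff_W_def using cutoff_bounds W by (intro SUP_least ennreal_leI) (simp add: mult_left_le_one_le)
  obtain R where "norm (snd x) \<le> real R" using real_arch_simple by blast
  then have "cutoff_W R x = ennreal (Wr x)" unfolding cutoff_W_def cutoff_def by simp
  then show "ennreal (Wr x) \<le> (SUP R. cutoff_W R x)" by (metis SUP_upper UNIV_I)
qed

lemma cutoff_integral_SUP:
  assumes [measurable]: "f \<in> borel_measurable M"
  shows "(\<integral>\<^sup>+x. f x * ennreal (Wr x) \<partial>M) = (SUP R. \<integral>\<^sup>+x. f x * cutoff_W R x \<partial>M)"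
    and "incseq (\<lambda>R. \<integral>\<^sup>+x. f x * cutoff_W R x \<partial>M)"
proof -
  show "(\<integral>\<^sup>+x. f x * ennreal (Wr x) \<partial>M) = (SUP R. \<integral>\<^sup>+x. f x * cutoff_W R x \<partial>M)"
    unfolding cutoff_W_SUP[symmetric] SUP_mult_left_ennreal
    by (intro nn_integral_monotone_convergence_SUP) (auto simp: incseq_def le_fun_def intro!: mult_left_mono cutoff_W_mono)
  show "incseq (\<lambda>R. \<integral>\<^sup>+x. f x * cutoff_W R x \<partial>M)"
    by (auto simp: incseq_def intro!: nn_integral_mono mult_left_mono cutoff_W_mono)
qed

lemma cutoff_integral_sum:
  assumes [measurable]: "f \<in> borel_measurable M"
  shows "(\<integral>\<^sup>+x. f x * cutoff_W R x \<partial>M) = (\<Sum>i\<in>UNIV. \<integral>\<^sup>+x. f x * species_test i (\<lambda>v. cutoff R v * Wr (i, v)) x \<partial>M)"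
  unfolding cutoff_W_sum sum_distrib_left by (rule nn_integral_sum) measurable

lemma cutoff_rates_measurable:
  shows "(\<lambda>s. \<integral>\<^sup>+x. gain (H s) x * cutoff_W R x \<partial>M) \<in> borel_measurable borel"
    and "(\<lambda>s. \<integral>\<^sup>+x. H s x * loss (H s) x * cutoff_W R x \<partial>M) \<in> borel_measurable borel"
    and "(\<lambda>s. \<integral>\<^sup>+x. gain (H s) x * species_test i (\<lambda>v. cutoff R v * Wr (i, v)) x \<partial>M) \<in> borel_measurable borel"
    and "(\<lambda>s. \<integral>\<^sup>+x. H s x * loss (H s) x * species_test i (\<lambda>v. cutoff R v * Wr (i, v)) x \<partial>M) \<in> borel_measurable borel"
proof -
  have *: "(\<lambda>s. \<integral>\<^sup>+x. gain (H s) x * species_test i (\<lambda>v. cutoff R v * Wr (i, v)) x \<partial>M) \<in> borel_measurable borel"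
    "(\<lambda>s. \<integral>\<^sup>+x. H s x * loss (H s) x * species_test i (\<lambda>v. cutoff R v * Wr (i, v)) x \<partial>M) \<in> borel_measurable borel" for i
  proof -
    obtain c where c: "0 \<le> c" "\<And>v. \<bar>cutoff R v * Wr (i, v)\<bar> \<le> c"
      and "(\<lambda>v. cutoff R v * Wr (i, v)) \<in> borel_measurable borel"
      by (rule test_function_bounded[OF cutoff_test[of R i]]) (rule that)
    have c': "cutoff R v * Wr (i, v) \<le> c" for v using c(2)[of v] by linarith
    have m: "species_test i (\<lambda>v. cutoff R v * Wr (i, v)) \<in> borel_measurable M" by measurable
    show "(\<lambda>s. \<integral>\<^sup>+x. gain (H s) x * species_test i (\<lambda>v. cutoff R v * Wr (i, v)) x \<partial>M) \<in> borel_measurable borel"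
      "(\<lambda>s. \<integral>\<^sup>+x. H s x * loss (H s) x * species_test i (\<lambda>v. cutoff R v * Wr (i, v)) x \<partial>M) \<in> borel_measurable borel"
      by (rule bounded_test_rates(1,2)[OF m species_test_le[OF c'] c(1)])+
  qed
  show "(\<lambda>s. \<integral>\<^sup>+x. gain (H s) x * species_test i (\<lambda>v. cutoff R v * Wr (i, v)) x \<partial>M) \<in> borel_measurable borel"
    "(\<lambda>s. \<integral>\<^sup>+x. H s x * loss (H s) x * species_test i (\<lambda>v. cutoff R v * Wr (i, v)) x \<partial>M) \<in> borel_measurable borel"
    by - (rule *)+
  have "(\<lambda>s. \<Sum>i\<in>UNIV. \<integral>\<^sup>+x. gain (H s) x * species_test i (\<lambda>v. cutoff R v * Wr (i, v)) x \<partial>M) \<in> borel_measurable borel"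
    "(\<lambda>s. \<Sum>i\<in>UNIV. \<integral>\<^sup>+x. H s x * loss (H s) x * species_test i (\<lambda>v. cutoff R v * Wr (i, v)) x \<partial>M) \<in> borel_measurable borel"
    by (intro borel_measurable_sum *)+
  then show "(\<lambda>s. \<integral>\<^sup>+x. gain (H s) x * cutoff_W R x \<partial>M) \<in> borel_measurable borel"
    "(\<lambda>s. \<integral>\<^sup>+x. H s x * loss (H s) x * cutoff_W R x \<partial>M) \<in> borel_measurable borel"
    by (simp_all add: cutoff_integral_sum)
qed

text \<open>The weak equation is summed over species with the truncated weights. Gain and loss stand
  on opposite sides, so both sides increase with \<open>R\<close> and the identity passes to the
  limit by monotone convergence, whether or not the terms are finite.\<close>

lemma H_energy_equation:
  assumes t: "t \<in> {0..T}"
  shows "(\<integral>\<^sup>+x. H t x * ennreal (Wr x) \<partial>M) +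
      (\<integral>\<^sup>+s. ennreal (\<gamma> s) * (\<integral>\<^sup>+x. H s x * loss (H s) x * ennreal (Wr x) \<partial>M) * indicator {0..t} s \<partial>lborel) =
      ennreal K + (\<integral>\<^sup>+s. ennreal (\<gamma> s) * (\<integral>\<^sup>+x. gain (H s) x * ennreal (Wr x) \<partial>M) * indicator {0..t} s \<partial>lborel)"
proof -
  note [measurable] = cutoff_rates_measurable
  have time_sum: "(\<integral>\<^sup>+s. ennreal (\<gamma> s) * (\<integral>\<^sup>+x. f s x * cutoff_W R x \<partial>M) * indicator {0..t} s \<partial>lborel) =
    (\<Sum>i\<in>UNIV. \<integral>\<^sup>+s. ennreal (\<gamma> s) * (\<integral>\<^sup>+x. f s x * species_test i (\<lambda>v. cutoff R v * Wr (i, v)) x \<partial>M) * indicator {0..t} s \<partial>lborel)"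
    if [measurable]: "\<And>s. f s \<in> borel_measurable M"
      "\<And>i. (\<lambda>s. \<integral>\<^sup>+x. f s x * species_test i (\<lambda>v. cutoff R v * Wr (i, v)) x \<partial>M) \<in> borel_measurable borel" for f R
    unfolding cutoff_integral_sum[OF that(1)] sum_distrib_left sum_distrib_right by (rule nn_integral_sum) measurable
  have time_SUP: "(\<integral>\<^sup>+s. ennreal (\<gamma> s) * (\<integral>\<^sup>+x. f s x * ennreal (Wr x) \<partial>M) * indicator {0..t} s \<partial>lborel) =
      (SUP R. \<integral>\<^sup>+s. ennreal (\<gamma> s) * (\<integral>\<^sup>+x. f s x * cutoff_W R x \<partial>M) * indicator {0..t} s \<partial>lborel)"
    and time_inc: "incseq (\<lambda>R. \<integral>\<^sup>+s. ennreal (\<gamma> s) * (\<integral>\<^sup>+x. f s x * cutoff_W R x \<partial>M) * indicator {0..t} s \<partial>lborel)"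
    if [measurable]: "\<And>s. f s \<in> borel_measurable M"
      "\<And>R. (\<lambda>s. \<integral>\<^sup>+x. f s x * cutoff_W R x \<partial>M) \<in> borel_measurable borel" for f
  proof -
    show "(\<integral>\<^sup>+s. ennreal (\<gamma> s) * (\<integral>\<^sup>+x. f s x * ennreal (Wr x) \<partial>M) * indicator {0..t} s \<partial>lborel) =
      (SUP R. \<integral>\<^sup>+s. ennreal (\<gamma> s) * (\<integral>\<^sup>+x. f s x * cutoff_W R x \<partial>M) * indicator {0..t} s \<partial>lborel)"
      unfolding cutoff_integral_SUP(1)[OF that(1)] SUP_mult_left_ennreal SUP_mult_right_ennreal
      by (intro nn_integral_monotone_convergence_SUP)
         (auto simp: incseq_def le_fun_def intro!: mult_mono nn_integral_mono cutoff_W_mono)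
    show "incseq (\<lambda>R. \<integral>\<^sup>+s. ennreal (\<gamma> s) * (\<integral>\<^sup>+x. f s x * cutoff_W R x \<partial>M) * indicator {0..t} s \<partial>lborel)"
      by (auto simp: incseq_def intro!: nn_integral_mono mult_mono cutoff_W_mono)
  qed
  have eq: "(\<integral>\<^sup>+x. H t x * cutoff_W R x \<partial>M) +
      (\<integral>\<^sup>+s. ennreal (\<gamma> s) * (\<integral>\<^sup>+x. H s x * loss (H s) x * cutoff_W R x \<partial>M) * indicator {0..t} s \<partial>lborel) =
      (\<integral>\<^sup>+x. phase f0 x * cutoff_W R x \<partial>M) +
      (\<integral>\<^sup>+s. ennreal (\<gamma> s) * (\<integral>\<^sup>+x. gain (H s) x * cutoff_W R x \<partial>M) * indicator {0..t} s \<partial>lborel)" for R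
  proof -
    have Lm: "(\<lambda>x. H s x * loss (H s) x) \<in> borel_measurable M" for s by measurable
    show ?thesis
      unfolding time_sum[OF Lm cutoff_rates_measurable(4)] time_sum[OF gain_H_measurable cutoff_rates_measurable(3)]
        cutoff_integral_sum[OF H_measurable] cutoff_integral_sum[OF phase_f0_measurable] sum.distrib[symmetric]
      by (intro sum.cong refl H_weak(2)[OF cutoff_test cutoff_W_nonneg t])
  qed
  have Lm: "(\<lambda>x. H s x * loss (H s) x) \<in> borel_measurable M" for s by measurable
  have "(\<integral>\<^sup>+x. H t x * ennreal (Wr x) \<partial>M) +
      (\<integral>\<^sup>+s. ennreal (\<gamma> s) * (\<integral>\<^sup>+x. H s x * loss (H s) x * ennreal (Wr x) \<partial>M) * indicator {0..t} s \<partial>lborel) =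
      (\<integral>\<^sup>+x. phase f0 x * ennreal (Wr x) \<partial>M) + (\<integral>\<^sup>+s. ennreal (\<gamma> s) * (\<integral>\<^sup>+x. gain (H s) x * ennreal (Wr x) \<partial>M) * indicator {0..t} s \<partial>lborel)"
    unfolding time_SUP[OF Lm cutoff_rates_measurable(2)] time_SUP[OF gain_H_measurable cutoff_rates_measurable(1)]
      cutoff_integral_SUP(1)[OF H_measurable] cutoff_integral_SUP(1)[OF phase_f0_measurable]
      ennreal_SUP_add[OF cutoff_integral_SUP(2)[OF H_measurable] time_inc[OF Lm cutoff_rates_measurable(2)], symmetric]
      ennreal_SUP_add[OF cutoff_integral_SUP(2)[OF phase_f0_measurable] time_inc[OF gain_H_measurable cutoff_rates_measurable(1)], symmetric]
      eq ..
  then show ?thesis unfolding phase_f0_W .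
qed

text \<open>An iterate below the competitor dissipates no more than the competitor does, so the heat
  of the next iterate can be charged to the energy the competitor has lost. The gain must be finite
  to be cancelled; here the third moment of the competitor is used.\<close>

lemma H_energy_bound:
  assumes le: "\<And>s. s \<in> {0..T} \<Longrightarrow> AE x in M. F n (\<tau> s) x \<le> H s x" and t: "t \<in> {0..T}"
  shows "(\<integral>\<^sup>+x. H t x * ennreal (Wr x) \<partial>M) + heat (Suc n) (\<tau> t) \<le> ennreal K"
proof -
  define P where "P s = (\<integral>\<^sup>+x. gain (H s) x * ennreal (Wr x) \<partial>M)" for s
  define N where "N s = (\<integral>\<^sup>+x. H s x * loss (H s) x * ennreal (Wr x) \<partial>M)" for s
  define d where "d s = dissipation (F n (\<tau> s))" for s
  note [measurable] = cutoff_rates_measurable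
  have [measurable]: "P \<in> borel_measurable borel"
    unfolding P_def cutoff_integral_SUP(1)[OF gain_H_measurable] by measurable
  have [measurable]: "d \<in> borel_measurable borel"
    unfolding d_def by measurable
  have PD: "P s + dissipation (H s) = N s" for s
    unfolding P_def N_def dissipation_def by (subst double_integral_loss[symmetric], measurable, rule J_W) measurable
  have Pd: "P s + d s \<le> N s" if "s \<in> {0..T}" for s
    unfolding PD[symmetric] d_def dissipation_def by (intro add_left_mono double_integral_mono_AE le that)
  define b where "b = ennreal (2 * (4 * c0)) * (ennreal Kh * ennreal Vh)"
  have P_le: "AE s in lborel. P s \<le> b"
    using h_V
  proof eventually_elim
    case (elim s)
    have "P s \<le> N s" unfolding PD[symmetric] by simp
    also have "\<dots> \<le> b"
      unfolding N_def b_def by (rule order_trans[OF loss_W_le]) (auto intro!: mult_left_mono mult_mono h_W elim)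
    finally show ?case .
  qed
  have "(\<integral>\<^sup>+s. ennreal (\<gamma> s) * P s * indicator {0..t} s \<partial>lborel) \<le> (\<integral>\<^sup>+s. ennreal G * b * indicator {0..t} s \<partial>lborel)"
    by (rule nn_integral_mono_AE, use P_le in eventually_elim) (intro mult_mono ennreal_leI \<gamma>_le, auto)
  also have "\<dots> < \<top>"
    unfolding b_def by (simp add: nn_integral_cmult ennreal_mult_less_top emeasure_lborel_Icc_eq)
  finally have fin: "(\<integral>\<^sup>+s. ennreal (\<gamma> s) * P s * indicator {0..t} s \<partial>lborel) < \<top>" .
  have heat: "heat (Suc n) (\<tau> t) = (\<integral>\<^sup>+s. ennreal (\<gamma> s) * d s * indicator {0..t} s \<partial>lborel)"
    unfolding heat_Suc d_def using t by (intro time_change[OF \<gamma>_borel \<gamma>_le G_nonneg, symmetric]) auto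
  have "(\<integral>\<^sup>+s. ennreal (\<gamma> s) * P s * indicator {0..t} s \<partial>lborel) + heat (Suc n) (\<tau> t) =
     (\<integral>\<^sup>+s. ennreal (\<gamma> s) * P s * indicator {0..t} s + ennreal (\<gamma> s) * d s * indicator {0..t} s \<partial>lborel)"
    unfolding heat by (rule nn_integral_add[symmetric]) measurable
  also have "\<dots> \<le> (\<integral>\<^sup>+s. ennreal (\<gamma> s) * N s * indicator {0..t} s \<partial>lborel)"
    using Pd t by (intro nn_integral_mono) (auto split: split_indicator intro!: mult_left_mono simp flip: distrib_left)
  finally have *: "(\<integral>\<^sup>+s. ennreal (\<gamma> s) * P s * indicator {0..t} s \<partial>lborel) + heat (Suc n) (\<tau> t) \<le>
    (\<integral>\<^sup>+s. ennreal (\<gamma> s) * N s * indicator {0..t} s \<partial>lborel)" .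
  have "((\<integral>\<^sup>+x. H t x * ennreal (Wr x) \<partial>M) + heat (Suc n) (\<tau> t)) + (\<integral>\<^sup>+s. ennreal (\<gamma> s) * P s * indicator {0..t} s \<partial>lborel) \<le>
    (\<integral>\<^sup>+x. H t x * ennreal (Wr x) \<partial>M) + (\<integral>\<^sup>+s. ennreal (\<gamma> s) * N s * indicator {0..t} s \<partial>lborel)"
    using add_left_mono[OF *, of "\<integral>\<^sup>+x. H t x * ennreal (Wr x) \<partial>M"] by (simp only: add_ac)
  also have "\<dots> = ennreal K + (\<integral>\<^sup>+s. ennreal (\<gamma> s) * P s * indicator {0..t} s \<partial>lborel)"
    using H_energy_equation[OF t] unfolding P_def N_def .
  finally show ?thesis
    using fin by (rule ennreal_add_le_add_rightD)
qed

text \<open>The competitor is a supersolution of the step equation. With \<open>e\<close> the energy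
  missing from it, the source of the iterate lies below that of the pair formed by
  \<open>H s\<close> and \<open>e\<close>, for which \<open>source_integral\<close> balances exactly
  with total energy \<open>K\<close>.\<close>

lemma source_le:
  assumes le: "AE x in M. F n (\<tau> s) x \<le> H s x"
    and energy: "(\<integral>\<^sup>+x. H s x * ennreal (Wr x) \<partial>M) + heat n (\<tau> s) \<le> ennreal K"
    and \<psi>[measurable]: "\<psi> \<in> borel_measurable M"
  shows "(\<integral>\<^sup>+x. source (F n (\<tau> s)) (heat n (\<tau> s)) x * \<psi> x \<partial>M) + (\<integral>\<^sup>+x. H s x * loss (H s) x * \<psi> x \<partial>M) \<le>
    (\<integral>\<^sup>+x. gain (H s) x * \<psi> x \<partial>M) + (\<integral>\<^sup>+x. H s x * (ennreal (rate x) * \<psi> x) \<partial>M) * ennreal K"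
proof -
  \<comment> \<open>\<open>source_mono\<close> compares everywhere, the hypothesis only almost
    everywhere; the maximum is a version of \<open>H s\<close> that dominates \<open>F n\<close> at
    every point.\<close>
  define H' where "H' x = max (F n (\<tau> s) x) (H s x)" for x
  have [measurable]: "H' \<in> borel_measurable M" unfolding H'_def by measurable
  have eq: "AE x in M. H' x = H s x"
    using le by eventually_elim (simp add: H'_def)
  have [measurable]: "gain H' \<in> borel_measurable M"
    using measurable_compose[OF measurable_Pair1' gain_measurable[of "\<lambda>_. H'" "borel :: real measure"], of 0] by simp
  define e where "e = ennreal K - (\<integral>\<^sup>+x. H s x * ennreal (Wr x) \<partial>M)"
  have Hle: "(\<integral>\<^sup>+x. H s x * ennreal (Wr x) \<partial>M) \<le> ennreal K"
    by (rule order_trans[OF _ energy]) simp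
  have e: "(\<integral>\<^sup>+x. H s x * ennreal (Wr x) \<partial>M) + e = ennreal K"
    unfolding e_def by (rule add_diff_inverse_ennreal[OF Hle])
  have "heat n (\<tau> s) \<le> e"
  proof (rule ennreal_add_le_add_rightD)
    show "heat n (\<tau> s) + (\<integral>\<^sup>+x. H s x * ennreal (Wr x) \<partial>M) \<le> e + (\<integral>\<^sup>+x. H s x * ennreal (Wr x) \<partial>M)"
      using energy e by (simp add: add.commute)
    show "(\<integral>\<^sup>+x. H s x * ennreal (Wr x) \<partial>M) < \<top>" using Hle by (rule le_less_trans) simp
  qed
  then have S_le: "(\<integral>\<^sup>+x. source (F n (\<tau> s)) (heat n (\<tau> s)) x * \<psi> x \<partial>M) \<le> (\<integral>\<^sup>+x. source H' e x * \<psi> x \<partial>M)"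
    by (intro nn_integral_mono mult_right_mono source_mono) (auto simp: H'_def)
  obtain R where R: "(\<integral>\<^sup>+x. source H' e x * \<psi> x \<partial>M) = (\<integral>\<^sup>+x. gain H' x * \<psi> x \<partial>M) + R"
    "R + (\<integral>\<^sup>+x. H' x * loss H' x * \<psi> x \<partial>M) = (\<integral>\<^sup>+x. H' x * (ennreal (rate x) * \<psi> x) \<partial>M) * ((\<integral>\<^sup>+x. H' x * ennreal (Wr x) \<partial>M) + e)"
    by (rule source_integral[of H' \<psi> e]) measurable
  have P: "(\<integral>\<^sup>+x. gain H' x * \<psi> x \<partial>M) = (\<integral>\<^sup>+x. gain (H s) x * \<psi> x \<partial>M)"
    by (subst (1 2) gain_weak) (auto intro!: double_integral_cong_AE eq)
  have N: "(\<integral>\<^sup>+x. H' x * loss H' x * \<psi> x \<partial>M) = (\<integral>\<^sup>+x. H s x * loss (H s) x * \<psi> x \<partial>M)"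
    by (subst (1 2) double_integral_loss[symmetric]) (auto intro!: double_integral_cong_AE eq)
  have L: "(\<integral>\<^sup>+x. H' x * w x \<partial>M) = (\<integral>\<^sup>+x. H s x * w x \<partial>M)" for w
    by (rule nn_integral_cong_AE, use eq in eventually_elim) simp
  have EQ: "(\<integral>\<^sup>+x. source H' e x * \<psi> x \<partial>M) + (\<integral>\<^sup>+x. H s x * loss (H s) x * \<psi> x \<partial>M) =
    (\<integral>\<^sup>+x. gain (H s) x * \<psi> x \<partial>M) + (\<integral>\<^sup>+x. H s x * (ennreal (rate x) * \<psi> x) \<partial>M) * ennreal K"
    using R(2) unfolding R(1) P N L e by (simp add: add.assoc)
  show ?thesis
    unfolding EQ[symmetric] by (rule add_right_mono[OF S_le])
qed


section \<open>Domination of the iterates by the competitor\<close>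

lemma linear_test_bound:
  assumes [measurable]: "f \<in> borel_measurable M" and fW: "(\<integral>\<^sup>+x. f x * ennreal (Wr x) \<partial>M) \<le> ennreal k"
    and k: "0 \<le> k" and \<psi>: "\<And>v. \<psi> v \<le> c" and c: "0 \<le> c"
  shows "(\<integral>\<^sup>+x. f x * species_test i \<psi> x \<partial>M) \<le> ennreal (c * k)"
proof -
  have "(\<integral>\<^sup>+x. f x * species_test i \<psi> x \<partial>M) \<le> (\<integral>\<^sup>+x. ennreal c * (f x * ennreal (Wr x)) \<partial>M)"
  proof (rule nn_integral_mono)
    fix x
    have "species_test i \<psi> x \<le> ennreal c * 1" using species_test_le[OF \<psi>] by simp
    also have "\<dots> \<le> ennreal c * ennreal (Wr x)" by (intro mult_left_mono W_ge_1) simp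
    finally have "f x * species_test i \<psi> x \<le> f x * (ennreal c * ennreal (Wr x))" by (rule mult_left_mono) simp
    then show "f x * species_test i \<psi> x \<le> ennreal c * (f x * ennreal (Wr x))" by (simp add: mult_ac)
  qed
  also have "\<dots> = ennreal c * (\<integral>\<^sup>+x. f x * ennreal (Wr x) \<partial>M)" by (rule nn_integral_cmult) measurable
  also have "\<dots> \<le> ennreal c * ennreal k" by (intro mult_left_mono fW) simp
  finally show ?thesis using c k by (simp add: ennreal_mult)
qed

lemma F_W_le: "0 \<le> t \<Longrightarrow> (\<integral>\<^sup>+x. F n t x * ennreal (Wr x) \<partial>M) \<le> ennreal K"
  by (rule order_trans[OF _ F_W_bound(1)[of t n]]) simp_all

text \<open>The order between competitor and next iterate is derived in weak form. A signed quantity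
  is needed, hence the passage to reals; both integrals are finite for bounded
  \<open>\<psi>\<close>.\<close>

definition gap :: "nat \<Rightarrow> 's \<Rightarrow> (real^'d \<Rightarrow> real) \<Rightarrow> real \<Rightarrow> real" where
  "gap n i \<psi> t = enn2real (\<integral>\<^sup>+x. H t x * species_test i \<psi> x \<partial>M) -
     enn2real (\<integral>\<^sup>+x. F (Suc n) (\<tau> t) x * species_test i \<psi> x \<partial>M)"

lemma gap_linear:
  assumes [measurable]: "\<psi> \<in> borel_measurable borel" "\<eta> \<in> borel_measurable borel"
    and \<psi>: "\<And>v. 0 \<le> \<psi> v" "\<And>v. \<psi> v \<le> c" and \<eta>: "\<And>v. 0 \<le> \<eta> v" "\<And>v. \<eta> v \<le> c" and a: "0 \<le> a"
  shows "gap n i (\<lambda>v. \<psi> v + \<eta> v) t = gap n i \<psi> t + gap n i \<eta> t"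
    and "gap n i (\<lambda>v. a * \<psi> v) t = a * gap n i \<psi> t"
proof -
  have c: "0 \<le> c" using \<psi>[of 0] by linarith
  have Fm: "F (Suc n) (\<tau> t) \<in> borel_measurable M" by measurable
  have *: "(\<integral>\<^sup>+x. H t x * species_test i f x \<partial>M) < \<top>" "(\<integral>\<^sup>+x. F (Suc n) (\<tau> t) x * species_test i f x \<partial>M) < \<top>"
    if f: "\<And>v. f v \<le> c" for f
    by (rule le_less_trans[OF linear_test_bound[where \<psi>=f, OF H_measurable h_W Kh_nonneg f c] ennreal_less_top],
        rule le_less_trans[OF linear_test_bound[where \<psi>=f, OF Fm F_W_le[OF clock_nonneg] less_imp_le[OF K_positive] f c] ennreal_less_top])
  note fin = *[OF \<psi>(2)] *[OF \<eta>(2)]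
  have add: "species_test i (\<lambda>v. \<psi> v + \<eta> v) x = species_test i \<psi> x + species_test i \<eta> x" for x
    unfolding species_test_def using \<psi> \<eta> by simp
  have mul: "species_test i (\<lambda>v. a * \<psi> v) x = ennreal a * species_test i \<psi> x" for x
    unfolding species_test_def using \<psi> a by (simp add: ennreal_mult)
  show "gap n i (\<lambda>v. \<psi> v + \<eta> v) t = gap n i \<psi> t + gap n i \<eta> t"
    unfolding gap_def add using fin by (simp add: distrib_left nn_integral_add enn2real_plus)
  have lin: "(\<integral>\<^sup>+x. f x * (ennreal a * species_test i \<psi> x) \<partial>M) = ennreal a * (\<integral>\<^sup>+x. f x * species_test i \<psi> x \<partial>M)"
    if [measurable]: "f \<in> borel_measurable M" for f
  proof -
    have "(\<integral>\<^sup>+x. f x * (ennreal a * species_test i \<psi> x) \<partial>M) = (\<integral>\<^sup>+x. ennreal a * (f x * species_test i \<psi> x) \<partial>M)"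
      by (simp add: mult_ac)
    then show ?thesis by (simp add: nn_integral_cmult)
  qed
  show "gap n i (\<lambda>v. a * \<psi> v) t = a * gap n i \<psi> t"
    unfolding gap_def mul lin[OF H_measurable] lin[OF Fm] using a by (simp add: enn2real_mult right_diff_distrib)
qed

text \<open>The integrated equations of competitor and iterate are subtracted, and
  \<open>source_le\<close> bounds the rate \<open>q\<close> of the gap from below by minus the gap
  of the damped test function \<open>\<phi>\<close>. The damping changes the test function, so this
  is not a closed inequality for one scalar.\<close>

lemma gap_integral:
  fixes i :: 's and \<psi> :: "real^'d \<Rightarrow> real"
  assumes le: "\<And>s. s \<in> {0..T} \<Longrightarrow> AE x in M. F n (\<tau> s) x \<le> H s x"
    and \<psi>: "test_function \<psi>" "\<And>v. 0 \<le> \<psi> v"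
  defines "\<phi> \<equiv> \<lambda>v. K * rate (i, v) * \<psi> v"
  obtains q where "set_integrable lborel {0..T} q"
    and "\<And>t. 0 \<le> t \<Longrightarrow> t \<le> T \<Longrightarrow> gap n i \<psi> t = (LINT s:{0..t}|lborel. q s)"
    and "\<And>s. s \<in> {0..T} \<Longrightarrow> - \<gamma> s * gap n i \<phi> s \<le> q s"
proof -
  obtain c where c: "0 \<le> c" "\<And>v. \<bar>\<psi> v\<bar> \<le> c" and [measurable]: "\<psi> \<in> borel_measurable borel"
    using test_function_bounded[OF \<psi>(1)] by blast
  have \<phi>_test: "test_function \<phi>"
  proof -
    have "continuous_on UNIV \<phi>"
      using \<psi>(1) unfolding test_function_def \<phi>_def rate_def rt_def fst_conv snd_conv by (intro continuous_intros) auto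
    moreover have "{v. \<phi> v \<noteq> 0} \<subseteq> {v. \<psi> v \<noteq> 0}" unfolding \<phi>_def by auto
    ultimately show ?thesis
      using \<psi>(1) unfolding test_function_def
      by (auto intro: compact_closure[THEN iffD2] bounded_subset[of "{v. \<psi> v \<noteq> 0}"] bounded_subset[OF compact_imp_bounded closure_subset])
  qed
  obtain c' where c': "0 \<le> c'" "\<And>v. \<bar>\<phi> v\<bar> \<le> c'" and [measurable]: "\<phi> \<in> borel_measurable borel"
    using test_function_bounded[OF \<phi>_test] by blast
  define st where "st = species_test i \<psi>"
  define sf where "sf = species_test i \<phi>"
  have st[measurable]: "st \<in> borel_measurable M" and sf[measurable]: "sf \<in> borel_measurable M"
    unfolding st_def sf_def by measurable
  have st_le: "st x \<le> ennreal c" for x unfolding st_def by (rule species_test_le) (use c(2) abs_le_D1 in blast)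
  have c'_le: "\<phi> v \<le> c'" for v using c'(2)[of v] by linarith
  have sf_eq: "ennreal K * (ennreal (rate x) * st x) = sf x" for x
    unfolding st_def sf_def species_test_def \<phi>_def using K_positive rate_nonneg \<psi>(2)
    by (cases x) (auto simp: ennreal_mult mult.assoc)
  note r = bounded_test_rates[OF st st_le c(1)]
  define P where "P s = (\<integral>\<^sup>+x. gain (H s) x * st x \<partial>M)" for s
  define N where "N s = (\<integral>\<^sup>+x. H s x * loss (H s) x * st x \<partial>M)" for s
  define L where "L \<sigma> = (\<integral>\<^sup>+x. F (Suc n) \<sigma> x * sf x \<partial>M)" for \<sigma>
  define S where "S \<sigma> = (\<integral>\<^sup>+x. source (F n \<sigma>) (heat n \<sigma>) x * st x \<partial>M)" for \<sigma>
  define E where "E s = (\<integral>\<^sup>+x. H s x * sf x \<partial>M)" for s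
  have [measurable]: "P \<in> borel_measurable borel" "N \<in> borel_measurable borel" "L \<in> borel_measurable borel" "S \<in> borel_measurable borel"
    unfolding P_def N_def L_def S_def by (rule r) (rule r, measurable)
  define b0 where "b0 = 2 * c0 * c * Kh * Kh"
  define b1 where "b1 = b0 + c' * Kh + c' * K"
  have b0: "0 \<le> b0" unfolding b0_def using c c0_nonneg Kh_nonneg by simp
  have b1: "b0 \<le> b1" "0 \<le> b1" unfolding b1_def using b0 c' Kh_nonneg K_positive by auto
  have PN: "P s \<le> ennreal b0" "N s \<le> ennreal b0" for s
    unfolding P_def N_def b0_def by (rule r)+
  have P_le: "P s \<le> ennreal b1" and N_le: "N s \<le> ennreal b1" for s
    using PN[of s] ennreal_leI[OF b1(1)] by (auto intro: order_trans)
  have E_le: "E s \<le> ennreal (c' * Kh)" for s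
    unfolding E_def sf_def by (rule linear_test_bound[OF H_measurable h_W Kh_nonneg c'_le c'(1)])
  have L_le0: "L \<sigma> \<le> ennreal (c' * K)" if "0 \<le> \<sigma>" for \<sigma>
    unfolding L_def sf_def by (rule linear_test_bound[OF _ F_W_le[OF that] _ c'_le c'(1)]) (use K_positive in auto)
  have L_le: "L (\<tau> s) \<le> ennreal b1" for s
    using L_le0[OF clock_nonneg] b0 c' Kh_nonneg unfolding b1_def by (rule_tac order_trans[OF _ ennreal_leI[of "c' * K"]]) auto
  have S_N: "S (\<tau> s) + N s \<le> P s + E s" if s: "s \<in> {0..T}" for s
  proof -
    \<comment> \<open>\<open>H_energy_bound\<close> yields \<open>heat (Suc n)\<close>, which
      dominates the \<open>heat n\<close> occurring in the source.\<close>
    have "(\<integral>\<^sup>+x. H s x * ennreal (Wr x) \<partial>M) + heat n (\<tau> s) \<le> (\<integral>\<^sup>+x. H s x * ennreal (Wr x) \<partial>M) + heat (Suc n) (\<tau> s)"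
      by (intro add_left_mono) (simp add: F_heat_mono)
    also have "\<dots> \<le> ennreal K" by (rule H_energy_bound[OF le s])
    finally have "S (\<tau> s) + N s \<le> P s + (\<integral>\<^sup>+x. H s x * (ennreal (rate x) * st x) \<partial>M) * ennreal K"
      unfolding S_def N_def P_def by (rule source_le[OF le[OF s]]) measurable
    also have "(\<integral>\<^sup>+x. H s x * (ennreal (rate x) * st x) \<partial>M) * ennreal K = (\<integral>\<^sup>+x. H s x * (ennreal (rate x) * st x) * ennreal K \<partial>M)"
      by (rule nn_integral_multc[symmetric]) measurable
    also have "\<dots> = E s"
      unfolding E_def sf_eq[symmetric] by (simp add: mult_ac)
    finally show ?thesis .
  qed
  have S_le: "S (\<tau> s) \<le> ennreal b1" if s: "s \<in> {0..T}" for s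
  proof -
    have "S (\<tau> s) \<le> S (\<tau> s) + N s" by simp
    also have "\<dots> \<le> P s + E s" by (rule S_N[OF s])
    also have "\<dots> \<le> ennreal b0 + ennreal (c' * Kh)" by (intro add_mono PN E_le)
    also have "\<dots> \<le> ennreal b1"
      using b0 c' Kh_nonneg K_positive unfolding b1_def by (simp flip: ennreal_plus add: ennreal_leI)
    finally show ?thesis .
  qed
  have mt: "(\<lambda>s. L (\<tau> s)) \<in> borel_measurable borel" "(\<lambda>s. S (\<tau> s)) \<in> borel_measurable borel" by measurable
  define q where "q s = \<gamma> s * (enn2real (P s) - enn2real (N s)) + \<gamma> s * (enn2real (L (\<tau> s)) - enn2real (S (\<tau> s)))" for s
  note D1 = set_integral_enn2real_diff[OF \<open>P \<in> _\<close> \<open>N \<in> _\<close> \<gamma>_borel \<gamma>_nonneg \<gamma>_le P_le N_le b1(2)]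
  show ?thesis
  proof (rule that[of q])
    show "set_integrable lborel {0..T} q"
      unfolding q_def
      by (intro set_integral_add(1) D1(1) set_integral_enn2real_diff(1)[OF mt \<gamma>_borel \<gamma>_nonneg \<gamma>_le L_le S_le b1(2)])
    show "gap n i \<psi> t = (LINT s:{0..t}|lborel. q s)" if t: "0 \<le> t" "t \<le> T" for t
    proof -
      have tT: "t \<in> {0..T}" using t by auto
      have S_le': "S (\<tau> s) \<le> ennreal b1" if "s \<in> {0..t}" for s using that t by (intro S_le) auto
      note D2 = set_integral_enn2real_diff[OF mt \<gamma>_borel \<gamma>_nonneg \<gamma>_le L_le S_le' b1(2)]
        and D3 = set_integral_enn2real_diff[OF mt(2,1) \<gamma>_borel \<gamma>_nonneg \<gamma>_le S_le' L_le b1(2)]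
      define l where "l = (\<integral>\<^sup>+s. ennreal (\<gamma> s) * L (\<tau> s) * indicator {0..t} s \<partial>lborel)"
      define w where "w = (\<integral>\<^sup>+s. ennreal (\<gamma> s) * S (\<tau> s) * indicator {0..t} s \<partial>lborel)"
      have lw: "l < \<top>" "w < \<top>" unfolding l_def w_def using D2(3) D3(3) by auto
      have "(LINT s:{0..t}|lborel. q s) = (LINT s:{0..t}|lborel. \<gamma> s * (enn2real (P s) - enn2real (N s))) +
        (LINT s:{0..t}|lborel. \<gamma> s * (enn2real (L (\<tau> s)) - enn2real (S (\<tau> s))))"
        unfolding q_def by (intro set_integral_add(2) D1(1) D2(1))
      also have "(LINT s:{0..t}|lborel. \<gamma> s * (enn2real (L (\<tau> s)) - enn2real (S (\<tau> s)))) = enn2real l - enn2real w"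
        unfolding l_def w_def by (rule D2(2))
      also have "(LINT s:{0..t}|lborel. \<gamma> s * (enn2real (P s) - enn2real (N s))) =
         enn2real (\<integral>\<^sup>+x. H t x * st x \<partial>M) - enn2real (\<integral>\<^sup>+x. phase f0 x * st x \<partial>M)"
        using H_weak(1)[OF \<psi> tT, of i] unfolding P_def N_def st_def by simp
      also have "enn2real l - enn2real w = enn2real (\<integral>\<^sup>+x. phase f0 x * st x \<partial>M) - enn2real (\<integral>\<^sup>+x. F (Suc n) (\<tau> t) x * st x \<partial>M)"
      proof -
        \<comment> \<open>\<open>F_Suc_integral\<close> at the clock value, with both time integrals
          carried back to the original time.\<close>
        have eq: "(\<integral>\<^sup>+x. F (Suc n) (\<tau> t) x * st x \<partial>M) + l = (\<integral>\<^sup>+x. phase f0 x * st x \<partial>M) + w"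
        proof -
          have "l = (\<integral>\<^sup>+\<sigma>. L \<sigma> * indicator {0..\<tau> t} \<sigma> \<partial>lborel)"
            unfolding l_def by (rule time_change[OF \<gamma>_borel \<gamma>_le G_nonneg _ t(1)]) measurable
          also have "\<dots> = (\<integral>\<^sup>+\<sigma>. ennreal K * ((\<integral>\<^sup>+x. F (Suc n) \<sigma> x * (ennreal (rate x) * st x) \<partial>M) * indicator {0..\<tau> t} \<sigma>) \<partial>lborel)"
          proof (rule nn_integral_cong)
            fix \<sigma>
            have "L \<sigma> = (\<integral>\<^sup>+x. ennreal K * (F (Suc n) \<sigma> x * (ennreal (rate x) * st x)) \<partial>M)"
              unfolding L_def sf_eq[symmetric] by (simp add: mult_ac)
            also have "\<dots> = ennreal K * (\<integral>\<^sup>+x. F (Suc n) \<sigma> x * (ennreal (rate x) * st x) \<partial>M)"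
              by (rule nn_integral_cmult) measurable
            finally show "L \<sigma> * indicator {0..\<tau> t} \<sigma> = ennreal K * ((\<integral>\<^sup>+x. F (Suc n) \<sigma> x * (ennreal (rate x) * st x) \<partial>M) * indicator {0..\<tau> t} \<sigma>)"
              by (simp add: mult.assoc)
          qed
          also have "\<dots> = ennreal K * (\<integral>\<^sup>+\<sigma>. (\<integral>\<^sup>+x. F (Suc n) \<sigma> x * (ennreal (rate x) * st x) \<partial>M) * indicator {0..\<tau> t} \<sigma> \<partial>lborel)"
            by (rule nn_integral_cmult) measurable
          finally have l: "l = \<dots>" .
          have w: "w = (\<integral>\<^sup>+\<sigma>. S \<sigma> * indicator {0..\<tau> t} \<sigma> \<partial>lborel)"
            unfolding w_def by (rule time_change[OF \<gamma>_borel \<gamma>_le G_nonneg _ t(1)]) measurable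
          show ?thesis unfolding l w S_def by (rule F_Suc_integral[OF st clock_nonneg])
        qed
        have f1: "(\<integral>\<^sup>+x. F (Suc n) (\<tau> t) x * st x \<partial>M) < \<top>" "(\<integral>\<^sup>+x. phase f0 x * st x \<partial>M) < \<top>"
        proof -
          have cc: "\<psi> v \<le> c" for v using c(2)[of v] by linarith
          have "(\<integral>\<^sup>+x. F (Suc n) (\<tau> t) x * st x \<partial>M) \<le> ennreal (c * K)"
            unfolding st_def by (rule linear_test_bound[OF _ F_W_le[OF clock_nonneg] _ cc c(1)]) (use K_positive in auto)
          then show "(\<integral>\<^sup>+x. F (Suc n) (\<tau> t) x * st x \<partial>M) < \<top>" by (rule le_less_trans) simp
          have "(\<integral>\<^sup>+x. phase f0 x * st x \<partial>M) \<le> ennreal (c * K)"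
            unfolding st_def by (rule linear_test_bound[OF _ _ _ cc c(1)]) (use K_positive phase_f0_W in auto)
          then show "(\<integral>\<^sup>+x. phase f0 x * st x \<partial>M) < \<top>" by (rule le_less_trans) simp
        qed
        show ?thesis
          using arg_cong[OF eq, of enn2real] unfolding enn2real_plus[OF f1(1) lw(1)] enn2real_plus[OF f1(2) lw(2)] by linarith
      qed
      finally show ?thesis unfolding gap_def st_def by simp
    qed
    show "- \<gamma> s * gap n i \<phi> s \<le> q s" if s: "s \<in> {0..T}" for s
    proof -
      have f: "S (\<tau> s) < \<top>" "N s < \<top>" "P s < \<top>" "E s < \<top>"
        using S_le[OF s] N_le[of s] P_le[of s] E_le[of s] by (auto intro: le_less_trans)
      have "enn2real (S (\<tau> s) + N s) \<le> enn2real (P s + E s)"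
        by (rule enn2real_mono[OF S_N[OF s]]) (use f in simp)
      then have "enn2real (S (\<tau> s)) + enn2real (N s) \<le> enn2real (P s) + enn2real (E s)"
        unfolding enn2real_plus[OF f(1,2)] enn2real_plus[OF f(3,4)] .
      then have "- gap n i \<phi> s \<le> (enn2real (P s) - enn2real (N s)) + (enn2real (L (\<tau> s)) - enn2real (S (\<tau> s)))"
        unfolding gap_def L_def E_def sf_def by linarith
      from mult_left_mono[OF this \<gamma>_nonneg[of s]] show ?thesis
        unfolding q_def by (simp add: distrib_left)
    qed
  qed
qed

text \<open>
  The loss rate is unbounded in \<open>v\<close>, so no Gronwall argument applies to \<open>gap\<close> directly.  On the support of
  the test function the rate is at most \<open>\<alpha>\<close>; splitting it as \<open>\<alpha> - (\<alpha> - rate)\<close> reduces a lower bound for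
  \<open>\<psi>\<close> to one for \<open>(1 - rate / \<alpha>) \<psi>\<close>, with the same support, at the cost of one more time integration.
\<close>

lemma gap_lower_bound:
  fixes i :: 's
  assumes le: "\<And>s. s \<in> {0..T} \<Longrightarrow> AE x in M. F n (\<tau> s) x \<le> H s x" and R: "0 \<le> R"
  defines "\<alpha> \<equiv> K * (c0 * (1 + sqrt (m $ i) * R)) + 1"
  assumes \<psi>: "test_function \<psi>" "\<And>v. 0 \<le> \<psi> v" "\<And>v. \<psi> v \<le> 1" "\<And>v. \<psi> v \<noteq> 0 \<Longrightarrow> norm v \<le> R"
    and t: "0 \<le> t" "t \<le> T"
  shows "- (K * ((\<alpha> * G * t) ^ k / fact k)) \<le> gap n i \<psi> t"
  using \<psi> t
proof (induction k arbitrary: \<psi> t)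
  case 0
  have Fm: "F (Suc n) (\<tau> t) \<in> borel_measurable M" by measurable
  have "(\<integral>\<^sup>+x. F (Suc n) (\<tau> t) x * species_test i \<psi> x \<partial>M) \<le> ennreal (1 * K)"
    by (rule linear_test_bound[OF Fm F_W_le[OF clock_nonneg] less_imp_le[OF K_positive] 0(3)]) simp
  then have "enn2real (\<integral>\<^sup>+x. F (Suc n) (\<tau> t) x * species_test i \<psi> x \<partial>M) \<le> K"
    using K_positive by (intro enn2real_leI) auto
  moreover have "0 \<le> enn2real (\<integral>\<^sup>+x. H t x * species_test i \<psi> x \<partial>M)" by simp
  ultimately have "- K \<le> enn2real (\<integral>\<^sup>+x. H t x * species_test i \<psi> x \<partial>M) - enn2real (\<integral>\<^sup>+x. F (Suc n) (\<tau> t) x * species_test i \<psi> x \<partial>M)"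
    by linarith
  then show ?case unfolding gap_def by simp
next
  case (Suc k)
  note \<psi> = Suc.prems(1-4)
  \<comment> \<open>The summand 1 in \<open>\<alpha>\<close> gives strict positivity from
    \<open>0 \<le> c0\<close> alone.\<close>
  have \<alpha>_pos: "0 < \<alpha>"
    unfolding \<alpha>_def using K_positive c0_nonneg R mass_pos[of i]
    by (intro add_nonneg_pos mult_nonneg_nonneg add_nonneg_nonneg) (auto simp: less_imp_le)
  have rate_le: "K * rate (i, v) \<le> \<alpha>" if "norm v \<le> R" for v
  proof -
    have "c0 * (1 + sqrt (m $ i) * norm v) \<le> c0 * (1 + sqrt (m $ i) * R)"
      using that c0_nonneg mass_pos[of i] by (intro mult_left_mono add_left_mono) (auto simp: less_imp_le)
    then have "K * (c0 * (1 + sqrt (m $ i) * norm v)) \<le> K * (c0 * (1 + sqrt (m $ i) * R))"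
      by (rule mult_left_mono) (use K_positive in simp)
    then show ?thesis unfolding \<alpha>_def rate_def rt_def fst_conv snd_conv by linarith
  qed
  define \<phi> where "\<phi> = (\<lambda>v. K * rate (i, v) * \<psi> v)"
  define \<eta> where "\<eta> = (\<lambda>v. (\<alpha> - K * rate (i, v)) / \<alpha> * \<psi> v)"
  have cont: "continuous_on UNIV \<psi>" using \<psi>(1) by (simp add: test_function_def)
  have \<eta>_cont: "continuous_on UNIV \<eta>" and \<phi>_cont: "continuous_on UNIV \<phi>"
    unfolding \<eta>_def \<phi>_def rate_def rt_def fst_conv snd_conv using \<alpha>_pos cont by (auto intro!: continuous_intros)
  have supp: "norm v \<le> R" if "\<eta> v \<noteq> 0" for v
    using that \<psi>(4)[of v] unfolding \<eta>_def by auto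
  have \<eta>_test: "test_function \<eta>" by (rule test_functionI[OF \<eta>_cont supp])
  have \<eta>_bounds: "0 \<le> \<eta> v \<and> \<eta> v \<le> 1" for v
  proof (cases "\<psi> v = 0")
    case False
    then have "K * rate (i, v) \<le> \<alpha>" by (intro rate_le \<psi>(4))
    moreover have "0 \<le> K * rate (i, v)" using K_positive rate_nonneg[of "(i, v)"] by simp
    ultimately have a: "0 \<le> (\<alpha> - K * rate (i, v)) / \<alpha>" "(\<alpha> - K * rate (i, v)) / \<alpha> \<le> 1"
      using \<alpha>_pos by (auto simp: field_simps)
    then show ?thesis
      unfolding \<eta>_def using mult_nonneg_nonneg[OF a(1) \<psi>(2)[of v]] mult_le_one[OF a(2) \<psi>(2)[of v] \<psi>(3)] by blast
  qed (simp add: \<eta>_def)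
  have \<phi>_bounds: "0 \<le> \<phi> v \<and> \<phi> v \<le> \<alpha>" for v
  proof (cases "\<psi> v = 0")
    case False
    then have "K * rate (i, v) \<le> \<alpha>" by (intro rate_le \<psi>(4))
    moreover have "0 \<le> K * rate (i, v)" using K_positive rate_nonneg[of "(i, v)"] by simp
    ultimately have "K * rate (i, v) * \<psi> v \<le> \<alpha> * 1" "0 \<le> K * rate (i, v) * \<psi> v"
      using mult_mono[of "K * rate (i, v)" \<alpha> "\<psi> v" 1] mult_nonneg_nonneg[of "K * rate (i, v)" "\<psi> v"] \<psi>(2,3)[of v] \<alpha>_pos by linarith+
    then show ?thesis unfolding \<phi>_def by simp
  qed (use \<alpha>_pos in \<open>simp add: \<phi>_def\<close>)
  have [measurable]: "\<psi> \<in> borel_measurable borel" "\<eta> \<in> borel_measurable borel" "\<phi> \<in> borel_measurable borel"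
    using cont \<eta>_cont \<phi>_cont by (auto intro: borel_measurable_continuous_onI)
  have gap_\<phi>: "gap n i \<phi> s = \<alpha> * gap n i \<psi> s - \<alpha> * gap n i \<eta> s" for s
  proof -
    have m: "(\<lambda>v. \<alpha> * \<eta> v) \<in> borel_measurable borel" by measurable
    have b: "0 \<le> \<alpha> * \<eta> v" "\<alpha> * \<eta> v \<le> \<alpha>" for v
      using \<eta>_bounds[of v] \<alpha>_pos by (auto simp: mult_left_le)
    have "(\<lambda>v. \<phi> v + \<alpha> * \<eta> v) = (\<lambda>v. \<alpha> * \<psi> v)"
      unfolding \<phi>_def \<eta>_def using \<alpha>_pos by (auto simp: fun_eq_iff field_simps)
    then have "gap n i (\<lambda>v. \<alpha> * \<psi> v) s = gap n i \<phi> s + gap n i (\<lambda>v. \<alpha> * \<eta> v) s"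
      using gap_linear(1)[OF \<open>\<phi> \<in> _\<close> m, of \<alpha> 0 n i s] \<phi>_bounds b by simp
    moreover have "gap n i (\<lambda>v. \<alpha> * \<psi> v) s = \<alpha> * gap n i \<psi> s" "gap n i (\<lambda>v. \<alpha> * \<eta> v) s = \<alpha> * gap n i \<eta> s"
      using gap_linear(2)[OF \<open>\<psi> \<in> _\<close> \<open>\<psi> \<in> _\<close>, of 1 \<alpha> n i s] gap_linear(2)[OF \<open>\<eta> \<in> _\<close> \<open>\<eta> \<in> _\<close>, of 1 \<alpha> n i s]
        \<psi>(2,3) \<eta>_bounds \<alpha>_pos by auto
    ultimately show ?thesis by simp
  qed
  obtain q where q: "set_integrable lborel {0..T} q"
    "\<And>t. 0 \<le> t \<Longrightarrow> t \<le> T \<Longrightarrow> gap n i \<psi> t = (LINT s:{0..t}|lborel. q s)"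
    "\<And>s. s \<in> {0..T} \<Longrightarrow> - \<gamma> s * gap n i \<phi> s \<le> q s"
    by (rule gap_integral[OF le \<psi>(1,2), of i]) (assumption, rule that, unfold \<phi>_def)
  define a where "a = \<alpha> * G"
  have a: "0 \<le> a" unfolding a_def using \<alpha>_pos G_nonneg by simp
  \<comment> \<open>The derivative of the bound claimed for \<open>Suc k\<close>, so that its
    integral returns this bound.\<close>
  define h where "h s = a * (K * ((a * s) ^ k / fact k))" for s
  have h_nonneg: "0 \<le> h s" if "0 \<le> s" for s unfolding h_def using that a K_positive by simp
  have FTC: "(\<integral>s. h s * indicator {0..r} s \<partial>lborel) = K * ((a * r) ^ Suc k / fact (Suc k)) - K * ((a * 0) ^ Suc k / fact (Suc k))"
    "integrable lborel (\<lambda>s. h s * indicator {0..r} s)" if "0 \<le> r" for r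
  proof -
    have hb: "h \<in> borel_measurable borel" unfolding h_def by measurable
    have hd: "((\<lambda>s. K * ((a * s) ^ Suc k / fact (Suc k))) has_real_derivative h s) (at s)" for s
      unfolding h_def by (rule power_fact_derivative)
    show "(\<integral>s. h s * indicator {0..r} s \<partial>lborel) = K * ((a * r) ^ Suc k / fact (Suc k)) - K * ((a * 0) ^ Suc k / fact (Suc k))"
      by (rule integral_FTC_Icc_nonneg[OF hb]) (use hd h_nonneg that in auto)
    show "integrable lborel (\<lambda>s. h s * indicator {0..r} s)"
      by (rule integrable_FTC_Icc_nonneg[OF hb]) (use hd h_nonneg that in auto)
  qed
  have h_int: "set_integrable lborel {0..T} h"
    using FTC(2)[of T] T_pos unfolding set_integrable_def by (simp add: mult.commute)
  have "- (LINT s:{0..t}|lborel. h s) \<le> gap n i \<psi> t"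
  proof (rule scalar_comparison[OF q(1) h_int q(2)])
    \<comment> \<open>Where the gap of \<open>\<psi>\<close> is negative, its contribution to
      \<open>- gap n i \<phi> s\<close> is nonnegative and may be dropped, and only the induction
      bound for \<open>\<eta>\<close> remains. \<open>scalar_comparison\<close> asks for nothing at
      other times.\<close>
    show "- h s \<le> q s" if s: "s \<in> {0..T}" and neg: "gap n i \<psi> s < 0" for s
    proof -
      have "- (K * ((a * s) ^ k / fact k)) \<le> gap n i \<eta> s"
        unfolding a_def by (rule Suc.IH[OF \<eta>_test]) (use \<eta>_bounds supp s in auto)
      then have 1: "\<alpha> * - (K * ((a * s) ^ k / fact k)) \<le> \<alpha> * gap n i \<eta> s"
        using \<alpha>_pos by (intro mult_left_mono) auto
      have "\<alpha> * gap n i \<psi> s \<le> 0" using \<alpha>_pos neg by (simp add: mult_nonneg_nonpos)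
      then have "- (\<alpha> * (K * ((a * s) ^ k / fact k))) \<le> - gap n i \<phi> s"
        unfolding gap_\<phi> using 1 by simp
      then have 2: "\<gamma> s * - (\<alpha> * (K * ((a * s) ^ k / fact k))) \<le> \<gamma> s * - gap n i \<phi> s"
        by (rule mult_left_mono[OF _ \<gamma>_nonneg])
      have "0 \<le> \<alpha> * (K * ((a * s) ^ k / fact k))" using \<alpha>_pos K_positive a s by simp
      then have "\<gamma> s * (\<alpha> * (K * ((a * s) ^ k / fact k))) \<le> G * (\<alpha> * (K * ((a * s) ^ k / fact k)))"
        by (rule mult_right_mono[OF \<gamma>_le])
      also have "\<dots> = h s" unfolding h_def a_def by (simp only: mult_ac)
      finally have "- h s \<le> \<gamma> s * - (\<alpha> * (K * ((a * s) ^ k / fact k)))" by simp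
      also note 2
      also have "\<gamma> s * - gap n i \<phi> s \<le> q s" using q(3)[OF s] by simp
      finally show ?thesis .
    qed
  qed (use h_nonneg Suc.prems(5,6) in auto)
  also have "(LINT s:{0..t}|lborel. h s) = K * ((\<alpha> * G * t) ^ Suc k / fact (Suc k))"
    using FTC(1)[OF Suc.prems(5)] unfolding set_lebesgue_integral_def a_def by (simp add: mult.commute)
  finally show ?case .
qed

text \<open>The lower bounds of \<open>gap_lower_bound\<close> hold for every \<open>k\<close> with
  one and the same \<open>\<alpha>\<close>, which depends only on a radius of the support; they tend
  to 0 as terms of an exponential series.\<close>

lemma gap_nonneg:
  assumes le: "\<And>s. s \<in> {0..T} \<Longrightarrow> AE x in M. F n (\<tau> s) x \<le> H s x"
    and \<psi>: "test_function \<psi>" "\<And>v. 0 \<le> \<psi> v" "\<And>v. \<psi> v \<le> 1" and t: "0 \<le> t" "t \<le> T"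
  shows "0 \<le> gap n i \<psi> t"
proof -
  have "bounded (closure {v. \<psi> v \<noteq> 0})" using \<psi>(1) unfolding test_function_def by (intro compact_imp_bounded) simp
  then obtain R where R: "\<forall>v\<in>closure {v. \<psi> v \<noteq> 0}. norm v \<le> R" unfolding bounded_iff by blast
  have supp: "norm v \<le> max R 0" if "\<psi> v \<noteq> 0" for v
    using R that closure_subset[of "{v. \<psi> v \<noteq> 0}"] by fastforce
  define \<alpha> where "\<alpha> = K * (c0 * (1 + sqrt (m $ i) * max R 0)) + 1"
  have "- (K * ((\<alpha> * G * t) ^ k / fact k)) \<le> gap n i \<psi> t" for k
    unfolding \<alpha>_def by (rule gap_lower_bound[OF le _ \<psi> supp t]) auto
  moreover have "(\<lambda>k. - (K * ((\<alpha> * G * t) ^ k / fact k))) \<longlonglongrightarrow> - (K * 0)"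
    using summable_LIMSEQ_zero[OF summable_exp[of "\<alpha> * G * t"]]
    by (intro tendsto_minus tendsto_mult tendsto_const) (simp add: divide_inverse mult.commute)
  ultimately have "- (K * 0) \<le> gap n i \<psi> t"
    by (intro LIMSEQ_le_const2) auto
  then show ?thesis by simp
qed

lemma enn2real_le_cancel: "x < \<top> \<Longrightarrow> y < \<top> \<Longrightarrow> enn2real x \<le> enn2real y \<Longrightarrow> x \<le> y"
  by (cases x; cases y) (auto intro: ennreal_leI)

text \<open>Induction with the time left general, because the comparison at \<open>t\<close> needs
  the order of the previous iterate at other times too. Nonnegative gaps for all test functions give
  the pointwise order through \<open>AE_le_of_tests\<close>.\<close>

lemma F_le_H: "t \<in> {0..T} \<Longrightarrow> AE x in M. F n (\<tau> t) x \<le> H t x"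
proof (induction n arbitrary: t)
  case 0
  then show ?case by (simp add: F_0)
next
  case (Suc n)
  have Fm[measurable]: "F (Suc n) (\<tau> t) \<in> borel_measurable M" by measurable
  have secm[measurable]: "(\<lambda>v. F (Suc n) (\<tau> t) (i, v)) \<in> borel_measurable borel" "(\<lambda>v. H t (i, v)) \<in> borel_measurable borel" for i
    by (rule measurable_compose[OF pair_measurable], measurable)+
  have fin: "(\<integral>\<^sup>+v. F (Suc n) (\<tau> t) (i, v) * ennreal (\<psi> v) \<partial>lborel) < \<top>" "(\<integral>\<^sup>+v. H t (i, v) * ennreal (\<psi> v) \<partial>lborel) < \<top>"
    if [measurable]: "\<psi> \<in> borel_measurable borel" and \<psi>: "\<And>v. \<psi> v \<le> 1" for \<psi> i
  proof -
    show "(\<integral>\<^sup>+v. F (Suc n) (\<tau> t) (i, v) * ennreal (\<psi> v) \<partial>lborel) < \<top>"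
      unfolding nn_integral_species_test[OF Fm that(1), symmetric]
      by (rule le_less_trans[OF linear_test_bound[where \<psi>=\<psi>, OF Fm F_W_le[OF clock_nonneg] less_imp_le[OF K_positive] \<psi> zero_le_one] ennreal_less_top])
    show "(\<integral>\<^sup>+v. H t (i, v) * ennreal (\<psi> v) \<partial>lborel) < \<top>"
      unfolding nn_integral_species_test[OF H_measurable that(1), symmetric]
      by (rule le_less_trans[OF linear_test_bound[where \<psi>=\<psi>, OF H_measurable h_W Kh_nonneg \<psi> zero_le_one] ennreal_less_top])
  qed
  have "AE v in lborel. F (Suc n) (\<tau> t) (i, v) \<le> H t (i, v)" for i
  proof (rule AE_le_of_tests[OF secm])
    show "(\<integral>\<^sup>+v. F (Suc n) (\<tau> t) (i, v) \<partial>lborel) < \<top>" "(\<integral>\<^sup>+v. H t (i, v) \<partial>lborel) < \<top>"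
      using fin[of "\<lambda>_. 1" i] by simp_all
    fix \<psi> :: "real^'d \<Rightarrow> real"
    assume c: "continuous_on UNIV \<psi>" "compact (closure {x. \<psi> x \<noteq> 0})" and b: "\<And>x. 0 \<le> \<psi> x \<and> \<psi> x \<le> 1"
    have [measurable]: "\<psi> \<in> borel_measurable borel" using c(1) by (rule borel_measurable_continuous_onI)
    have "0 \<le> gap n i \<psi> t"
      by (rule gap_nonneg[OF Suc.IH]) (use c b Suc.prems in \<open>auto simp: test_function_def\<close>)
    then show "(\<integral>\<^sup>+v. F (Suc n) (\<tau> t) (i, v) * ennreal (\<psi> v) \<partial>lborel) \<le> (\<integral>\<^sup>+v. H t (i, v) * ennreal (\<psi> v) \<partial>lborel)"
      unfolding gap_def nn_integral_species_test[OF Fm \<open>\<psi> \<in> _\<close>] nn_integral_species_test[OF H_measurable \<open>\<psi> \<in> _\<close>]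
      using fin[of \<psi> i] b by (intro enn2real_le_cancel) auto
  qed
  then show ?case by (subst AE_phase_iff) simp_all
qed

text \<open>The heat is finite and can be removed from the two energy relations, so the weighted
  integral of the competitor is at most that of the smaller function \<open>sol\<close>. The
  difference has integral zero, and the weight, being at least 1, can be divided out.\<close>

lemma H_eq_sol:
  assumes t: "t \<in> {0..T}"
  shows "AE x in M. H t x = sol (\<tau> t) x"
proof -
  define Hw where "Hw x = H t x * ennreal (Wr x)" for x
  define Sw where "Sw x = sol (\<tau> t) x * ennreal (Wr x)" for x
  have [measurable]: "Hw \<in> borel_measurable M" "Sw \<in> borel_measurable M" unfolding Hw_def Sw_def by measurable
  have "AE x in M. \<forall>n. F n (\<tau> t) x \<le> H t x"
    using F_le_H[OF t] by (simp add: AE_all_countable)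
  then have sol_le: "AE x in M. sol (\<tau> t) x \<le> H t x"
    by eventually_elim (auto simp: sol_def intro: SUP_least)
  then have Sw_le: "AE x in M. Sw x \<le> Hw x"
    unfolding Sw_def Hw_def by eventually_elim (simp add: mult_right_mono)
  have "(\<integral>\<^sup>+x. Hw x \<partial>M) + total_heat (\<tau> t) = (SUP n. (\<integral>\<^sup>+x. Hw x \<partial>M) + heat (Suc n) (\<tau> t))"
    unfolding total_heat_def SUP_Suc_shift[OF incseq_heat, symmetric] by (rule ennreal_SUP_add_right) simp
  also have "\<dots> \<le> ennreal K"
    unfolding Hw_def by (intro SUP_least H_energy_bound F_le_H t)
  also have "\<dots> = (\<integral>\<^sup>+x. Sw x \<partial>M) + total_heat (\<tau> t)"
    unfolding Sw_def by (rule energy_balance[OF clock_nonneg, symmetric])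
  finally have "(\<integral>\<^sup>+x. Hw x \<partial>M) \<le> (\<integral>\<^sup>+x. Sw x \<partial>M)"
  proof (rule ennreal_add_le_add_rightD)
    show "total_heat (\<tau> t) < \<top>"
      using sol_W_bound[OF clock_nonneg[of \<gamma> t]] by (rule_tac le_less_trans[where y="ennreal K"]) (auto intro: order_trans[rotated])
  qed
  moreover have fin: "(\<integral>\<^sup>+x. Sw x \<partial>M) \<noteq> \<top>"
    unfolding Sw_def using sol_W_fin[OF clock_nonneg] by (simp add: less_top)
  moreover have "(\<integral>\<^sup>+x. Hw x - Sw x \<partial>M) = (\<integral>\<^sup>+x. Hw x \<partial>M) - (\<integral>\<^sup>+x. Sw x \<partial>M)"
    by (rule nn_integral_diff) (use fin Sw_le in \<open>auto simp: infinity_ennreal_def\<close>)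
  ultimately have "(\<integral>\<^sup>+x. Hw x - Sw x \<partial>M) = 0"
    by (simp add: diff_eq_0_iff_ennreal less_top)
  then have "AE x in M. Hw x - Sw x = 0"
    by (subst (asm) nn_integral_0_iff_AE) auto
  then show ?thesis
    using sol_le sol_W_finite[OF clock_nonneg[of \<gamma> t]]
  proof eventually_elim
    case (elim x)
    have W: "1 \<le> Wr x" by (rule Wr_ge_1)
    have "Sw x < \<top>" unfolding Sw_def using elim(3) by (simp add: ennreal_mult_less_top)
    then have "Hw x \<le> Sw x" using elim(1) by (simp add: diff_eq_0_iff_ennreal)
    then have "Hw x * ennreal (1 / Wr x) \<le> Sw x * ennreal (1 / Wr x)" by (rule mult_right_mono) simp
    moreover have "ennreal (Wr x) * ennreal (1 / Wr x) = 1"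
      using W by (simp flip: ennreal_mult)
    ultimately have "H t x \<le> sol (\<tau> t) x" unfolding Hw_def Sw_def by (simp add: mult.assoc)
    with elim(2) show ?case by simp
  qed
qed

end

section \<open>From Lebesgue classes to Borel representatives\<close>

text \<open>By completeness both functions are measurable or neither is, and in the second case both
  integrals take the default value 0. This covers the collision terms of an arbitrary solution,
  whose measurability in time is not part of the definition.\<close>

lemma lebesgue_integral_cong_AE:
  fixes f g :: "'a::euclidean_space \<Rightarrow> 'b::{banach, second_countable_topology}"
  assumes eq: "AE x in lebesgue. f x = g x"
  shows "(LINT x|lebesgue. f x) = (LINT x|lebesgue. g x)"
proof -
  have meas: "f2 \<in> borel_measurable lebesgue"
    if f1: "f1 \<in> borel_measurable lebesgue" and ae: "AE x in lebesgue. f1 x = f2 x" for f1 f2 :: "'a \<Rightarrow> 'b"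
  proof (rule measurableI)
    fix A :: "'b set" assume "A \<in> sets borel"
    then have "f1 -` A \<in> sets lebesgue" using measurable_sets[OF f1, of A] by simp
    moreover have "AE x in lebesgue. x \<in> f1 -` A \<longleftrightarrow> x \<in> f2 -` A"
      using ae by eventually_elim simp
    ultimately show "f2 -` A \<inter> space lebesgue \<in> sets lebesgue"
      by - (rule completion.in_sets_AE[where A="f1 -` A"], simp_all)
  qed simp
  have eq': "AE x in lebesgue. g x = f x" using eq by eventually_elim simp
  show ?thesis
  proof (cases "f \<in> borel_measurable lebesgue")
    case True
    then show ?thesis using meas[OF True eq] eq by (intro integral_cong_AE)
  next
    case False
    then have "g \<notin> borel_measurable lebesgue" using meas[OF _ eq'] by blast
    with False have "\<not> integrable lebesgue f" "\<not> integrable lebesgue g"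
      by (auto dest: borel_measurable_integrable)
    then show ?thesis by (simp add: not_integrable_integral_eq)
  qed
qed

text \<open>The initial datum enters the notion of solution only through its class, so it may be
  replaced by a Borel representative.\<close>

lemma is_solution_cong:
  assumes eq: "AE v in lebesgue. f v = f' v" and sol: "is_solution m B f T g"
  shows "is_solution m B f' T g"
proof -
  have "(LINT v|lebesgue. f v $ i * \<psi> v) = (LINT v|lebesgue. f' v $ i * \<psi> v)" for i \<psi>
    by (rule lebesgue_integral_cong_AE) (use eq in eventually_elim, simp)
  moreover have "AE v in lebesgue. g 0 v = f' v"
    using sol eq unfolding is_solution_def by (auto elim: eventually_elim2)
  ultimately show ?thesis using sol unfolding is_solution_def by simp
qed

text \<open>Each component has a Borel version; taking its positive part changes it only on a null
  set.\<close>

lemma borel_version_nonneg: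
  fixes f :: "real^'d \<Rightarrow> real^'s"
  assumes f: "f \<in> borel_measurable lebesgue" and nn: "AE v in lebesgue. \<forall>i. 0 \<le> f v $ i"
  obtains h :: "real^'d \<Rightarrow> real^'s" where "\<And>i. (\<lambda>v. h v $ i) \<in> borel_measurable borel" "\<And>v i. 0 \<le> h v $ i"
    "AE v in lborel. f v = h v"
proof -
  have "\<exists>g. g \<in> borel_measurable borel \<and> (AE v in lborel. f v $ i = g v)" for i
  proof -
    have "(\<lambda>v. f v $ i) \<in> borel_measurable lebesgue"
      using f by (intro measurable_compose[OF f] borel_measurable_nth)
    from completion_ex_borel_measurable_real[OF this] show ?thesis by auto
  qed
  then obtain g where g: "\<And>i. g i \<in> borel_measurable borel" "\<And>i. AE v in lborel. f v $ i = g i v"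
    by metis
  define h :: "real^'d \<Rightarrow> real^'s" where "h v = (\<chi> i. max 0 (g i v))" for v
  show ?thesis
  proof (rule that[of h])
    show "(\<lambda>v. h v $ i) \<in> borel_measurable borel" for i
      unfolding h_def using g(1)[of i] by simp
    show "0 \<le> h v $ i" for v i unfolding h_def by simp
    have "AE v in lborel. \<forall>i. f v $ i = g i v"
      using g(2) by (intro eventually_all_finite) auto
    moreover have "AE v in lborel. \<forall>i. 0 \<le> f v $ i"
      using nn by (simp add: AE_completion_iff)
    ultimately show "AE v in lborel. f v = h v"
      by eventually_elim (simp add: h_def vec_eq_iff max_def)
  qed
qed

context inelastic_kernel
begin

text \<open>Counterpart of \<open>L1q_phase\<close>: there finiteness of the phase-space integral
  gives membership, here membership supplies the finiteness.\<close>

lemma L1q_phase_finite: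
  assumes w[measurable]: "w \<in> borel_measurable M" and w_nn: "\<And>x. 0 \<le> w x"
    and weight: "\<And>i v. L1q_weight m q i v = w (i, v)"
    and h[measurable]: "\<And>i. (\<lambda>v. h v $ i) \<in> borel_measurable borel" and eq: "AE v in lborel. f v = h v"
    and f: "f \<in> L1q m q"
  shows "(\<integral>\<^sup>+x. ennreal \<bar>h (snd x) $ fst x\<bar> * ennreal (w x) \<partial>M) = ennreal (L1q_norm m q f)"
proof -
  have [measurable]: "(\<lambda>v. w (i, v)) \<in> borel_measurable borel" for i
    by (rule measurable_compose[OF pair_measurable w])
  have hm: "(\<lambda>x. ennreal \<bar>h (snd x) $ fst x\<bar> * ennreal (w x)) \<in> borel_measurable M"
    by (rule borel_phase_measurable) simp
  have "(\<integral>\<^sup>+v. ennreal \<bar>h v $ i\<bar> * ennreal (w (i, v)) \<partial>lborel) < \<top>" for i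
  proof -
    have mi: "(\<lambda>v. \<bar>h v $ i\<bar> * w (i, v)) \<in> borel_measurable borel" by measurable
    have eqi: "AE v in lborel. \<bar>f v $ i\<bar> * L1q_weight m q i v = \<bar>h v $ i\<bar> * w (i, v)"
      using eq by eventually_elim (simp add: weight)
    have "integrable lebesgue (\<lambda>v. \<bar>f v $ i\<bar> * L1q_weight m q i v)"
      using f by (simp add: L1q_def)
    then have "integrable lborel (\<lambda>v. \<bar>h v $ i\<bar> * w (i, v))"
      unfolding lebesgue_integral_AE(2)[OF mi eqi] .
    then show ?thesis
      unfolding integrable_iff_bounded using w_nn by (simp add: ennreal_mult abs_mult)
  qed
  then have "(\<integral>\<^sup>+x. ennreal \<bar>h (snd x) $ fst x\<bar> * ennreal (w x) \<partial>M) < \<top>"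
    unfolding nn_integral_phase_measure[OF hm] by simp
  with L1q_phase(2)[OF w w_nn weight h eq] show ?thesis by simp
qed

lemma weak_pairing:
  assumes [measurable]: "\<And>i. (\<lambda>v. h v $ i) \<in> borel_measurable borel" and h: "\<And>v i. 0 \<le> h v $ i"
    and \<psi>[measurable]: "\<psi> \<in> borel_measurable borel" and \<psi>_nn: "\<And>v. 0 \<le> \<psi> v"
    and eq: "AE v in lborel. f v = h v"
  shows "(LINT v|lebesgue. f v $ i * \<psi> v) = enn2real (\<integral>\<^sup>+x. phase h x * species_test i \<psi> x \<partial>M)"
proof -
  have "(LINT v|lebesgue. f v $ i * \<psi> v) = (LINT v|lborel. h v $ i * \<psi> v)"
    by (rule lebesgue_integral_AE(1), measurable, use eq in eventually_elim, simp)
  also have "\<dots> = enn2real (\<integral>\<^sup>+v. ennreal (h v $ i * \<psi> v) \<partial>lborel)"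
    by (rule integral_eq_nn_integral) (auto simp: h \<psi>_nn)
  also have "\<dots> = enn2real (\<integral>\<^sup>+x. phase h x * species_test i \<psi> x \<partial>M)"
    by (subst nn_integral_species_test[OF phase_measurable \<psi>]) (simp_all add: phase_def ennreal_mult h \<psi>_nn)
  finally show ?thesis .
qed

end

context boltzmann_problem
begin

text \<open>Nonnegative Borel representatives of \<open>g\<close> are shown to satisfy the
  hypotheses of \<open>comparison\<close>. The bound on the second moment comes from continuity on
  the compact interval \<open>{0..T}\<close>, that on the third from the essential bound.\<close>

theorem uniqueness:
  assumes sol: "is_solution m B f0 T g" and t: "t \<in> {0..T}"
  shows "AE v in lebesgue. g t v = u t v"
proof -
  have nn: "0 \<le> Wr x" "0 \<le> Vr x" for x using Wr_ge_1[of x] Vr_ge_1[of x] by linarith+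
  have gL: "g t \<in> L1q m 2"
    and g_cont: "((\<lambda>s. L1q_norm m 2 (\<lambda>v. g s v - g t v)) \<longlongrightarrow> 0) (at t within {0..T})"
    and g_nn: "AE v in lebesgue. \<forall>i. 0 \<le> g t v $ i" if "t \<in> {0..T}" for t
    using sol that unfolding is_solution_def continuous_L1q_def by auto
  let ?P = "\<lambda>t h. (\<forall>i. (\<lambda>v. h v $ i) \<in> borel_measurable borel) \<and> (\<forall>v i. 0 \<le> h v $ i) \<and>
      (t \<in> {0..T} \<longrightarrow> (AE v in lborel. g t v = h v)) \<and> (t \<notin> {0..T} \<longrightarrow> h = (\<lambda>_. 0))"
  have "\<exists>h. ?P t h" for t
  proof (cases "t \<in> {0..T}")
    case True
    then have "g t \<in> borel_measurable lebesgue" using gL[of t] by (simp add: L1q_def)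
    then obtain h where "\<And>i. (\<lambda>v. h v $ i) \<in> borel_measurable borel" "\<And>v i. 0 \<le> h v $ i" "AE v in lborel. g t v = h v"
      by (rule borel_version_nonneg[OF _ g_nn[OF True]]) (rule that)
    then show ?thesis using True by (intro exI[of _ h]) simp
  next
    case False
    then show ?thesis by (intro exI[of _ "\<lambda>_. 0"]) auto
  qed
  \<comment> \<open>The representatives at different times are chosen independently, which is why
    nothing is known about their joint measurability.\<close>
  then have "\<exists>h. \<forall>t. ?P t (h t)" by (intro choice allI)
  then obtain h where "\<forall>t. ?P t (h t)" ..
  then have h_borel[measurable]: "\<And>t i. (\<lambda>v. h t v $ i) \<in> borel_measurable borel"
    and h_nn: "\<And>t v i. 0 \<le> h t v $ i" and gh: "\<And>t. t \<in> {0..T} \<Longrightarrow> AE v in lborel. g t v = h t v"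
    and h_out: "\<And>t. t \<notin> {0..T} \<Longrightarrow> h t = (\<lambda>_. 0)"
    by auto
  have [measurable]: "phase (h t) \<in> borel_measurable M" for t by (rule phase_measurable) simp
  have phase_abs: "phase (h t) x = ennreal \<bar>h t (snd x) $ fst x\<bar>" for t x
    using h_nn[of t "snd x" "fst x"] by (simp add: phase_def)
  have hW: "(\<integral>\<^sup>+x. phase (h t) x * ennreal (Wr x) \<partial>M) = ennreal (L1q_norm m 2 (g t))" if "t \<in> {0..T}" for t
    unfolding phase_abs by (rule L1q_phase_finite[OF _ nn(1) L1q_weight_2 h_borel gh[OF that] gL[OF that]]) measurable
  have dist: "(\<integral>\<^sup>+x. ennreal \<bar>h s (snd x) $ fst x - h t (snd x) $ fst x\<bar> * ennreal (Wr x) \<partial>M) =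
      ennreal (L1q_norm m 2 (\<lambda>v. g s v - g t v))" (is "?d s t = _")
    and norm_diff: "\<bar>L1q_norm m 2 (g s) - L1q_norm m 2 (g t)\<bar> \<le> L1q_norm m 2 (\<lambda>v. g s v - g t v)"
    if s: "s \<in> {0..T}" and t: "t \<in> {0..T}" for s t
  proof -
    have dm: "(\<lambda>x. ennreal \<bar>h s (snd x) $ fst x - h t (snd x) $ fst x\<bar>) \<in> borel_measurable M" for s t
      by (rule borel_phase_measurable) simp
    note [measurable] = dm
    have tri: "(\<integral>\<^sup>+x. phase (h a) x * ennreal (Wr x) \<partial>M) \<le> (\<integral>\<^sup>+x. phase (h b) x * ennreal (Wr x) \<partial>M) + ?d a b" for a b
    proof -
      have "(\<integral>\<^sup>+x. phase (h a) x * ennreal (Wr x) \<partial>M) \<le>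
        (\<integral>\<^sup>+x. phase (h b) x * ennreal (Wr x) + ennreal \<bar>h a (snd x) $ fst x - h b (snd x) $ fst x\<bar> * ennreal (Wr x) \<partial>M)"
        unfolding phase_abs distrib_right[symmetric]
        by (intro nn_integral_mono mult_right_mono) (auto simp flip: ennreal_plus intro!: ennreal_leI)
      then show ?thesis by (subst (asm) nn_integral_add) measurable
    qed
    have "?d s t \<le> (\<integral>\<^sup>+x. phase (h s) x * ennreal (Wr x) + phase (h t) x * ennreal (Wr x) \<partial>M)"
      unfolding phase_abs distrib_right[symmetric]
      by (intro nn_integral_mono mult_right_mono) (auto simp flip: ennreal_plus intro!: ennreal_leI)
    also have "\<dots> = ennreal (L1q_norm m 2 (g s)) + ennreal (L1q_norm m 2 (g t))"
      unfolding hW[OF s, symmetric] hW[OF t, symmetric] by (rule nn_integral_add) measurable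
    also have "\<dots> < \<top>" by simp
    finally have fin: "?d s t < \<top>" .
    have eq: "AE v in lborel. g s v - g t v = h s v - h t v"
      using gh[OF s] gh[OF t] by eventually_elim simp
    have m: "(\<lambda>v. (h s v - h t v) $ i) \<in> borel_measurable borel" for i by simp
    have "L1q_norm m 2 (\<lambda>v. g s v - g t v) = enn2real (?d s t)"
      using L1q_phase(2)[OF _ nn(1) L1q_weight_2 m eq] fin by simp
    then show d: "?d s t = ennreal (L1q_norm m 2 (\<lambda>v. g s v - g t v))" using fin by simp
    have sym: "?d t s = ?d s t" by (simp add: abs_minus_commute)
    have nonneg: "0 \<le> L1q_norm m 2 f" for f :: "real^'d \<Rightarrow> real^'s"
      unfolding L1q_norm_def by (intro sum_nonneg integral_nonneg_AE) (auto simp: L1q_weight_2 nn)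
    show "\<bar>L1q_norm m 2 (g s) - L1q_norm m 2 (g t)\<bar> \<le> L1q_norm m 2 (\<lambda>v. g s v - g t v)"
      using tri[of s t] tri[of t s] unfolding hW[OF s] hW[OF t] sym d
      by (auto simp: nonneg simp flip: ennreal_plus)
  qed
  have "continuous_on {0..T} (\<lambda>t. L1q_norm m 2 (g t))"
    unfolding continuous_on_def
  proof
    fix t assume t: "t \<in> {0..T}"
    have "((\<lambda>s. L1q_norm m 2 (g s) - L1q_norm m 2 (g t)) \<longlongrightarrow> 0) (at t within {0..T})"
      by (rule Lim_null_comparison[OF _ g_cont[OF t]]) (use norm_diff[OF _ t] in \<open>auto simp: eventually_at_filter\<close>)
    then show "((\<lambda>s. L1q_norm m 2 (g s)) \<longlongrightarrow> L1q_norm m 2 (g t)) (at t within {0..T})"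
      by (rule LIM_zero_cancel)
  qed
  then have "bounded ((\<lambda>t. L1q_norm m 2 (g t)) ` {0..T})"
    by (intro compact_imp_bounded compact_continuous_image) auto
  then obtain Kh where "\<forall>x\<in>(\<lambda>t. L1q_norm m 2 (g t)) ` {0..T}. norm x \<le> Kh"
    unfolding bounded_iff by blast
  then have Kh: "\<And>t. t \<in> {0..T} \<Longrightarrow> \<bar>L1q_norm m 2 (g t)\<bar> \<le> Kh" by auto
  have Kh_nn: "0 \<le> Kh" using Kh[of 0] T_pos by simp
  have hW_le: "(\<integral>\<^sup>+x. phase (h t) x * ennreal (Wr x) \<partial>M) \<le> ennreal Kh" for t
  proof (cases "t \<in> {0..T}")
    case True
    then show ?thesis using Kh[OF True] unfolding hW[OF True] by (intro ennreal_leI) simp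
  qed (simp add: h_out phase_def)
  obtain Vh where "AE t in lebesgue_on {0<..<T}. g t \<in> L1q m 3" "AE t in lebesgue_on {0<..<T}. L1q_norm m 3 (g t) \<le> Vh"
    using sol unfolding is_solution_def Linf_L1q_def by auto
  then have "AE t in lborel. t \<in> {0<..<T} \<longrightarrow> g t \<in> L1q m 3" "AE t in lborel. t \<in> {0<..<T} \<longrightarrow> L1q_norm m 3 (g t) \<le> Vh"
    by (auto simp: AE_restrict_space_iff AE_completion_iff)
  \<comment> \<open>The third-moment bound lives on the open interval, while \<open>h\<close> is
    nonzero possibly also at the two endpoints.\<close>
  moreover have "AE t in lborel. t \<noteq> 0" "AE t in lborel. t \<noteq> T" by (rule AE_lborel_singleton)+
  ultimately have hV: "AE t in lborel. (\<integral>\<^sup>+x. phase (h t) x * ennreal (Vr x) \<partial>M) \<le> ennreal (max 0 Vh)"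
  proof eventually_elim
    case (elim t)
    show ?case
    proof (cases "t \<in> {0..T}")
      case True
      with elim have L: "g t \<in> L1q m 3" "L1q_norm m 3 (g t) \<le> Vh" by auto
      have "(\<integral>\<^sup>+x. phase (h t) x * ennreal (Vr x) \<partial>M) = ennreal (L1q_norm m 3 (g t))"
        unfolding phase_abs by (rule L1q_phase_finite[OF _ nn(2) L1q_weight_3 h_borel gh[OF True] L(1)]) measurable
      then show ?thesis using L(2) by (auto intro: ennreal_leI)
    qed (simp add: h_out phase_def)
  qed
  have speed_fin: "(\<integral>\<^sup>+x. \<integral>\<^sup>+y. phase (h s) x * phase (h s) y * ennreal (speed x y) \<partial>M \<partial>M) < \<top>" for s
  proof -
    have "(\<integral>\<^sup>+x. \<integral>\<^sup>+y. phase (h s) x * phase (h s) y * ennreal (speed x y) \<partial>M \<partial>M) \<le>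
        ennreal (2 * c0) * ((\<integral>\<^sup>+x. phase (h s) x * ennreal (Wr x) \<partial>M) * (\<integral>\<^sup>+x. phase (h s) x * ennreal (Wr x) \<partial>M))"
      by (intro quadratic_form_le speed_le_Wr) measurable
    also have "\<dots> < \<top>"
      using hW_le[of s] by (auto simp: ennreal_mult_less_top intro: le_less_trans)
    finally show ?thesis .
  qed
  interpret C: comparison m \<beta> f0 \<gamma> B G T K V0 h Kh "max 0 Vh"
  proof unfold_locales
    fix t assume t: "t \<in> {0..T}"
    have "((\<lambda>s. ennreal (L1q_norm m 2 (\<lambda>v. g s v - g t v))) \<longlongrightarrow> ennreal 0) (at t within {0..T})"
      by (rule tendsto_ennrealI[OF g_cont[OF t]])
    moreover have "\<forall>\<^sub>F s in at t within {0..T}. ennreal (L1q_norm m 2 (\<lambda>v. g s v - g t v)) =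
      (\<integral>\<^sup>+x. ennreal \<bar>h s (snd x) $ fst x - h t (snd x) $ fst x\<bar> * ennreal (Wr x) \<partial>M)"
      using dist[OF _ t] by (simp add: eventually_at_filter)
    ultimately show "((\<lambda>s. \<integral>\<^sup>+x. ennreal \<bar>h s (snd x) $ fst x - h t (snd x) $ fst x\<bar> * ennreal (Wr x) \<partial>M) \<longlongrightarrow> 0) (at t within {0..T})"
      using Lim_transform_eventually by simp
  next
    fix \<psi> :: "real^'d \<Rightarrow> real" and t i
    assume \<psi>: "test_function \<psi>" "\<And>v. 0 \<le> \<psi> v" and t: "t \<in> {0..T}"
    obtain c where c: "\<And>v. \<bar>\<psi> v\<bar> \<le> c" and \<psi>m[measurable]: "\<psi> \<in> borel_measurable borel"
      by (rule test_function_bounded[OF \<psi>(1)]) (rule that)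
    have \<psi>c: "\<psi> v \<le> c" for v using c[of v] by simp
    let ?P = "\<lambda>s. \<integral>\<^sup>+x. gain (phase (h s)) x * species_test i \<psi> x \<partial>M"
    let ?N = "\<lambda>s. \<integral>\<^sup>+x. phase (h s) x * loss (phase (h s)) x * species_test i \<psi> x \<partial>M"
    have P: "?P s = (\<integral>\<^sup>+x. \<integral>\<^sup>+y. phase (h s) x * phase (h s) y * gain_adj (species_test i \<psi>) x y \<partial>M \<partial>M)" for s
      by (rule gain_weak) measurable
    have N: "?N s = (\<integral>\<^sup>+x. \<integral>\<^sup>+y. phase (h s) x * phase (h s) y * (ennreal (speed x y) * species_test i \<psi> x) \<partial>M \<partial>M)" for s
      by (rule double_integral_loss[symmetric]) measurable
    have rhs: "AE s in lebesgue. indicator {0<..<t} s *\<^sub>R (\<Sum>j\<in>UNIV. collision_weak m (B s) i j (\<lambda>v. g s v $ i) (\<lambda>v. g s v $ j) \<psi>) =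
        indicator {0<..<t} s *\<^sub>R (\<gamma> s * (enn2real (?P s) - enn2real (?N s)))"
      using AE_completion[OF B_integral]
    proof eventually_elim
      case (elim s)
      show ?case
      proof (cases "s \<in> {0<..<t}")
        case True
        with t have s: "0 < s" "s < T" "s \<in> {0..T}" by auto
        have eq: "AE v in lborel. g s v $ i = h s v $ i" for i
          using gh[OF s(3)] by eventually_elim simp
        have "(\<Sum>j\<in>UNIV. collision_weak m (B s) i j (\<lambda>v. g s v $ i) (\<lambda>v. g s v $ j) \<psi>) = \<gamma> s * (enn2real (?P s) - enn2real (?N s))"
          unfolding P N by (rule collision_weak_eq(1)[OF _ \<gamma>_nonneg \<psi>m \<psi>(2) \<psi>c h_borel h_nn eq speed_fin])
            (use elim s in auto)
        then show ?thesis by simp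
      qed simp
    qed
    have "(LINT v|lebesgue. g t v $ i * \<psi> v) = (LINT v|lebesgue. f0 v $ i * \<psi> v) +
        (LINT s|lebesgue_on {0<..<t}. (\<Sum>j\<in>UNIV. collision_weak m (B s) i j (\<lambda>v. g s v $ i) (\<lambda>v. g s v $ j) \<psi>))"
      using sol \<psi>(1) t unfolding is_solution_def by blast
    moreover have "(LINT v|lebesgue. g t v $ i * \<psi> v) = enn2real (\<integral>\<^sup>+x. phase (h t) x * species_test i \<psi> x \<partial>M)"
      by (rule weak_pairing[OF h_borel h_nn \<psi>m \<psi>(2) gh[OF t]])
    moreover have "(LINT v|lebesgue. f0 v $ i * \<psi> v) = enn2real (\<integral>\<^sup>+x. phase f0 x * species_test i \<psi> x \<partial>M)"
      by (rule weak_pairing[OF f0_borel f0_nonneg \<psi>m \<psi>(2)]) simp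
    moreover have "(LINT s|lebesgue_on {0<..<t}. (\<Sum>j\<in>UNIV. collision_weak m (B s) i j (\<lambda>v. g s v $ i) (\<lambda>v. g s v $ j) \<psi>)) =
        (LINT s|lebesgue_on {0<..<t}. \<gamma> s * (enn2real (?P s) - enn2real (?N s)))"
      using lebesgue_integral_cong_AE[OF rhs] by (simp add: integral_restrict_space)
    ultimately show "enn2real (\<integral>\<^sup>+x. phase (h t) x * species_test i \<psi> x \<partial>M) =
      enn2real (\<integral>\<^sup>+x. phase f0 x * species_test i \<psi> x \<partial>M) +
      (LINT s|lebesgue_on {0<..<t}. \<gamma> s * (enn2real (?P s) - enn2real (?N s)))"
      by simp
  qed (use h_nn h_out hW_le Kh_nn hV in auto)
  have "\<forall>i. AE v in lborel. phase (h t) (i, v) = sol (\<tau> t) (i, v)"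
    using C.H_eq_sol[OF t] by (subst (asm) AE_phase_iff) simp_all
  then have "AE v in lborel. \<forall>i. phase (h t) (i, v) = sol (\<tau> t) (i, v)"
    by (intro eventually_all_finite) auto
  with gh[OF t] have "AE v in lborel. g t v = u t v"
  proof eventually_elim
    case (elim v)
    have "h t v $ i = u t v $ i" for i
      using elim(2)[rule_format, of i, symmetric] h_nn[of t v i] by (simp add: phase_def)
    then show ?case using elim(1) by (simp add: vec_eq_iff)
  qed
  then show ?thesis by (rule AE_completion)
qed

end

context inelastic_kernel
begin

text \<open>The third moment bounds the second, so both are finite; the unit mass of a single
  species makes \<open>K\<close> positive.\<close>

lemma initial_data:
  assumes L1: "fin \<in> L1q m 3" and nn: "AE v in lebesgue. \<forall>i. 0 \<le> fin v $ i"
    and mass: "\<And>i. species_mass m fin i = 1"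
  obtains f0 K V0 where "\<And>i. (\<lambda>v. f0 v $ i) \<in> borel_measurable borel" "\<And>v i. 0 \<le> f0 v $ i"
    "(\<integral>\<^sup>+x. phase f0 x * ennreal (Wr x) \<partial>M) = ennreal K"
    "(\<integral>\<^sup>+x. phase f0 x * ennreal (Vr x) \<partial>M) = ennreal V0"
    "0 < K" "0 \<le> V0" "AE v in lebesgue. fin v = f0 v"
proof -
  have "fin \<in> borel_measurable lebesgue" using L1 by (simp add: L1q_def)
  then obtain f0 where f0: "\<And>i. (\<lambda>v. f0 v $ i) \<in> borel_measurable borel" "\<And>v i. 0 \<le> f0 v $ i" "AE v in lborel. fin v = f0 v"
    by (rule borel_version_nonneg[OF _ nn]) (rule that)
  note [measurable] = f0(1)
  have [measurable]: "phase f0 \<in> borel_measurable M" by (rule phase_measurable) simp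
  have abs: "phase f0 x = ennreal \<bar>f0 (snd x) $ fst x\<bar>" for x
    using f0(2)[of "snd x" "fst x"] by (simp add: phase_def)
  have Vr_nn: "0 \<le> Vr x" for x using Vr_ge_1[of x] by linarith
  have V: "(\<integral>\<^sup>+x. phase f0 x * ennreal (Vr x) \<partial>M) < \<top>" (is "?V < _")
    unfolding abs L1q_phase_finite[OF Vr_measurable Vr_nn L1q_weight_3 f0(1) f0(3) L1] by simp
  have W_le: "Wr x \<le> 2 * Vr x" for x
  proof -
    have "rt x ^ 2 \<le> 1 + 2 * rt x ^ 3"
    proof (cases "rt x \<le> 1")
      case True
      then have "rt x ^ 2 \<le> 1" using rt_nonneg[of x] by (simp add: power_le_one)
      then show ?thesis using rt_nonneg[of x] by (simp add: add_increasing2)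
    next
      case False
      then have "rt x ^ 2 \<le> rt x ^ 3" by (intro power_increasing) auto
      moreover have "0 \<le> rt x ^ 3" using rt_nonneg[of x] by simp
      ultimately show ?thesis by linarith
    qed
    then show ?thesis unfolding Wr_def Vr_def by simp
  qed
  have "(\<integral>\<^sup>+x. phase f0 x * ennreal (Wr x) \<partial>M) \<le> (\<integral>\<^sup>+x. 2 * (phase f0 x * ennreal (Vr x)) \<partial>M)"
  proof (intro nn_integral_mono)
    fix x
    have "phase f0 x * ennreal (Wr x) \<le> phase f0 x * ennreal (2 * Vr x)"
      by (intro mult_left_mono ennreal_leI W_le) simp
    also have "ennreal (2 * Vr x) = 2 * ennreal (Vr x)"
      using Vr_nn[of x] by (simp add: ennreal_mult)
    finally show "phase f0 x * ennreal (Wr x) \<le> 2 * (phase f0 x * ennreal (Vr x))" by (simp add: mult_ac)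
  qed
  also have "\<dots> = 2 * ?V" by (rule nn_integral_cmult) measurable
  also have "\<dots> < \<top>" using V by (simp add: ennreal_mult_less_top)
  finally have W: "(\<integral>\<^sup>+x. phase f0 x * ennreal (Wr x) \<partial>M) < \<top>" (is "?W < _") .
  fix i :: 's
  have one: "(\<lambda>_. 1) \<in> borel_measurable (borel :: (real^'d) measure)" by simp
  have "(LINT v|lebesgue. fin v $ i * 1) = enn2real (\<integral>\<^sup>+x. phase f0 x * species_test i (\<lambda>_. 1) x \<partial>M)"
    by (rule weak_pairing[OF f0(1,2) one _ f0(3)]) simp
  also have "\<dots> \<le> enn2real ?W"
    using Wr_ge_1 by (intro enn2real_mono W nn_integral_mono mult_left_mono) (auto simp: species_test_def)
  finally have "(LINT v|lebesgue. fin v $ i) \<le> enn2real ?W" by simp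
  moreover have "0 < (LINT v|lebesgue. fin v $ i)"
    using mass[of i] mass_pos[of i] unfolding species_mass_def by (simp add: zero_less_mult_iff) (metis mult_zero_right not_less_iff_gr_or_eq zero_less_mult_iff zero_less_one)
  ultimately have "0 < enn2real ?W" by linarith
  with V W show ?thesis
    by (intro that[of f0 "enn2real ?W" "enn2real ?V"] f0 AE_completion[OF f0(3)]) auto
qed

end

section \<open>Reduction of the theorem to the Borel setting\<close>

text \<open>The given kernel lives on the ball as a subspace. Its image under the inclusion is a
  kernel on the whole space that inherits measurability and symmetry and is concentrated on the
  ball.\<close>

lemma inelastic_kernel_ball:
  fixes m :: "real^'s" and b :: "real^'d \<Rightarrow> (real^'d) measure"
  assumes m: "\<And>i. 0 < m $ i"
    and b: "b \<in> borel \<rightarrow>\<^sub>M prob_algebra (restrict_space borel (cball 0 1))"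
    and sym: "\<And>u. b u = distr (b (- u)) (restrict_space borel (cball 0 1)) uminus"
  shows "inelastic_kernel m (\<lambda>u. distr (b u) borel (\<lambda>z. z))"
proof
  let ?R = "restrict_space borel (cball 0 1) :: (real^'d) measure"
  have id: "(\<lambda>z. z) \<in> ?R \<rightarrow>\<^sub>M borel" by (rule measurable_restrict_space1) simp
  have neg: "uminus \<in> ?R \<rightarrow>\<^sub>M ?R" by (rule measurable_restrict_space3) auto
  have sets: "sets (b u) = sets ?R" for u
    using measurable_space[OF b, of u] by (simp add: space_prob_algebra)
  note cong = measurable_cong_sets[OF sets refl]
  show "0 < m $ i" for i by (rule m)
  show "(\<lambda>u. distr (b u) borel (\<lambda>z. z)) \<in> borel \<rightarrow>\<^sub>M prob_algebra borel"
    by (rule measurable_compose[OF b measurable_distr_prob_space[OF id]])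
  show "AE z in distr (b u) borel (\<lambda>z. z). norm z \<le> 1" for u
  proof (subst AE_distr_iff)
    show "(\<lambda>z. z) \<in> b u \<rightarrow>\<^sub>M borel" unfolding cong by (rule id)
    have "space (b u) = cball 0 1"
      using sets_eq_imp_space_eq[OF sets[of u]] by (simp add: space_restrict_space)
    then show "AE z in b u. norm z \<le> 1" by (intro AE_I2) simp
  qed simp
  show "distr (b u) borel (\<lambda>z. z) = distr (distr (b (- u)) borel (\<lambda>z. z)) borel uminus" for u
  proof -
    have "distr (b u) borel (\<lambda>z. z) = distr (distr (b (- u)) ?R uminus) borel (\<lambda>z. z)"
      by (subst sym) (rule refl)
    also have "\<dots> = distr (b (- u)) borel ((\<lambda>z. z) \<circ> uminus)"
      by (rule distr_distr) (use id neg in \<open>simp_all add: cong\<close>)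
    also have "\<dots> = distr (distr (b (- u)) borel (\<lambda>z. z)) borel uminus"
      by (subst distr_distr) (use id in \<open>simp_all add: cong comp_def\<close>)
    finally show ?thesis .
  qed
qed

context boltzmann_problem
begin

lemma u_solution: "is_solution m B f0 T u"
  unfolding is_solution_def
  using u_continuous u_Linf u_weak AE_completion[OF u_initial] by (auto simp del: atLeastAtMost_iff) auto

text \<open>Mass and momentum are carried over from time 0, where \<open>u\<close> agrees with
  \<open>f0\<close> almost everywhere; the positive mass of any one species yields positive
  energy.\<close>

theorem well_posed:
  assumes mass: "\<And>i. species_mass m f0 i = 1" and mom: "momentum m f0 = 0"
  shows "\<exists>f. is_solution m B f0 T f \<and>
         (\<forall>g. is_solution m B f0 T g \<longrightarrow> (\<forall>t\<in>{0..T}. AE v in lebesgue. g t v = f t v)) \<and>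
         (\<forall>t\<in>{0..T}. (\<forall>i. species_mass m (f t) i = 1) \<and> momentum m (f t) = 0) \<and>
         (\<forall>t\<in>{0..T}. kinetic_energy m (f t) > 0) \<and>
         antimono_on {0..T} (\<lambda>t. kinetic_energy m (f t))"
proof (intro exI[of _ u] conjI ballI allI impI u_solution uniqueness u_energy_antimono)
  have init: "AE v in lebesgue. u 0 v = f0 v" by (rule AE_completion[OF u_initial])
  have u0: "(LINT v|lebesgue. u 0 v $ i) = (LINT v|lebesgue. f0 v $ i)" for i
    by (rule lebesgue_integral_cong_AE) (use init in eventually_elim, simp)
  have "momentum m (u 0) = momentum m f0"
    unfolding momentum_def by (intro sum.cong refl lebesgue_integral_cong_AE) (use init in eventually_elim, simp)
  fix t assume t: "t \<in> {0..T}"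
  then have t0: "0 \<le> t" by simp
  show "momentum m (u t) = 0"
    unfolding u_momentum[OF t0] \<open>momentum m (u 0) = momentum m f0\<close> by (rule mom)
  have mass_eq: "m $ i * (LINT v|lebesgue. u t v $ i) = 1" for i
    unfolding u_mass[OF t0] u0 using mass[of i] by (simp only: species_mass_def integral_mult_right_zero)
  show "species_mass m (u t) i = 1" for i
    using mass_eq[of i] by (simp only: species_mass_def integral_mult_right_zero)
  fix i :: 's
  have "0 < m $ i * (LINT v|lebesgue. u t v $ i)" unfolding mass_eq by simp
  then have "0 < (LINT v|lebesgue. u t v $ i)"
    using mass_pos[of i] by (simp only: zero_less_mult_pos)
  then show "0 < kinetic_energy m (u t)" by (rule u_energy_pos)
qed

end

theorem theorem5p7:
  fixes m :: "real^'s"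
    and Tstar \<gamma>star :: real
    and B :: "real \<Rightarrow> real^'d \<Rightarrow> (real^'d) measure"
    and \<gamma> :: "real \<Rightarrow> real"
    and b :: "real^'d \<Rightarrow> (real^'d) measure"
    and fin :: "real^'d \<Rightarrow> real^'s"
  assumes masses: "\<And>i. m $ i > 0"
    and Tstar: "Tstar > 0"
    and b_kernel: "b \<in> borel \<rightarrow>\<^sub>M prob_algebra (restrict_space borel (cball 0 1))"
    and b_sym: "\<And>u. b u = distr (b (- u)) (restrict_space borel (cball 0 1)) uminus"
    and \<gamma>_meas: "\<gamma> \<in> borel_measurable (lebesgue_on {0<..<Tstar})"
    and \<gamma>_bound: "\<And>t. t \<in> {0<..<Tstar} \<Longrightarrow> 0 \<le> \<gamma> t \<and> \<gamma> t \<le> \<gamma>star"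
    and B_form: "\<And>t u. t \<in> {0<..<Tstar} \<Longrightarrow> B t u = scale_measure (ennreal (norm u * \<gamma> t)) (b u)"
    and fin_L1: "fin \<in> L1q m 3"
    and fin_nonneg: "AE v in lebesgue. \<forall>i. 0 \<le> fin v $ i"
    and fin_mass: "\<And>i. species_mass m fin i = 1"
    and fin_momentum: "momentum m fin = 0"
  shows "\<forall>T. 0 < T \<and> T \<le> Tstar \<longrightarrow>
    (\<exists>f. is_solution m B fin T f \<and>
         (\<forall>g. is_solution m B fin T g \<longrightarrow> (\<forall>t\<in>{0..T}. AE v in lebesgue. g t v = f t v)) \<and>
         (\<forall>t\<in>{0..T}. (\<forall>i. species_mass m (f t) i = 1) \<and> momentum m (f t) = 0) \<and>
         (\<forall>t\<in>{0..T}. kinetic_energy m (f t) > 0) \<and>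
         antimono_on {0..T} (\<lambda>t. kinetic_energy m (f t)))"
proof (intro allI impI)
  fix T assume T: "0 < T \<and> T \<le> Tstar"
  define \<beta> where "\<beta> u = distr (b u) borel (\<lambda>z. z)" for u
  interpret kernel: inelastic_kernel m \<beta>
    unfolding \<beta>_def by (rule inelastic_kernel_ball[OF masses b_kernel b_sym])
  obtain f0 K V0 where f0: "\<And>i. (\<lambda>v. f0 v $ i) \<in> borel_measurable borel" "\<And>v i. 0 \<le> f0 v $ i"
    "(\<integral>\<^sup>+x. kernel.phase f0 x * ennreal (kernel.Wr x) \<partial>phase_measure) = ennreal K"
    "(\<integral>\<^sup>+x. kernel.phase f0 x * ennreal (kernel.Vr x) \<partial>phase_measure) = ennreal V0"
    "0 < K" "0 \<le> V0" and fin_f0: "AE v in lebesgue. fin v = f0 v"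
    by (rule kernel.initial_data[OF fin_L1 fin_nonneg fin_mass]) (rule that)
  have "(\<lambda>t. indicator {0<..<Tstar} t *\<^sub>R \<gamma> t) \<in> borel_measurable lebesgue"
    using \<gamma>_meas by (subst (asm) borel_measurable_restrict_space_iff) auto
  from completion_ex_borel_measurable_real[OF this] obtain \<gamma>' where
    [measurable]: "\<gamma>' \<in> borel_measurable borel" and \<gamma>': "AE t in lborel. indicator {0<..<Tstar} t *\<^sub>R \<gamma> t = \<gamma>' t"
    by auto
  \<comment> \<open>The Borel version \<open>\<gamma>'\<close> agrees with \<open>\<gamma>\<close>
    almost everywhere on the interval. Clipping secures the bounds at every real time and changes
    nothing where the two agree.\<close>
  define \<gamma>0 where "\<gamma>0 t = min \<gamma>star (max 0 (\<gamma>' t))" for t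
  have \<gamma>star: "0 \<le> \<gamma>star" using \<gamma>_bound[of "Tstar / 2"] Tstar by simp
  interpret boltzmann_problem m \<beta> f0 \<gamma>0 B \<gamma>star T K V0
  proof unfold_locales
    show "AE s in lborel. 0 < s \<longrightarrow> s < T \<longrightarrow> (\<forall>u h. h \<in> borel_measurable borel \<longrightarrow>
      (LINT z|B s u. h z) = norm u * \<gamma>0 s * (LINT z|\<beta> u. (h z :: real)))"
      using \<gamma>'
    proof eventually_elim
      case (elim s)
      show ?case
      proof (intro impI allI)
        fix u and h :: "real^'d \<Rightarrow> real" assume s: "0 < s" "s < T" and h: "h \<in> borel_measurable borel"
        have s': "s \<in> {0<..<Tstar}" using s T by simp
        have "\<gamma>0 s = \<gamma> s" using elim \<gamma>_bound[OF s'] s' unfolding \<gamma>0_def by simp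
        moreover have "(LINT z|B s u. h z) = norm u * \<gamma> s * (LINT z|\<beta> u. h z)"
          by (rule kernel.integral_scaled_kernel[OF b_kernel \<beta>_def B_form[OF s'] _ h]) (use \<gamma>_bound[OF s'] in simp)
        ultimately show "(LINT z|B s u. h z) = norm u * \<gamma>0 s * (LINT z|\<beta> u. h z)" by simp
      qed
    qed
  qed (use f0 \<gamma>star T in \<open>auto simp: \<gamma>0_def[abs_def]\<close>)
  have "species_mass m fin i = species_mass m f0 i" for i
    unfolding species_mass_def by (rule lebesgue_integral_cong_AE) (use fin_f0 in eventually_elim, simp)
  moreover have "momentum m fin = momentum m f0"
    unfolding momentum_def by (intro sum.cong refl lebesgue_integral_cong_AE) (use fin_f0 in eventually_elim, simp)
  ultimately have wp: "\<exists>f. is_solution m B f0 T f \<and>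
         (\<forall>g. is_solution m B f0 T g \<longrightarrow> (\<forall>t\<in>{0..T}. AE v in lebesgue. g t v = f t v)) \<and>
         (\<forall>t\<in>{0..T}. (\<forall>i. species_mass m (f t) i = 1) \<and> momentum m (f t) = 0) \<and>
         (\<forall>t\<in>{0..T}. kinetic_energy m (f t) > 0) \<and>
         antimono_on {0..T} (\<lambda>t. kinetic_energy m (f t))"
    using fin_mass fin_momentum by (intro well_posed) auto
  have f0_fin: "AE v in lebesgue. f0 v = fin v" using fin_f0 by eventually_elim simp
  \<comment> \<open>Both directions matter: existence passes from \<open>f0\<close> to
    \<open>fin\<close>, while uniqueness quantifies over the solutions for
    \<open>fin\<close>.\<close>
  have "is_solution m B f0 T f \<longleftrightarrow> is_solution m B fin T f" for f
    using is_solution_cong[OF fin_f0] is_solution_cong[OF f0_fin] by blast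
  then show "\<exists>f. is_solution m B fin T f \<and>
         (\<forall>g. is_solution m B fin T g \<longrightarrow> (\<forall>t\<in>{0..T}. AE v in lebesgue. g t v = f t v)) \<and>
         (\<forall>t\<in>{0..T}. (\<forall>i. species_mass m (f t) i = 1) \<and> momentum m (f t) = 0) \<and>
         (\<forall>t\<in>{0..T}. kinetic_energy m (f t) > 0) \<and>
         antimono_on {0..T} (\<lambda>t. kinetic_energy m (f t))"
    using wp by (simp only:)
qed

end
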